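(* Let $q=2^r$ ($r\ge1$), and let all notation be as in the context. For $\epsilon\in\{+,-\}$ and $i\in\{1,2,3,4\}$ write $A=A_i^{\epsilon}(n,q)$, $B=B_i^{\epsilon}(n,q)$, $N=N_i^{\epsilon}(n,q):=|DC_i^{\epsilon}(n,q)|$, and let $\{C_{i,j}^{\epsilon}(n,q)\}_{j=0}^{N}$ be the weight distribution of the binary code $C(DC_i^{\epsilon}(n,q))$. Identify the sign $\epsilon$ with the number $\epsilon 1\in\{1,-1\}$. Then $N=A\,B$, and moreover: (a) Suppose one of the following holds: $i=1$, $\epsilon=+$, $n\ge2$ even, $q$ arbitrary; or $i=3$, $\epsilon=+$, and either $n\ge4$ even ($q$ arbitrary) or $n=2$ and $q\ge8$; or $i=1$, $\epsilon=-$, $n\ge1$ odd, $q$ arbitrary; or $i=3$, $\epsilon=-$, $n\ge3$ odd, $q$ arbitrary. Then for every $h=1,2,\ldots$, $$(-\epsilon)^h MK^h=-\sum_{l=0}^{h-1}(-\epsilon)^l\binom{h}{l}B^{h-l}MK^l+qA^{-h}\sum_{j=0}^{\min\{N,h\}}(-1)^jC_{i,j}^{\epsilon}(n,q)\sum_{t=j}^{h}t!\,S(h,t)\,2^{h-t}\binom{N-j}{N-t},$$ and $$C_{i,j}^{\epsilon}(n,q)=\sum\binom{q^{-1}A(B+\epsilon 1)}{\nu_0}\prod_{\beta\in\mathbb{F}_q^*,\ tr(\beta^{-1})=0}\binom{q^{-1}A(B+\epsilon(q+1))}{\nu_\beta}\prod_{\beta\in\mathbb{F}_q^*,\ tr(\beta^{-1})=1}\binom{q^{-1}A(B+\epsilon(-q+1))}{\nu_\beta},$$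 the sum being over all families of nonnegative integers $\{\nu_\beta\}_{\beta\in\mathbb{F}_q}$ with $\sum_{\beta\in\mathbb{F}_q}\nu_\beta=j$ and $\sum_{\beta\in\mathbb{F}_q}\nu_\beta\beta=0$ (in $\mathbb{F}_q$). (b) Let $i=2$, and suppose either $\epsilon=+$, $n\ge2$ even and $q\ge4$, or $\epsilon=-$, $n\ge3$ odd and $q\ge4$. Then for every $h=1,2,\ldots$, writing $\Sigma_h=qA^{-h}\sum_{j=0}^{\min\{N,h\}}(-1)^jC_{2,j}^{\epsilon}(n,q)\sum_{t=j}^{h}t!\,S(h,t)\,2^{h-t}\binom{N-j}{N-t}$, $$\epsilon^h MK_2^h=-\sum_{l=0}^{h-1}\epsilon^l\binom hl(B+\epsilon q)^{h-l}MK_2^l+\Sigma_h,\qquad \epsilon^h MK^{2h}=-\sum_{l=0}^{h-1}\epsilon^l\binom hl B^{h-l}MK^{2l}+\Sigma_h,$$ and $$C_{2,j}^{\epsilon}(n,q)=\sum\binom{q^{-1}A(B+\epsilon(q+1-q^2))}{\nu_0}\prod_{\substack{\tau\in\mathbb{Z},\ |\tau|<2\sqrt q\\ \tau\equiv-1\ (\mathrm{mod}\ 4)}}\ \prod_{\beta\in\mathbb{F}_q^*:\ K(\lambda;\beta^{-1})=\tau}\binom{q^{-1}A(B+\epsilon(q+1-q\tau))}{\nu_\beta},$$ the sum being over all families of nonnegative integers $\{\nu_\beta\}_{\beta\in\mathbb{F}_q}$ with $\sum_\beta\nu_\beta=j$ and $\sum_\beta\nu_\beta\beta=0$. (c) Let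 $i=4$, and suppose either $\epsilon=+$, $n\ge4$ even and $q\ge4$, or $\epsilon=-$, $n\ge3$ odd and $q\ge4$. Then for every $h=1,2,\ldots$, with $\Sigma_h=qA^{-h}\sum_{j=0}^{\min\{N,h\}}(-1)^jC_{4,j}^{\epsilon}(n,q)\sum_{t=j}^{h}t!\,S(h,t)\,2^{h-t}\binom{N-j}{N-t}$, $$\epsilon^h MK_2^h=-\sum_{l=0}^{h-1}\epsilon^l\binom hl(B+\epsilon q^2)^{h-l}MK_2^l+\Sigma_h,\qquad \epsilon^h MK^{2h}=-\sum_{l=0}^{h-1}\epsilon^l\binom hl (B+\epsilon(q^2-q))^{h-l}MK^{2l}+\Sigma_h,$$ and $$C_{4,j}^{\epsilon}(n,q)=\sum\binom{q^{-1}A(B+\epsilon(q^2+1-q^3))}{\nu_0}\prod_{\substack{\tau\in\mathbb{Z},\ |\tau|<2\sqrt q\\ \tau\equiv-1\ (\mathrm{mod}\ 4)}}\ \prod_{\beta\in\mathbb{F}_q^*:\ K(\lambda;\beta^{-1})=\tau}\binom{q^{-1}A(B+\epsilon(q^2+1-q\tau))}{\nu_\beta},$$ the sum being over all families of nonnegative integers $\{\nu_\beta\}_{\beta\in\mathbb{F}_q}$ with $\sum_\beta\nu_\beta=j$ and $\sum_\beta\nu_\beta\beta=0$.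
   Context: Let $q=2^r$, $\mathbb{F}_q$ the field with $q$ elements, $tr(x)=x+x^2+\cdots+x^{2^{r-1}}$ the trace $\mathbb{F}_q\to\mathbb{F}_2$, $\lambda(x)=(-1)^{tr(x)}$. For $a\in\mathbb{F}_q^*$: $K(\lambda;a)=\sum_{\alpha\in\mathbb{F}_q^*}\lambda(\alpha+a\alpha^{-1})$ and $K_2(\lambda;a)=\sum_{\alpha_1,\alpha_2\in\mathbb{F}_q^*}\lambda(\alpha_1+\alpha_2+a\alpha_1^{-1}\alpha_2^{-1})$. Power moments: $MK^h=\sum_{a\in\mathbb{F}_q^*}K(\lambda;a)^h$, $MK_2^h=\sum_{a\in\mathbb{F}_q^*}K_2(\lambda;a)^h$ (both equal $q-1$ for $h=0$). $S(h,t)=\frac1{t!}\sum_{j=0}^t(-1)^{t-j}\binom tj j^h$ (Stirling numbers of the second kind); $\binom ba=0$ if $a>b$ or $a<0$. $\mathrm{Tr}$ is matrix trace, ${}^tX$ transpose; a square matrix is alternating if it is symmetric with zero diagonal. Gaussian binomial $\left[\substack{m\\ s}\right]_q=\prod_{j=0}^{s-1}(q^{m-j}-1)/(q^{s-j}-1)$; empty products are 1. Fix $\kappa\in\mathbb{F}_q$ with $z^2+z+\kappa$ irreducible over $\mathbb{F}_q$. For $n\ge1$, $\theta^-(x)=\sum_{i=1}^{n-1}x_ix_{n-1+i}+x_{2n-1}^2+x_{2n-1}x_{2n}+\kappa x_{2n}^2$ on $\mathbb{F}_q^{2n\times1}$, and $O^-(2n,q)=\{g\in GL(2n,q):\theta^-(gx)=\theta^-(x)\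 \forall x\}$. Let $\delta=\begin{pmatrix}1&1\\0&\kappa\end{pmatrix}$, $\eta=\begin{pmatrix}0&1\\1&0\end{pmatrix}$, $SO^-(2,q)=\{\begin{pmatrix}d_1&\kappa d_2\\ d_2&d_1+d_2\end{pmatrix}: d_1^2+d_1d_2+\kappa d_2^2=1\}$. $Q^-(2n,q)$ is the subgroup of $O^-(2n,q)$ of all products (blocks of sizes $n-1,n-1,2$) $\begin{pmatrix}A&0&0\\0&{}^tA^{-1}&0\\0&0&i\end{pmatrix}\begin{pmatrix}1_{n-1}&B&{}^th\,{}^ti\,\eta\, i\\0&1_{n-1}&0\\0&h&1_2\end{pmatrix}$ with $A\in GL(n-1,q)$, $i\in SO^-(2,q)$, $B\in\mathbb{F}_q^{(n-1)\times(n-1)}$, $h\in\mathbb{F}_q^{2\times(n-1)}$, ${}^tB+{}^th\delta h$ alternating. Let $\rho=\mathrm{diag}\big(1_{2n-2},\begin{pmatrix}1&1\\0&1\end{pmatrix}\big)$. For $0\le s\le n-1$, $\sigma_s$ is the permutation matrix interchanging standard basis vectors $e^j$ and $e^{n-1+j}$ for $1\le j\le s$ and fixing the others. Write $Q=Q^-(2n,q)$ and $XgY=\{xgy\}$. Double cosets: $DC_1^+(n,q)=Q\sigma_{n-1}Q$, $DC_2^+(n,q)=Q\sigma_{n-2}Q$, $DC_3^+(n,q)=\rho Q\sigma_{n-2}Q$ (for $n=2,4,6,\dots$); $DC_4^+(n,q)=\rho Q\sigma_{n-3}Q$ ($n=4,6,\dots$); $DC_1^-(n,q)=Q\sigma_{n-1}Q$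 ($n=1,3,5,\dots$); $DC_2^-(n,q)=Q\sigma_{n-2}Q$, $DC_3^-(n,q)=\rho Q\sigma_{n-2}Q$, $DC_4^-(n,q)=\rho Q\sigma_{n-3}Q$ ($n=3,5,\dots$). Constants: $A_1^+=q^{(5n^2-2n-4)/4}(q^{n-1}-1)\prod_{j=1}^{(n-2)/2}(q^{2j-1}-1)$; $B_1^+=(q+1)q^{n^2/4}\prod_{j=1}^{(n-2)/2}(q^{2j}-1)$; $A_2^+=q^{(5n^2-2n-8)/4}\left[\substack{n-1\\1}\right]_q\prod_{j=1}^{(n-2)/2}(q^{2j-1}-1)$; $B_2^+=(q+1)q^{(n-2)^2/4}(q^{n-1}-1)\prod_{j=1}^{(n-2)/2}(q^{2j}-1)$; $A_3^+=(q+1)q^{(5n^2-2n-8)/4}\left[\substack{n-1\\1}\right]_q\prod_{j=1}^{(n-2)/2}(q^{2j-1}-1)$; $B_3^+=q^{(n-2)^2/4}(q^{n-1}-1)\prod_{j=1}^{(n-2)/2}(q^{2j}-1)$; $A_4^+=(q+1)q^{(5n^2-6n-4)/4}\left[\substack{n-1\\2}\right]_q\prod_{j=1}^{(n-2)/2}(q^{2j-1}-1)$; $B_4^+=q^{(n-2)^2/4}(q^{n-1}-1)\prod_{j=1}^{(n-2)/2}(q^{2j}-1)$; $A_1^-=q^{5(n^2-1)/4}\prod_{j=1}^{(n-1)/2}(q^{2j-1}-1)$; $B_1^-=(q+1)q^{(n-1)^2/4}\prod_{j=1}^{(n-1)/2}(q^{2j}-1)$; $A_2^-=q^{(5n^2-4n-5)/4}\left[\substack{n-1\\1}\right]_q\prod_{j=1}^{(n-1)/2}(q^{2j-1}-1)$;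 $B_2^-=(q+1)q^{(n-1)^2/4}\prod_{j=1}^{(n-1)/2}(q^{2j}-1)$; $A_3^-=(q+1)q^{(5n^2-4n-5)/4}\left[\substack{n-1\\1}\right]_q\prod_{j=1}^{(n-1)/2}(q^{2j-1}-1)$; $B_3^-=q^{(n-1)^2/4}\prod_{j=1}^{(n-1)/2}(q^{2j}-1)$; $A_4^-=(q+1)q^{(5n^2-4n-9)/4}\left[\substack{n-1\\2}\right]_q\prod_{j=1}^{(n-3)/2}(q^{2j-1}-1)$; $B_4^-=q^{(n-3)^2/4}(q^{n-2}-1)(q^{n-1}-1)\prod_{j=1}^{(n-3)/2}(q^{2j}-1)$ (all arguments $(n,q)$). Codes: for $D=DC_i^\epsilon(n,q)$ with $N=|D|$, fix an ordering $g_1,\dots,g_N$ of $D$ and set $C(D)=\{u\in\mathbb{F}_2^N:\sum_{k=1}^N u_k\mathrm{Tr}(g_k)=0\text{ in }\mathbb{F}_q\}$; its weight distribution $C_{i,j}^\epsilon(n,q)$ is the number of codewords of Hamming weight $j$. *)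

theory Defs
  imports
    Complex_Main
    "HOL-Library.Cardinality"
    "HOL-Library.Z2"
    "HOL-Number_Theory.Cong"
    "HOL-Computational_Algebra.Polynomial"
    "Jordan_Normal_Form.Matrix"
    "Jordan_Normal_Form.Gauss_Jordan_Elimination"
begin

text \<open>Throughout, the field with \<open>q = 2 ^ r\<close> elements is a type \<open>'a :: {field, finite}\<close>
  with \<open>CARD('a) = 2 ^ r\<close>. Vector and matrix indices start at 0.\<close>


section \<open>Kloosterman sums and their power moments\<close>

definition tr :: "nat \<Rightarrow> 'a::field \<Rightarrow> 'a" where
  "tr r x = (\<Sum>k<r. x ^ (2 ^ k))"

text \<open>\<open>tr r x\<close> is 0 or 1, so this is \<open>(-1)\<close> to the power \<open>tr r x\<close>.\<close>

definition lam :: "nat \<Rightarrow> 'a::field \<Rightarrow> int" where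
  "lam r x = (if tr r x = 0 then 1 else - 1)"

definition kloosterman :: "nat \<Rightarrow> 'a::{field,finite} \<Rightarrow> int" where
  "kloosterman r a = (\<Sum>\<alpha>\<in>UNIV - {0}. lam r (\<alpha> + a * inverse \<alpha>))"

definition kloosterman2 :: "nat \<Rightarrow> 'a::{field,finite} \<Rightarrow> int" where
  "kloosterman2 r a =
     (\<Sum>\<alpha>\<in>UNIV - {0}. \<Sum>\<beta>\<in>UNIV - {0}. lam r (\<alpha> + \<beta> + a * inverse \<alpha> * inverse \<beta>))"

definition power_moment :: "('a::{field,finite} \<Rightarrow> int) \<Rightarrow> nat \<Rightarrow> real" where
  "power_moment f h = (\<Sum>a\<in>UNIV - {0}. real_of_int (f a) ^ h)"


section \<open>Combinatorial numbers\<close>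

definition stirling2 :: "nat \<Rightarrow> nat \<Rightarrow> real" where
  "stirling2 h t = 1 / fact t * (\<Sum>j=0..t. (- 1) ^ (t - j) * real (t choose j) * real j ^ h)"

text \<open>The binomial coefficient with the convention that it vanishes if \<open>a < 0\<close> or \<open>a > b\<close>.
  The upper argument is real because the numbers \<open>q\<^sup>-\<^sup>1 A (B + \<dots>)\<close> below are written as quotients.\<close>

definition binom :: "real \<Rightarrow> int \<Rightarrow> real" where
  "binom b a = (if a < 0 \<or> real_of_int a > b then 0 else b gchoose nat a)"

definition gauss_binom :: "nat \<Rightarrow> nat \<Rightarrow> nat \<Rightarrow> real" where
  "gauss_binom q m s = (\<Prod>j<s. (real q ^ (m - j) - 1) / (real q ^ (s - j) - 1))"


section \<open>The orthogonal group of minus type and its double cosets\<close>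

definition mat_trace :: "'a::comm_monoid_add mat \<Rightarrow> 'a" where
  "mat_trace M = (\<Sum>k<dim_row M. M $$ (k, k))"

definition alternating_mat :: "'a::zero mat \<Rightarrow> bool" where
  "alternating_mat M \<longleftrightarrow>
     square_mat M \<and> transpose_mat M = M \<and> (\<forall>k<dim_row M. M $$ (k, k) = 0)"

definition GL :: "nat \<Rightarrow> 'a::field mat set" where
  "GL m = {M \<in> carrier_mat m m. invertible_mat M}"

definition theta_minus :: "'a::field \<Rightarrow> nat \<Rightarrow> 'a vec \<Rightarrow> 'a" where
  "theta_minus \<kappa> n x =
     (\<Sum>k<n - 1. x $ k * x $ (n - 1 + k))
     + (x $ (2 * n - 2))\<^sup>2 + x $ (2 * n - 2) * x $ (2 * n - 1) + \<kappa> * (x $ (2 * n - 1))\<^sup>2"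

definition O_minus :: "'a::field \<Rightarrow> nat \<Rightarrow> 'a mat set" where
  "O_minus \<kappa> n =
     {g \<in> GL (2 * n). \<forall>x \<in> carrier_vec (2 * n). theta_minus \<kappa> n (g *\<^sub>v x) = theta_minus \<kappa> n x}"

definition delta_mat :: "'a::field \<Rightarrow> 'a mat" where
  "delta_mat \<kappa> = mat_of_rows_list 2 [[1, 1], [0, \<kappa>]]"

definition eta_mat :: "'a::field mat" where
  "eta_mat = mat_of_rows_list 2 [[0, 1], [1, 0]]"

definition SO_minus_2 :: "'a::field \<Rightarrow> 'a mat set" where
  "SO_minus_2 \<kappa> =
     {mat_of_rows_list 2 [[d1, \<kappa> * d2], [d2, d1 + d2]] | d1 d2. d1\<^sup>2 + d1 * d2 + \<kappa> * d2\<^sup>2 = 1}"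

text \<open>The 3-by-3 block matrix with the given blocks, listed row by row.\<close>

definition block33 ::
  "'a::zero mat \<Rightarrow> 'a mat \<Rightarrow> 'a mat \<Rightarrow> 'a mat \<Rightarrow> 'a mat \<Rightarrow> 'a mat \<Rightarrow> 'a mat \<Rightarrow> 'a mat \<Rightarrow> 'a mat \<Rightarrow> 'a mat"
  where
  "block33 M11 M12 M13
           M21 M22 M23
           M31 M32 M33 =
     four_block_mat
       (four_block_mat M11 M12 M21 M22)
       (M13 @\<^sub>r M23)
       (transpose_mat (transpose_mat M31 @\<^sub>r transpose_mat M32))
       M33"

definition Q_minus :: "'a::field \<Rightarrow> nat \<Rightarrow> 'a mat set" where
  "Q_minus \<kappa> n =
     {g \<in> O_minus \<kappa> n. \<exists>A i B h.
        A \<in> GL (n - 1) \<and> i \<in> SO_minus_2 \<kappa> \<and>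
        B \<in> carrier_mat (n - 1) (n - 1) \<and> h \<in> carrier_mat 2 (n - 1) \<and>
        alternating_mat (transpose_mat B + transpose_mat h * delta_mat \<kappa> * h) \<and>
        g =
          block33 A                     (0\<^sub>m (n - 1) (n - 1))                   (0\<^sub>m (n - 1) 2)
                  (0\<^sub>m (n - 1) (n - 1)) (transpose_mat (the (mat_inverse A))) (0\<^sub>m (n - 1) 2)
                  (0\<^sub>m 2 (n - 1))       (0\<^sub>m 2 (n - 1))                         i
          *
          block33 (1\<^sub>m (n - 1))         B              (transpose_mat h * transpose_mat i * eta_mat * i)
                  (0\<^sub>m (n - 1) (n - 1)) (1\<^sub>m (n - 1)) (0\<^sub>m (n - 1) 2)
                  (0\<^sub>m 2 (n - 1))       h              (1\<^sub>m 2)}"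

definition rho_mat :: "nat \<Rightarrow> 'a::field mat" where
  "rho_mat n = diag_block_mat [1\<^sub>m (2 * n - 2), mat_of_rows_list 2 [[1, 1], [0, 1]]]"

definition sigma_perm :: "nat \<Rightarrow> nat \<Rightarrow> nat \<Rightarrow> nat" where
  "sigma_perm n s j =
     (if j < s then n - 1 + j
      else if n - 1 \<le> j \<and> j < n - 1 + s then j - (n - 1)
      else j)"

definition sigma_mat :: "nat \<Rightarrow> nat \<Rightarrow> 'a::field mat" where
  "sigma_mat n s = mat (2 * n) (2 * n) (\<lambda>(k, j). if k = sigma_perm n s j then 1 else 0)"

definition double_coset :: "'a::field mat set \<Rightarrow> 'a mat \<Rightarrow> 'a mat set \<Rightarrow> 'a mat set" where
  "double_coset X g Y = {x * g * y | x y. x \<in> X \<and> y \<in> Y}"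

text \<open>The sign \<open>\<epsilon> \<in> {1, -1}\<close>, the index \<open>i\<close> and \<open>n\<close> for which the double coset
  with this sign and index is considered. The sign records the parity of \<open>n\<close>.\<close>

definition admissible :: "real \<Rightarrow> nat \<Rightarrow> nat \<Rightarrow> bool" where
  "admissible \<epsilon> i n \<longleftrightarrow>
     \<epsilon> = 1 \<and> i \<in> {1, 2, 3} \<and> even n \<and> n \<ge> 2 \<or>
     \<epsilon> = 1 \<and> i = 4 \<and> even n \<and> n \<ge> 4 \<or>
     \<epsilon> = - 1 \<and> i = 1 \<and> odd n \<and> n \<ge> 1 \<or>
     \<epsilon> = - 1 \<and> i \<in> {2, 3, 4} \<and> odd n \<and> n \<ge> 3"

text \<open>For admissible \<open>(\<epsilon>, i, n)\<close> the defining formula depends on \<open>i\<close> and \<open>n\<close> only.\<close>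

definition DC :: "'a::field \<Rightarrow> nat \<Rightarrow> nat \<Rightarrow> 'a mat set" where
  "DC \<kappa> i n =
     (let Q = Q_minus \<kappa> n in
      if i = 1 then double_coset Q (sigma_mat n (n - 1)) Q
      else if i = 2 then double_coset Q (sigma_mat n (n - 2)) Q
      else if i = 3 then (\<lambda>x. rho_mat n * x) ` double_coset Q (sigma_mat n (n - 2)) Q
      else (\<lambda>x. rho_mat n * x) ` double_coset Q (sigma_mat n (n - 3)) Q)"


section \<open>The constants\<close>

text \<open>Subtraction and division in the exponents are on natural numbers; no subtraction
  truncates and all divisions are exact for admissible \<open>(\<epsilon>, i, n)\<close>. The final branch
  is for \<open>i = 4\<close>.\<close>

definition odd_prod :: "nat \<Rightarrow> nat \<Rightarrow> real" where
  "odd_prod q m = (\<Prod>j=1..m. real q ^ (2 * j - 1) - 1)"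

definition even_prod :: "nat \<Rightarrow> nat \<Rightarrow> real" where
  "even_prod q m = (\<Prod>j=1..m. real q ^ (2 * j) - 1)"

definition A_plus :: "nat \<Rightarrow> nat \<Rightarrow> nat \<Rightarrow> real" where
  "A_plus i n q =
     (if i = 1 then
        real q ^ ((5 * n\<^sup>2 - 2 * n - 4) div 4) * (real q ^ (n - 1) - 1) * odd_prod q ((n - 2) div 2)
      else if i = 2 then
        real q ^ ((5 * n\<^sup>2 - 2 * n - 8) div 4) * gauss_binom q (n - 1) 1 * odd_prod q ((n - 2) div 2)
      else if i = 3 then
        (real q + 1) * real q ^ ((5 * n\<^sup>2 - 2 * n - 8) div 4) * gauss_binom q (n - 1) 1
          * odd_prod q ((n - 2) div 2)
      else
        (real q + 1) * real q ^ ((5 * n\<^sup>2 - 6 * n - 4) div 4) * gauss_binom q (n - 1) 2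
          * odd_prod q ((n - 2) div 2))"

definition B_plus :: "nat \<Rightarrow> nat \<Rightarrow> nat \<Rightarrow> real" where
  "B_plus i n q =
     (if i = 1 then
        (real q + 1) * real q ^ (n\<^sup>2 div 4) * even_prod q ((n - 2) div 2)
      else if i = 2 then
        (real q + 1) * real q ^ ((n - 2)\<^sup>2 div 4) * (real q ^ (n - 1) - 1) * even_prod q ((n - 2) div 2)
      else if i = 3 then
        real q ^ ((n - 2)\<^sup>2 div 4) * (real q ^ (n - 1) - 1) * even_prod q ((n - 2) div 2)
      else
        real q ^ ((n - 2)\<^sup>2 div 4) * (real q ^ (n - 1) - 1) * even_prod q ((n - 2) div 2))"

definition A_minus :: "nat \<Rightarrow> nat \<Rightarrow> nat \<Rightarrow> real" where
  "A_minus i n q =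
     (if i = 1 then
        real q ^ (5 * (n\<^sup>2 - 1) div 4) * odd_prod q ((n - 1) div 2)
      else if i = 2 then
        real q ^ ((5 * n\<^sup>2 - 4 * n - 5) div 4) * gauss_binom q (n - 1) 1 * odd_prod q ((n - 1) div 2)
      else if i = 3 then
        (real q + 1) * real q ^ ((5 * n\<^sup>2 - 4 * n - 5) div 4) * gauss_binom q (n - 1) 1
          * odd_prod q ((n - 1) div 2)
      else
        (real q + 1) * real q ^ ((5 * n\<^sup>2 - 4 * n - 9) div 4) * gauss_binom q (n - 1) 2
          * odd_prod q ((n - 3) div 2))"

definition B_minus :: "nat \<Rightarrow> nat \<Rightarrow> nat \<Rightarrow> real" where
  "B_minus i n q =
     (if i = 1 then
        (real q + 1) * real q ^ ((n - 1)\<^sup>2 div 4) * even_prod q ((n - 1) div 2)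
      else if i = 2 then
        (real q + 1) * real q ^ ((n - 1)\<^sup>2 div 4) * even_prod q ((n - 1) div 2)
      else if i = 3 then
        real q ^ ((n - 1)\<^sup>2 div 4) * even_prod q ((n - 1) div 2)
      else
        real q ^ ((n - 3)\<^sup>2 div 4) * (real q ^ (n - 2) - 1) * (real q ^ (n - 1) - 1)
          * even_prod q ((n - 3) div 2))"

definition A_const :: "real \<Rightarrow> nat \<Rightarrow> nat \<Rightarrow> nat \<Rightarrow> real" where
  "A_const \<epsilon> i n q = (if \<epsilon> = 1 then A_plus i n q else A_minus i n q)"

definition B_const :: "real \<Rightarrow> nat \<Rightarrow> nat \<Rightarrow> nat \<Rightarrow> real" where
  "B_const \<epsilon> i n q = (if \<epsilon> = 1 then B_plus i n q else B_minus i n q)"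


section \<open>The binary codes\<close>

text \<open>\<open>g 0, \<dots>, g (N - 1)\<close> is the chosen ordering of the double coset.\<close>

definition binary_code :: "nat \<Rightarrow> (nat \<Rightarrow> 'a::field mat) \<Rightarrow> bit vec set" where
  "binary_code N g = {u \<in> carrier_vec N. (\<Sum>k<N. of_bit (u $ k) * mat_trace (g k)) = 0}"

definition hamming_weight :: "bit vec \<Rightarrow> nat" where
  "hamming_weight u = card {k. k < dim_vec u \<and> u $ k \<noteq> 0}"

definition weight_distribution :: "bit vec set \<Rightarrow> nat \<Rightarrow> nat" where
  "weight_distribution C j = card {u \<in> C. hamming_weight u = j}"

definition weight_families :: "nat \<Rightarrow> ('a::{field,finite} \<Rightarrow> nat) set" where
  "weight_families j =
     {\<nu>. (\<Sum>\<beta>\<in>UNIV. \<nu> \<beta>) = j \<and> (\<Sum>\<beta>\<in>UNIV. of_nat (\<nu> \<beta>) * \<beta>) = 0}"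

text \<open>The term \<open>\<Sigma>\<^sub>h\<close>, with \<open>C\<close> the weight distribution of a code of length \<open>N\<close>.\<close>

definition Sigma_term :: "nat \<Rightarrow> real \<Rightarrow> nat \<Rightarrow> (nat \<Rightarrow> nat) \<Rightarrow> nat \<Rightarrow> real" where
  "Sigma_term q A N C h =
     real q * inverse (A ^ h) *
       (\<Sum>j=0..min N h. (- 1) ^ j * real (C j) *
          (\<Sum>t=j..h. fact t * stirling2 h t * 2 ^ (h - t)
             * binom (real N - real j) (int N - int t)))"

definition tau_range :: "nat \<Rightarrow> int set" where
  "tau_range q = {\<tau>. real_of_int \<bar>\<tau>\<bar> < 2 * sqrt (real q) \<and> [\<tau> = - 1] (mod 4)}"

end

theory Submission
  imports Defs "Jordan_Normal_Form.Determinant"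
begin

text \<open>By Pless' power moment identity, the moments of the weights of the words
  \<open>(tr (a Tr g))\<^sub>g\<close>, \<open>a \<in> F\<^sub>q\<close>, which form the dual code, are determined by the weight distribution
  of the code. So everything follows from the exponential sums \<open>S(a) = \<Sum>\<^sub>g \<lambda>(a Tr g)\<close> over a
  double coset: the weights are \<open>(N - S(a)) / 2\<close>, and Fourier inversion counts the elements of given trace.

  Since the trace is invariant under conjugation, \<open>S(a)\<close> is a multiple of \<open>\<Sum>\<lambda>(a Tr (w \<sigma>\<^sub>s))\<close> over
  \<open>w \<in> Q\<close>, with factor \<open>|Q|\<close> divided by the order of the stabilizer \<open>Q \<inter> \<sigma>\<^sub>s Q \<sigma>\<^sub>s\<close>. In the coordinates
  \<open>(A, i, h, B)\<close> of \<open>w\<close>, the sum over \<open>B\<close> vanishes unless \<open>A\<close> is block lower triangular with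
  symmetric upper left block of size \<open>s\<close>; the sum over \<open>h\<close> is then a Gauss sum with sign \<open>(-1)\<^sup>s\<close>,
  the sum over \<open>i\<close> is \<open>-K(a)\<close> (or \<open>q + 1\<close> in the presence of \<open>\<rho>\<close>), and the sum over the lower right
  block is a matrix Kloosterman sum of size at most 2. Symmetric invertible matrices are counted
  by orbits of their first column.

  The range of \<open>\<tau>\<close> requires the strict Weil bound for Kloosterman sums. It is obtained by Manin's
  elementary method: the degrees of the abscissae of the points \<open>P + n (t, 0)\<close> on a twisted elliptic
  curve over \<open>F\<^sub>q(t)\<close> form a quadratic polynomial in \<open>n\<close>, which is nonnegative.\<close>

section \<open>Fields of characteristic two\<close>

text \<open>Two features of characteristic two shape the argument. Alternating matrices are the
  symmetric ones with zero diagonal, so summation over the alternating parameter forces symmetry of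
  a block of A but says nothing about its diagonal. The diagonal survives in the sum over h, where
  square roots make it linear, because \<chi> (x^2) = \<chi> x. What is left is \<chi> (\<kappa>
  e^2), with e the parity of s; since \<chi> \<kappa> = -1 expresses the irreducibility of z^2 + z +
  \<kappa>, this is the origin of the sign. The lower right block has size t = 0, 1, 2, 1 for i = 1,
  2, 4, 3. Together with the factor of the torus this gives multiples of K, K^2, q (K^2 + q^2 - q)
  and K for S(a). Carlitz' identity K^2 = K2 + q reads the same weights in terms of K2 or of K^2,
  whence two recursions for i = 2 and i = 4. The constant A is, up to sign, the coefficient of the
  Kloosterman term in S(a), and B is N / A; so the weights are A/2 times B plus or minus a
  Kloosterman expression, and A^h can be divided out.\<close>

locale char2_field =
  fixes r q :: nat and F :: "'a::{field,finite} itself"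
  assumes r_pos: "r \<ge> 1" and q_eq: "q = 2 ^ r" and card_UNIV: "CARD('a) = q"
begin

abbreviation \<chi> :: "'a \<Rightarrow> int" where "\<chi> \<equiv> lam r"

lemma q_ge_2: "q \<ge> 2"
  using r_pos q_eq power_increasing[of 1 r "2::nat"] by simp

text \<open>Translation by 1 permutes the field, so the sum of all elements does not change when q
  times 1 is added to it. Hence 2^r = 0.\<close>

lemma two_eq_0: "(2::'a) = 0"
proof -
  have "(\<Sum>x\<in>(UNIV::'a set). x + 1) = (\<Sum>x\<in>UNIV. x)"
    by (rule sum.reindex_bij_witness[of _ "\<lambda>x. x - 1" "\<lambda>x. x + 1"]) auto
  then have "(of_nat CARD('a) :: 'a) = 0"
    by (simp add: sum.distrib)
  then have "(2::'a) ^ r = 0"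
    by (simp add: card_UNIV q_eq)
  then show ?thesis by simp
qed

lemma add_self: "x + x = (0::'a)"
  using two_eq_0 by (metis mult_2 mult_zero_left)

lemma add_left_self: "x + (x + y) = (y::'a)"
  by (simp add: add_self flip: add.assoc)

lemma uminus_self: "- x = (x::'a)"
  using add_self minus_unique by blast

lemma diff_eq_add: "x - y = x + (y::'a)"
  by (simp add: diff_conv_add_uminus uminus_self del: add_uminus_conv_diff)

lemmas char2 = add_self add_left_self uminus_self diff_eq_add

lemma add_eq_0: "x + y = 0 \<longleftrightarrow> x = (y::'a)"
  by (metis diff_eq_add eq_iff_diff_eq_0)

lemma add_sq: "(x + y)\<^sup>2 = x\<^sup>2 + (y::'a)\<^sup>2"
  by (simp add: power2_eq_square algebra_simps char2)

lemma sq_inj: "x\<^sup>2 = y\<^sup>2 \<longleftrightarrow> x = (y::'a)"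
  by (metis add_sq add_eq_0 power_eq_0_iff zero_neq_numeral zero_less_numeral)

lemma sq_bij: "bij (\<lambda>x::'a. x\<^sup>2)"
  by (metis (mono_tags, lifting) finite_UNIV_inj_surj bijI injI sq_inj finite_class.finite_UNIV)

lemma ex_sqrt: "\<exists>y. y\<^sup>2 = (x::'a)"
  using sq_bij by (metis bij_pointE)

lemma pow2_Suc: "(x::'b::monoid_mult) ^ (2 ^ Suc k) = (x ^ (2 ^ k))\<^sup>2"
  by (simp add: mult.commute flip: power_mult)

lemma add_pow2: "(x + y) ^ (2 ^ k) = x ^ (2 ^ k) + (y::'a) ^ (2 ^ k)"
  by (induction k) (simp_all add: pow2_Suc add_sq del: power_Suc)

lemma sum_sq: "(\<Sum>i\<in>I. f i)\<^sup>2 = (\<Sum>i\<in>I. (f i :: 'a)\<^sup>2)"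
  by (induction I rule: infinite_finite_induct) (simp_all add: add_sq)

text \<open>Multiplication by x permutes the nonzero elements; compare their products.\<close>

lemma power_q_minus_1: "x ^ (q - 1) = 1" if "x \<noteq> (0::'a)"
proof -
  have "(\<Prod>y\<in>UNIV - {0::'a}. y) = (\<Prod>y\<in>UNIV - {0}. x * y)"
    by (rule prod.reindex_bij_witness[of _ "\<lambda>y. x * y" "\<lambda>y. y / x"]) (use that in auto)
  also have "\<dots> = x ^ (q - 1) * (\<Prod>y\<in>UNIV - {0}. y)"
    by (simp add: prod.distrib card_UNIV card_Diff_singleton)
  finally show ?thesis by simp
qed

lemma power_q: "x ^ q = (x::'a)"
proof (cases "x = 0")
  case True then show ?thesis using q_ge_2 by simp
next
  case False
  have "x ^ q = x ^ (q - 1) * x"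
    using q_ge_2 by (simp flip: power_Suc2)
  then show ?thesis using power_q_minus_1[OF False] by simp
qed

lemma card_nz: "card (UNIV - {0::'a}) = q - 1"
  by (simp add: card_UNIV card_Diff_singleton)

section \<open>The additive character\<close>

lemma tr_0 [simp]: "tr r (0::'a) = 0"
  by (simp add: tr_def power_0_left)

lemma tr_add: "tr r (x + y) = tr r x + tr r (y::'a)"
  by (simp add: tr_def add_pow2 sum.distrib)

text \<open>The shifted sum minus the trace telescopes to x^q - x = 0. Invariance of the trace under
  squaring of the argument and of the value both follow, and the latter confines the trace to 0 and
  1.\<close>

lemma sum_pow2_shift: "(\<Sum>k<r. (x::'a) ^ (2 ^ Suc k)) = tr r x"
proof -
  have "(\<Sum>k<r. x ^ (2 ^ Suc k) - x ^ (2 ^ k)) = x ^ (2 ^ r) - x"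
    using sum_lessThan_telescope[of "\<lambda>k. x ^ (2 ^ k)" r] by simp
  also have "\<dots> = 0" using power_q[of x] q_eq by simp
  finally show ?thesis by (simp add: sum_subtractf tr_def)
qed

lemma tr_sq: "tr r (x\<^sup>2) = tr r (x::'a)"
  using sum_pow2_shift[of x] by (simp add: tr_def flip: power_mult)

lemma tr_idem: "(tr r x)\<^sup>2 = tr r (x::'a)"
  using sum_pow2_shift[of x] unfolding tr_def by (simp add: sum_sq mult.commute flip: power_mult)

lemma tr_cases: "tr r (x::'a) = 0 \<or> tr r x = 1"
proof -
  have "tr r x * (tr r x - 1) = 0"
    using tr_idem[of x] by (simp add: power2_eq_square algebra_simps)
  then show ?thesis by simp
qed

text \<open>As a polynomial the trace is nonzero of degree at most 2^(r-1), which is less than q, so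
  it cannot vanish on the whole field.\<close>

lemma tr_nontrivial: "\<exists>x::'a. tr r x \<noteq> 0"
proof (rule ccontr)
  assume *: "\<not> ?thesis"
  define p :: "'a poly" where "p = (\<Sum>k<r. monom 1 (2 ^ k))"
  have "coeff p 1 = (\<Sum>k<r. if k = 0 then 1 else 0)"
    unfolding p_def coeff_sum by (intro sum.cong) auto
  then have "coeff p 1 \<noteq> 0" using r_pos by simp
  then have "p \<noteq> 0" by auto
  have "degree p \<le> 2 ^ (r - 1)"
    unfolding p_def by (intro degree_sum_le) (auto simp: degree_monom_eq intro!: power_increasing)
  moreover have "{x. poly p x = 0} = UNIV"
    using * by (auto simp: p_def poly_sum poly_monom tr_def)
  then have "q \<le> degree p"
    using card_poly_roots_bound[OF \<open>p \<noteq> 0\<close>] card_UNIV by simp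
  moreover have "2 ^ (r - 1) < q" using r_pos q_eq by simp
  ultimately show False by simp
qed

lemma lam_0 [simp]: "\<chi> 0 = 1"
  by (simp add: lam_def)

lemma lam_add: "\<chi> (x + y) = \<chi> x * \<chi> y"
  using tr_cases[of x] tr_cases[of y] by (auto simp: lam_def tr_add add_self)

lemma lam_mult_self: "\<chi> x * \<chi> x = 1"
  by (simp add: lam_def)

lemma lam_sq: "\<chi> (x\<^sup>2) = \<chi> x"
  by (simp add: lam_def tr_sq)

lemma lam_cases: "\<chi> x = 1 \<or> \<chi> x = - 1"
  by (simp add: lam_def)

lemma lam_sum: "\<chi> (\<Sum>i\<in>I. f i) = (\<Prod>i\<in>I. \<chi> (f i))"
  by (induction I rule: infinite_finite_induct) (simp_all add: lam_add)

lemma lam_nontrivial: "\<exists>x. \<chi> x = - 1"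
  using tr_nontrivial by (auto simp: lam_def)

lemma lam_mult_nontrivial: "\<exists>x. \<chi> (c * x) = - 1" if "c \<noteq> 0"
proof -
  obtain y where "\<chi> y = - 1" using lam_nontrivial by blast
  then show ?thesis using that by (intro exI[of _ "y / c"]) simp
qed

lemma sum_lam: "(\<Sum>x\<in>UNIV. \<chi> (c * x)) = (if c = 0 then int q else 0)"
proof (cases "c = 0")
  case True then show ?thesis by (simp add: card_UNIV)
next
  case False
  then obtain y where y: "\<chi> (c * y) = - 1" using lam_mult_nontrivial by blast
  have "(\<Sum>x\<in>UNIV. \<chi> (c * x)) = (\<Sum>x\<in>UNIV. \<chi> (c * (x + y)))"
    by (rule sum.reindex_bij_witness[of _ "\<lambda>x. x + y" "\<lambda>x. x - y"]) auto
  also have "\<dots> = - (\<Sum>x\<in>UNIV. \<chi> (c * x))"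
    by (simp add: distrib_left lam_add y sum_negf)
  finally show ?thesis using False by simp
qed

lemma sum_lam_nz: "(\<Sum>x\<in>UNIV - {0}. \<chi> (c * x)) = (if c = 0 then int q - 1 else - 1)"
  using sum_lam[of c] by (simp add: sum_diff1)

lemma sum_lam_nz': "(\<Sum>x\<in>UNIV - {0}. \<chi> x) = - 1"
  using sum_lam_nz[of 1] by simp

lemma sum_nz_reindex_mult:
  fixes f :: "'a \<Rightarrow> 'b::comm_monoid_add"
  assumes "c \<noteq> 0"
  shows "(\<Sum>x\<in>UNIV - {0}. f (c * x)) = (\<Sum>x\<in>UNIV - {0}. f x)"
  by (rule sum.reindex_bij_witness[of _ "\<lambda>x. x / c" "\<lambda>x. c * x"]) (use assms in auto)

lemma sum_nz_reindex_inverse: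
  fixes f :: "'a \<Rightarrow> 'b::comm_monoid_add"
  assumes "c \<noteq> 0"
  shows "(\<Sum>x\<in>UNIV - {0}. f (c * inverse x)) = (\<Sum>x\<in>UNIV - {0}. f x)"
  by (rule sum.reindex_bij_witness[of _ "\<lambda>x. c * inverse x" "\<lambda>x. c * inverse x"]) (use assms in auto)

text \<open>The additive map v^2 + v has fibres {w, w + 1}, so its image has q/2 elements. The image
  lies in the kernel of \<chi>, which also has q/2 elements because \<chi> sums to 0; hence the two
  sets agree.\<close>

lemma card_artin_schreier: "int (card {v. v\<^sup>2 + v = c}) = 1 + \<chi> c"
proof -
  let ?f = "\<lambda>v::'a. v\<^sup>2 + v"
  have fib: "{v. ?f v = ?f w} = {w, w + 1}" for w
  proof -
    have "?f v = ?f w \<longleftrightarrow> v = w \<or> v = w + 1" for v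
    proof -
      have "?f v = ?f w \<longleftrightarrow> (v + w) * (v + w + 1) = 0"
        using add_eq_0[of "?f v" "?f w"] by (simp add: power2_eq_square algebra_simps char2)
      then show ?thesis using add_eq_0[of v w] add_eq_0[of v "w + 1"] by (auto simp: ac_simps)
    qed
    then show ?thesis by blast
  qed
  have fib2: "card {v. ?f v = c} = 2" if "c \<in> range ?f" for c
    using that fib by auto
  have lam1: "\<chi> c = 1" if "c \<in> range ?f" for c
    using that by (auto simp: lam_add lam_sq lam_mult_self)
  have "q = (\<Sum>c\<in>range ?f. card {v. ?f v = c})"
    using card_UNIV sum.image_gen[of "UNIV::'a set" "\<lambda>_. 1::nat" ?f] by simp
  then have im: "q = 2 * card (range ?f)" using fib2 by simp
  have "0 = (\<Sum>x\<in>UNIV. \<chi> x)" using sum_lam[of 1] by simp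
  also have "\<dots> = (\<Sum>x\<in>UNIV. 2 * (if \<chi> x = 1 then 1 else 0) - 1)"
    by (rule sum.cong) (auto simp: lam_def)
  also have "\<dots> = 2 * int (card {x. \<chi> x = 1}) - int q"
    by (simp add: sum_subtractf sum.If_cases card_UNIV flip: sum_distrib_left)
  finally have "card {x. \<chi> x = 1} = card (range ?f)" using im by simp
  moreover have "range ?f \<subseteq> {x. \<chi> x = 1}" using lam1 by blast
  ultimately have eq: "range ?f = {x. \<chi> x = 1}" by (intro card_subset_eq) auto
  show ?thesis
  proof (cases "c \<in> range ?f")
    case True then show ?thesis using fib2 lam1 by simp
  next
    case False
    then have "\<chi> c = -1" using eq lam_cases[of c] by blast
    moreover have "{v. ?f v = c} = {}" using False by blast
    ultimately
    show ?thesis by simp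
  qed
qed

lemma sum_artin_schreier:
  fixes f :: "'a \<Rightarrow> int"
  shows "(\<Sum>v\<in>UNIV. f (v\<^sup>2 + v)) = (\<Sum>c\<in>UNIV. (1 + \<chi> c) * f c)"
proof -
  have "(\<Sum>v\<in>UNIV. f (v\<^sup>2 + v)) = (\<Sum>c\<in>UNIV. \<Sum>v\<in>{v. v\<^sup>2 + v = c}. f (v\<^sup>2 + v))"
    using sum.group[of "UNIV::'a set" UNIV "\<lambda>v. v\<^sup>2 + v" "\<lambda>v. f (v\<^sup>2 + v)"] by simp
  also have "\<dots> = (\<Sum>c\<in>UNIV. (1 + \<chi> c) * f c)"
    by (rule sum.cong) (simp_all flip: card_artin_schreier)
  finally show ?thesis .
qed

section \<open>Kloosterman sums\<close>

abbreviation K :: "'a \<Rightarrow> int" where "K \<equiv> kloosterman r"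
abbreviation K2 :: "'a \<Rightarrow> int" where "K2 \<equiv> kloosterman2 r"

text \<open>Squaring permutes the nonzero elements and \<chi> does not see it.\<close>

lemma kloosterman_sq: "K (a\<^sup>2) = K a"
proof -
  have "K (a\<^sup>2) = (\<Sum>x\<in>UNIV - {0}. \<chi> (x\<^sup>2 + a\<^sup>2 * inverse (x\<^sup>2)))"
    unfolding kloosterman_def
  proof (rule sum.reindex_bij_betw[symmetric])
    show "bij_betw (\<lambda>x::'a. x\<^sup>2) (UNIV - {0}) (UNIV - {0})"
      unfolding bij_betw_def
    proof (intro conjI subset_antisym subsetI)
      show "inj_on (\<lambda>x::'a. x\<^sup>2) (UNIV - {0})" by (simp add: inj_on_def sq_inj)
      fix y :: 'a assume y: "y \<in> UNIV - {0}"
      obtain x where "x\<^sup>2 = y" using ex_sqrt by blast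
      then show "y \<in> (\<lambda>x. x\<^sup>2) ` (UNIV - {0})" using y by force
    qed auto
  qed
  also have "\<dots> = (\<Sum>x\<in>UNIV - {0}. \<chi> ((x + a * inverse x)\<^sup>2))"
    by (intro sum.cong) (auto simp: add_sq power_mult_distrib power_inverse)
  finally show ?thesis by (simp add: lam_sq kloosterman_def)
qed

text \<open>Traces of a matrix and its inverse come with one common factor a. Replacing x by x/a
  turns the sum into K (a^2), which equals K a.\<close>

lemma kloosterman_scaled: "(\<Sum>x\<in>UNIV - {0}. \<chi> (a * (x + inverse x))) = K a" if "a \<noteq> 0"
proof -
  have "K a = K (a\<^sup>2)" by (simp add: kloosterman_sq)
  also have "\<dots> = (\<Sum>x\<in>UNIV - {0}. \<chi> (a * x + a\<^sup>2 * inverse (a * x)))"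
    unfolding kloosterman_def by (rule sum_nz_reindex_mult[OF that, symmetric])
  also have "\<dots> = (\<Sum>x\<in>UNIV - {0}. \<chi> (a * (x + inverse x)))"
    using that by (intro sum.cong) (auto simp: field_simps power2_eq_square)
  finally show ?thesis ..
qed

text \<open>The shape in which K arises from the torus: the Artin-Schreier count of
  \<open>SO2\<close> contributes \<chi> (inverse d), the trace contributes \<chi> (a d).\<close>

lemma kloosterman_scaled': "(\<Sum>x\<in>UNIV - {0}. \<chi> (a * x + inverse x)) = K a" if "a \<noteq> 0"
proof -
  have "K a = (\<Sum>x\<in>UNIV - {0}. \<chi> (a * x + a * inverse (a * x)))"
    unfolding kloosterman_def by (rule sum_nz_reindex_mult[OF that, symmetric])
  also have "\<dots> = (\<Sum>x\<in>UNIV - {0}. \<chi> (a * x + inverse x))"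
    using that by (intro sum.cong) (auto simp: field_simps)
  finally show ?thesis ..
qed

text \<open>Put \<open>x = s v\<close>, \<open>y = s (v + 1)\<close> in the off-diagonal part of \<open>K a ^ 2\<close>.\<close>

lemma carlitz: "(K a)\<^sup>2 = K2 a + int q" if "a \<noteq> 0"
proof -
  let ?g = "\<lambda>x y. \<chi> (x + a * inverse x) * \<chi> (y + a * inverse y)"
  let ?N = "UNIV - {0::'a}"
  have "(K a)\<^sup>2 = (\<Sum>x\<in>?N. \<Sum>y\<in>?N. ?g x y)"
    by (simp add: power2_eq_square kloosterman_def sum_product)
  also have "\<dots> = (\<Sum>x\<in>?N. ?g x x + (\<Sum>y\<in>?N - {x}. ?g x y))"
    by (intro sum.cong) (auto simp: sum.remove)
  also have "\<dots> = int q - 1 + (\<Sum>x\<in>?N. \<Sum>y\<in>?N - {x}. ?g x y)"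
    using q_ge_2 by (simp add: sum.distrib lam_mult_self card_nz)
  also have "(\<Sum>x\<in>?N. \<Sum>y\<in>?N - {x}. ?g x y) = (\<Sum>(x,y)\<in>Sigma ?N (\<lambda>x. ?N - {x}). ?g x y)"
    by (subst sum.Sigma) auto
  also have "\<dots> = (\<Sum>(s,v)\<in>?N \<times> (UNIV - {0,1}). \<chi> (s + a * inverse (s * (v\<^sup>2 + v))))"
  proof (rule sum.reindex_bij_witness[of _ "\<lambda>(s,v). (s * v, s * (v + 1))" "\<lambda>(x,y). (x + y, x / (x + y))"])
    fix p assume "p \<in> Sigma ?N (\<lambda>x. ?N - {x})"
    then obtain x y where p: "p = (x, y)" "x \<noteq> 0" "y \<noteq> 0" "x \<noteq> y" by auto
    then have nz: "x + y \<noteq> 0" using add_eq_0 by auto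
    have yy: "x + (x + y) = y" by (simp add: char2)
    have v1: "x / (x + y) + 1 = y / (x + y)"
      using nz yy by (simp add: field_simps)
    show "(case case p of (x, y) \<Rightarrow> (x + y, x / (x + y)) of (s, v) \<Rightarrow> (s * v, s * (v + 1))) = p"
      using nz v1 by (simp add: p)
    show "(case p of (x, y) \<Rightarrow> (x + y, x / (x + y))) \<in> ?N \<times> (UNIV - {0, 1})"
      using p nz by auto
    have "(x + y) * ((x / (x + y))\<^sup>2 + x / (x + y)) = (x + y) * (x / (x + y) * (x / (x + y) + 1))"
      by (simp add: power2_eq_square algebra_simps)
    also have "\<dots> = x * y / (x + y)" using nz v1 by simp
    finally have w: "(x + y) * ((x / (x + y))\<^sup>2 + x / (x + y)) = x * y / (x + y)" .
    have "(x + y) + a * ((x + y) / (x * y)) = (x + a * inverse x) + (y + a * inverse y)"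
      using p by (simp add: field_simps)
    then have "(x + y) + a * inverse ((x + y) * ((x / (x + y))\<^sup>2 + x / (x + y)))
        = (x + a * inverse x) + (y + a * inverse y)"
      unfolding w by (simp add: inverse_eq_divide)
    then show "(case (case p of (x, y) \<Rightarrow> (x + y, x / (x + y))) of (s, v) \<Rightarrow> \<chi> (s + a * inverse (s * (v\<^sup>2 + v)))) = (case p of (x, y) \<Rightarrow> ?g x y)"
      unfolding p prod.case by (simp only: lam_add[symmetric])
  next
    fix p assume "p \<in> ?N \<times> (UNIV - {0,1::'a})"
    then obtain s v where p: "p = (s, v)" "s \<noteq> 0" "v \<noteq> 0" "v \<noteq> 1" by auto
    have v1: "v + 1 \<noteq> 0" using p add_eq_0 by simp
    have sm: "s * v + s * (v + 1) = s" by (simp add: algebra_simps char2)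
    show "(case case p of (s, v) \<Rightarrow> (s * v, s * (v + 1)) of (x, y) \<Rightarrow> (x + y, x / (x + y))) = p"
      using p sm by simp
    show "(case p of (s, v) \<Rightarrow> (s * v, s * (v + 1))) \<in> Sigma ?N (\<lambda>x. ?N - {x})"
      using p v1 by auto
  qed
  also have "\<dots> = (\<Sum>s\<in>?N. \<Sum>v\<in>UNIV - {0,1}. \<chi> (s + a * inverse (s * (v\<^sup>2 + v))))"
    by (simp add: sum.cartesian_product)
  also have "\<dots> = (\<Sum>s\<in>?N. \<Sum>c\<in>?N. (1 + \<chi> c) * \<chi> (s + a * inverse (s * c)))"
  proof (rule sum.cong)
    fix s :: 'a assume "s \<in> ?N"
    let ?f = "\<lambda>c. if c = 0 then 0 else \<chi> (s + a * inverse (s * c))"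
    have nz: "v\<^sup>2 + v = 0 \<longleftrightarrow> v \<in> {0, 1}" for v :: 'a
    proof -
      have "v\<^sup>2 + v = v * (v + 1)" by (simp add: power2_eq_square algebra_simps)
      then show ?thesis using add_eq_0[of v 1] by auto
    qed
    have "(\<Sum>v\<in>UNIV - {0,1}. \<chi> (s + a * inverse (s * (v\<^sup>2 + v)))) = (\<Sum>v\<in>UNIV. ?f (v\<^sup>2 + v))"
      unfolding nz by (rule sum.mono_neutral_cong_left) auto
    also have "\<dots> = (\<Sum>c\<in>UNIV. (1 + \<chi> c) * ?f c)" by (rule sum_artin_schreier)
    also have "\<dots> = (\<Sum>c\<in>?N. (1 + \<chi> c) * \<chi> (s + a * inverse (s * c)))"
      by (rule sum.mono_neutral_cong_right) auto
    finally show "(\<Sum>v\<in>UNIV - {0,1}. \<chi> (s + a * inverse (s * (v\<^sup>2 + v)))) = (\<Sum>c\<in>?N. (1 + \<chi> c) * \<chi> (s + a * inverse (s * c)))" .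
  qed simp
  \<comment> \<open>The factor 1 + \<chi> c splits the sum. The part with \<chi> c is K2 a, with s
    and c as the two variables. In the other part the inner sum is -1 and the outer one again -1;
    the resulting 1 completes the q - 1 of the diagonal to q.\<close>
  also have "\<dots> = (\<Sum>s\<in>?N. \<chi> s * (\<Sum>c\<in>?N. \<chi> ((a / s) * inverse c))) + K2 a"
    by (simp add: kloosterman2_def lam_add distrib_right distrib_left sum.distrib sum_distrib_left divide_inverse mult_ac)
  also have "(\<Sum>s\<in>?N. \<chi> s * (\<Sum>c\<in>?N. \<chi> ((a / s) * inverse c))) = (\<Sum>s\<in>?N. \<chi> s * (- 1))"
    using that sum_lam_nz' by (intro sum.cong refl) (subst sum_nz_reindex_inverse, auto)
  also have "\<dots> = 1" using sum_lam_nz' by (simp add: sum_negf)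
  finally show ?thesis by simp
qed

lemma lam_odd: "odd (\<chi> x)"
  by (simp add: lam_def)

lemma odd_sum_odd: "odd (sum f I) \<longleftrightarrow> odd (card I)" if "\<And>x. x \<in> I \<Longrightarrow> odd (f x :: int)"
  using that by (induction I rule: infinite_finite_induct) auto

text \<open>The involution \<open>x \<mapsto> a / x\<close> preserves the summands and has one fixed point.\<close>

lemma kloosterman_cong: "[K a = - 1] (mod 4)" if "a \<noteq> 0" "q \<ge> 4"
proof -
  obtain b where b: "b\<^sup>2 = a" using ex_sqrt by blast
  have bnz: "b \<noteq> 0" using that b by auto
  have invb: "a * inverse b = b" using bnz by (simp add: b[symmetric] power2_eq_square)
  let ?N = "UNIV - {0,b::'a}"
  let ?i = "\<lambda>x. a * inverse x"
  let ?f = "\<lambda>x. \<chi> (x + ?i x)"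
  have i_nz: "?i x \<in> ?N" "?i x \<noteq> x" "?i (?i x) = x" "?f (?i x) = ?f x" if "x \<in> ?N" for x
  proof -
    have x: "x \<noteq> 0" "x \<noteq> b" using that by auto
    show e: "?i (?i x) = x" using x \<open>a \<noteq> 0\<close> by simp
    show "?i x \<noteq> x"
    proof
      assume "?i x = x"
      then have "x\<^sup>2 = a" using x by (simp add: field_simps power2_eq_square)
      then show False using b sq_inj x by metis
    qed
    have "?i x \<noteq> b" using e invb x by metis
    then show "?i x \<in> ?N" using x \<open>a \<noteq> 0\<close> by auto
    show "?f (?i x) = ?f x" unfolding e by (simp add: add.commute)
  qed
  \<comment> \<open>S takes from each pair {x, a/x} the member with the smaller number under an
    arbitrary injection into the naturals.\<close>
  have ex: "\<exists>S. S \<subseteq> ?N \<and> ?N = S \<union> ?i ` S \<and> S \<inter> ?i ` S = {}"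
  proof -
    obtain e :: "'a \<Rightarrow> nat" where e: "inj e" using finite_imp_inj_to_nat_seg[of "UNIV::'a set"] by auto
    define S where "S = {x\<in>?N. e x < e (?i x)}"
    have "?N \<subseteq> S \<union> ?i ` S"
    proof
      fix x assume x: "x \<in> ?N"
      have "e x \<noteq> e (?i x)" using e i_nz(2)[OF x] by (auto dest: injD)
      then consider "e x < e (?i x)" | "e (?i x) < e x" by linarith
      then show "x \<in> S \<union> ?i ` S"
      proof cases
        case 1 then show ?thesis using x by (simp add: S_def)
      next
        case 2
        then have "?i x \<in> ?N \<and> e (?i x) < e (?i (?i x))"
          unfolding i_nz(3)[OF x] using i_nz(1)[OF x] by blast
        then have "?i x \<in> S" by (simp only: S_def mem_Collect_eq)
        then show ?thesis using i_nz(3)[OF x] by (metis UnI2 imageI)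
      qed
    qed
    moreover have SN: "S \<subseteq> ?N" by (simp only: S_def Collect_restrict)
    moreover have "?i ` S \<subseteq> ?N"
    proof (rule image_subsetI)
      fix x assume "x \<in> S"
      then have "x \<in> ?N" using SN by (rule rev_subsetD)
      then show "?i x \<in> ?N" by (rule i_nz(1))
    qed
    moreover have "S \<inter> ?i ` S = {}"
    proof -
      have False if "x \<in> S" "?i x \<in> S" for x
        using that i_nz(3)[of x] unfolding S_def mem_Collect_eq by (metis less_asym)
      then show ?thesis by (metis (no_types, lifting) disjoint_iff imageE)
    qed
    ultimately show ?thesis by (metis (no_types, lifting) Un_subset_iff subset_antisym)
  qed
  then obtain S where S: "S \<subseteq> ?N" "?N = S \<union> ?i ` S" "S \<inter> ?i ` S = {}" by blast
  have inj: "inj_on ?i S" using i_nz(3) S(1) by (intro inj_on_inverseI[of _ ?i]) blast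
  have fS: "sum ?f (?i ` S) = sum ?f S"
    using inj i_nz(4) S(1) by (subst sum.reindex) (auto intro!: sum.cong)
  have "sum ?f ?N = 2 * sum ?f S"
    by (subst S(2), subst sum.union_disjoint) (use S(3) fS in auto)
  moreover have "K a = ?f b + sum ?f ?N"
    unfolding kloosterman_def using bnz
    by (subst sum.remove[of _ b]) (auto intro!: sum.cong arg_cong2[of _ _ _ _ "(+)"])
  ultimately have K: "K a = 1 + 2 * sum ?f S" using invb by (simp add: add_self)
  have "card ?N = 2 * card S"
    by (subst S(2), subst card_Un_disjoint) (use S(3) card_image[OF inj] in auto)
  moreover have "card ?N = q - 2" using bnz by (simp add: card_UNIV card_Diff_subset)
  ultimately have "q = 2 * card S + 2" using that by simp
  moreover have "4 dvd q"
  proof -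
    have "r \<ge> 2" using that q_eq r_pos by (cases "r = 1") auto
    then obtain k where "r = k + 2" by (metis le_add_diff_inverse2)
    then have "q = 4 * 2 ^ k" using q_eq by (simp add: power_add)
    then show ?thesis by simp
  qed
  \<comment> \<open>Here card S = (q - 2)/2 is odd because 4 divides q. A sum of an odd number of
    signs is odd, so K a = 1 + 2 * odd.\<close>
  ultimately have "odd (card S)" by presburger
  then have "odd (sum ?f S)" using odd_sum_odd[of S ?f] lam_odd by blast
  then obtain k where "sum ?f S = 2 * k + 1" by (elim oddE)
  then have "K a - (- 1) = 4 * (k + 1)" using K by simp
  then show ?thesis unfolding cong_iff_dvd_diff by (metis dvd_triv_left)
qed

section \<open>Fourier transforms\<close>

text \<open>Summing over a before x is orthogonality: up to a constant only x = inverse \<beta>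
  contributes. This is what Fourier inversion needs in order to count the group elements of trace
  \<beta> when S(a) is a multiple of K a.\<close>

lemma fourier_kloosterman:
  "(\<Sum>a\<in>UNIV - {0}. \<chi> (a * \<beta>) * K a) = (if \<beta> = 0 then 1 else int q * \<chi> (inverse \<beta>) + 1)"
proof -
  let ?N = "UNIV - {0::'a}"
  have "(\<Sum>a\<in>?N. \<chi> (a * \<beta>) * K a) = (\<Sum>x\<in>?N. \<chi> x * (\<Sum>a\<in>?N. \<chi> ((\<beta> + inverse x) * a)))"
    unfolding kloosterman_def sum_distrib_left
    by (subst sum.swap) (auto intro!: sum.cong simp: lam_add algebra_simps)
  also have "\<dots> = (\<Sum>x\<in>?N. (if \<beta> = inverse x then int q * \<chi> x else 0) - \<chi> x)"
    unfolding sum_lam_nz add_eq_0 by (intro sum.cong) (auto simp: algebra_simps)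
  also have "\<dots> = (\<Sum>x\<in>?N. (if \<beta> = inverse x then int q * \<chi> x else 0)) + 1"
    using sum_lam_nz' by (simp add: sum_subtractf)
  also have "(\<Sum>x\<in>?N. (if \<beta> = inverse x then int q * \<chi> x else 0)) = (\<Sum>x\<in>?N. (if inverse \<beta> = x then int q * \<chi> x else 0))"
    by (intro sum.cong) auto
  also have "\<dots> = (if \<beta> = 0 then 0 else int q * \<chi> (inverse \<beta>))"
    by (simp add: sum.delta')
  finally show ?thesis by simp
qed

text \<open>Orthogonality in a ties y to inverse \<beta> * inverse x, and the remaining sum over x
  is a one-dimensional Kloosterman sum. This is why values of K at inverse \<beta> govern the weight
  distribution when S(a) involves K2.\<close>

lemma fourier_kloosterman2:
  "(\<Sum>a\<in>UNIV - {0}. \<chi> (a * \<beta>) * K2 a) = (if \<beta> = 0 then - 1 else int q * K (inverse \<beta>) - 1)"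
proof -
  let ?N = "UNIV - {0::'a}"
  have "(\<Sum>a\<in>?N. \<chi> (a * \<beta>) * K2 a)
      = (\<Sum>x\<in>?N. \<Sum>y\<in>?N. \<chi> (x + y) * (\<Sum>a\<in>?N. \<chi> ((\<beta> + inverse x * inverse y) * a)))"
    unfolding kloosterman2_def sum_distrib_left
    by (subst sum.swap, rule sum.cong[OF refl], subst sum.swap)
       (auto intro!: sum.cong simp: lam_add algebra_simps)
  also have "\<dots> = (\<Sum>x\<in>?N. \<Sum>y\<in>?N. (if \<beta> = inverse x * inverse y then int q * \<chi> (x + y) else 0) - \<chi> x * \<chi> y)"
    unfolding sum_lam_nz add_eq_0 by (intro sum.cong) (auto simp: algebra_simps lam_add)
  also have "\<dots> = (\<Sum>x\<in>?N. \<Sum>y\<in>?N. (if \<beta> = inverse x * inverse y then int q * \<chi> (x + y) else 0)) - 1"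
    using sum_lam_nz' by (simp add: sum_subtractf sum_negf sum.distrib flip: sum_distrib_left)
  also have "(\<Sum>x\<in>?N. \<Sum>y\<in>?N. (if \<beta> = inverse x * inverse y then int q * \<chi> (x + y) else 0))
     = (\<Sum>x\<in>?N. if \<beta> = 0 then 0 else int q * \<chi> (x + inverse \<beta> * inverse x))"
  proof (rule sum.cong[OF refl])
    fix x assume x: "x \<in> ?N"
    have "(\<beta> = inverse x * inverse y) = (y = inverse \<beta> * inverse x \<and> \<beta> \<noteq> 0)" if "y \<in> ?N" for y
    proof
      assume "\<beta> = inverse x * inverse y"
      then show "y = inverse \<beta> * inverse x \<and> \<beta> \<noteq> 0" using x that by simp
    next
      assume "y = inverse \<beta> * inverse x \<and> \<beta> \<noteq> 0"
      then show "\<beta> = inverse x * inverse y" using x by simp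
    qed
    then have "(\<Sum>y\<in>?N. (if \<beta> = inverse x * inverse y then int q * \<chi> (x + y) else 0)) =
       (\<Sum>y\<in>?N. (if y = inverse \<beta> * inverse x then if \<beta> \<noteq> 0 then int q * \<chi> (x + y) else 0 else 0))"
      by (intro sum.cong) auto
    also have "\<dots> = (if \<beta> = 0 then 0 else int q * \<chi> (x + inverse \<beta> * inverse x))"
      using x by (subst sum.delta) auto
    finally show "(\<Sum>y\<in>?N. (if \<beta> = inverse x * inverse y then int q * \<chi> (x + y) else 0)) = \<dots>" .
  qed
  also have "\<dots> = (if \<beta> = 0 then 0 else int q * K (inverse \<beta>))"
    by (simp add: kloosterman_def sum_distrib_left)
  finally show ?thesis by simp
qed

end

section \<open>The Weil bound\<close>

text \<open>Coprimality with an explicit certificate: certificates for new pairs are produced from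
  old ones by polynomial identities.\<close>

definition bezout :: "'b::comm_ring_1 \<Rightarrow> 'b \<Rightarrow> bool" where
  "bezout u v \<longleftrightarrow> (\<exists>x y. x * u + y * v = 1)"

lemma bezout_commute: "bezout u v \<longleftrightarrow> bezout v u"
  unfolding bezout_def by (metis add.commute)

lemma bezout_dvd_mult_cancel:
  assumes "bezout u v" and "v dvd w * u"
  shows "v dvd w"
proof -
  obtain x y where xy: "x * u + y * v = 1" using assms(1) by (auto simp: bezout_def)
  have "w = w * (x * u + y * v)" by (simp add: xy)
  then have "w = x * (w * u) + v * (w * y)" by (simp add: algebra_simps)
  moreover have "v dvd x * (w * u) + v * (w * y)" using assms(2) by simp
  ultimately show ?thesis by simp
qed

lemma bezout_mult:
  assumes "bezout w u" and "bezout w v"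
  shows "bezout w (u * v)"
proof -
  obtain x y x' y' where "x * w + y * u = 1" "x' * w + y' * v = 1"
    using assms by (auto simp: bezout_def)
  then have "(x * w + y * u) * (x' * w + y' * v) = 1" by simp
  then have "(x * x' * w + x * y' * v + y * u * x') * w + (y * y') * (u * v) = 1"
    by (simp add: algebra_simps)
  then show ?thesis unfolding bezout_def by blast
qed

lemma bezout_prod: "(\<And>i. i \<in> I \<Longrightarrow> bezout w (f i)) \<Longrightarrow> bezout w (prod f I)"
proof (induction I rule: infinite_finite_induct)
  case (insert i I)
  then show ?case by (simp add: bezout_mult)
qed (auto simp: bezout_def intro: exI[of _ 0] exI[of _ 1])

text \<open>Synthetic division gives p = (X - c) s + p(c), and p(c) is a unit.\<close>

lemma bezout_linear:
  assumes "poly p (c::'b::field) \<noteq> 0"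
  shows "bezout p [:- c, 1:]"
proof -
  have "p = [:- c, 1:] * synthetic_div p c + [:poly p c:]"
    using synthetic_div_correct'[of c p] by simp
  then have "e * p + (- (e * synthetic_div p c)) * [:- c, 1:] = e * [:poly p c:]" for e
    by (metis (no_types, lifting) add.commute add_diff_cancel_left' diff_conv_add_uminus
        distrib_left mult.assoc mult.commute mult_minus_left)
  moreover have "[:inverse (poly p c):] * [:poly p c:] = 1" using assms by (simp add: one_pCons)
  ultimately show ?thesis unfolding bezout_def by metis
qed

lemma prod_linear_dvd:
  assumes "finite S" and "\<And>u. u \<in> S \<Longrightarrow> poly p u = (0::'b::field)"
  shows "(\<Prod>u\<in>S. [:- u, 1:]) dvd p"
  using assms
proof (induction S rule: finite_induct)
  case (insert u S)
  then obtain s where s: "p = (\<Prod>u\<in>S. [:- u, 1:]) * s" by (auto elim: dvdE)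
  have "(\<Prod>v\<in>S. u - v) * poly s u = 0"
    using insert.prems[of u] by (simp add: s poly_prod)
  moreover have "(\<Prod>v\<in>S. u - v) \<noteq> 0" using insert.hyps by auto
  ultimately have "[:- u, 1:] dvd s" by (simp add: poly_eq_0_iff_dvd)
  then show ?case unfolding s prod.insert[OF insert.hyps]
    by (metis mult.commute mult_dvd_mono dvd_refl)
qed simp

lemma degree_prod_linear: "degree (\<Prod>u\<in>S. [:- u, 1:]) = card S" for S :: "'b::field set"
  by (induction S rule: infinite_finite_induct) (simp_all add: degree_mult_eq del: mult_pCons_left)

lemma monic_prod_linear: "lead_coeff (\<Prod>u\<in>S. [:- u, 1:]) = 1" for S :: "'b::field set"
  by (induction S rule: infinite_finite_induct) (simp_all add: lead_coeff_mult del: mult_pCons_left)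

text \<open>Every monomial of degree 5 in two variables contains one of the two cubes. Applied to a
  Bezout equation raised to the fifth power, this yields a certificate for the pair of
  cubes.\<close>

lemma add_power5:
  "(x + y) ^ 5 = x ^ 3 * (x\<^sup>2 + 5 * x * y + 10 * y\<^sup>2) + y ^ 3 * (10 * x\<^sup>2 + 5 * x * y + y\<^sup>2)"
  for x y :: "'b::comm_ring_1"
  by (simp add: eval_nat_numeral algebra_simps)

text \<open>For coprime entries this is the degree of the fraction as a rational function, the naive
  height over the rational function field.\<close>

definition ht :: "'b::zero poly \<times> 'b poly \<Rightarrow> nat" where
  "ht p = max (degree (fst p)) (degree (snd p))"

lemma ht_coeff:
  assumes "bezout (fst p) (snd p)"
  shows "coeff (fst p) (ht p) \<noteq> 0 \<or> coeff (snd p) (ht p) \<noteq> 0"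
proof (rule ccontr)
  assume *: "\<not> ?thesis"
  have "fst p \<noteq> 0 \<or> snd p \<noteq> 0" using assms by (auto simp: bezout_def)
  then show False using * unfolding ht_def max_def
    by (smt (verit) le_degree leading_coeff_0_iff le_zero_eq degree_0 nle_le)
qed

lemma coeff_mult_top:
  fixes p q :: "'b::comm_ring_1 poly"
  assumes "degree p \<le> m" "degree q \<le> n"
  shows "coeff (p * q) (m + n) = coeff p m * coeff q n"
proof -
  have "coeff (p * q) (m + n) = (\<Sum>i\<le>m + n. coeff p i * coeff q (m + n - i))"
    by (simp add: coeff_mult)
  also have "\<dots> = (\<Sum>i\<in>{m}. coeff p i * coeff q (m + n - i))"
  proof (rule sum.mono_neutral_right)
    show "\<forall>i\<in>{..m + n} - {m}. coeff p i * coeff q (m + n - i) = 0"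
    proof
      fix i assume "i \<in> {..m + n} - {m}"
      then consider "i > m" | "m + n - i > n" by fastforce
      then show "coeff p i * coeff q (m + n - i) = 0"
        using assms by cases (simp_all add: coeff_eq_0)
    qed
  qed auto
  finally show ?thesis by simp
qed

text \<open>Multiplicativity of the Gauss norm at infinity, for the two linear forms \<open>v Z + u W\<close>.\<close>

lemma ht_add:
  fixes u v u' v' :: "'b::field poly"
  assumes "bezout u v" "bezout u' v'"
    and "degree (v * v') \<le> d" "degree (u * v' + u' * v) \<le> d" "degree (u * u') \<le> d"
    and "coeff (v * v') d \<noteq> 0 \<or> coeff (u * u') d \<noteq> 0"
  shows "ht (u, v) + ht (u', v') = d"
proof -
  let ?m = "ht (u, v)" and ?m' = "ht (u', v')"
  have deg: "degree u \<le> ?m" "degree v \<le> ?m" "degree u' \<le> ?m'" "degree v' \<le> ?m'"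
    by (simp_all add: ht_def)
  have c1: "coeff (v * v') (?m + ?m') = coeff v ?m * coeff v' ?m'"
    and c2: "coeff (u * u') (?m + ?m') = coeff u ?m * coeff u' ?m'"
    and c3: "coeff (u * v' + u' * v) (?m + ?m') = coeff u ?m * coeff v' ?m' + coeff u' ?m' * coeff v ?m"
    using deg coeff_mult_top[of v ?m v' ?m'] coeff_mult_top[of u ?m u' ?m']
      coeff_mult_top[of u ?m v' ?m'] coeff_mult_top[of u' ?m' v ?m] by (simp_all add: add.commute)
  have nz: "coeff u ?m \<noteq> 0 \<or> coeff v ?m \<noteq> 0" "coeff u' ?m' \<noteq> 0 \<or> coeff v' ?m' \<noteq> 0"
    using ht_coeff[of "(u, v)"] ht_coeff[of "(u', v')"] assms by simp_all
  \<comment> \<open>Otherwise the product of two nonzero linear forms over the field, formed from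
    the coefficients in degrees \<open>?m\<close> and \<open>?m'\<close>, would be zero. The
    opposite inequality comes from the degrees of the two outer products, one of which reaches
    d.\<close>
  have "\<not> ?m + ?m' > d"
  proof
    assume "?m + ?m' > d"
    then have "coeff v ?m * coeff v' ?m' = 0" "coeff u ?m * coeff u' ?m' = 0"
      "coeff u ?m * coeff v' ?m' + coeff u' ?m' * coeff v ?m = 0"
      using assms(3-5) c1 c2 c3 by (metis coeff_eq_0 le_less_trans)+
    then show False using nz by auto
  qed
  moreover have "\<not> ?m + ?m' < d"
  proof
    assume "?m + ?m' < d"
    moreover have "degree (v * v') \<le> ?m + ?m'" "degree (u * u') \<le> ?m + ?m'"
      using deg by (meson add_mono degree_mult_le order_trans)+
    ultimately have "coeff (v * v') d = 0" "coeff (u * u') d = 0"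
      by (auto intro!: coeff_eq_0)
    then show False using assms(6) by simp
  qed
  ultimately show ?thesis by simp
qed

text \<open>Both factors would be powers of two greater than 1, hence both even. This excludes
  equality in the quadratic inequality behind the Weil bound and makes the bound strict.\<close>

lemma consecutive_prod_not_pow2:
  assumes "r \<ge> 2" and "n * (n - 1) = (2::nat) ^ r"
  shows False
proof -
  have n: "n \<ge> 3"
  proof (rule ccontr)
    assume "\<not> n \<ge> 3"
    then have "n * (n - 1) \<le> 2 * 1" by (intro mult_le_mono) auto
    moreover have "(2::nat) ^ r \<ge> 2 ^ 2" using assms(1) by (intro power_increasing) auto
    ultimately show False using assms(2) by simp
  qed
  obtain i j where "n = 2 ^ i" "n - 1 = 2 ^ j"
    using assms(2) divides_primepow_nat[OF two_is_prime_nat, of n r] divides_primepow_nat[OF two_is_prime_nat, of "n - 1" r]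
    by (metis dvd_triv_left dvd_triv_right)
  moreover have "i \<noteq> 0" "j \<noteq> 0" using n calculation by (auto intro!: Nat.gr0I)
  ultimately have "even n" "even (n - 1)" by simp_all
  then show False using n by simp
qed

section \<open>Heights along an arithmetic progression of points on the twisted curve\<close>

context char2_field
begin

lemma poly_add_self: "p + p = (0 :: 'a poly)"
  by (rule poly_eqI) (simp only: coeff_add add_self coeff_0)

lemma poly_add_left_self: "p + (p + s) = (s :: 'a poly)"
  by (simp add: poly_add_self flip: add.assoc)

lemma poly_uminus_self: "- p = (p :: 'a poly)"
  by (simp add: poly_eq_iff uminus_self)

lemma poly_diff_eq_add: "p - s = p + (s :: 'a poly)"
  by (simp add: poly_eq_iff diff_eq_add)

lemmas poly_char2 = poly_add_self poly_add_left_self poly_uminus_self poly_diff_eq_add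

lemma poly_add_eq_0: "p + s = 0 \<longleftrightarrow> p = (s :: 'a poly)"
  by (metis poly_diff_eq_add eq_iff_diff_eq_0)

lemma poly_add_sq: "(p + s)\<^sup>2 = p\<^sup>2 + (s::'a poly)\<^sup>2"
  by (simp add: power2_eq_square algebra_simps poly_char2)

lemma poly_sum_sq: "(\<Sum>i\<in>I. f i)\<^sup>2 = (\<Sum>i\<in>I. (f i :: 'a poly)\<^sup>2)"
  by (induction I rule: infinite_finite_induct) (simp_all add: poly_add_sq)

text \<open>The symmetric biquadratic relation between the abscissae \<open>f / g\<close> and \<open>u / v\<close> of two points
  differing by \<open>(t, 0)\<close> on the twist \<open>y\<^sup>2 + y = x + a\<^sup>2 / x\<^sup>2 + t + a\<^sup>2 / t\<^sup>2\<close> over the rational function field.\<close>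

definition biquad :: "'a \<Rightarrow> 'a poly \<times> 'a poly \<Rightarrow> 'a poly \<times> 'a poly \<Rightarrow> bool" where
  "biquad a = (\<lambda>(f, g) (u, v).
     (f + [:0, 1:] * g)\<^sup>2 * u\<^sup>2 + [:0, 1:] * f * g * u * v + ([:0, 1:] * f + [:a:] * g)\<^sup>2 * v\<^sup>2 = 0)"

text \<open>Expanded, the relation between X and X' reads X^2 X'^2 + t^2 (X^2 + X'^2) + t X X' + a^2
  = 0. Symmetry lets each point of the progression serve in turn as the centre of the next
  step.\<close>

lemma biquad_sym: "biquad a p p' \<longleftrightarrow> biquad a p' p"
  unfolding biquad_def
  by (cases p; cases p') (simp add: poly_add_sq power_mult_distrib algebra_simps del: mult_pCons_left mult_pCons_right)

text \<open>A root u/v in lowest terms splits off with polynomial cofactor: the quadratic form with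
  coefficients \<open>\<alpha>\<close>, \<open>\<beta>\<close>, \<open>\<gamma>\<close> becomes (v Z
  + u W)(v' Z + u' W). By coprimality v divides \<open>\<alpha>\<close> and u divides
  \<open>\<gamma>\<close>; the middle coefficient follows by cancelling u v. If u or v is zero the
  other one is a unit, and the missing cofactor is read off from \<open>\<beta>\<close>.\<close>

lemma biquad_factor:
  fixes \<alpha> \<beta> \<gamma> u v :: "'a poly"
  assumes "bezout u v" "\<alpha> * u\<^sup>2 + \<beta> * u * v + \<gamma> * v\<^sup>2 = 0"
  obtains u' v' where "\<alpha> = v * v'" "\<beta> = u * v' + u' * v" "\<gamma> = u * u'"
proof -
  have unit: "x * (y * z) = z" if "y * x = 1" for x y z :: "'a poly"
    using that by (metis mult.assoc mult.commute mult_1)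
  have "v dvd (\<alpha> * u) * u"
  proof -
    have "\<alpha> * u\<^sup>2 = v * (\<beta> * u + \<gamma> * v)"
      using assms(2) poly_add_eq_0[of "\<alpha> * u\<^sup>2" "\<beta> * u * v + \<gamma> * v\<^sup>2"]
      by (simp add: algebra_simps power2_eq_square)
    then show ?thesis by (metis dvd_triv_left mult.assoc power2_eq_square)
  qed
  then have "v dvd \<alpha>"
    using bezout_dvd_mult_cancel[OF assms(1)] by blast
  then obtain v1 where v1: "\<alpha> = v * v1" by (elim dvdE)
  have "u dvd (\<gamma> * v) * v"
  proof -
    have "\<gamma> * v\<^sup>2 = u * (\<alpha> * u + \<beta> * v)"
      using assms(2) poly_add_eq_0[of "\<alpha> * u\<^sup>2 + \<beta> * u * v" "\<gamma> * v\<^sup>2"]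
      by (simp add: algebra_simps power2_eq_square)
    then show ?thesis by (metis dvd_triv_left mult.assoc power2_eq_square)
  qed
  then have "u dvd \<gamma>"
    using bezout_dvd_mult_cancel[of v u] assms(1) bezout_commute by blast
  then obtain u1 where u1: "\<gamma> = u * u1" by (elim dvdE)
  consider "u = 0" | "v = 0" | "u \<noteq> 0" "v \<noteq> 0" by blast
  then show ?thesis
  proof cases
    case 1
    then obtain y where y: "y * v = 1" using assms(1) by (auto simp: bezout_def)
    show ?thesis
      by (rule that[of v1 "y * \<beta>"]) (use 1 v1 u1 unit[OF y] in \<open>simp_all add: mult_ac\<close>)
  next
    case 2
    then obtain y where y: "y * u = 1" using assms(1) by (auto simp: bezout_def)
    show ?thesis
      by (rule that[of "y * \<beta>" u1]) (use 2 v1 u1 unit[OF y] in \<open>simp_all add: mult_ac\<close>)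
  next
    case 3
    have "(u * v) * (\<beta> + (u * v1 + u1 * v)) = 0"
      using assms(2) by (simp add: v1 u1 power2_eq_square algebra_simps)
    then have "\<beta> = u * v1 + u1 * v" using 3 poly_add_eq_0 by simp
    then show ?thesis using that v1 u1 by blast
  qed
qed

text \<open>For given f/g the relation is a quadratic equation for u/v, and u'/v' is its other root,
  the neighbour on the other side. The coefficients have degree at most 2 d + 2, where d is the
  height of f/g, and in that degree the outer ones have the coefficients (coeff g d)^2 and (coeff f
  d)^2, not both zero. Multiplicativity of the Gauss norm then adds the heights of the two roots up
  to 2 d + 2.\<close>

lemma biquad_step:
  fixes f g u v :: "'a poly"
  assumes "a \<noteq> 0" "bezout f g" "bezout u v" "biquad a (f, g) (u, v)"
  shows "\<exists>u' v'. bezout u' v' \<and> biquad a (f, g) (u', v') \<and> ht (u, v) + ht (u', v') = 2 * ht (f, g) + 2"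
proof -
  let ?t = "[:0, 1::'a:]" and ?c = "[:a:]"
  define \<alpha> \<beta> \<gamma> where "\<alpha> = (f + ?t * g)\<^sup>2" and "\<beta> = ?t * f * g" and "\<gamma> = (?t * f + ?c * g)\<^sup>2"
  have "\<alpha> * u\<^sup>2 + \<beta> * u * v + \<gamma> * v\<^sup>2 = 0"
    using assms(4) by (simp add: biquad_def \<alpha>_def \<beta>_def \<gamma>_def)
  from biquad_factor[OF assms(3) this] obtain u' v'
    where \<alpha>: "\<alpha> = v * v'" and \<beta>: "\<beta> = u * v' + u' * v" and \<gamma>: "\<gamma> = u * u'" .
  \<comment> \<open>The identities f \<alpha> + t g \<beta> = f^3 and g \<gamma> + t f \<beta> = a^2
    g^3 hold because the mixed terms cancel in characteristic two. Since \<alpha>, \<beta>, \<gamma>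
    are combinations of u' and v', so are the cubes of f and g, and a certificate for f and g passes
    to u' and v'.\<close>
  have f3: "f ^ 3 = (?t * g * v) * u' + (f * v + ?t * g * u) * v'"
  proof -
    have "f ^ 3 = f * \<alpha> + ?t * g * \<beta>"
      by (simp add: \<alpha>_def \<beta>_def power2_eq_square power3_eq_cube algebra_simps poly_char2 del: mult_pCons_left mult_pCons_right)
    then show ?thesis by (simp add: \<alpha> \<beta> algebra_simps del: mult_pCons_left mult_pCons_right)
  qed
  define b where "b = [:inverse a:]"
  have b: "b * ?c = 1" using assms(1) by (simp add: b_def one_pCons)
  have g3: "g ^ 3 = (b\<^sup>2 * (g * u + ?t * f * v)) * u' + (b\<^sup>2 * (?t * f * u)) * v'"
  proof -
    have "?c\<^sup>2 * g ^ 3 = g * \<gamma> + ?t * f * \<beta>"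
      by (simp add: \<gamma>_def \<beta>_def power2_eq_square power3_eq_cube algebra_simps poly_char2 del: mult_pCons_left mult_pCons_right)
    then have "(b * ?c)\<^sup>2 * g ^ 3 = b\<^sup>2 * (g * \<gamma> + ?t * f * \<beta>)"
      by (metis mult.assoc power_mult_distrib)
    then have "g ^ 3 = b\<^sup>2 * (g * \<gamma> + ?t * f * \<beta>)" by (simp only: b power_one mult_1)
    then show ?thesis by (simp add: \<gamma> \<beta> algebra_simps del: mult_pCons_left mult_pCons_right)
  qed
  have cop: "bezout u' v'"
  proof -
    obtain k l where kl: "k * f + l * g = 1" using assms(2) by (auto simp: bezout_def)
    have "(k * f + l * g) ^ 5 = f ^ 3 * (k ^ 3 * ((k * f)\<^sup>2 + 5 * (k * f) * (l * g) + 10 * (l * g)\<^sup>2))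
      + g ^ 3 * (l ^ 3 * (10 * (k * f)\<^sup>2 + 5 * (k * f) * (l * g) + (l * g)\<^sup>2))"
      unfolding add_power5 power_mult_distrib by (simp only: mult_ac)
    then obtain P R where PR: "1 = f ^ 3 * P + g ^ 3 * R" using kl by (metis power_one)
    then show ?thesis unfolding f3 g3 bezout_def
      by (intro exI[of _ "(?t * g * v) * P + (b\<^sup>2 * (g * u + ?t * f * v)) * R"]
          exI[of _ "(f * v + ?t * g * u) * P + (b\<^sup>2 * (?t * f * u)) * R"])
         (simp add: algebra_simps del: mult_pCons_left mult_pCons_right)
  qed
  have "\<alpha> * u'\<^sup>2 + \<beta> * u' * v' + \<gamma> * v'\<^sup>2 = 0"
    by (simp add: \<alpha> \<beta> \<gamma> power2_eq_square algebra_simps poly_char2)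
  then have biq: "biquad a (f, g) (u', v')"
    by (simp add: biquad_def \<alpha>_def \<beta>_def \<gamma>_def)
  let ?d = "ht (f, g)"
  have degs: "degree f \<le> ?d" "degree g \<le> ?d" by (simp_all add: ht_def)
  have dt: "degree (?t * h) \<le> Suc ?d" "coeff (?t * h) (Suc ?d) = coeff h ?d" if "degree h \<le> ?d" for h
    using that by (simp_all add: degree_pCons_le order_trans[OF degree_pCons_le])
  have dc: "degree (?c * h) \<le> ?d" if "degree h \<le> ?d" for h
    using that by simp
  have d1: "degree (f + ?t * g) \<le> Suc ?d" "degree (?t * f + ?c * g) \<le> Suc ?d"
    using dt(1) dc degs by (meson degree_add_le le_SucI)+
  have c1: "coeff (f + ?t * g) (Suc ?d) = coeff g ?d" "coeff (?t * f + ?c * g) (Suc ?d) = coeff f ?d"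
    using dt(2) dc degs by (simp_all add: coeff_eq_0 le_imp_less_Suc)
  have two_d: "2 * ?d + 2 = Suc ?d + Suc ?d" by simp
  have "degree \<alpha> \<le> 2 * ?d + 2" "degree \<gamma> \<le> 2 * ?d + 2"
    using d1 degree_mult_le[of "f + ?t * g" "f + ?t * g"] degree_mult_le[of "?t * f + ?c * g" "?t * f + ?c * g"]
    unfolding \<alpha>_def \<gamma>_def power2_eq_square by linarith+
  moreover have "degree \<beta> \<le> 2 * ?d + 2"
    using degree_mult_le[of "?t * f" g] dt(1)[of f] degs unfolding \<beta>_def by linarith
  moreover have "coeff \<alpha> (2 * ?d + 2) = (coeff g ?d)\<^sup>2" "coeff \<gamma> (2 * ?d + 2) = (coeff f ?d)\<^sup>2"
    using coeff_mult_top[OF d1(1) d1(1), unfolded c1] coeff_mult_top[OF d1(2) d1(2), unfolded c1]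
    unfolding \<alpha>_def \<gamma>_def power2_eq_square two_d by simp_all
  moreover have "coeff f ?d \<noteq> 0 \<or> coeff g ?d \<noteq> 0" using ht_coeff[of "(f, g)"] assms(2) by simp
  ultimately have "ht (u, v) + ht (u', v') = 2 * ?d + 2"
    unfolding \<alpha> \<beta> \<gamma> by (intro ht_add assms(3) cop) auto
  then show ?thesis using cop biq by blast
qed

text \<open>Consecutive heights satisfy h(n) + h(n + 2) = 2 h(n + 1) + 2, so their second difference
  is 2 and they form the quadratic polynomial fixed by the two initial values. As heights its values
  are nonnegative.\<close>

lemma ht_quadratic:
  assumes "a \<noteq> 0" "bezout (fst p0) (snd p0)" "bezout (fst p1) (snd p1)" "biquad a p0 p1"
    and "int (ht p0) = d" "int (ht p1) = d + 1 - k"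
  shows "int n ^ 2 - k * int n + d \<ge> 0"
proof -
  have "\<exists>p p'. bezout (fst p) (snd p) \<and> bezout (fst p') (snd p') \<and> biquad a p p'
    \<and> int (ht p) = int n ^ 2 - k * int n + d \<and> int (ht p') = (int n + 1) ^ 2 - k * (int n + 1) + d"
  proof (induction n)
    case 0
    then show ?case using assms by (intro exI[of _ p0] exI[of _ p1]) simp
  next
    case (Suc n)
    then obtain p p' where pp: "bezout (fst p) (snd p)" "bezout (fst p') (snd p')" "biquad a p p'"
      "int (ht p) = int n ^ 2 - k * int n + d" "int (ht p') = (int n + 1) ^ 2 - k * (int n + 1) + d" by blast
    have "biquad a (fst p', snd p') (fst p, snd p)" using pp(3) biquad_sym by simp
    from biquad_step[OF assms(1) pp(2) pp(1) this] obtain u v where uv: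
      "bezout u v" "biquad a p' (u, v)" "ht p + ht (u, v) = 2 * ht p' + 2" by auto
    have "int (ht p) + int (ht (u, v)) = 2 * int (ht p') + 2"
      using uv(3) by linarith
    then have "int (ht (u, v)) = (int (Suc n) + 1) ^ 2 - k * (int (Suc n) + 1) + d"
      unfolding pp(4,5) by (simp add: power2_eq_square algebra_simps)
    then show ?case using pp uv
      by (intro exI[of _ p'] exI[of _ "(u, v)"]) (simp add: add.commute)
  qed
  then show ?thesis by (metis of_nat_0_le_iff)
qed

text \<open>The progression starts at abscissa t^q. The quotient W / t^(q/2) is the formal trace of
  t + a/t and, up to the summand a/t + a/t^q, an ordinate of that point. At a nonzero u the value of
  W is u^(q/2) times the trace of u + a/u, so W shares with t^(q-1) + 1 exactly the roots u with
  \<chi> (u + a/u) = 1. After cancelling them the degree of the neighbouring abscissa counts these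
  u, which is how K a enters.\<close>

lemma kloosterman_start:
  assumes "a \<noteq> 0"
  shows "\<exists>p. bezout (fst p) (snd p) \<and> biquad a ([:0, 1:] ^ q, 1) p \<and> int (ht p) = int q + 1 - K a"
proof -
  let ?t = "[:0, 1::'a:]" and ?c = "[:a:]"
  define h where "h = (2::nat) ^ (r - 1)"
  have hq: "h + h = q" using r_pos q_eq by (simp add: h_def flip: mult_2 power_Suc)
  have le_h: "2 ^ k \<le> h" if "k < r" for k
    unfolding h_def using that by (intro power_increasing) auto
  \<comment> \<open>The power h = q/2 clears all denominators of the trace of t + a/t; each 2^k is
    at most h, so the exponents do not truncate.\<close>
  define W where "W = (\<Sum>k<r. ?t ^ (h + 2 ^ k) + ?c ^ (2 ^ k) * ?t ^ (h - 2 ^ k))"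
  define F where "F k = ?t ^ (q + 2 ^ k) + ?c ^ (2 ^ k) * ?t ^ (q - 2 ^ k)" for k
  have cq: "?c ^ q = ?c"
    using power_q[of a] poly_const_pow by metis
  \<comment> \<open>Squaring W shifts the index of F by one relative to multiplication by t^h, so
    the sum of both telescopes to F r + F 0.\<close>
  have W_eq: "W\<^sup>2 + ?t ^ h * W = (?t ^ (q + 1) + ?c) * (?t ^ (q - 1) + 1)"
  proof -
    have "W\<^sup>2 = (\<Sum>k<r. F (Suc k))"
      unfolding W_def poly_sum_sq
    proof (intro sum.cong refl)
      fix k assume "k \<in> {..<r}"
      then have "h - 2 ^ k + (h - 2 ^ k) = q - 2 ^ Suc k" "h + 2 ^ k + (h + 2 ^ k) = q + 2 ^ Suc k"
        using le_h[of k] hq by auto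
      then have "(?t ^ (h + 2 ^ k))\<^sup>2 = ?t ^ (q + 2 ^ Suc k)" "(?t ^ (h - 2 ^ k))\<^sup>2 = ?t ^ (q - 2 ^ Suc k)"
        by (simp_all only: power2_eq_square power_add[symmetric])
      moreover have "(?c ^ (2 ^ k))\<^sup>2 = ?c ^ (2 ^ Suc k)" by (rule pow2_Suc[symmetric])
      ultimately show "(?t ^ (h + 2 ^ k) + ?c ^ (2 ^ k) * ?t ^ (h - 2 ^ k))\<^sup>2 = F (Suc k)"
        by (simp only: F_def poly_add_sq power_mult_distrib)
    qed
    moreover have "?t ^ h * W = (\<Sum>k<r. F k)"
      unfolding W_def sum_distrib_left
    proof (intro sum.cong refl)
      fix k assume "k \<in> {..<r}"
      then have "h + (h - 2 ^ k) = q - 2 ^ k" "h + (h + 2 ^ k) = q + 2 ^ k"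
        using le_h[of k] hq by auto
      then have "?t ^ h * ?t ^ (h + 2 ^ k) = ?t ^ (q + 2 ^ k)" "?t ^ h * ?t ^ (h - 2 ^ k) = ?t ^ (q - 2 ^ k)"
        by (simp_all only: power_add[symmetric])
      then show "?t ^ h * (?t ^ (h + 2 ^ k) + ?c ^ (2 ^ k) * ?t ^ (h - 2 ^ k)) = F k"
        by (simp only: F_def distrib_left mult.left_commute[of "?t ^ h" "?c ^ (2 ^ k)"])
    qed
    ultimately have "W\<^sup>2 + ?t ^ h * W = (\<Sum>k<r. F (Suc k)) - (\<Sum>k<r. F k)"
      by (simp only: poly_diff_eq_add)
    also have "\<dots> = F r - F 0"
      unfolding sum_subtractf[symmetric] by (rule sum_lessThan_telescope)
    also have "\<dots> = F r + F 0" by (rule poly_diff_eq_add)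
    also have "\<dots> = (?t ^ (q + 1) + ?c) * (?t ^ (q - 1) + 1)"
    proof -
      have "q + 1 + (q - 1) = q + q" using q_ge_2 by simp
      then have z: "?t ^ (q + 1) * ?t ^ (q - 1) = ?t ^ (q + q)"
        by (simp only: power_add[symmetric])
      have "F r = ?t ^ (q + q) + ?c" "F 0 = ?t ^ (q + 1) + ?c * ?t ^ (q - 1)"
        unfolding F_def q_eq[symmetric] cq by simp_all
      moreover have "z + c + (x + c * y) = (x + c) * (y + 1)" if "x * y = z" for x y z c :: "'a poly"
        using that by (auto simp: algebra_simps)
      ultimately show ?thesis using z by metis
    qed
    finally show ?thesis .
  qed
  define P where "P = ?t ^ (q - 1) + 1"
  define S where "S = {u::'a. u \<noteq> 0 \<and> \<chi> (u + a * inverse u) = 1}"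
  define S' where "S' = {u::'a. u \<noteq> 0 \<and> \<chi> (u + a * inverse u) \<noteq> 1}"
  define Z where "Z = (\<Prod>u\<in>S. [:- u, 1:])"
  define Y where "Y = (\<Prod>u\<in>S'. [:- u, 1:])"
  have SS: "S \<inter> S' = {}" "S \<union> S' = UNIV - {0}" by (auto simp: S_def S'_def)
  have degP: "degree P = q - 1" "lead_coeff P = 1"
  proof -
    have "P = monom 1 (q - 1) + 1" by (simp add: P_def monom_altdef)
    moreover have "degree (1::'a poly) < degree (monom (1::'a) (q - 1))" using q_ge_2 by (simp add: degree_monom_eq)
    ultimately show "degree P = q - 1" "lead_coeff P = 1"
      using q_ge_2 by (simp_all add: degree_add_eq_left degree_monom_eq)
  qed
  have ZY: "P = Z * Y"
  proof -
    have ZY': "Z * Y = (\<Prod>u\<in>UNIV - {0::'a}. [:- u, 1:])"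
      unfolding Z_def Y_def SS(2)[symmetric] by (rule prod.union_disjoint[symmetric]) (use SS(1) in auto)
    have "Z * Y dvd P" unfolding ZY'
      by (rule prod_linear_dvd) (use power_q_minus_1 in \<open>auto simp: P_def add_self\<close>)
    then obtain s where s: "P = Z * Y * s" by (elim dvdE)
    have "P \<noteq> 0" using degP(2) by auto
    then have "degree P = degree (Z * Y) + degree s" unfolding s by (intro degree_mult_eq) auto
    moreover have "degree (Z * Y) = q - 1" unfolding ZY' by (simp add: degree_prod_linear card_nz)
    ultimately have "degree s = 0" using degP by simp
    moreover have "lead_coeff s = 1"
      using degP(2) unfolding s lead_coeff_mult ZY' monic_prod_linear
      by (metis ZY' lead_coeff_mult monic_prod_linear mult_1)
    ultimately have "s = 1" by (metis degree_eq_zeroE lead_coeff_pCons(2) one_pCons)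
    then show ?thesis using s by simp
  qed
  have polyW: "poly W u = u ^ h * tr r (u + a * inverse u)" if "u \<noteq> 0" for u
  proof -
    have "poly W u = (\<Sum>k<r. u ^ h * (u ^ 2 ^ k + (a * inverse u) ^ 2 ^ k))"
      unfolding W_def poly_sum
    proof (intro sum.cong refl)
      fix k assume "k \<in> {..<r}"
      then have "u ^ (h - 2 ^ k) = u ^ h * inverse u ^ 2 ^ k"
        using le_h[of k] that by (simp add: power_diff divide_inverse power_inverse)
      then show "poly (?t ^ (h + 2 ^ k) + ?c ^ 2 ^ k * ?t ^ (h - 2 ^ k)) u = u ^ h * (u ^ 2 ^ k + (a * inverse u) ^ 2 ^ k)"
        by (simp add: power_add power_mult_distrib algebra_simps del: poly_const_pow)
    qed
    then show ?thesis by (simp add: tr_def add_pow2 sum_distrib_left)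
  qed
  have W0: "poly W 0 \<noteq> 0"
  proof
    assume "poly W 0 = 0"
    then have "0 = poly ((?t ^ (q + 1) + ?c) * (?t ^ (q - 1) + 1)) 0"
      unfolding W_eq[symmetric] by simp
    also have "\<dots> = a" using q_ge_2 by (simp add: power_0_left)
    finally show False using assms by simp
  qed
  have "Z dvd W" unfolding Z_def
    by (rule prod_linear_dvd) (auto simp: S_def polyW lam_def split: if_splits)
  then obtain W' where W': "W = Z * W'" by (elim dvdE)
  have W'nz: "poly W' u \<noteq> 0" if "u \<in> insert 0 S'" for u
  proof -
    have "poly W u \<noteq> 0"
    proof (cases "u = 0")
      case False
      then have "tr r (u + a * inverse u) \<noteq> 0" using that by (auto simp: S'_def lam_def)
      then show ?thesis using False by (simp add: polyW)
    qed (use W0 in simp)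
    then show ?thesis by (simp add: W')
  qed
  have bezout0: "bezout W' ?t" using bezout_linear[OF W'nz[of 0]] by simp
  have bezoutY: "bezout W' Y" unfolding Y_def
    by (intro bezout_prod bezout_linear W'nz) auto
  have "bezout W' (?t * Y\<^sup>2)"
    using bezout0 bezoutY by (simp add: bezout_mult power2_eq_square del: mult_pCons_left)
  then have bez: "bezout (W'\<^sup>2) (?t * Y\<^sup>2)"
    unfolding power2_eq_square by (metis bezout_commute bezout_mult)
  have Znz: "Z \<noteq> 0" "Y \<noteq> 0" using ZY degP by auto
  \<comment> \<open>Squaring the equation for W replaces t^h by t^q. Writing W = Z W' and t^(q-1) +
    1 = Z Y, the common factor Z^2 cancels.\<close>
  have biq: "biquad a (?t ^ q, 1) (W'\<^sup>2, ?t * Y\<^sup>2)"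
  proof -
    have tq: "?t ^ q = ?t * ?t ^ (q - 1)" using q_ge_2 by (simp flip: power_Suc)
    have tP: "?t ^ q + ?t = ?t * Z * Y" unfolding tq using ZY P_def
      by (metis distrib_left mult.assoc mult_1_right)
    have "(W\<^sup>2 + ?t ^ h * W)\<^sup>2 = W ^ 4 + ?t ^ q * W\<^sup>2"
      unfolding poly_add_sq power_mult_distrib
      by (simp add: hq[symmetric] power_add power2_eq_square power4_eq_xxxx mult.assoc flip: power_mult)
    then have "W ^ 4 + ?t ^ q * W\<^sup>2 = (?t ^ (q + 1) + ?c)\<^sup>2 * (Z * Y)\<^sup>2"
      unfolding W_eq P_def[symmetric] ZY by (simp only: power_mult_distrib)
    then have "Z\<^sup>2 * (Z\<^sup>2 * W' ^ 4 + ?t ^ q * W'\<^sup>2) = Z\<^sup>2 * ((?t ^ (q + 1) + ?c)\<^sup>2 * Y\<^sup>2)"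
      unfolding W' by (simp only: power_mult_distrib) (simp add: algebra_simps power2_eq_square power4_eq_xxxx del: mult_pCons_left mult_pCons_right)
    then have *: "Z\<^sup>2 * W' ^ 4 + ?t ^ q * W'\<^sup>2 = (?t ^ (q + 1) + ?c)\<^sup>2 * Y\<^sup>2"
      using Znz by simp
    have "(?t ^ q + ?t * 1)\<^sup>2 * (W'\<^sup>2)\<^sup>2 + ?t * ?t ^ q * 1 * W'\<^sup>2 * (?t * Y\<^sup>2)
        = ?t\<^sup>2 * Y\<^sup>2 * (Z\<^sup>2 * W' ^ 4 + ?t ^ q * W'\<^sup>2)"
      unfolding mult_1_right tP by (simp only: power_mult_distrib) (simp add: algebra_simps power2_eq_square power4_eq_xxxx del: mult_pCons_left mult_pCons_right)
    also have "\<dots> = (?t * ?t ^ q + ?c * 1)\<^sup>2 * (?t * Y\<^sup>2)\<^sup>2"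
      unfolding * by (simp add: power2_eq_square mult_ac del: mult_pCons_left mult_pCons_right)
    finally show ?thesis unfolding biquad_def prod.case by (simp only: poly_add_eq_0)
  qed
  have degW: "degree W = q"
  proof -
    have "degree W \<le> q" unfolding W_def
    proof (intro degree_sum_le degree_add_le finite_lessThan)
      fix k assume "k \<in> {..<r}"
      then have k: "h + 2 ^ k \<le> q" "h - 2 ^ k \<le> q" using le_h[of k] hq by auto
      show "degree (?t ^ (h + 2 ^ k)) \<le> q" using k by (simp add: degree_power_eq)
      have "degree (?c ^ 2 ^ k * ?t ^ (h - 2 ^ k)) \<le> 0 + (h - 2 ^ k)"
        by (rule order_trans[OF degree_mult_le])
           (simp add: degree_power_eq poly_const_pow)
      then show "degree (?c ^ 2 ^ k * ?t ^ (h - 2 ^ k)) \<le> q" using k by linarith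
    qed
    moreover have "\<not> degree W < q"
    proof
      assume "degree W < q"
      then have "degree (W\<^sup>2 + ?t ^ h * W) < 2 * q"
        using degree_mult_le[of W W] degree_mult_le[of "?t ^ h" W] hq
        by (intro degree_add_less) (simp_all add: power2_eq_square degree_power_eq)
      moreover have "degree ((?t ^ (q + 1) + ?c) * (?t ^ (q - 1) + 1)) = (q + 1) + (q - 1)"
      proof -
        have d: "degree (?t ^ (q + 1) + ?c) = q + 1"
          by (subst degree_add_eq_left) (simp_all add: degree_power_eq del: power_Suc)
        then show ?thesis using degP unfolding P_def
          by (metis degree_mult_eq degree_0 add_is_0 degP(2) leading_coeff_0_iff one_neq_zero P_def zero_neq_one)
      qed
      ultimately show False unfolding W_eq using q_ge_2 by simp
    qed
    ultimately show ?thesis by simp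
  qed
  then have Wnz: "W \<noteq> 0" using q_ge_2 by auto
  then have degW': "card S + degree W' = q"
    using degW unfolding W' by (simp add: degree_mult_eq Z_def degree_prod_linear)
  have cS: "card S + card S' = q - 1"
    using card_Un_disjoint[of S S'] SS card_nz by simp
  have "degree (?t * Y\<^sup>2) = Suc (2 * card S')"
    using Znz by (simp add: degree_power_eq Y_def degree_prod_linear)
  moreover have "degree (W'\<^sup>2) = 2 * (q - card S)" using degW' Wnz by (auto simp: degree_power_eq W')
  ultimately have ht: "ht (W'\<^sup>2, ?t * Y\<^sup>2) = 2 * (q - card S)"
    unfolding ht_def using cS q_ge_2 by simp
  have "K a = (\<Sum>u\<in>S. \<chi> (u + a * inverse u)) + (\<Sum>u\<in>S'. \<chi> (u + a * inverse u))"
    unfolding kloosterman_def SS(2)[symmetric] by (rule sum.union_disjoint) (use SS(1) in auto)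
  also have "(\<Sum>u\<in>S. \<chi> (u + a * inverse u)) = int (card S)" by (simp add: S_def)
  also have "(\<Sum>u\<in>S'. \<chi> (u + a * inverse u)) = (\<Sum>u\<in>S'. - 1)"
    by (rule sum.cong) (auto simp: S'_def lam_def)
  finally have "K a = int (card S) - int (card S')" by simp
  then have "int (ht (W'\<^sup>2, ?t * Y\<^sup>2)) = int q + 1 - K a"
    unfolding ht using cS degW' q_ge_2 by linarith
  then show ?thesis using bez biq by (intro exI[of _ "(W'\<^sup>2, ?t * Y\<^sup>2)"]) simp
qed

text \<open>The inequality n^2 - |K a| n + q >= 0 holds at all natural numbers n only, so it does
  not bound the discriminant directly. But K a is odd, say |K a| = 2 k + 1; n = k + 1 gives k (k +
  1) <= q, equality is impossible for a power of two, and (2 k + 1)^2 = 4 k (k + 1) + 1 is then less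
  than 4 q.\<close>

theorem weil_kloosterman:
  assumes "a \<noteq> 0" and "q \<ge> 4"
  shows "real_of_int \<bar>K a\<bar> < 2 * sqrt (real q)"
proof -
  let ?p0 = "([:0, 1:] ^ q, 1) :: 'a poly \<times> 'a poly"
  have p0: "bezout (fst ?p0) (snd ?p0)" by (auto simp: bezout_def intro: exI[of _ 0] exI[of _ 1])
  have h0: "ht ?p0 = q" by (simp add: ht_def degree_power_eq)
  obtain p1 where p1: "bezout (fst p1) (snd p1)" "biquad a ?p0 p1" "int (ht p1) = int q + 1 - K a"
    using kloosterman_start[OF assms(1)] by blast
  have 1: "int n ^ 2 - K a * int n + int q \<ge> 0" for n
    by (rule ht_quadratic[OF assms(1) p0 p1(1,2)]) (use h0 p1 in auto)
  \<comment> \<open>The other neighbour of the starting point has height 2 q + 2 - (q + 1 - K a) = q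
    + 1 + K a; walking in this direction gives the inequality with -K a.\<close>
  obtain u v where uv: "bezout u v" "biquad a ?p0 (u, v)" "ht p1 + ht (u, v) = 2 * q + 2"
    using biquad_step[OF assms(1), of "[:0, 1:] ^ q" 1 "fst p1" "snd p1"] p0 p1 h0 by auto
  have 2: "int n ^ 2 - (- K a) * int n + int q \<ge> 0" for n
    by (rule ht_quadratic[OF assms(1) p0, of "(u, v)"]) (use h0 p1 uv in auto)
  have 3: "int n ^ 2 - \<bar>K a\<bar> * int n + int q \<ge> 0" for n
    using 1[of n] 2[of n] by (cases "K a \<ge> 0") auto
  have "odd \<bar>K a\<bar>"
  proof -
    have "even (K a - (- 1))"
      using kloosterman_cong[OF assms] unfolding cong_iff_dvd_diff by (meson dvd_trans even_numeral)
    then show ?thesis by simp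
  qed
  then obtain k where k: "\<bar>K a\<bar> = 2 * k + 1" by (elim oddE)
  have k0: "k \<ge> 0" using k by linarith
  \<comment> \<open>One of the two integers closest to |K a| / 2, where the quadratic polynomial is
    smallest on the integers.\<close>
  define n where "n = nat (k + 1)"
  have n: "int n = k + 1" using k0 by (simp add: n_def)
  have le: "k * (k + 1) \<le> int q"
    using 3[of n] unfolding n k by (simp add: power2_eq_square algebra_simps)
  moreover have "k * (k + 1) \<noteq> int q"
  proof
    assume "k * (k + 1) = int q"
    moreover have "int (n - 1) = k" using k0 by (simp add: n_def nat_add_distrib)
    ultimately have "int (n * (n - 1)) = int q" unfolding of_nat_mult n by (simp only: mult.commute)
    then have "n * (n - 1) = 2 ^ r" using q_eq by (metis of_nat_eq_iff)
    moreover have "r \<ge> 2" using assms(2) q_eq r_pos by (cases "r = 1") auto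
    ultimately show False using consecutive_prod_not_pow2 by blast
  qed
  ultimately have "(2 * k + 1)\<^sup>2 < 4 * int q"
    by (simp add: power2_eq_square algebra_simps)
  then have "real_of_int (\<bar>K a\<bar>\<^sup>2) < real_of_int (4 * int q)" unfolding k using of_int_less_iff by blast
  then have "(real_of_int \<bar>K a\<bar>)\<^sup>2 < (2 * sqrt (real q))\<^sup>2" by (simp add: power_mult_distrib)
  then show ?thesis by (rule power2_less_imp_less) simp
qed

end

section \<open>Power moments and weight distributions\<close>

text \<open>The t-th finite difference at 0 of the h-th power function; equivalently the number of
  surjections from h onto t points.\<close>

definition diff_power :: "nat \<Rightarrow> nat \<Rightarrow> real" where
  "diff_power h t = (\<Sum>j=0..t. (- 1) ^ (t - j) * real (t choose j) * real j ^ h)"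

lemma fact_stirling2: "fact t * stirling2 h t = diff_power h t"
  by (simp add: stirling2_def diff_power_def)

lemma diff_power_0: "diff_power 0 t = (if t = 0 then 1 else 0)"
proof (cases "t = 0")
  case False
  have "diff_power 0 t = (\<Sum>j=0..t. (- 1) ^ j * real (t choose j))"
    unfolding diff_power_def
    by (rule sum.reindex_bij_witness[of _ "\<lambda>j. t - j" "\<lambda>j. t - j"])
       (auto simp: binomial_symmetric[symmetric])
  then show ?thesis using False choose_alternating_sum[of t, where 'a = real] by (simp add: atLeast0AtMost)
qed (simp add: diff_power_def)

lemma diff_power_Suc_0: "diff_power (Suc h) 0 = 0"
  by (simp add: diff_power_def)

text \<open>The recurrence of the Stirling numbers, multiplied by (s + 1)!. It rests on the
  absorption identity (s + 1) (C(s + 1, j) - C(s, j)) = j C(s + 1, j), applied term by term.\<close>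

lemma diff_power_Suc_Suc:
  "diff_power (Suc h) (Suc s) = real (Suc s) * (diff_power h (Suc s) + diff_power h s)"
proof -
  have ab: "real (Suc s) * (real (Suc s choose j) - real (s choose j)) = real j * real (Suc s choose j)" for j
  proof (cases j)
    case (Suc i)
    have "Suc i * (Suc s choose Suc i) = Suc s * (s choose i)"
      using binomial_absorption[of i "Suc s"] by simp
    then have "real (Suc i) * real (Suc s choose Suc i) = real (Suc s) * real (s choose i)"
      by (metis of_nat_mult)
    moreover have "real (Suc s choose Suc i) - real (s choose Suc i) = real (s choose i)" by simp
    ultimately show ?thesis unfolding Suc by (simp only:)
  qed simp
  define e b c where "e j = (- 1) ^ (Suc s - j) * real j ^ h" and "b j = real (Suc s choose j)"
    and "c j = real (s choose j)" for j
  have "diff_power h s = (\<Sum>j=0..s. - (e j * c j))"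
    unfolding diff_power_def e_def c_def by (rule sum.cong) (simp_all add: Suc_diff_le)
  also have "\<dots> = (\<Sum>j=0..Suc s. - (e j * c j))" by (simp add: c_def)
  finally have s: "diff_power h s = (\<Sum>j=0..Suc s. - (e j * c j))" .
  have Ss: "diff_power h (Suc s) = (\<Sum>j=0..Suc s. e j * b j)"
    unfolding diff_power_def e_def b_def by (rule sum.cong) (simp_all only: mult_ac)
  have "real (Suc s) * (diff_power h (Suc s) + diff_power h s)
      = (\<Sum>j=0..Suc s. real (Suc s) * (e j * b j + - (e j * c j)))"
    unfolding s Ss sum.distrib[symmetric] sum_distrib_left ..
  also have "\<dots> = diff_power (Suc h) (Suc s)"
    unfolding diff_power_def
  proof (rule sum.cong[OF refl])
    fix j
    have "real (Suc s) * (e j * b j + - (e j * c j)) = e j * (real (Suc s) * (b j - c j))"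
      by (simp add: algebra_simps del: of_nat_Suc)
    also have "\<dots> = e j * (real j * b j)" unfolding b_def c_def ab ..
    also have "\<dots> = (- 1) ^ (Suc s - j) * real (Suc s choose j) * real j ^ Suc h"
      unfolding e_def b_def power_Suc by (simp only: mult_ac)
    finally show "real (Suc s) * (e j * b j + - (e j * c j)) = (- 1) ^ (Suc s - j) * real (Suc s choose j) * real j ^ Suc h" .
  qed
  finally show ?thesis ..
qed

lemma diff_power_eq_0: "t > h \<Longrightarrow> diff_power h t = 0"
proof (induction h arbitrary: t)
  case 0 then show ?case by (simp add: diff_power_0)
next
  case (Suc h)
  then obtain s where "t = Suc s" "s > h" by (metis Suc_less_eq2)
  then show ?case using Suc.IH by (simp add: diff_power_Suc_Suc)
qed

text \<open>Powers in the binomial basis. Induction on h: multiplication by w sends C(w, t) to t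
  C(w, t) + (t + 1) C(w, t + 1), which matches the recurrence of \<open>diff_power\<close>.\<close>

lemma power_eq_sum_stirling2:
  "real w ^ h = (\<Sum>t=0..h. fact t * stirling2 h t * real (w choose t))"
proof (induction h)
  case 0 then show ?case by (simp add: stirling2_def)
next
  case (Suc h)
  have step: "real w * real (w choose t) = real t * real (w choose t) + real (Suc t) * real (w choose Suc t)" for t
  proof (cases "t \<le> w")
    case True
    have "(w - t) * (w choose t) = Suc t * (w choose Suc t)"
      by (metis binomial_absorb_comp binomial_absorption mult.commute)
    then have "real (w - t) * real (w choose t) = real (Suc t) * real (w choose Suc t)"
      by (metis of_nat_mult)
    then show ?thesis using True by (simp add: of_nat_diff algebra_simps)
  qed (simp add: binomial_eq_0)
  define D c where "D t = diff_power h t" and "c t = real (w choose t)" for t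
  have "real w ^ Suc h = (\<Sum>t=0..h. D t * (real w * c t))"
    unfolding power_Suc Suc fact_stirling2 sum_distrib_left D_def c_def
    by (rule sum.cong) (simp_all only: mult_ac)
  also have "\<dots> = (\<Sum>t=0..h. D t * real t * c t + D t * real (Suc t) * c (Suc t))"
    unfolding c_def step by (rule sum.cong) (simp_all only: distrib_left mult_ac)
  also have "\<dots> = (\<Sum>t=0..h. D t * real t * c t) + (\<Sum>t=0..h. D t * real (Suc t) * c (Suc t))"
    by (rule sum.distrib)
  also have "(\<Sum>t=0..h. D t * real t * c t) = (\<Sum>t=0..Suc h. D t * real t * c t)"
    by (simp add: D_def diff_power_eq_0)
  also have "\<dots> = (\<Sum>t=0..h. D (Suc t) * real (Suc t) * c (Suc t))"
    by (subst sum.atLeast0_atMost_Suc_shift) simp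
  also have "\<dots> + (\<Sum>t=0..h. D t * real (Suc t) * c (Suc t))
     = (\<Sum>t=0..h. D (Suc t) * real (Suc t) * c (Suc t) + D t * real (Suc t) * c (Suc t))"
    by (rule sum.distrib[symmetric])
  also have "\<dots> = (\<Sum>t=0..h. diff_power (Suc h) (Suc t) * c (Suc t))"
    unfolding diff_power_Suc_Suc D_def by (rule sum.cong) (simp_all add: algebra_simps del: of_nat_Suc)
  also have "\<dots> = (\<Sum>t=0..Suc h. diff_power (Suc h) t * c t)"
    by (subst sum.atLeast0_atMost_Suc_shift) (simp add: diff_power_Suc_0)
  finally show ?case unfolding fact_stirling2 c_def .
qed

section \<open>Codewords, their supports and the values of the trace on them\<close>

lemma card_supersets:
  assumes "finite I" "U \<subseteq> I"
  shows "card {T. U \<subseteq> T \<and> T \<subseteq> I \<and> card T = t}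
    = (if card U \<le> t then (card I - card U) choose (t - card U) else 0)"
proof (cases "card U \<le> t")
  case False
  then have "{T. U \<subseteq> T \<and> T \<subseteq> I \<and> card T = t} = {}"
    using assms(1) by (auto dest: card_mono[OF finite_subset])
  then show ?thesis using False by (metis card.empty)
next
  case True
  have fU: "finite U" using assms finite_subset by blast
  have "card {T. U \<subseteq> T \<and> T \<subseteq> I \<and> card T = t} = card {V. V \<subseteq> I - U \<and> card V = t - card U}"
  proof (rule bij_betw_same_card[of "\<lambda>T. T - U"], rule bij_betw_byWitness[where f' = "\<lambda>V. V \<union> U"])
    show "(\<lambda>T. T - U) ` {T. U \<subseteq> T \<and> T \<subseteq> I \<and> card T = t} \<subseteq> {V. V \<subseteq> I - U \<and> card V = t - card U}"
      using fU by (intro image_subsetI) (simp add: card_Diff_subset Diff_mono)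
    show "(\<lambda>V. V \<union> U) ` {V. V \<subseteq> I - U \<and> card V = t - card U} \<subseteq> {T. U \<subseteq> T \<and> T \<subseteq> I \<and> card T = t}"
    proof safe
      fix V assume V: "V \<subseteq> I - U" "card V = t - card U"
      then have "V \<inter> U = {}" by blast
      moreover have "finite V" using V(1) assms(1) by (meson finite_Diff finite_subset)
      ultimately show "card (V \<union> U) = t" using V True fU by (simp add: card_Un_disjoint)
    qed (use assms in auto)
  qed auto
  then show ?thesis using True assms fU by (simp add: n_subsets card_Diff_subset)
qed

text \<open>The supports of the codewords of weight j: over the field with two elements a word is
  its support, and it lies in the code iff the values x over the support add up to zero. Only the
  family x of traces matters from here on.\<close>

definition zero_sum_sets :: "nat \<Rightarrow> (nat \<Rightarrow> 'b::comm_monoid_add) \<Rightarrow> nat \<Rightarrow> nat set set" where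
  "zero_sum_sets N x j = {U. U \<subseteq> {..<N} \<and> card U = j \<and> (\<Sum>k\<in>U. x k) = 0}"

lemma weight_distribution_eq:
  "weight_distribution (binary_code N g) j = card (zero_sum_sets N (\<lambda>k. mat_trace (g k)) j)"
  unfolding weight_distribution_def
proof (rule bij_betw_same_card[of "\<lambda>u. {k. k < N \<and> u $ k \<noteq> 0}"],
    rule bij_betw_byWitness[where f' = "\<lambda>U. vec N (\<lambda>k. if k \<in> U then 1 else 0)"])
  have odd_bit: "odd b \<longleftrightarrow> b \<noteq> 0" for b :: bit by (cases b) simp_all
  have sum_eq: "(\<Sum>k<N. of_bit (u $ k) * mat_trace (g k)) = (\<Sum>k\<in>{k. k < N \<and> u $ k \<noteq> 0}. mat_trace (g k))" for u
    by (rule sum.mono_neutral_cong_right) (auto simp: odd_bit)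
  let ?C = "{u \<in> binary_code N g. hamming_weight u = j}"
  show "\<forall>u\<in>?C. vec N (\<lambda>k. if k \<in> {k. k < N \<and> u $ k \<noteq> 0} then 1 else 0) = u"
  proof
    fix u assume "u \<in> ?C"
    then have u: "u \<in> carrier_vec N" by (simp add: binary_code_def)
    have "(1::bit) = b" if "b \<noteq> 0" for b using that by (cases b) simp_all
    then show "vec N (\<lambda>k. if k \<in> {k. k < N \<and> u $ k \<noteq> 0} then 1 else 0) = u"
      using u by (intro eq_vecI) auto
  qed
  show "\<forall>U\<in>zero_sum_sets N (\<lambda>k. mat_trace (g k)) j. {k. k < N \<and> vec N (\<lambda>k. if k \<in> U then 1 else (0::bit)) $ k \<noteq> 0} = U"
    by (auto simp: zero_sum_sets_def split: if_splits)
  show "(\<lambda>u. {k. k < N \<and> u $ k \<noteq> 0}) ` ?C \<subseteq> zero_sum_sets N (\<lambda>k. mat_trace (g k)) j"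
  proof safe
    fix u assume u: "u \<in> binary_code N g"
    then have "dim_vec u = N" "(\<Sum>k<N. of_bit (u $ k) * mat_trace (g k)) = 0"
      by (simp_all add: binary_code_def)
    then show "{k. k < N \<and> u $ k \<noteq> 0} \<in> zero_sum_sets N (\<lambda>k. mat_trace (g k)) (hamming_weight u)"
      unfolding sum_eq zero_sum_sets_def hamming_weight_def by blast
  qed
  show "(\<lambda>U. vec N (\<lambda>k. if k \<in> U then 1 else 0)) ` zero_sum_sets N (\<lambda>k. mat_trace (g k)) j \<subseteq> ?C"
  proof safe
    fix U assume U: "U \<in> zero_sum_sets N (\<lambda>k. mat_trace (g k)) j"
    let ?u = "vec N (\<lambda>k. if k \<in> U then 1 else (0::bit))"
    have "{k. k < N \<and> ?u $ k \<noteq> 0} = U" using U by (auto simp: zero_sum_sets_def split: if_splits)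
    moreover have "card U = j" "(\<Sum>k\<in>U. mat_trace (g k)) = 0" using U by (auto simp: zero_sum_sets_def)
    ultimately show "?u \<in> binary_code N g" "hamming_weight ?u = j"
      unfolding binary_code_def hamming_weight_def mem_Collect_eq sum_eq dim_vec by (simp_all only: vec_carrier simp_thms)
  qed
qed

lemma finite_weight_families: "finite (weight_families j :: ('b::{field,finite} \<Rightarrow> nat) set)"
proof (rule finite_subset)
  show "weight_families j \<subseteq> PiE (UNIV::'b set) (\<lambda>_. {..j})"
    by (auto simp: weight_families_def PiE_def extensional_def intro!: member_le_sum)
  show "finite (PiE (UNIV::'b set) (\<lambda>_. {..j}))" by (intro finite_PiE) auto
qed

lemma card_subsets_fibres:
  fixes x :: "nat \<Rightarrow> 'b::finite" and \<nu> :: "'b \<Rightarrow> nat"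
  shows "card {U. U \<subseteq> {..<N} \<and> (\<forall>\<beta>. card {k\<in>U. x k = \<beta>} = \<nu> \<beta>)}
    = (\<Prod>\<beta>\<in>UNIV. card {k. k < N \<and> x k = \<beta>} choose \<nu> \<beta>)"
proof -
  let ?P = "PiE (UNIV::'b set) (\<lambda>\<beta>. {V. V \<subseteq> {k. k < N \<and> x k = \<beta>} \<and> card V = \<nu> \<beta>})"
  have "card {U. U \<subseteq> {..<N} \<and> (\<forall>\<beta>. card {k\<in>U. x k = \<beta>} = \<nu> \<beta>)} = card ?P"
  proof (rule bij_betw_same_card[of "\<lambda>U \<beta>. {k\<in>U. x k = \<beta>}"], rule bij_betw_byWitness[where f' = "\<lambda>f. \<Union>\<beta>. f \<beta>"])
    show "\<forall>f\<in>?P. (\<lambda>\<beta>. {k \<in> \<Union>\<beta>. f \<beta>. x k = \<beta>}) = f"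
    proof
      fix f assume "f \<in> ?P"
      then have "f \<beta> \<subseteq> {k. k < N \<and> x k = \<beta>}" for \<beta> by (auto simp: PiE_def)
      then show "(\<lambda>\<beta>. {k \<in> \<Union>\<beta>. f \<beta>. x k = \<beta>}) = f" by (intro ext) auto
    qed
    show "(\<lambda>f. \<Union>\<beta>. f \<beta>) ` ?P \<subseteq> {U. U \<subseteq> {..<N} \<and> (\<forall>\<beta>. card {k\<in>U. x k = \<beta>} = \<nu> \<beta>)}"
    proof safe
      fix f \<beta> assume "f \<in> ?P"
      then have f: "f \<beta> \<subseteq> {k. k < N \<and> x k = \<beta>}" "card (f \<beta>) = \<nu> \<beta>" for \<beta> by (auto simp: PiE_def)
      then have "{k \<in> \<Union>\<beta>. f \<beta>. x k = \<beta>} = f \<beta>" by auto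
      then show "card {k \<in> \<Union>\<beta>. f \<beta>. x k = \<beta>} = \<nu> \<beta>" using f by simp
    qed (auto simp: PiE_def)
  qed auto
  then show ?thesis by (simp add: card_PiE n_subsets)
qed

lemma sum_by_fibre:
  fixes x :: "nat \<Rightarrow> 'b::{field,finite}"
  assumes "finite U"
  shows "(\<Sum>k\<in>U. x k) = (\<Sum>\<beta>\<in>UNIV. of_nat (card {k\<in>U. x k = \<beta>}) * \<beta>)"
    and "card U = (\<Sum>\<beta>\<in>UNIV. card {k\<in>U. x k = \<beta>})"
proof -
  have "(\<Sum>k\<in>U. x k) = (\<Sum>\<beta>\<in>UNIV. \<Sum>k\<in>{k\<in>U. x k = \<beta>}. x k)"
    using sum.group[of U UNIV x x] assms by simp
  then show "(\<Sum>k\<in>U. x k) = (\<Sum>\<beta>\<in>UNIV. of_nat (card {k\<in>U. x k = \<beta>}) * \<beta>)" by simp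
  show "card U = (\<Sum>\<beta>\<in>UNIV. card {k\<in>U. x k = \<beta>})"
    using sum.group[of U UNIV x "\<lambda>_. 1::nat"] assms by simp
qed

text \<open>An index set is sorted by the number \<nu> \<beta> of its members with value \<beta>.
  These numbers decide whether the sum is zero, and the members within the different fibres can be
  chosen independently.\<close>

lemma card_zero_sum_sets:
  fixes x :: "nat \<Rightarrow> 'b::{field,finite}"
  shows "card (zero_sum_sets N x j)
    = (\<Sum>\<nu>\<in>weight_families j. \<Prod>\<beta>\<in>UNIV. card {k. k < N \<and> x k = \<beta>} choose \<nu> \<beta>)"
proof -
  let ?S = "\<lambda>\<nu>. {U. U \<subseteq> {..<N} \<and> (\<forall>\<beta>. card {k\<in>U. x k = \<beta>} = \<nu> \<beta>)}"
  have "zero_sum_sets N x j = (\<Union>\<nu>\<in>weight_families j. ?S \<nu>)"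
  proof (intro subset_antisym subsetI)
    fix U assume "U \<in> zero_sum_sets N x j"
    then have U: "U \<subseteq> {..<N}" "card U = j" "(\<Sum>k\<in>U. x k) = 0" "finite U"
      by (auto simp: zero_sum_sets_def intro: finite_subset)
    then have "(\<lambda>\<beta>. card {k\<in>U. x k = \<beta>}) \<in> weight_families j"
      using sum_by_fibre[OF U(4), of x] by (simp add: weight_families_def)
    then show "U \<in> (\<Union>\<nu>\<in>weight_families j. ?S \<nu>)" using U by blast
  next
    fix U assume "U \<in> (\<Union>\<nu>\<in>weight_families j. ?S \<nu>)"
    then obtain \<nu> where \<nu>: "\<nu> \<in> weight_families j" "U \<subseteq> {..<N}" "\<And>\<beta>. card {k\<in>U. x k = \<beta>} = \<nu> \<beta>" by blast
    then have "finite U" using finite_subset by blast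
    then show "U \<in> zero_sum_sets N x j"
      using sum_by_fibre[of U x] \<nu> by (simp add: zero_sum_sets_def weight_families_def)
  qed
  moreover have "card (\<Union>\<nu>\<in>weight_families j. ?S \<nu>) = (\<Sum>\<nu>\<in>weight_families j. card (?S \<nu>))"
  proof (rule card_UN_disjoint)
    show "\<forall>\<nu>\<in>weight_families j. \<forall>\<nu>'\<in>weight_families j. \<nu> \<noteq> \<nu>' \<longrightarrow> ?S \<nu> \<inter> ?S \<nu>' = {}"
      by (auto simp: fun_eq_iff)
    show "\<forall>\<nu>\<in>weight_families j. finite (?S \<nu>)"
      by (auto intro: finite_subset[of _ "Pow {..<N}"])
  qed (rule finite_weight_families)
  ultimately show ?thesis by (simp add: card_subsets_fibres)
qed

lemma binom_of_nat: "binom (real m) (int k) = real (m choose k)"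
  by (auto simp: binom_def binomial_gbinomial[symmetric])

text \<open>Passes from the lower index N - t, as in \<open>Sigma_term\<close>, to t - j, the number
  of elements by which a set of size j is enlarged to size t. If t exceeds N, both sides vanish, one
  by the convention for negative lower indices.\<close>

lemma binom_complement:
  assumes "j \<le> t" "j \<le> N"
  shows "binom (real N - real j) (int N - int t) = real ((N - j) choose (t - j))"
proof (cases "t \<le> N")
  case True
  have "binom (real (N - j)) (int (N - t)) = real ((N - j) choose (N - t))" by (rule binom_of_nat)
  also have "(N - j) choose (N - t) = (N - j) choose (t - j)"
    using binomial_symmetric[of "N - t" "N - j"] assms True by simp
  finally show ?thesis using True assms by (simp add: of_nat_diff)
qed (use assms in \<open>auto simp: binom_def intro!: binomial_eq_0\<close>)

section \<open>Weights of the dual words and the moment identity\<close>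

context char2_field
begin

text \<open>The Hamming weight of the dual word whose k-th letter is the trace of a x_k, since
  \<chi> is -1 exactly where the trace is 1.\<close>

definition wt :: "nat \<Rightarrow> (nat \<Rightarrow> 'a) \<Rightarrow> 'a \<Rightarrow> nat" where
  "wt N x a = card {k. k < N \<and> \<chi> (a * x k) = - 1}"

lemma wt_eq: "2 * int (wt N x a) = int N - (\<Sum>k<N. \<chi> (a * x k))"
proof -
  have "(\<Sum>k<N. \<chi> (a * x k)) = (\<Sum>k<N. 1 - 2 * (if \<chi> (a * x k) = - 1 then 1 else 0))"
    by (rule sum.cong) (auto simp: lam_def)
  also have "\<dots> = int N - 2 * (\<Sum>k<N. if \<chi> (a * x k) = - 1 then 1 else 0)"
    by (simp add: sum_subtractf sum_distrib_left)
  also have "(\<Sum>k<N. if \<chi> (a * x k) = - 1 then 1 else 0) = int (wt N x a)"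
    by (simp add: sum.If_cases wt_def lessThan_def Collect_conj_eq)
  finally show ?thesis by simp
qed

text \<open>The product over T is 2^t if T lies in the support of the word and 0 otherwise, so the
  sum counts the t-subsets of the support.\<close>

lemma wt_choose:
  "real (wt N x a choose t)
    = (\<Sum>T\<in>{T. T \<subseteq> {..<N} \<and> card T = t}. (\<Prod>k\<in>T. 1 - real_of_int (\<chi> (a * x k)))) / 2 ^ t"
proof -
  let ?W = "{k. k < N \<and> \<chi> (a * x k) = - 1}"
  let ?T = "{T. T \<subseteq> {..<N} \<and> card T = t}"
  have fT: "finite ?T" by (rule finite_subset[of _ "Pow {..<N}"]) auto
  have *: "(\<Prod>k\<in>T. 1 - real_of_int (\<chi> (a * x k))) = (if T \<subseteq> ?W then 2 ^ t else 0)" if "T \<in> ?T" for T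
  proof (cases "T \<subseteq> ?W")
    case True
    then have "(\<Prod>k\<in>T. 1 - real_of_int (\<chi> (a * x k))) = (\<Prod>k\<in>T. 2)" by (intro prod.cong) auto
    then show ?thesis using True that by simp
  next
    case False
    then obtain k where k: "k \<in> T" "k \<notin> ?W" by blast
    then have "\<chi> (a * x k) \<noteq> - 1" using that by auto
    then have "\<chi> (a * x k) = 1" using lam_cases by blast
    moreover have "finite T" using that by (auto intro: finite_subset)
    moreover note k
    ultimately show ?thesis using False by (auto intro!: prod_zero bexI[of _ k])
  qed
  have "(\<Sum>T\<in>?T. (\<Prod>k\<in>T. 1 - real_of_int (\<chi> (a * x k)))) = (\<Sum>T\<in>?T. if T \<subseteq> ?W then 2 ^ t else 0)"
    using * by (intro sum.cong) auto
  also have "\<dots> = 2 ^ t * real (card (?T \<inter> {T. T \<subseteq> ?W}))"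
    using fT by (simp add: sum.If_cases)
  also have "?T \<inter> {T. T \<subseteq> ?W} = {T. T \<subseteq> ?W \<and> card T = t}" by auto
  also have "card \<dots> = wt N x a choose t" unfolding wt_def by (rule n_subsets) simp
  finally show ?thesis by simp
qed

lemma sum_prod_lam:
  "(\<Sum>a\<in>UNIV. \<Prod>k\<in>U. \<chi> (a * x k)) = (if (\<Sum>k\<in>U. x k) = 0 then int q else 0)"
proof -
  have "(\<Prod>k\<in>U. \<chi> (a * x k)) = \<chi> ((\<Sum>k\<in>U. x k) * a)" for a
    by (simp add: lam_sum[symmetric] sum_distrib_left[symmetric] mult.commute)
  then show ?thesis by (simp add: sum_lam)
qed

text \<open>Pless' identity in terms of binomial moments. Expanding each product over subsets U of T
  and summing over a keeps only the U of zero sum, with sign (-1)^|U|; each such U lies in C(N -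
  |U|, t - |U|) sets T.\<close>

lemma sum_wt_choose:
  "(\<Sum>a\<in>UNIV. real (wt N x a choose t))
    = real q / 2 ^ t * (\<Sum>j=0..min N t. (- 1) ^ j * real (card (zero_sum_sets N x j)) * real ((N - j) choose (t - j)))"
proof -
  let ?T = "{T. T \<subseteq> {..<N} \<and> card T = t}"
  let ?f = "\<lambda>U a. (- 1) ^ card U * (\<Prod>k\<in>U. real_of_int (\<chi> (a * x k)))"
  let ?F = "\<lambda>U. (\<Sum>a\<in>UNIV. ?f U a)"
  have fT: "finite ?T" by (rule finite_subset[of _ "Pow {..<N}"]) auto
  have ex: "(\<Prod>k\<in>T. 1 - real_of_int (\<chi> (a * x k))) = (\<Sum>U\<in>Pow T. ?f U a)" if "T \<in> ?T" for T a
  proof -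
    have "finite T" using that finite_subset by blast
    then have "(\<Prod>k\<in>T. - real_of_int (\<chi> (a * x k)) + 1) = (\<Sum>U\<in>Pow T. (\<Prod>k\<in>U. - real_of_int (\<chi> (a * x k))) * (\<Prod>k\<in>T - U. 1))"
      by (rule prod_add)
    then show ?thesis by (simp add: prod_uminus)
  qed
  have Fval: "?F U = (- 1) ^ card U * (if (\<Sum>k\<in>U. x k) = 0 then real q else 0)" for U
  proof -
    have "?F U = (- 1) ^ card U * real_of_int (\<Sum>a\<in>UNIV. \<Prod>k\<in>U. \<chi> (a * x k))"
      by (simp add: sum_distrib_left)
    then show ?thesis by (simp add: sum_prod_lam)
  qed
  have "2 ^ t * (\<Sum>a\<in>UNIV. real (wt N x a choose t)) = (\<Sum>a\<in>UNIV. \<Sum>T\<in>?T. \<Sum>U\<in>Pow T. ?f U a)"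
    unfolding wt_choose sum_distrib_left using ex by (intro sum.cong) auto
  also have "\<dots> = (\<Sum>T\<in>?T. \<Sum>a\<in>UNIV. \<Sum>U\<in>Pow T. ?f U a)" by (rule sum.swap)
  also have "\<dots> = (\<Sum>T\<in>?T. \<Sum>U\<in>Pow T. ?F U)" by (intro sum.cong refl sum.swap)
  also have "\<dots> = (\<Sum>T\<in>?T. \<Sum>U\<in>Pow {..<N}. if U \<subseteq> T then ?F U else 0)"
    by (intro sum.cong refl sum.mono_neutral_cong_left) auto
  also have "\<dots> = (\<Sum>U\<in>Pow {..<N}. \<Sum>T\<in>?T. if U \<subseteq> T then ?F U else 0)" by (rule sum.swap)
  also have "\<dots> = (\<Sum>U\<in>Pow {..<N}. ?F U * real (card {T. U \<subseteq> T \<and> T \<subseteq> {..<N} \<and> card T = t}))"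
  proof (intro sum.cong refl)
    fix U
    have "?T \<inter> {T. U \<subseteq> T} = {T. U \<subseteq> T \<and> T \<subseteq> {..<N} \<and> card T = t}" by auto
    then show "(\<Sum>T\<in>?T. if U \<subseteq> T then ?F U else 0) = ?F U * real (card {T. U \<subseteq> T \<and> T \<subseteq> {..<N} \<and> card T = t})"
      using fT by (simp only: sum.If_cases sum.neutral_const sum_constant mult.commute add_0_right)
  qed
  also have "\<dots> = (\<Sum>U\<in>Pow {..<N}. ?F U * real (if card U \<le> t then (N - card U) choose (t - card U) else 0))"
    using card_supersets[of "{..<N}"] by (intro sum.cong) auto
  also have "\<dots> = (\<Sum>U\<in>{U. U \<subseteq> {..<N} \<and> (\<Sum>k\<in>U. x k) = 0 \<and> card U \<le> min N t}.
      real q * ((- 1) ^ card U * real ((N - card U) choose (t - card U))))"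
  proof (rule sum.mono_neutral_cong_right)
    show "\<forall>U\<in>Pow {..<N} - {U. U \<subseteq> {..<N} \<and> (\<Sum>k\<in>U. x k) = 0 \<and> card U \<le> min N t}.
       ?F U * real (if card U \<le> t then (N - card U) choose (t - card U) else 0) = 0"
    proof
      fix U assume "U \<in> Pow {..<N} - {U. U \<subseteq> {..<N} \<and> (\<Sum>k\<in>U. x k) = 0 \<and> card U \<le> min N t}"
      then have U: "U \<subseteq> {..<N}" "(\<Sum>k\<in>U. x k) \<noteq> 0 \<or> \<not> card U \<le> min N t" by auto
      have "card U \<le> N" using card_mono[OF _ U(1)] by simp
      then show "?F U * real (if card U \<le> t then (N - card U) choose (t - card U) else 0) = 0"
        unfolding Fval using U by auto
    qed
  qed (auto simp: Fval)
  also have "\<dots> = (\<Sum>j=0..min N t. \<Sum>U\<in>zero_sum_sets N x j.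
      real q * ((- 1) ^ card U * real ((N - card U) choose (t - card U))))"
  proof -
    let ?V = "{U. U \<subseteq> {..<N} \<and> (\<Sum>k\<in>U. x k) = 0 \<and> card U \<le> min N t}"
    have "finite ?V" by (rule finite_subset[of _ "Pow {..<N}"]) auto
    then have "(\<Sum>j=0..min N t. \<Sum>U\<in>{U\<in>?V. card U = j}. real q * ((- 1) ^ card U * real ((N - card U) choose (t - card U))))
      = (\<Sum>U\<in>?V. real q * ((- 1) ^ card U * real ((N - card U) choose (t - card U))))"
      by (intro sum.group) auto
    moreover have "{U\<in>?V. card U = j} = zero_sum_sets N x j" if "j \<in> {0..min N t}" for j
      using that by (auto simp: zero_sum_sets_def)
    ultimately show ?thesis by (metis (no_types, lifting) sum.cong)
  qed
  also have "\<dots> = (\<Sum>j=0..min N t. real q * ((- 1) ^ j * real (card (zero_sum_sets N x j)) * real ((N - j) choose (t - j))))"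
  proof (intro sum.cong refl)
    fix j
    have "(\<Sum>U\<in>zero_sum_sets N x j. real q * ((- 1) ^ card U * real ((N - card U) choose (t - card U))))
      = (\<Sum>U\<in>zero_sum_sets N x j. real q * ((- 1) ^ j * real ((N - j) choose (t - j))))"
      by (rule sum.cong) (auto simp: zero_sum_sets_def)
    then show "(\<Sum>U\<in>zero_sum_sets N x j. real q * ((- 1) ^ card U * real ((N - card U) choose (t - card U))))
      = real q * ((- 1) ^ j * real (card (zero_sum_sets N x j)) * real ((N - j) choose (t - j)))"
      by simp
  qed
  also have "\<dots> = real q * (\<Sum>j=0..min N t. (- 1) ^ j * real (card (zero_sum_sets N x j)) * real ((N - j) choose (t - j)))"
    unfolding sum_distrib_left ..
  finally have "2 ^ t * (\<Sum>a\<in>UNIV. real (wt N x a choose t)) = \<dots>" .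
  moreover have "L = Q / 2 ^ t * R" if "2 ^ t * L = Q * R" for L Q R :: real
    using that by (simp add: field_simps)
  ultimately show ?thesis by blast
qed

text \<open>The dual code enters as a family of words indexed by the field, so that Pless' identity
  needs no injectivity of \<open>a \<mapsto> (tr (a x\<^sub>k))\<^sub>k\<close>.\<close>

lemma pless_moment:
  assumes "h \<ge> 1" and "C = (\<lambda>j. card (zero_sum_sets N x j))" and "A \<noteq> 0"
  shows "(\<Sum>a\<in>UNIV - {0}. (2 * real (wt N x a)) ^ h) = A ^ h * Sigma_term q A N C h"
proof -
  have w0: "wt N x 0 = 0" by (simp add: wt_def)
  have "(\<Sum>a\<in>UNIV - {0}. (2 * real (wt N x a)) ^ h) = (\<Sum>a\<in>UNIV. (2 * real (wt N x a)) ^ h)"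
    using assms(1) w0 by (simp add: sum_diff1 power_0_left)
  also have "\<dots> = 2 ^ h * (\<Sum>a\<in>UNIV. \<Sum>t=0..h. fact t * stirling2 h t * real (wt N x a choose t))"
    by (simp add: power_mult_distrib power_eq_sum_stirling2 sum_distrib_left)
  also have "\<dots> = 2 ^ h * (\<Sum>t=0..h. fact t * stirling2 h t * (\<Sum>a\<in>UNIV. real (wt N x a choose t)))"
    by (subst sum.swap) (simp add: sum_distrib_left)
  also have "\<dots> = (\<Sum>t=0..h. \<Sum>j=0..min N t. real q * ((- 1) ^ j * real (C j) *
      (fact t * stirling2 h t * 2 ^ (h - t) * real ((N - j) choose (t - j)))))"
    unfolding sum_wt_choose sum_distrib_left assms(2)
    by (intro sum.cong refl) (simp add: power_diff mult_ac)
  also have "\<dots> = (\<Sum>t=0..h. \<Sum>j\<in>{j\<in>{0..min N h}. j \<le> t}. real q * ((- 1) ^ j * real (C j) *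
      (fact t * stirling2 h t * 2 ^ (h - t) * real ((N - j) choose (t - j)))))"
    by (intro sum.cong refl) auto
  also have "\<dots> = (\<Sum>j=0..min N h. \<Sum>t\<in>{t\<in>{0..h}. j \<le> t}. real q * ((- 1) ^ j * real (C j) *
      (fact t * stirling2 h t * 2 ^ (h - t) * real ((N - j) choose (t - j)))))"
    by (rule sum.swap_restrict) auto
  also have "\<dots> = (\<Sum>j=0..min N h. \<Sum>t=j..h. real q * ((- 1) ^ j * real (C j) *
      (fact t * stirling2 h t * 2 ^ (h - t) * binom (real N - real j) (int N - int t))))"
    by (intro sum.cong) (auto simp: binom_complement)
  also have "\<dots> = real q * (\<Sum>j=0..min N h. (- 1) ^ j * real (C j) *
      (\<Sum>t=j..h. fact t * stirling2 h t * 2 ^ (h - t) * binom (real N - real j) (int N - int t)))"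
    unfolding sum_distrib_left ..
  also have "\<dots> = A ^ h * Sigma_term q A N C h"
    using assms(3) unfolding Sigma_term_def by simp
  finally show ?thesis .
qed

text \<open>Twice the weight of the word of a is N - S(a) = A (B + e f(a)). In the h-th moment A^h
  cancels, the binomial theorem brings in all power moments of f up to h, and the highest one is
  isolated.\<close>

lemma moment_identity:
  fixes f :: "'a \<Rightarrow> int"
  assumes "h \<ge> 1" and "C = (\<lambda>j. card (zero_sum_sets N x j))" and "A \<noteq> 0"
    and "\<And>a. a \<noteq> 0 \<Longrightarrow> real N - real_of_int (\<Sum>k<N. \<chi> (a * x k)) = A * (B + e * real_of_int (f a))"
  shows "e ^ h * power_moment f h = - (\<Sum>l=0..h - 1. e ^ l * real (h choose l) * B ^ (h - l) * power_moment f l)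
     + Sigma_term q A N C h"
proof -
  have "2 * real (wt N x a) = A * (B + e * real_of_int (f a))" if "a \<noteq> 0" for a
  proof -
    have "2 * real (wt N x a) = real_of_int (2 * int (wt N x a))" by simp
    then show ?thesis unfolding wt_eq using assms(4)[OF that] by simp
  qed
  then have "(\<Sum>a\<in>UNIV - {0}. (2 * real (wt N x a)) ^ h) = A ^ h * (\<Sum>a\<in>UNIV - {0}. (B + e * real_of_int (f a)) ^ h)"
    by (simp add: power_mult_distrib sum_distrib_left)
  then have "Sigma_term q A N C h = (\<Sum>a\<in>UNIV - {0}. (e * real_of_int (f a) + B) ^ h)"
    using pless_moment[OF assms(1,2,3)] assms(3) by (simp add: add.commute)
  also have "\<dots> = (\<Sum>a\<in>UNIV - {0}. \<Sum>l\<le>h. e ^ l * real (h choose l) * B ^ (h - l) * real_of_int (f a) ^ l)"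
    unfolding binomial_ring by (intro sum.cong refl) (simp add: power_mult_distrib mult_ac)
  also have "\<dots> = (\<Sum>l\<le>h. e ^ l * real (h choose l) * B ^ (h - l) * power_moment f l)"
    by (subst sum.swap) (simp add: power_moment_def sum_distrib_left)
  also have "\<dots> = (\<Sum>l=0..h - 1. e ^ l * real (h choose l) * B ^ (h - l) * power_moment f l) + e ^ h * power_moment f h"
  proof -
    obtain m where "h = Suc m" using assms(1) by (cases h) auto
    then show ?thesis unfolding atMost_atLeast0 by simp
  qed
  finally show ?thesis by simp
qed

text \<open>Orthogonality detects x_k = \<beta>; the term a = 0 contributes N.\<close>

lemma count_by_fourier:
  "int q * int (card {k. k < N \<and> x k = \<beta>}) = int N + (\<Sum>a\<in>UNIV - {0}. \<chi> (a * \<beta>) * (\<Sum>k<N. \<chi> (a * x k)))"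
proof -
  have "int q * int (card {k. k < N \<and> x k = \<beta>}) = (\<Sum>k<N. if x k = \<beta> then int q else 0)"
    by (simp add: sum.If_cases lessThan_def Collect_conj_eq)
  also have "\<dots> = (\<Sum>k<N. \<Sum>a\<in>UNIV. \<chi> ((\<beta> + x k) * a))"
    unfolding sum_lam add_eq_0 by (intro sum.cong) auto
  also have "\<dots> = (\<Sum>a\<in>UNIV. \<Sum>k<N. \<chi> (a * \<beta>) * \<chi> (a * x k))"
    by (subst sum.swap) (simp add: lam_add[symmetric] algebra_simps)
  also have "\<dots> = (\<Sum>a\<in>UNIV. \<chi> (a * \<beta>) * (\<Sum>k<N. \<chi> (a * x k)))"
    by (simp add: sum_distrib_left)
  also have "\<dots> = int N + (\<Sum>a\<in>UNIV - {0}. \<chi> (a * \<beta>) * (\<Sum>k<N. \<chi> (a * x k)))"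
    by (subst sum.remove[of _ 0]) auto
  finally show ?thesis .
qed

end

section \<open>Counting matrices\<close>

lemma mult_mat_index:
  assumes "A \<in> carrier_mat nr n" "B \<in> carrier_mat n nc" "i < nr" "j < nc"
  shows "(A * B) $$ (i, j) = (\<Sum>k<n. A $$ (i, k) * B $$ (k, j))"
  using assms by (simp add: scalar_prod_def atLeast0LessThan)

lemma mult_mat_vec_index:
  assumes "A \<in> carrier_mat nr n" "v \<in> carrier_vec n" "i < nr"
  shows "(A *\<^sub>v v) $ i = (\<Sum>k<n. A $$ (i, k) * v $ k)"
  using assms by (simp add: scalar_prod_def atLeast0LessThan)

lemma GL_iff: "A \<in> GL m \<longleftrightarrow> A \<in> carrier_mat m m \<and> det A \<noteq> 0"
proof
  assume "A \<in> GL m"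
  then obtain B where A: "A \<in> carrier_mat m m" and AB: "A * B = 1\<^sub>m (dim_row A)" and BA: "B * A = 1\<^sub>m (dim_row B)"
    by (auto simp: GL_def invertible_mat_def inverts_mat_def)
  have "dim_col B = m" using arg_cong[OF AB, of dim_col] A by simp
  moreover have "dim_row B = m" using arg_cong[OF BA, of dim_col] A by simp
  ultimately have B: "B \<in> carrier_mat m m" by auto
  have "det A * det B = 1" using det_mult[OF A B] AB A by simp
  then show "A \<in> carrier_mat m m \<and> det A \<noteq> 0" using A by auto
next
  assume "A \<in> carrier_mat m m \<and> det A \<noteq> 0"
  then have A: "A \<in> carrier_mat m m" and "A \<in> Units (ring_mat TYPE('a) m ())"
    using det_non_zero_imp_unit by auto
  then obtain B where "B \<in> carrier_mat m m" "B * A = 1\<^sub>m m" "A * B = 1\<^sub>m m"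
    by (auto simp: Units_def ring_mat_simps)
  then show "A \<in> GL m" using A by (auto simp: GL_def invertible_mat_def inverts_mat_def)
qed

lemma GL_inverse:
  assumes "A \<in> GL m"
  obtains B where "B \<in> GL m" "A * B = 1\<^sub>m m" "B * A = 1\<^sub>m m"
proof -
  have A: "A \<in> carrier_mat m m" "det A \<noteq> 0" using assms by (auto simp: GL_iff)
  from det_non_zero_imp_unit[OF A, of "()"]
  obtain B where B: "B \<in> carrier_mat m m" "B * A = 1\<^sub>m m" "A * B = 1\<^sub>m m"
    by (auto simp: Units_def ring_mat_simps)
  have "det A * det B = 1" using det_mult[OF A(1) B(1)] B by simp
  then have "B \<in> GL m" using B by (auto simp: GL_iff)
  then show ?thesis using that B by blast
qed

lemma mult_mat_unit_vec:
  assumes "A \<in> carrier_mat nr nc" "j < nc"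
  shows "A *\<^sub>v unit_vec nc j = col (A :: 'b::semiring_1 mat) j"
  using assms by (intro eq_vecI) auto

lemma GL_mult: "A \<in> GL m \<Longrightarrow> B \<in> GL m \<Longrightarrow> A * B \<in> GL m"
  by (auto simp: GL_iff det_mult)

lemma GL_mult_cancel:
  assumes "P \<in> GL m" "A \<in> carrier_mat m n" "B \<in> carrier_mat m n" "P * A = P * B"
  shows "A = B"
proof -
  obtain R where R: "R \<in> GL m" "R * P = 1\<^sub>m m" using GL_inverse[OF assms(1)] by metis
  have c: "P \<in> carrier_mat m m" "R \<in> carrier_mat m m" using assms R by (auto simp: GL_iff)
  have "R * (P * A) = R * (P * B)" using assms(4) by simp
  then have "(R * P) * A = (R * P) * B" using c assms(2,3) by (simp add: assoc_mult_mat)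
  then show ?thesis using R(2) assms(2,3) by simp
qed

lemma GL_mult_cancel_right:
  assumes "P \<in> GL m" "A \<in> carrier_mat n m" "B \<in> carrier_mat n m" "A * P = B * P"
  shows "A = B"
proof -
  obtain R where R: "R \<in> GL m" "P * R = 1\<^sub>m m" using GL_inverse[OF assms(1)] by metis
  have c: "P \<in> carrier_mat m m" "R \<in> carrier_mat m m" using assms R by (auto simp: GL_iff)
  have "(A * P) * R = (B * P) * R" using assms(4) by simp
  then have "A * (P * R) = B * (P * R)" using c assms(2,3) by (simp add: assoc_mult_mat)
  then show ?thesis using R(2) assms(2,3) by simp
qed

lemma GL_transpose: "A \<in> GL m \<Longrightarrow> transpose_mat A \<in> GL m"
  by (auto simp: GL_iff det_transpose)

lemma det_kernel:
  fixes M :: "'b::field mat"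
  assumes "M \<in> carrier_mat n n" "det M = 0"
  obtains w where "\<exists>j<n. w j \<noteq> 0" "\<And>i. i < n \<Longrightarrow> (\<Sum>j<n. M $$ (i, j) * w j) = 0"
proof -
  obtain v where v: "v \<in> carrier_vec n" "v \<noteq> 0\<^sub>v n" "M *\<^sub>v v = 0\<^sub>v n"
    using det_0_iff_vec_prod_zero_field[OF assms(1)] assms(2) by auto
  have "\<exists>j<n. v $ j \<noteq> 0" using v by (metis carrier_vecD eq_vecI index_zero_vec(1) index_zero_vec(2))
  moreover have "(\<Sum>j<n. M $$ (i, j) * v $ j) = 0" if "i < n" for i
    using mult_mat_vec_index[OF assms(1) v(1) that] v(3) that by simp
  ultimately show ?thesis by (rule that)
qed

lemma det_nonzero_kernel:
  fixes M :: "'b::field mat"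
  assumes "M \<in> carrier_mat n n" "det M \<noteq> 0" "\<And>i. i < n \<Longrightarrow> (\<Sum>j<n. M $$ (i, j) * w j) = 0" "j < n"
  shows "w j = 0"
proof -
  have c: "vec n w \<in> carrier_vec n" by simp
  have "M *\<^sub>v vec n w = 0\<^sub>v n"
  proof (rule eq_vecI)
    fix i assume "i < dim_vec (0\<^sub>v n :: 'b vec)"
    then have "i < n" by simp
    then have "(M *\<^sub>v vec n w) $ i = (\<Sum>j<n. M $$ (i, j) * vec n w $ j)"
      using mult_mat_vec_index[OF assms(1) c] by blast
    then show "(M *\<^sub>v vec n w) $ i = 0\<^sub>v n $ i" using assms(3) \<open>i < n\<close> by simp
  qed (use assms in auto)
  then have "vec n w = 0\<^sub>v n"
    using det_0_iff_vec_prod_zero_field[OF assms(1)] assms(2) c by blast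
  then show ?thesis using assms(4) by (metis index_vec index_zero_vec(1))
qed

lemma det_nonzero_solve:
  fixes M :: "'b::field mat"
  assumes "M \<in> carrier_mat n n" "det M \<noteq> 0"
  obtains w where "\<And>i. i < n \<Longrightarrow> (\<Sum>j<n. M $$ (i, j) * w j) = e i"
proof -
  have "M \<in> GL n" using assms by (auto simp: GL_iff)
  then obtain R where R: "R \<in> GL n" "M * R = 1\<^sub>m n" using GL_inverse by metis
  have Rc: "R \<in> carrier_mat n n" using R by (auto simp: GL_iff)
  have c: "R *\<^sub>v vec n e \<in> carrier_vec n" using Rc by simp
  have "M *\<^sub>v (R *\<^sub>v vec n e) = vec n e"
    using assoc_mult_mat_vec[OF assms(1) Rc, of "vec n e"] R(2) by simp
  then have "(\<Sum>j<n. M $$ (i, j) * (R *\<^sub>v vec n e) $ j) = e i" if "i < n" for i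
    using mult_mat_vec_index[OF assms(1) c that] that by simp
  then show ?thesis by (rule that)
qed

text \<open>If the first coordinate is nonzero, a lower triangular matrix scales it to 1 and clears
  the others. Otherwise a row with a nonzero coordinate is added to the first row
  beforehand.\<close>

lemma ex_GL_to_unit_vec:
  fixes v :: "'b::field vec"
  assumes "v \<in> carrier_vec m" "v \<noteq> 0\<^sub>v m"
  obtains P where "P \<in> GL m" "P *\<^sub>v v = unit_vec m 0"
proof -
  have *: "\<exists>P \<in> GL m. P *\<^sub>v w = unit_vec m 0" if w: "w \<in> carrier_vec m" "0 < m" "w $ 0 \<noteq> 0" for w :: "'b vec"
  proof -
    define P where "P = mat m m (\<lambda>(i, j). if j = 0 then (if i = 0 then 1 / w $ 0 else - w $ i / w $ 0) else if i = j then 1 else 0)"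
    have P: "P \<in> carrier_mat m m" by (simp add: P_def)
    have "det P = prod_list (diag_mat P)"
      by (rule det_lower_triangular[OF _ P]) (auto simp: P_def)
    also have "\<dots> \<noteq> 0" using w unfolding prod_list_zero_iff by (auto simp: diag_mat_def P_def)
    finally have "P \<in> GL m" using P by (auto simp: GL_iff)
    moreover have "P *\<^sub>v w = unit_vec m 0"
    proof (rule eq_vecI)
      fix i assume "i < dim_vec (unit_vec m 0 :: 'b vec)"
      then have i: "i < m" by simp
      have "(P *\<^sub>v w) $ i = (\<Sum>k<m. P $$ (i, k) * w $ k)" by (rule mult_mat_vec_index[OF P w(1) i])
      also have "\<dots> = P $$ (i, 0) * w $ 0 + (\<Sum>k\<in>{..<m} - {0}. P $$ (i, k) * w $ k)"
        using w(2) by (subst sum.remove[of _ 0]) auto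
      also have "(\<Sum>k\<in>{..<m} - {0}. P $$ (i, k) * w $ k) = (\<Sum>k\<in>{..<m} - {0}. if i = k then w $ k else 0)"
        using i by (intro sum.cong) (auto simp: P_def)
      also have "\<dots> = (if i = 0 then 0 else w $ i)" using i by (simp add: sum.delta)
      also have "P $$ (i, 0) * w $ 0 + \<dots> = unit_vec m 0 $ i" using i w by (auto simp: P_def)
      finally show "(P *\<^sub>v w) $ i = unit_vec m 0 $ i" .
    qed (simp add: P_def)
    ultimately show ?thesis by blast
  qed
  obtain k where k: "k < m" "v $ k \<noteq> 0"
    using assms by (metis carrier_vecD eq_vecI index_zero_vec(1) index_zero_vec(2))
  show ?thesis
  proof (cases "v $ 0 = 0")
    case False
    then show ?thesis using *[of v] that k assms by auto
  next
    case True
    then have k0: "0 \<noteq> k" using k(2) by metis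
    let ?E = "addrow_mat m 1 0 k :: 'b mat"
    have E: "?E \<in> carrier_mat m m" by simp
    have EG: "?E \<in> GL m" using k0 by (simp add: GL_iff det_addrow_mat)
    have c: "?E *\<^sub>v v \<in> carrier_vec m" using E assms(1) by (rule mult_mat_vec_carrier)
    have "(?E *\<^sub>v v) $ 0 = (\<Sum>j<m. ?E $$ (0, j) * v $ j)"
      using k by (intro mult_mat_vec_index[OF E assms(1)]) auto
    also have "\<dots> = (\<Sum>j<m. if j = k then v $ k else 0)"
      using k k0 True by (intro sum.cong) auto
    also have "\<dots> = v $ k" using k by simp
    finally have "(?E *\<^sub>v v) $ 0 \<noteq> 0" using k by simp
    then obtain P where P: "P \<in> GL m" "P *\<^sub>v (?E *\<^sub>v v) = unit_vec m 0"
      using *[OF c] k by auto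
    then have "(P * ?E) *\<^sub>v v = unit_vec m 0"
      using E assms(1) by (metis GL_iff assoc_mult_mat_vec)
    then show ?thesis using that GL_mult[OF P(1) EG] by blast
  qed
qed

section \<open>Counting invertible symmetric matrices by their first column\<close>

definition SymGL :: "nat \<Rightarrow> 'b::field mat set" where
  "SymGL m = {A \<in> carrier_mat m m. transpose_mat A = A \<and> det A \<noteq> 0}"

lemma symmetric_index: "A \<in> carrier_mat m m \<Longrightarrow> transpose_mat A = A \<longleftrightarrow> (\<forall>i<m. \<forall>j<m. A $$ (i, j) = A $$ (j, i))"
  by (auto simp: mat_eq_iff)

lemma congruence_SymGL:
  assumes "P \<in> GL m" "A \<in> SymGL m"
  shows "P * A * transpose_mat P \<in> SymGL m"
proof -
  have c: "P \<in> carrier_mat m m" "A \<in> carrier_mat m m" "transpose_mat P \<in> carrier_mat m m"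
    using assms by (auto simp: GL_iff SymGL_def)
  have "transpose_mat (P * A * transpose_mat P) = P * (A * transpose_mat P)"
    using c assms(2) by (simp add: transpose_mult[of _ m m _ m] SymGL_def)
  also have "\<dots> = P * A * transpose_mat P" using c by (simp add: assoc_mult_mat[of _ m m _ m _ m])
  finally show ?thesis using assms c
    by (auto simp: SymGL_def GL_iff det_mult[of _ m] det_transpose)
qed

definition SymGL_col :: "nat \<Rightarrow> 'b::field vec \<Rightarrow> 'b mat set" where
  "SymGL_col m w = {A \<in> SymGL m. col A 0 = w}"

lemma finite_carrier_mat: "finite (carrier_mat m n :: 'b::finite mat set)"
proof -
  have "carrier_mat m n \<subseteq> (\<lambda>f. mat m n f) ` (PiE ({..<m} \<times> {..<n}) (\<lambda>_. UNIV :: 'b set))"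
  proof
    fix A :: "'b mat" assume A: "A \<in> carrier_mat m n"
    then have "A = mat m n (restrict (\<lambda>ij. A $$ ij) ({..<m} \<times> {..<n}))" by (intro eq_matI) auto
    then show "A \<in> (\<lambda>f. mat m n f) ` (PiE ({..<m} \<times> {..<n}) (\<lambda>_. UNIV))" 
      by (intro image_eqI[of _ _ "restrict (\<lambda>ij. A $$ ij) ({..<m} \<times> {..<n})"]) auto
  qed
  then show ?thesis by (rule finite_subset) (intro finite_imageI finite_PiE, auto)
qed

lemma finite_SymGL: "finite (SymGL m :: 'b::{field,finite} mat set)"
  by (rule finite_subset[OF _ finite_carrier_mat[of m m]]) (auto simp: SymGL_def)

lemma finite_GL: "finite (GL m :: 'b::{field,finite} mat set)"
  by (rule finite_subset[OF _ finite_carrier_mat[of m m]]) (auto simp: GL_def)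

lemma card_carrier_vec: "card (carrier_vec n :: 'b::finite vec set) = CARD('b) ^ n"
proof -
  have "bij_betw (\<lambda>f. vec n f) (PiE {..<n} (\<lambda>_. UNIV :: 'b set)) (carrier_vec n)"
    by (rule bij_betw_byWitness[where f' = "\<lambda>v. restrict (\<lambda>i. v $ i) {..<n}"])
       (auto simp: fun_eq_iff PiE_def extensional_def)
  then have "card (carrier_vec n :: 'b vec set) = card (PiE {..<n} (\<lambda>_. UNIV :: 'b set))"
    by (rule bij_betw_same_card[symmetric])
  then show ?thesis by (simp add: card_PiE)
qed

lemma card_carrier_mat: "card (carrier_mat m n :: 'b::finite mat set) = CARD('b) ^ (m * n)"
proof -
  have "bij_betw (\<lambda>f. mat m n f) (PiE ({..<m} \<times> {..<n}) (\<lambda>_. UNIV :: 'b set)) (carrier_mat m n)"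
    by (rule bij_betw_byWitness[where f' = "\<lambda>A. restrict (\<lambda>ij. A $$ ij) ({..<m} \<times> {..<n})"])
       (auto simp: fun_eq_iff PiE_def extensional_def)
  then have "card (carrier_mat m n :: 'b mat set) = card (PiE ({..<m} \<times> {..<n}) (\<lambda>_. UNIV :: 'b set))"
    by (rule bij_betw_same_card[symmetric])
  then show ?thesis by (simp add: card_PiE)
qed

text \<open>The condition on the first row of P says that its transpose fixes the first unit vector,
  so the congruence by P moves the first column w to P w. The inverse of P has the same property,
  which turns the inequality into an equality.\<close>

lemma card_SymGL_col_le:
  fixes P :: "'b::{field,finite} mat"
  assumes "0 < m" "P \<in> GL m" "row P 0 = unit_vec m 0"
  shows "card (SymGL_col m w) \<le> card (SymGL_col m (P *\<^sub>v w))"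
proof (rule card_inj_on_le[of "\<lambda>A. P * A * transpose_mat P"])
  have P: "P \<in> carrier_mat m m" using assms by (auto simp: GL_iff)
  have PT: "transpose_mat P \<in> GL m" using assms GL_transpose by auto
  have PTc: "transpose_mat P \<in> carrier_mat m m" using P by simp
  show "inj_on (\<lambda>A. P * A * transpose_mat P) (SymGL_col m w)"
  proof (rule inj_onI)
    fix A B assume AB: "A \<in> SymGL_col m w" "B \<in> SymGL_col m w" "P * A * transpose_mat P = P * B * transpose_mat P"
    then have c: "A \<in> carrier_mat m m" "B \<in> carrier_mat m m" by (auto simp: SymGL_col_def SymGL_def)
    have "P * A = P * B"
      by (rule GL_mult_cancel_right[OF PT _ _ AB(3)]) (use P c in auto)
    then show "A = B" by (rule GL_mult_cancel[OF assms(2) c])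
  qed
  show "(\<lambda>A. P * A * transpose_mat P) ` SymGL_col m w \<subseteq> SymGL_col m (P *\<^sub>v w)"
  proof (rule image_subsetI)
    fix A assume A: "A \<in> SymGL_col m w"
    then have Ac: "A \<in> carrier_mat m m" "col A 0 = w" by (auto simp: SymGL_col_def SymGL_def)
    have "col (transpose_mat P) 0 = unit_vec m 0" using assms P by simp
    then have "col (P * A * transpose_mat P) 0 = (P * A) *\<^sub>v unit_vec m 0"
      using col_mult2[of "P * A" m m "transpose_mat P" m 0] P Ac assms(1) by simp
    also have "\<dots> = col (P * A) 0" using P Ac assms(1) by (simp add: mult_mat_unit_vec)
    also have "\<dots> = P *\<^sub>v w" using col_mult2[OF P Ac(1) assms(1)] Ac(2) by simp
    finally show "P * A * transpose_mat P \<in> SymGL_col m (P *\<^sub>v w)"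
      using congruence_SymGL[OF assms(2)] A by (simp add: SymGL_col_def)
  qed
  show "finite (SymGL_col m (P *\<^sub>v w))"
    using finite_SymGL by (rule rev_finite_subset) (auto simp: SymGL_col_def)
qed

lemma card_SymGL_col_cong:
  fixes P :: "'b::{field,finite} mat"
  assumes "0 < m" "P \<in> GL m" "row P 0 = unit_vec m 0" "w \<in> carrier_vec m"
  shows "card (SymGL_col m w) = card (SymGL_col m (P *\<^sub>v w))"
proof (rule antisym)
  show "card (SymGL_col m w) \<le> card (SymGL_col m (P *\<^sub>v w))" by (rule card_SymGL_col_le) (use assms in auto)
  obtain R where R: "R \<in> GL m" "P * R = 1\<^sub>m m" "R * P = 1\<^sub>m m" using GL_inverse[OF assms(2)] by metis
  have c: "P \<in> carrier_mat m m" "R \<in> carrier_mat m m" using assms R by (auto simp: GL_iff)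
  have "row (P * R) 0 = row R 0"
  proof (rule eq_vecI)
    fix j assume "j < dim_vec (row R 0)"
    then have j: "j < m" using c by simp
    have "(P * R) $$ (0, j) = (\<Sum>k<m. P $$ (0, k) * R $$ (k, j))"
      by (rule mult_mat_index[OF c assms(1) j])
    also have "\<dots> = (\<Sum>k<m. if k = 0 then R $$ (0, j) else 0)"
    proof (rule sum.cong)
      fix k assume "k \<in> {..<m}"
      then have "P $$ (0, k) = unit_vec m 0 $ k" using assms(1,3) c by (metis carrier_matD index_row(1) lessThan_iff)
      then show "P $$ (0, k) * R $$ (k, j) = (if k = 0 then R $$ (0, j) else 0)" using \<open>k \<in> {..<m}\<close> by simp
    qed simp
    also have "\<dots> = R $$ (0, j)" using assms(1) by simp
    finally show "row (P * R) 0 $ j = row R 0 $ j" using c j assms(1) by simp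
  qed (use c in simp)
  then have "row R 0 = unit_vec m 0" using R(2) assms(1) by simp
  then have "card (SymGL_col m (P *\<^sub>v w)) \<le> card (SymGL_col m (R *\<^sub>v (P *\<^sub>v w)))"
    using assms(1) R(1) by (intro card_SymGL_col_le) auto
  also have "R *\<^sub>v (P *\<^sub>v w) = w" using c assms(4) R(3) by (metis assoc_mult_mat_vec one_mult_mat_vec)
  finally show "card (SymGL_col m (P *\<^sub>v w)) \<le> card (SymGL_col m w)" .
qed

definition corner_ext :: "'b::zero \<Rightarrow> 'b mat \<Rightarrow> 'b mat" where
  "corner_ext \<alpha> A = four_block_mat (mat 1 1 (\<lambda>_. \<alpha>)) (0\<^sub>m 1 (dim_col A)) (0\<^sub>m (dim_row A) 1) A"

lemma card_SymGL_col_diag: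
  fixes \<alpha> :: "'b::{field,finite}"
  assumes "\<alpha> \<noteq> 0"
  shows "card (SymGL_col (Suc m) (\<alpha> \<cdot>\<^sub>v unit_vec (Suc m) 0)) = card (SymGL m :: 'b mat set)"
proof -
  have det: "det (corner_ext \<alpha> A) = \<alpha> * det A" if "A \<in> carrier_mat m m" for A :: "'b mat"
    unfolding corner_ext_def using that
    by (subst det_four_block_mat_lower_left_zero_col[where n = m]) (auto simp: det_single)
  have idx: "corner_ext \<alpha> A $$ (i, j) = (if i = 0 then if j = 0 then \<alpha> else 0 else if j = 0 then 0 else A $$ (i - 1, j - 1))"
    if "A \<in> carrier_mat m m" "i < Suc m" "j < Suc m" for A :: "'b mat" and i j
    using that by (auto simp: corner_ext_def)
  have dim: "corner_ext \<alpha> A \<in> carrier_mat (Suc m) (Suc m)" if "A \<in> carrier_mat m m" for A :: "'b mat"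
    using that by (auto simp: corner_ext_def)
  have "card (SymGL m :: 'b mat set) = card (SymGL_col (Suc m) (\<alpha> \<cdot>\<^sub>v unit_vec (Suc m) 0))"
  proof (rule bij_betw_same_card[of "corner_ext \<alpha>"], rule bij_betw_byWitness[where f' = "\<lambda>A. mat_delete A 0 0"])
    show "\<forall>A\<in>SymGL m. mat_delete (corner_ext \<alpha> A) 0 0 = A"
    proof
      fix A :: "'b mat" assume "A \<in> SymGL m"
      then have A: "A \<in> carrier_mat m m" by (simp add: SymGL_def)
      show "mat_delete (corner_ext \<alpha> A) 0 0 = A"
        by (rule eq_matI) (use A dim[OF A] idx[OF A] in \<open>auto simp: mat_delete_def\<close>)
    qed
    have del: "mat_delete A 0 0 \<in> carrier_mat m m \<and> corner_ext \<alpha> (mat_delete A 0 0) = A" if A': "A \<in> SymGL_col (Suc m) (\<alpha> \<cdot>\<^sub>v unit_vec (Suc m) 0)" for A :: "'b mat"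
    proof -
      have A: "A \<in> carrier_mat (Suc m) (Suc m)" "transpose_mat A = A" "col A 0 = \<alpha> \<cdot>\<^sub>v unit_vec (Suc m) 0"
        using A' by (auto simp: SymGL_col_def SymGL_def)
      have D: "mat_delete A 0 0 \<in> carrier_mat m m" using A mat_delete_carrier[OF A(1)] by simp
      have c0: "A $$ (i, 0) = (if i = 0 then \<alpha> else 0)" if "i < Suc m" for i
        using arg_cong[OF A(3), of "\<lambda>v. v $ i"] A(1) that by simp
      have r0: "A $$ (0, i) = (if i = 0 then \<alpha> else 0)" if "i < Suc m" for i
        using c0[OF that] A(2) symmetric_index[OF A(1)] that by auto
      have "corner_ext \<alpha> (mat_delete A 0 0) = A"
        by (rule eq_matI) (use A dim[OF D] idx[OF D] c0 r0 in \<open>auto simp: mat_delete_def\<close>)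
      then show ?thesis using D by simp
    qed
    then show "\<forall>A\<in>SymGL_col (Suc m) (\<alpha> \<cdot>\<^sub>v unit_vec (Suc m) 0). corner_ext \<alpha> (mat_delete A 0 0) = A" by blast
    show "corner_ext \<alpha> ` SymGL m \<subseteq> SymGL_col (Suc m) (\<alpha> \<cdot>\<^sub>v unit_vec (Suc m) 0)"
    proof (rule image_subsetI)
      fix A :: "'b mat" assume "A \<in> SymGL m"
      then have A: "A \<in> carrier_mat m m" "transpose_mat A = A" "det A \<noteq> 0" by (auto simp: SymGL_def)
      have "transpose_mat (corner_ext \<alpha> A) = corner_ext \<alpha> A"
        unfolding symmetric_index[OF dim[OF A(1)]] using idx[OF A(1)] A(2) symmetric_index[OF A(1)] by auto
      moreover have "col (corner_ext \<alpha> A) 0 = \<alpha> \<cdot>\<^sub>v unit_vec (Suc m) 0"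
        by (rule eq_vecI) (use dim[OF A(1)] idx[OF A(1)] in auto)
      ultimately show "corner_ext \<alpha> A \<in> SymGL_col (Suc m) (\<alpha> \<cdot>\<^sub>v unit_vec (Suc m) 0)"
        using A dim det assms by (auto simp: SymGL_col_def SymGL_def)
    qed
    show "(\<lambda>A. mat_delete A 0 0) ` SymGL_col (Suc m) (\<alpha> \<cdot>\<^sub>v unit_vec (Suc m) 0) \<subseteq> SymGL m"
    proof (rule image_subsetI)
      fix A :: "'b mat" assume A': "A \<in> SymGL_col (Suc m) (\<alpha> \<cdot>\<^sub>v unit_vec (Suc m) 0)"
      then have A: "A \<in> carrier_mat (Suc m) (Suc m)" "transpose_mat A = A" "det A \<noteq> 0"
        by (auto simp: SymGL_col_def SymGL_def)
      let ?D = "mat_delete A 0 0"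
      have D: "?D \<in> carrier_mat m m" "corner_ext \<alpha> ?D = A" using del[OF A'] by auto
      have "det ?D \<noteq> 0" using det[OF D(1)] D(2) A(3) by auto
      moreover have "transpose_mat ?D = ?D"
        unfolding symmetric_index[OF D(1)] using A(1,2) symmetric_index[OF A(1)] by (auto simp: mat_delete_def)
      ultimately show "?D \<in> SymGL m" using D by (simp add: SymGL_def)
    qed
  qed
  then show ?thesis ..
qed

text \<open>The general symmetric matrix whose first column is the second unit vector, a hyperbolic
  plane glued to A. The entry \<beta> and the vector c are free: they drop out of the determinant
  under expansion along the first column and then the first row.\<close>

definition hyp_ext :: "'b::zero_neq_one \<Rightarrow> 'b vec \<Rightarrow> 'b mat \<Rightarrow> 'b mat" where
  "hyp_ext \<beta> c A = mat (dim_row A + 2) (dim_row A + 2) (\<lambda>(i, j).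
     if i = 0 then (if j = 1 then 1 else 0)
     else if j = 0 then (if i = 1 then 1 else 0)
     else if i = 1 then (if j = 1 then \<beta> else c $ (j - 2))
     else if j = 1 then c $ (i - 2) else A $$ (i - 2, j - 2))"

lemma det_hyp_ext:
  assumes A: "A \<in> carrier_mat m m"
  shows "det (hyp_ext \<beta> c A) = - det (A :: 'b::field mat)"
proof -
  let ?E = "hyp_ext \<beta> c A"
  have E: "?E \<in> carrier_mat (m + 2) (m + 2)" using A by (simp add: hyp_ext_def)
  have "det ?E = (\<Sum>i<m + 2. ?E $$ (i, 0) * cofactor ?E i 0)"
    by (rule laplace_expansion_column[OF E]) simp
  also have "\<dots> = (\<Sum>i<m + 2. if i = 1 then cofactor ?E 1 0 else 0)"
    using A by (intro sum.cong) (auto simp: hyp_ext_def)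
  also have "\<dots> = - det (mat_delete ?E 1 0)" by (simp add: cofactor_def)
  finally have 1: "det ?E = - det (mat_delete ?E 1 0)" .
  let ?D = "mat_delete ?E 1 0"
  have D: "?D \<in> carrier_mat (m + 1) (m + 1)" using mat_delete_carrier[OF E] by simp
  have "det ?D = (\<Sum>j<m + 1. ?D $$ (0, j) * cofactor ?D 0 j)"
    by (rule laplace_expansion_row[OF D]) simp
  also have "\<dots> = (\<Sum>j<m + 1. if j = 0 then cofactor ?D 0 0 else 0)"
    using A E by (intro sum.cong) (auto simp: hyp_ext_def mat_delete_def)
  also have "\<dots> = det (mat_delete ?D 0 0)" by (simp add: cofactor_def)
  also have "mat_delete ?D 0 0 = A"
    using A E D by (intro eq_matI) (auto simp: hyp_ext_def mat_delete_def)
  finally show ?thesis using 1 by simp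
qed

lemma card_SymGL_col_hyp:
  "card (SymGL_col (Suc (Suc m)) (unit_vec (Suc (Suc m)) 1) :: 'b::{field,finite} mat set)
    = CARD('b) ^ Suc m * card (SymGL m :: 'b mat set)"
proof -
  let ?M = "Suc (Suc m)"
  let ?S = "SymGL_col ?M (unit_vec ?M 1) :: 'b mat set"
  let ?D = "(UNIV :: 'b set) \<times> ((carrier_vec m :: 'b vec set) \<times> (SymGL m :: 'b mat set))"
  have idx: "hyp_ext \<beta> c A $$ (i, j) = (if i = 0 then (if j = 1 then 1 else 0)
     else if j = 0 then (if i = 1 then 1 else 0)
     else if i = 1 then (if j = 1 then \<beta> else c $ (j - 2))
     else if j = 1 then c $ (i - 2) else A $$ (i - 2, j - 2))"
    if "A \<in> carrier_mat m m" "i < ?M" "j < ?M" for A :: "'b mat" and i j \<beta> c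
    using that by (auto simp: hyp_ext_def)
  have dim: "hyp_ext \<beta> c A \<in> carrier_mat ?M ?M" if "A \<in> carrier_mat m m" for A :: "'b mat" and \<beta> c
    using that by (auto simp: hyp_ext_def)
  let ?f = "\<lambda>(\<beta>, c, A). hyp_ext \<beta> c A :: 'b mat"
  let ?g = "\<lambda>A::'b mat. (A $$ (1, 1), vec m (\<lambda>i. A $$ (1, i + 2)), mat m m (\<lambda>(i, j). A $$ (i + 2, j + 2)))"
  have inv: "hyp_ext (A $$ (1, 1)) (vec m (\<lambda>i. A $$ (1, i + 2))) (mat m m (\<lambda>(i, j). A $$ (i + 2, j + 2))) = A"
    if A': "A \<in> ?S" for A
  proof -
    have A: "A \<in> carrier_mat ?M ?M" "transpose_mat A = A" "col A 0 = unit_vec ?M 1"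
      using A' by (auto simp: SymGL_col_def SymGL_def)
    have c0: "A $$ (i, 0) = (if i = 1 then 1 else 0)" if "i < ?M" for i
      using arg_cong[OF A(3), of "\<lambda>v. v $ i"] A(1) that by simp
    have sym: "A $$ (i, j) = A $$ (j, i)" if "i < ?M" "j < ?M" for i j
      using A(2) symmetric_index[OF A(1)] that by auto
    have m: "mat m m (\<lambda>(i, j). A $$ (i + 2, j + 2)) \<in> carrier_mat m m" by simp
    show ?thesis
    proof (rule eq_matI)
      fix i j assume "i < dim_row A" "j < dim_col A"
      then have ij: "i < ?M" "j < ?M" using A by auto
      have r0: "A $$ (0, j) = (if j = 1 then 1 else 0)" using c0[OF ij(2)] sym[of 0 j] ij by simp
      have c1: "A $$ (i, Suc 0) = A $$ (Suc 0, i)" using sym[of i 1] ij by simp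
      have e: "Suc (Suc (k - 2)) = k" if "k \<noteq> 0" "k \<noteq> 1" for k :: nat using that by arith
      show "hyp_ext (A $$ (1, 1)) (vec m (\<lambda>i. A $$ (1, i + 2))) (mat m m (\<lambda>(i, j). A $$ (i + 2, j + 2))) $$ (i, j) = A $$ (i, j)"
        unfolding idx[OF m ij] using ij c0[OF ij(1)] r0 c1 by (auto simp: e)
    qed (use A dim[OF m] in auto)
  qed
  have "card ?D = card ?S"
  proof (rule bij_betw_same_card[of ?f], rule bij_betw_byWitness[where f' = ?g])
    show "\<forall>p\<in>?D. ?g (?f p) = p"
    proof
      fix p assume "p \<in> ?D"
      then obtain \<beta> c A where p: "p = (\<beta>, c, A)" "c \<in> carrier_vec m" "A \<in> SymGL m" by auto
      then have A: "A \<in> carrier_mat m m" by (simp add: SymGL_def)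
      have "vec m (\<lambda>i. hyp_ext \<beta> c A $$ (1, i + 2)) = c" "mat m m (\<lambda>(i, j). hyp_ext \<beta> c A $$ (i + 2, j + 2)) = A"
        "hyp_ext \<beta> c A $$ (1, 1) = \<beta>"
        using p(2) A idx[OF A] by (auto intro!: eq_vecI eq_matI)
      then show "?g (?f p) = p" using p by simp
    qed
    show "\<forall>A\<in>?S. ?f (?g A) = A" using inv by simp
    show "?f ` ?D \<subseteq> ?S"
    proof (rule image_subsetI)
      fix p assume "p \<in> ?D"
      then obtain \<beta> c A where p: "p = (\<beta>, c, A)" "c \<in> carrier_vec m" "A \<in> SymGL m" by auto
      then have A: "A \<in> carrier_mat m m" "transpose_mat A = A" "det A \<noteq> 0" by (simp_all add: SymGL_def)
      have "transpose_mat (hyp_ext \<beta> c A) = hyp_ext \<beta> c A"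
        unfolding symmetric_index[OF dim[OF A(1)]] using idx[OF A(1)] A(2) symmetric_index[OF A(1)] by auto
      moreover have "col (hyp_ext \<beta> c A) 0 = unit_vec ?M 1"
        by (rule eq_vecI) (use dim[OF A(1), of \<beta> c] idx[OF A(1)] in auto)
      ultimately show "?f p \<in> ?S"
        using A dim[OF A(1)] det_hyp_ext[OF A(1)] by (auto simp: p SymGL_col_def SymGL_def)
    qed
    show "?g ` ?S \<subseteq> ?D"
    proof (rule image_subsetI)
      fix A assume A': "A \<in> ?S"
      then have A: "A \<in> carrier_mat ?M ?M" "transpose_mat A = A" "det A \<noteq> 0"
        by (auto simp: SymGL_col_def SymGL_def)
      let ?B = "mat m m (\<lambda>(i, j). A $$ (i + 2, j + 2))"
      have B: "?B \<in> carrier_mat m m" by simp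
      have "det A = - det ?B" using arg_cong[OF inv[OF A'], of det] det_hyp_ext[OF B] by simp
      then have "det ?B \<noteq> 0" using A(3) by simp
      moreover have "transpose_mat ?B = ?B"
        unfolding symmetric_index[OF B] using A(2) symmetric_index[OF A(1)] by auto
      ultimately show "?g A \<in> ?D" using B by (simp add: SymGL_def)
    qed
  qed
  then show ?thesis by (simp add: card_cartesian_product card_carrier_vec)
qed

lemma finite_carrier_vec: "finite (carrier_vec n :: 'b::finite vec set)"
proof -
  have "card (carrier_vec n :: 'b vec set) > 0" by (simp add: card_carrier_vec)
  then show ?thesis by (rule card_ge_0_finite)
qed

lemma det_nonzero_col_0:
  assumes "0 < m" "A \<in> carrier_mat m m" "det (A :: 'b::field mat) \<noteq> 0"
  shows "col A 0 \<noteq> 0\<^sub>v m"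
proof
  assume "col A 0 = 0\<^sub>v m"
  note * = assms this
  have "A *\<^sub>v unit_vec m 0 = 0\<^sub>v m" using * by (simp add: mult_mat_unit_vec)
  moreover have "unit_vec m 0 \<noteq> (0\<^sub>v m :: 'b vec)" using *(1) by (metis index_unit_vec(2) index_zero_vec(1) zero_neq_one)
  ultimately show False using det_0_iff_vec_prod_zero_field[OF *(2)] *(3) unit_vec_carrier by blast
qed

lemma card_vec_0_coord:
  "card {w \<in> carrier_vec (Suc m). w $ 0 = (0::'b::{field,finite}) \<and> w \<noteq> 0\<^sub>v (Suc m)} = CARD('b) ^ m - 1"
  "card {w \<in> carrier_vec (Suc m). w $ 0 \<noteq> (0::'b)} = (CARD('b) - 1) * CARD('b) ^ m"
proof -
  let ?c = "carrier_vec (Suc m) :: 'b vec set"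
  have "card {w \<in> ?c. w $ 0 = 0} = card (carrier_vec m :: 'b vec set)"
  proof (rule bij_betw_same_card[of "\<lambda>w. vec m (\<lambda>i. w $ (Suc i))"],
      rule bij_betw_byWitness[where f' = "\<lambda>v. vec (Suc m) (\<lambda>i. if i = 0 then 0 else v $ (i - 1))"])
    show "\<forall>w\<in>{w \<in> ?c. w $ 0 = 0}. vec (Suc m) (\<lambda>i. if i = 0 then 0 else vec m (\<lambda>i. w $ (Suc i)) $ (i - 1)) = w"
      by (auto intro!: eq_vecI)
  qed (auto intro!: eq_vecI)
  then have c0: "card {w \<in> ?c. w $ 0 = 0} = CARD('b) ^ m" by (simp add: card_carrier_vec)
  have f: "finite {w \<in> ?c. w $ 0 = 0}" by (simp add: finite_carrier_vec)
  have "{w \<in> ?c. w $ 0 = 0 \<and> w \<noteq> 0\<^sub>v (Suc m)} = {w \<in> ?c. w $ 0 = 0} - {0\<^sub>v (Suc m)}" by auto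
  then show "card {w \<in> ?c. w $ 0 = 0 \<and> w \<noteq> 0\<^sub>v (Suc m)} = CARD('b) ^ m - 1"
    using c0 f by (simp add: card_Diff_singleton)
  have "{w \<in> ?c. w $ 0 \<noteq> 0} = ?c - {w \<in> ?c. w $ 0 = 0}" by auto
  then have "card {w \<in> ?c. w $ 0 \<noteq> 0} = CARD('b) ^ Suc m - CARD('b) ^ m"
    using c0 f by (simp add: card_Diff_subset card_carrier_vec)
  then show "card {w \<in> ?c. w $ 0 \<noteq> 0} = (CARD('b) - 1) * CARD('b) ^ m"
    by (simp add: diff_mult_distrib)
qed

lemma card_SymGL_0: "card (SymGL 0 :: 'b::field mat set) = 1"
proof -
  have "SymGL 0 = {1\<^sub>m 0 :: 'b mat}" by (auto simp: SymGL_def intro!: eq_matI)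
  then show ?thesis by simp
qed

text \<open>Sorted by the first column w. If w has nonzero first coordinate, elimination below it
  leaves a multiple of the first unit vector and a symmetric block of size m. The other nonzero w
  are all equivalent to the second unit vector, where \<open>hyp_ext\<close> applies. For m = 0
  there are none of the latter, so the truncated m - 1 does no harm.\<close>

lemma card_SymGL_Suc:
  "card (SymGL (Suc m) :: 'b::{field,finite} mat set)
    = (CARD('b) - 1) * CARD('b) ^ m * card (SymGL m :: 'b mat set)
      + (CARD('b) ^ m - 1) * (CARD('b) ^ m * card (SymGL (m - 1) :: 'b mat set))"
proof -
  let ?M = "Suc m"
  let ?c = "carrier_vec ?M :: 'b vec set"
  let ?W1 = "{w \<in> ?c. w $ 0 \<noteq> 0}" and ?W2 = "{w \<in> ?c. w $ 0 = 0 \<and> w \<noteq> 0\<^sub>v ?M}"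
  have fin: "finite ?W1" "finite ?W2" by (simp_all add: finite_carrier_vec)
  have "SymGL ?M = (\<Union>w\<in>?W1 \<union> ?W2. SymGL_col ?M w)"
  proof (intro subset_antisym subsetI)
    fix A :: "'b mat" assume A: "A \<in> SymGL ?M"
    then have "col A 0 \<noteq> 0\<^sub>v ?M" using det_nonzero_col_0[of ?M A] by (simp add: SymGL_def)
    moreover have "col A 0 \<in> ?c" by (rule carrier_vecI) (use A in \<open>auto simp: SymGL_def\<close>)
    ultimately have "col A 0 \<in> ?W1 \<union> ?W2" by blast
    then show "A \<in> (\<Union>w\<in>?W1 \<union> ?W2. SymGL_col ?M w)" using A by (auto simp: SymGL_col_def)
  qed (auto simp: SymGL_col_def)
  then have "card (SymGL ?M :: 'b mat set) = (\<Sum>w\<in>?W1 \<union> ?W2. card (SymGL_col ?M w))"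
    using fin by (simp only:) (intro card_UN_disjoint, auto simp: SymGL_col_def finite_SymGL)
  also have "\<dots> = (\<Sum>w\<in>?W1. card (SymGL_col ?M w)) + (\<Sum>w\<in>?W2. card (SymGL_col ?M w))"
    using fin by (intro sum.union_disjoint) auto
  also have "(\<Sum>w\<in>?W1. card (SymGL_col ?M w)) = (\<Sum>w\<in>?W1. card (SymGL m :: 'b mat set))"
  proof (rule sum.cong)
    fix w assume "w \<in> ?W1"
    then have w: "w \<in> ?c" "w $ 0 \<noteq> 0" by auto
    define P where "P = mat ?M ?M (\<lambda>(i, j). if i = j then 1 else if j = 0 then - w $ i / w $ 0 else 0)"
    have P: "P \<in> carrier_mat ?M ?M" by (simp add: P_def)
    have "det P = prod_list (diag_mat P)" by (rule det_lower_triangular[OF _ P]) (auto simp: P_def)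
    also have "\<dots> \<noteq> 0" unfolding prod_list_zero_iff by (auto simp: diag_mat_def P_def)
    finally have PG: "P \<in> GL ?M" using P by (auto simp: GL_iff)
    have r: "row P 0 = unit_vec ?M 0" by (rule eq_vecI) (auto simp: P_def)
    have "P *\<^sub>v w = w $ 0 \<cdot>\<^sub>v unit_vec ?M 0"
    proof (rule eq_vecI)
      fix i assume "i < dim_vec (w $ 0 \<cdot>\<^sub>v unit_vec ?M 0)"
      then have i: "i < ?M" by simp
      have "(P *\<^sub>v w) $ i = (\<Sum>k<?M. P $$ (i, k) * w $ k)" by (rule mult_mat_vec_index[OF P w(1) i])
      also have "\<dots> = P $$ (i, 0) * w $ 0 + (\<Sum>k\<in>{..<?M} - {0}. P $$ (i, k) * w $ k)"
        by (subst sum.remove[of _ 0]) auto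
      also have "(\<Sum>k\<in>{..<?M} - {0}. P $$ (i, k) * w $ k) = (\<Sum>k\<in>{..<?M} - {0}. if i = k then w $ k else 0)"
        using i by (intro sum.cong) (auto simp: P_def)
      also have "\<dots> = (if i = 0 then 0 else w $ i)" using i by (subst sum.delta') auto
      also have "P $$ (i, 0) * w $ 0 + \<dots> = (w $ 0 \<cdot>\<^sub>v unit_vec ?M 0) $ i" using i w by (auto simp: P_def)
      finally show "(P *\<^sub>v w) $ i = (w $ 0 \<cdot>\<^sub>v unit_vec ?M 0) $ i" .
    qed (simp add: P_def)
    then show "card (SymGL_col ?M w) = card (SymGL m :: 'b mat set)"
      using card_SymGL_col_cong[OF _ PG r w(1)] card_SymGL_col_diag[OF w(2)] by simp
  qed simp
  also have "(\<Sum>w\<in>?W2. card (SymGL_col ?M w)) = (\<Sum>w\<in>?W2. CARD('b) ^ m * card (SymGL (m - 1) :: 'b mat set))"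
  proof (rule sum.cong)
    fix w assume "w \<in> ?W2"
    then have w: "w \<in> ?c" "w $ 0 = 0" "w \<noteq> 0\<^sub>v ?M" by auto
    have "m \<noteq> 0"
    proof
      assume "m = 0"
      then have "w = 0\<^sub>v ?M" using w(1,2) by (intro eq_vecI) auto
      then show False using w by blast
    qed
    then obtain k where k: "m = Suc k" by (cases m) auto
    define v where "v = vec m (\<lambda>i. w $ Suc i)"
    have vc: "v \<in> carrier_vec m" by (simp add: v_def)
    have "v \<noteq> 0\<^sub>v m"
    proof
      assume v: "v = 0\<^sub>v m"
      have "w $ i = 0" if "i < ?M" for i
        using w(2) v that unfolding v_def by (cases i) (auto simp: vec_eq_iff)
      then have "w = 0\<^sub>v ?M" using w(1) by (intro eq_vecI) auto
      then show False using w by blast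
    qed
    then obtain P' where P': "P' \<in> GL m" "P' *\<^sub>v v = unit_vec m 0" using ex_GL_to_unit_vec[OF vc] by blast
    then have P'c: "P' \<in> carrier_mat m m" by (simp add: GL_iff)
    define P where "P = corner_ext 1 P'"
    have P: "P \<in> carrier_mat ?M ?M" using P'c by (auto simp: P_def corner_ext_def)
    have idx: "P $$ (i, j) = (if i = 0 then if j = 0 then 1 else 0 else if j = 0 then 0 else P' $$ (i - 1, j - 1))"
      if "i < ?M" "j < ?M" for i j
      using that P'c by (auto simp: P_def corner_ext_def)
    have "det P = det P'" unfolding P_def corner_ext_def using P'c
      by (subst det_four_block_mat_lower_left_zero_col[where n = m]) (auto simp: det_single)
    then have PG: "P \<in> GL ?M" using P P'(1) by (simp add: GL_iff)
    have r: "row P 0 = unit_vec ?M 0" by (rule eq_vecI) (use P idx in auto)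
    have "P *\<^sub>v w = unit_vec ?M 1"
    proof (rule eq_vecI)
      fix i assume "i < dim_vec (unit_vec ?M 1 :: 'b vec)"
      then have i: "i < ?M" by simp
      have "(P *\<^sub>v w) $ i = (\<Sum>k<?M. P $$ (i, k) * w $ k)" by (rule mult_mat_vec_index[OF P w(1) i])
      also have "\<dots> = (\<Sum>k<m. P $$ (i, Suc k) * w $ Suc k)"
        unfolding lessThan_Suc_eq_insert_0 by (subst sum.insert) (auto simp: w(2) sum.reindex)
      also have "\<dots> = (if i = 0 then 0 else (\<Sum>k<m. P' $$ (i - 1, k) * v $ k))"
        using i idx[OF i] by (auto simp: v_def)
      also have "\<dots> = unit_vec ?M 1 $ i"
      proof (cases i)
        case (Suc l)
        then have "(\<Sum>k<m. P' $$ (l, k) * v $ k) = unit_vec m 0 $ l"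
          using mult_mat_vec_index[OF P'c vc, of l] P'(2) i by simp
        then show ?thesis using Suc i by simp
      qed (use k in simp)
      finally show "(P *\<^sub>v w) $ i = unit_vec ?M 1 $ i" .
    qed (use P in simp)
    then show "card (SymGL_col ?M w) = CARD('b) ^ m * card (SymGL (m - 1) :: 'b mat set)"
      using card_SymGL_col_cong[OF _ PG r w(1)] card_SymGL_col_hyp[of k, where 'b = 'b] k by simp
  qed simp
  finally show ?thesis by (simp add: card_vec_0_coord)
qed

section \<open>Orders of general linear groups and spaces of alternating matrices\<close>

lemma card_GL_0: "card (GL 0 :: 'b::field mat set) = 1"
proof -
  have "GL 0 = {1\<^sub>m 0 :: 'b mat}" by (auto simp: GL_iff intro!: eq_matI)
  then show ?thesis by simp
qed

text \<open>Left multiplication makes all nonzero first columns equivalent, and the matrices whose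
  first column is the first unit vector are block upper triangular.\<close>

lemma card_GL_Suc:
  "card (GL (Suc m) :: 'b::{field,finite} mat set) = (CARD('b) ^ Suc m - 1) * (CARD('b) ^ m * card (GL m :: 'b mat set))"
proof -
  let ?M = "Suc m"
  let ?G = "\<lambda>v. {A \<in> GL ?M. col A 0 = (v :: 'b vec)}"
  let ?V = "carrier_vec ?M - {0\<^sub>v ?M} :: 'b vec set"
  have finG: "finite (?G v)" for v by (simp add: finite_GL)
  have le: "card (?G v) \<le> card (?G (P *\<^sub>v v))" if P: "P \<in> GL ?M" for P v
  proof (rule card_inj_on_le[of "\<lambda>A. P * A"])
    show "inj_on (\<lambda>A. P * A) (?G v)"
    proof (rule inj_onI)
      fix A B assume AB: "A \<in> ?G v" "B \<in> ?G v" "P * A = P * B"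
      then have "A \<in> carrier_mat ?M ?M" "B \<in> carrier_mat ?M ?M" by (auto simp: GL_iff)
      then show "A = B" using AB(3) by (rule GL_mult_cancel[OF P])
    qed
    show "(\<lambda>A. P * A) ` ?G v \<subseteq> ?G (P *\<^sub>v v)"
    proof (rule image_subsetI)
      fix A assume A: "A \<in> ?G v"
      then have "col (P * A) 0 = P *\<^sub>v v" using P col_mult2[of P ?M ?M A ?M 0] by (simp add: GL_iff)
      then show "P * A \<in> ?G (P *\<^sub>v v)" using GL_mult[OF P] A by simp
    qed
  qed (rule finG)
  have eq: "card (?G v) = card (?G (unit_vec ?M 0))" if v: "v \<in> ?V" for v
  proof -
    obtain P where P: "P \<in> GL ?M" "P *\<^sub>v v = unit_vec ?M 0" using ex_GL_to_unit_vec[of v ?M] v by auto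
    obtain R where R: "R \<in> GL ?M" "R * P = 1\<^sub>m ?M" using GL_inverse[OF P(1)] by metis
    have "R *\<^sub>v unit_vec ?M 0 = v"
      using P R v by (metis DiffD1 GL_iff assoc_mult_mat_vec one_mult_mat_vec)
    then show ?thesis using le[OF P(1), of v] le[OF R(1), of "unit_vec ?M 0"] P(2) by simp
  qed
  have base: "card (?G (unit_vec ?M 0)) = CARD('b) ^ m * card (GL m :: 'b mat set)"
  proof -
    let ?f = "\<lambda>(c, A). four_block_mat (1\<^sub>m 1) c (0\<^sub>m m 1) A :: 'b mat"
    let ?g = "\<lambda>A::'b mat. (mat 1 m (\<lambda>(i, j). A $$ (0, Suc j)), mat m m (\<lambda>(i, j). A $$ (Suc i, Suc j)))"
    have inv: "?f (?g A) = A" if "A \<in> ?G (unit_vec ?M 0)" for A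
    proof -
      have A: "A \<in> carrier_mat ?M ?M" "col A 0 = unit_vec ?M 0" using that by (auto simp: GL_iff)
      have c0: "A $$ (i, 0) = (if i = 0 then 1 else 0)" if "i < ?M" for i
        using arg_cong[OF A(2), of "\<lambda>v. v $ i"] A(1) that by simp
      show ?thesis
        by (rule eq_matI) (use A c0 in \<open>auto simp: less_Suc_eq_0_disj\<close>)
    qed
    have det: "det (?f (c, A)) = det A" if "c \<in> carrier_mat 1 m" "A \<in> carrier_mat m m" for c A
      using that by (simp, subst det_four_block_mat_lower_left_zero_col[where n = m]) auto
    have "card ((carrier_mat 1 m :: 'b mat set) \<times> (GL m :: 'b mat set)) = card (?G (unit_vec ?M 0))"
    proof (rule bij_betw_same_card[of ?f], rule bij_betw_byWitness[where f' = ?g])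
      show "\<forall>p\<in>carrier_mat 1 m \<times> GL m. ?g (?f p) = p"
        by (auto simp: GL_iff intro!: eq_matI)
      show "\<forall>A\<in>?G (unit_vec ?M 0). ?f (?g A) = A" using inv by blast
      show "?f ` (carrier_mat 1 m \<times> GL m) \<subseteq> ?G (unit_vec ?M 0)"
      proof (rule image_subsetI)
        fix p :: "'b mat \<times> 'b mat" assume "p \<in> carrier_mat 1 m \<times> GL m"
        then obtain c A where p: "p = (c, A)" "c \<in> carrier_mat 1 m" "A \<in> carrier_mat m m" "det A \<noteq> 0"
          by (auto simp: GL_iff)
        have "?f p \<in> carrier_mat ?M ?M" using p by auto
        moreover have "col (?f p) 0 = unit_vec ?M 0" using p by (intro eq_vecI) auto
        ultimately show "?f p \<in> ?G (unit_vec ?M 0)" using det[OF p(2,3)] p by (simp add: GL_iff)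
      qed
      show "?g ` ?G (unit_vec ?M 0) \<subseteq> carrier_mat 1 m \<times> GL m"
      proof (rule image_subsetI)
        fix A assume A: "A \<in> ?G (unit_vec ?M 0)"
        have "det (?f (?g A)) \<noteq> 0" unfolding inv[OF A] using A by (simp add: GL_iff)
        then have "det (mat m m (\<lambda>(i, j). A $$ (Suc i, Suc j))) \<noteq> 0" by (subst (asm) det) auto
        then show "?g A \<in> carrier_mat 1 m \<times> GL m" by (simp add: GL_iff)
      qed
    qed
    then show ?thesis by (simp add: card_cartesian_product card_carrier_mat)
  qed
  have "GL ?M = (\<Union>v\<in>?V. ?G v)"
  proof (intro subset_antisym subsetI)
    fix A :: "'b mat" assume A: "A \<in> GL ?M"
    then have "col A 0 \<noteq> 0\<^sub>v ?M" using det_nonzero_col_0[of ?M A] by (simp add: GL_iff)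
    moreover have "col A 0 \<in> carrier_vec ?M" by (rule carrier_vecI) (use A in \<open>auto simp: GL_iff\<close>)
    ultimately show "A \<in> (\<Union>v\<in>?V. ?G v)" using A by blast
  qed blast
  then have "card (GL ?M :: 'b mat set) = card (\<Union>v\<in>?V. ?G v)" by (rule arg_cong)
  also have "\<dots> = (\<Sum>v\<in>?V. card (?G v))"
    by (intro card_UN_disjoint) (auto simp: finite_carrier_vec finG)
  also have "\<dots> = (\<Sum>v\<in>?V. CARD('b) ^ m * card (GL m :: 'b mat set))"
    using eq base by (intro sum.cong) simp_all
  also have "card ?V = CARD('b) ^ Suc m - 1"
    using finite_carrier_vec by (simp add: card_Diff_singleton card_carrier_vec)
  then have "(\<Sum>v\<in>?V. CARD('b) ^ m * card (GL m :: 'b mat set)) = (CARD('b) ^ Suc m - 1) * (CARD('b) ^ m * card (GL m :: 'b mat set))" by simp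
  finally show ?thesis .
qed

text \<open>With s = 0 these are all alternating matrices, the free parameter in an element of Q;
  with general s the vanishing block is what membership in the stabilizer of \<sigma>_s
  imposes.\<close>

definition alt_mats :: "nat \<Rightarrow> nat \<Rightarrow> 'b::zero mat set" where
  "alt_mats m s = {T \<in> carrier_mat m m. alternating_mat T \<and> (\<forall>i<s. \<forall>j<s. T $$ (i, j) = 0)}"

lemma alternating_mat_iff:
  "T \<in> carrier_mat m m \<Longrightarrow> alternating_mat T \<longleftrightarrow> (\<forall>i<m. T $$ (i, i) = 0) \<and> (\<forall>i<m. \<forall>j<m. T $$ (i, j) = T $$ (j, i))"
  using symmetric_index[of T m] by (auto simp: alternating_mat_def)

text \<open>The entries above the diagonal in columns j >= s are free, and column j has j of
  them.\<close>

lemma card_alt_mats: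
  assumes "s \<le> m"
  shows "card (alt_mats m s :: 'b::{field,finite} mat set) = CARD('b) ^ (\<Sum>j\<in>{s..<m}. j)"
proof -
  let ?I = "{(i, j). i < j \<and> s \<le> j \<and> j < m}"
  have I: "?I = (\<lambda>(j, i). (i, j)) ` (SIGMA j:{s..<m}. {..<j})" by auto
  have "card ?I = card (SIGMA j:{s..<m}. {..<j})"
    unfolding I by (rule card_image) (auto simp: inj_on_def)
  then have cI: "card ?I = (\<Sum>j\<in>{s..<m}. j)" by simp
  have fI: "finite ?I" unfolding I by (intro finite_imageI finite_SigmaI) auto
  let ?f = "\<lambda>h. mat m m (\<lambda>(i, j). if i < j \<and> s \<le> j then h (i, j) else if j < i \<and> s \<le> i then h (j, i) else (0::'b))"
  have "card (PiE ?I (\<lambda>_. UNIV :: 'b set)) = card (alt_mats m s :: 'b mat set)"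
  proof (rule bij_betw_same_card[of ?f], rule bij_betw_byWitness[where f' = "\<lambda>T. restrict (\<lambda>ij. T $$ ij) ?I"])
    show "\<forall>h\<in>PiE ?I (\<lambda>_. UNIV). restrict (\<lambda>ij. ?f h $$ ij) ?I = h"
      by (auto simp: fun_eq_iff PiE_def extensional_def)
    show "\<forall>T\<in>alt_mats m s. ?f (restrict (\<lambda>ij. T $$ ij) ?I) = T"
    proof
      fix T :: "'b mat" assume T: "T \<in> alt_mats m s"
      then have c: "T \<in> carrier_mat m m" and a: "\<forall>i<m. T $$ (i, i) = 0" "\<And>i j. i < m \<Longrightarrow> j < m \<Longrightarrow> T $$ (i, j) = T $$ (j, i)"
        and z: "\<And>i j. i < s \<Longrightarrow> j < s \<Longrightarrow> T $$ (i, j) = 0"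
        using alternating_mat_iff[of T m] by (auto simp: alt_mats_def)
      show "?f (restrict (\<lambda>ij. T $$ ij) ?I) = T"
      proof (rule eq_matI)
        fix i j assume "i < dim_row T" "j < dim_col T"
        then have ij: "i < m" "j < m" using c by auto
        consider "i < j" "s \<le> j" | "j < i" "s \<le> i" | "i = j" | "i < s" "j < s" by linarith
        then show "?f (restrict (\<lambda>ij. T $$ ij) ?I) $$ (i, j) = T $$ (i, j)"
          using ij a z by cases auto
      qed (use c in auto)
    qed
    show "?f ` PiE ?I (\<lambda>_. UNIV) \<subseteq> alt_mats m s"
    proof (rule image_subsetI)
      fix h :: "nat \<times> nat \<Rightarrow> 'b" assume "h \<in> PiE ?I (\<lambda>_. UNIV)"
      have c: "?f h \<in> carrier_mat m m" by simp
      have "alternating_mat (?f h)" unfolding alternating_mat_iff[OF c] by auto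
      then show "?f h \<in> alt_mats m s" using assms c by (auto simp: alt_mats_def)
    qed
  qed (auto simp: PiE_def extensional_def split: if_splits)
  then show ?thesis using cI fI by (simp add: card_PiE)
qed

section \<open>Alternating and symmetric matrices in characteristic two\<close>

context char2_field
begin

lemma of_nat_eq_0: "(of_nat n :: 'a) = 0 \<longleftrightarrow> even n"
proof -
  have "(of_nat n :: 'a) = (if even n then 0 else 1)"
    by (induction n) (auto simp: add_self[of 1, simplified])
  then show ?thesis by simp
qed

text \<open>Two equal summands cancel in characteristic two, so an involution need not change signs;
  only its fixed points could contribute. It is applied to double sums under transposition of
  indices and to determinants under inversion of permutations.\<close>

lemma sum_involution:
  fixes f :: "'b \<Rightarrow> 'a"
  assumes "finite S" "\<And>x. x \<in> S \<Longrightarrow> \<iota> x \<in> S" "\<And>x. x \<in> S \<Longrightarrow> \<iota> (\<iota> x) = x"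
    "\<And>x. x \<in> S \<Longrightarrow> f (\<iota> x) = f x" "\<And>x. x \<in> S \<Longrightarrow> \<iota> x = x \<Longrightarrow> f x = 0"
  shows "sum f S = 0"
  using assms
proof (induction S rule: finite_psubset_induct)
  case (psubset S)
  show ?case
  proof (cases "S = {}")
    case False
    then obtain x where x: "x \<in> S" by blast
    let ?S = "S - {x, \<iota> x}"
    have "sum f ?S = 0"
    proof (rule psubset.IH)
      show "?S \<subset> S" using x by blast
      show "\<iota> y \<in> ?S" if "y \<in> ?S" for y
        using that psubset.prems(1,2) x by (metis Diff_iff insert_iff singletonD)
    qed (use psubset.prems in auto)
    moreover have "sum f S = sum f {x, \<iota> x} + sum f ?S"
      using psubset.hyps x psubset.prems(1) by (metis empty_subsetI insert_subset sum.subset_diff add.commute)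
    moreover have "sum f {x, \<iota> x} = 0"
      using psubset.prems(3,4)[OF x] by (cases "\<iota> x = x") (auto simp: add_self)
    ultimately show ?thesis by simp
  qed simp
qed

text \<open>A permutation and its inverse give the same term of the Leibniz formula. A permutation
  equal to its inverse has a fixed point, n being odd, and there the term contains a diagonal
  entry.\<close>

lemma det_alternating_odd:
  fixes M :: "'a mat"
  assumes "M \<in> carrier_mat n n" "alternating_mat M" "odd n"
  shows "det M = 0"
proof -
  let ?P = "{p. p permutes {0..<n}}"
  let ?f = "\<lambda>p. \<Prod>i = 0..<n. M $$ (i, p i)"
  have sym: "M $$ (i, j) = M $$ (j, i)" "M $$ (i, i) = 0" if "i < n" "j < n" for i j
    using assms(2) alternating_mat_iff[OF assms(1)] that by auto
  have "det M = (\<Sum>p\<in>?P. ?f p)"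
    unfolding det_def'[OF assms(1)] by (intro sum.cong) (auto simp: sign_def uminus_self)
  also have "\<dots> = 0"
  proof (rule sum_involution[where \<iota> = "inv_into UNIV"])
    show "finite ?P" by (simp add: finite_permutations)
    fix p assume "p \<in> ?P"
    then have p: "p permutes {0..<n}" by simp
    show "inv_into UNIV p \<in> ?P" using permutes_inv[OF p] by simp
    show "inv_into UNIV (inv_into UNIV p) = p" using p permutes_inv_inv by blast
    have "?f p = (\<Prod>i = 0..<n. M $$ (inv_into UNIV p i, p (inv_into UNIV p i)))"
      by (rule prod.permute[OF permutes_inv[OF p], unfolded o_def])
    also have "\<dots> = ?f (inv_into UNIV p)"
    proof (rule prod.cong)
      fix i assume "i \<in> {0..<n}"
      then have "inv_into UNIV p i \<in> {0..<n}" using permutes_in_image[OF permutes_inv[OF p]] by blast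
      then show "M $$ (inv_into UNIV p i, p (inv_into UNIV p i)) = M $$ (i, inv_into UNIV p i)"
        using sym(1)[of "inv_into UNIV p i" i] \<open>i \<in> {0..<n}\<close> permutes_inverses(1)[OF p] by simp
    qed simp
    finally show "?f (inv_into UNIV p) = ?f p" ..
    assume ip: "inv_into UNIV p = p"
    then have pp: "p (p i) = i" for i using permutes_inverses(1)[OF p, of i] by simp
    show "?f p = 0"
    proof (rule ccontr)
      assume nz: "?f p \<noteq> 0"
      \<comment> \<open>Were the term nonzero, p would be free of fixed points and would pair off
        the n points; the principle of cancelling pairs, now applied to p itself, would make n
        even.\<close>
      have "(\<Sum>i\<in>{0..<n}. (1::'a)) = 0"
      proof (rule sum_involution[where \<iota> = p])
        fix i assume i: "i \<in> {0..<n}"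
        show "p i \<in> {0..<n}" using permutes_in_image[OF p] i by blast
        assume "p i = i"
        then have "M $$ (i, p i) = 0" using sym(2) i by auto
        then have "?f p = 0" using i by (intro prod_zero) auto
        then show "(1::'a) = 0" using nz by blast
      qed (use pp in auto)
      then show False using assms(3) of_nat_eq_0[of n] by simp
    qed
  qed
  finally show ?thesis .
qed

text \<open>The diagonal of a symmetric matrix \<open>A\<close> is \<open>e\<close> squared entrywise, so \<open>A + e e\<^sup>T\<close> is alternating,
  hence singular in odd dimension; in even dimension it is bordered by \<open>e\<close>.\<close>

lemma symmetric_diag_parity:
  fixes A :: "'a mat"
  assumes "A \<in> SymGL s" "\<And>k. k < s \<Longrightarrow> (e k)\<^sup>2 = A $$ (k, k)"
    and u: "\<And>i. i < s \<Longrightarrow> (\<Sum>j<s. A $$ (i, j) * u j) = e i"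
  shows "(\<Sum>k<s. e k * u k) = of_nat s"
proof -
  have A: "A \<in> carrier_mat s s" "det A \<noteq> 0" and sym: "\<And>i j. i < s \<Longrightarrow> j < s \<Longrightarrow> A $$ (i, j) = A $$ (j, i)"
    using assms(1) symmetric_index[of A s] by (auto simp: SymGL_def)
  have multiple: "v j = z * u j" if "\<And>i. i < s \<Longrightarrow> (\<Sum>j<s. A $$ (i, j) * v j) = z * e i" "j < s" for v z j
  proof -
    have "v j - z * u j = 0"
    proof (rule det_nonzero_kernel[OF A _ that(2), of "\<lambda>j. v j - z * u j"])
      fix i assume i: "i < s"
      have "(\<Sum>j<s. A $$ (i, j) * (v j - z * u j)) = (\<Sum>j<s. A $$ (i, j) * v j) - z * (\<Sum>j<s. A $$ (i, j) * u j)"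
        by (simp add: sum_subtractf sum_distrib_left algebra_simps)
      then show "(\<Sum>j<s. A $$ (i, j) * (v j - z * u j)) = 0" using that(1)[OF i] u[OF i] by simp
    qed
    then show ?thesis by simp
  qed
  show ?thesis
  proof (cases "even s")
    case False
    define M where "M = mat s s (\<lambda>(i, j). A $$ (i, j) + e i * e j)"
    have M: "M \<in> carrier_mat s s" by (simp add: M_def)
    have "alternating_mat M" unfolding alternating_mat_iff[OF M]
      using sym assms(2) by (auto simp: M_def power2_eq_square add_self mult.commute)
    then have "det M = 0" using det_alternating_odd[OF M] False by blast
    then obtain v where v: "\<exists>j<s. v j \<noteq> 0" "\<And>i. i < s \<Longrightarrow> (\<Sum>j<s. M $$ (i, j) * v j) = 0"
      using det_kernel[OF M] by blast
    \<comment> \<open>A kernel vector v of M satisfies A v = z e, so v = z u by invertibility of A,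
      and z is nonzero because v is. Then z = e.v = z (e.u) gives e.u = 1.\<close>
    define z where "z = (\<Sum>j<s. e j * v j)"
    have "(\<Sum>j<s. A $$ (i, j) * v j) = z * e i" if "i < s" for i
    proof -
      have "(\<Sum>j<s. M $$ (i, j) * v j) = (\<Sum>j<s. A $$ (i, j) * v j) + z * e i"
        using that by (simp add: M_def z_def algebra_simps sum.distrib sum_distrib_left)
      then show ?thesis using v(2)[OF that] add_eq_0 by simp
    qed
    then have vu: "v j = z * u j" if "j < s" for j using multiple that by blast
    have "z \<noteq> 0" using v(1) vu by auto
    moreover have "z = z * (\<Sum>j<s. e j * u j)"
      unfolding sum_distrib_left by (subst z_def) (simp add: vu mult_ac)
    ultimately have "(\<Sum>j<s. e j * u j) = 1" by simp
    moreover have "of_nat s = (1::'a)"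
      using False of_nat_eq_0[of "Suc s"] add_eq_0[of 1 "of_nat s"] by simp
    ultimately show ?thesis by simp
  next
    case True
    \<comment> \<open>The border raises the dimension to an odd number. The last row of M v = 0 says
      e.v = 0, the other rows say A v = z e with z the last coordinate; again v = z u with z
      nonzero, and now e.u = 0.\<close>
    define M where "M = mat (Suc s) (Suc s) (\<lambda>(i, j). if i < s then if j < s then A $$ (i, j) + e i * e j else e i
       else if j < s then e j else 0)"
    have M: "M \<in> carrier_mat (Suc s) (Suc s)" by (simp add: M_def)
    have "alternating_mat M" unfolding alternating_mat_iff[OF M]
      using sym assms(2) by (auto simp: M_def power2_eq_square add_self mult.commute)
    then have "det M = 0" using det_alternating_odd[OF M] True by simp
    then obtain v where v: "\<exists>j<Suc s. v j \<noteq> 0" "\<And>i. i < Suc s \<Longrightarrow> (\<Sum>j<Suc s. M $$ (i, j) * v j) = 0"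
      using det_kernel[OF M] by blast
    define z where "z = v s"
    have ev: "(\<Sum>j<s. e j * v j) = 0" using v(2)[of s] by (simp add: M_def)
    have "(\<Sum>j<s. A $$ (i, j) * v j) = z * e i" if "i < s" for i
    proof -
      have "(\<Sum>j<Suc s. M $$ (i, j) * v j) = (\<Sum>j<s. A $$ (i, j) * v j) + e i * (\<Sum>j<s. e j * v j) + z * e i"
        using that by (simp add: M_def z_def algebra_simps sum.distrib sum_distrib_left)
      then show ?thesis using v(2)[of i] that ev add_eq_0 by simp
    qed
    then have vu: "v j = z * u j" if "j < s" for j using multiple that by blast
    have "z \<noteq> 0" using v(1) vu z_def by (auto simp: less_Suc_eq)
    moreover have "z * (\<Sum>j<s. e j * u j) = 0"
      using ev unfolding sum_distrib_left by (simp add: vu mult_ac)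
    ultimately have "(\<Sum>j<s. e j * u j) = 0" by simp
    then show ?thesis using True of_nat_eq_0[of s] by simp
  qed
qed

end

text \<open>Here m is n - 1, so that no truncated subtraction occurs, and \<chi> \<kappa> = -1
  encodes the irreducibility of z^2 + z + \<kappa>. Within this locale \<open>N\<close> is the
  matrix size 2n, not the length of a code.\<close>

locale minus_form = char2_field r q F
  for r q :: nat and F :: "'a::{field,finite} itself" +
  fixes \<kappa> :: 'a and m :: nat
  assumes lam_kappa: "lam r \<kappa> = - 1"
begin

abbreviation N :: nat where "N \<equiv> Suc (Suc (2 * m))"
abbreviation \<theta> :: "'a vec \<Rightarrow> 'a" where "\<theta> \<equiv> theta_minus \<kappa> (Suc m)"
abbreviation Q :: "'a mat set" where "Q \<equiv> Q_minus \<kappa> (Suc m)"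

section \<open>The quadratic form\<close>

lemma sum_split3: "(\<Sum>j<N. f j) = (\<Sum>j<m. f j) + (\<Sum>j<m. f (m + j)) + (f (2 * m) + f (Suc (2 * m)))"
  for f :: "nat \<Rightarrow> 'b::comm_monoid_add"
proof -
  have "(\<Sum>j<N. f j) = (\<Sum>j<m + m. f j) + (f (2 * m) + f (Suc (2 * m)))"
    by (simp add: add.assoc mult_2)
  also have "(\<Sum>j<m + m. f j) = (\<Sum>j<m. f j) + (\<Sum>j<m. f (m + j))"
    using sum.nat_group[of f] by (simp add: lessThan_atLeast0 sum.atLeastLessThan_concat[of 0 m "m + m", symmetric]
        sum.shift_bounds_nat_ivl[of f 0 m m, simplified] add.commute)
  finally show ?thesis .
qed

lemma index_cases:
  assumes "k < N"
  obtains "k < m" | k' where "k = m + k'" "k' < m" | c where "k = 2 * m + c" "c < 2"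
proof -
  consider "k < m" | "m \<le> k" "k < 2 * m" | "2 * m \<le> k" by linarith
  then show ?thesis
  proof cases
    case 2 then show ?thesis using that(2)[of "k - m"] by auto
  next
    case 3 then show ?thesis using that(3)[of "k - 2 * m"] assms by auto
  qed (rule that(1))
qed

lemma less_2_cases: "c < 2 \<Longrightarrow> c = 0 \<or> c = (1::nat)" by auto

lemma theta_eq: "\<theta> x = (\<Sum>k<m. x $ k * x $ (m + k)) + (x $ (2 * m))\<^sup>2 + x $ (2 * m) * x $ (Suc (2 * m)) + \<kappa> * (x $ (Suc (2 * m)))\<^sup>2"
  by (simp add: theta_minus_def)

definition polar :: "'a vec \<Rightarrow> 'a vec \<Rightarrow> 'a" where
  "polar x y = (\<Sum>k<m. x $ k * y $ (m + k) + x $ (m + k) * y $ k) + (x $ (2 * m) * y $ (Suc (2 * m)) + x $ (Suc (2 * m)) * y $ (2 * m))"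

lemma theta_add:
  assumes "x \<in> carrier_vec N" "y \<in> carrier_vec N"
  shows "\<theta> (x + y) = \<theta> x + \<theta> y + polar x y"
proof -
  have i: "(x + y) $ k = x $ k + y $ k" if "k < N" for k using assms that by auto
  have s: "(\<Sum>k<m. (x + y) $ k * (x + y) $ (m + k)) = (\<Sum>k<m. x $ k * x $ (m + k)) + (\<Sum>k<m. y $ k * y $ (m + k))
     + (\<Sum>k<m. x $ k * y $ (m + k) + x $ (m + k) * y $ k)"
    unfolding sum.distrib[symmetric] by (rule sum.cong) (auto simp: i algebra_simps)
  show ?thesis unfolding theta_eq polar_def s
    by (simp add: i add_sq algebra_simps)
qed

lemma col_index:
  fixes g :: "'a mat"
  assumes "g \<in> carrier_mat N N" "k < N" "j < N"
  shows "(g *\<^sub>v unit_vec N k) $ j = g $$ (j, k)"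
  unfolding mult_mat_unit_vec[OF assms(1,2)] using assms by simp

lemma preserve_polar:
  assumes "g \<in> carrier_mat N N" "\<And>x. x \<in> carrier_vec N \<Longrightarrow> \<theta> (g *\<^sub>v x) = \<theta> x"
    and "x \<in> carrier_vec N" "y \<in> carrier_vec N"
  shows "polar (g *\<^sub>v x) (g *\<^sub>v y) = polar x y"
proof -
  have c: "g *\<^sub>v x \<in> carrier_vec N" "g *\<^sub>v y \<in> carrier_vec N"
    using assms by (auto intro: mult_mat_vec_carrier)
  have "\<theta> (g *\<^sub>v (x + y)) = \<theta> (g *\<^sub>v x + g *\<^sub>v y)" using assms by (simp add: mult_add_distrib_mat_vec[of g N N])
  then have "\<theta> (x + y) = \<theta> (g *\<^sub>v x) + \<theta> (g *\<^sub>v y) + polar (g *\<^sub>v x) (g *\<^sub>v y)"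
    using assms(2)[of "x + y"] assms(3,4) theta_add[OF c] by simp
  then show ?thesis using assms theta_add[OF assms(3,4)] by simp
qed

lemma polar_unit:
  assumes "x \<in> carrier_vec N"
  shows "k < m \<Longrightarrow> polar x (unit_vec N k) = x $ (m + k)"
    and "k < m \<Longrightarrow> polar x (unit_vec N (m + k)) = x $ k"
    and "polar x (unit_vec N (2 * m)) = x $ (Suc (2 * m))"
    and "polar x (unit_vec N (Suc (2 * m))) = x $ (2 * m)"
proof -
  have u: "unit_vec N k $ j = (if j = k then 1 else 0)" if "j < N" "k < N" for j k using that by simp
  show "polar x (unit_vec N k) = x $ (m + k)" if "k < m"
  proof -
    have "(\<Sum>j<m. x $ j * unit_vec N k $ (m + j) + x $ (m + j) * unit_vec N k $ j) = (\<Sum>j<m. if j = k then x $ (m + k) else 0)"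
      using that by (intro sum.cong) (auto simp: u)
    then show ?thesis using that by (simp add: polar_def)
  qed
  show "polar x (unit_vec N (m + k)) = x $ k" if "k < m"
  proof -
    have "(\<Sum>j<m. x $ j * unit_vec N (m + k) $ (m + j) + x $ (m + j) * unit_vec N (m + k) $ j) = (\<Sum>j<m. if j = k then x $ k else 0)"
      using that by (intro sum.cong) (auto simp: u)
    then show ?thesis using that by (simp add: polar_def)
  qed
  show "polar x (unit_vec N (2 * m)) = x $ (Suc (2 * m))"
    unfolding polar_def by (subst sum.neutral) auto
  show "polar x (unit_vec N (Suc (2 * m))) = x $ (2 * m)"
    unfolding polar_def by (subst sum.neutral) auto
qed

text \<open>The polar form is nondegenerate and preserved, so the kernel of g is trivial. An
  isometry can therefore be recognised by \<theta> alone.\<close>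

lemma preserve_GL:
  assumes g: "g \<in> carrier_mat N N" "\<And>x. x \<in> carrier_vec N \<Longrightarrow> \<theta> (g *\<^sub>v x) = \<theta> x"
  shows "g \<in> GL N"
proof -
  have "det g \<noteq> 0"
  proof
    assume "det g = 0"
    then obtain x where x: "x \<in> carrier_vec N" "x \<noteq> 0\<^sub>v N" "g *\<^sub>v x = 0\<^sub>v N"
      using det_0_iff_vec_prod_zero_field[OF g(1)] by auto
    have p: "polar x y = 0" if "y \<in> carrier_vec N" for y
    proof -
      have "polar x y = polar (0\<^sub>v N) (g *\<^sub>v y)" using preserve_polar[OF g x(1) that] x(3) by simp
      then show ?thesis by (simp add: polar_def)
    qed
    have "x $ k = 0" if "k < N" for k
      using that
    proof (cases rule: index_cases)
      case 1 then show ?thesis using polar_unit(2)[OF x(1) 1] p[of "unit_vec N (m + k)"] by simp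
    next
      case (2 k') then show ?thesis using polar_unit(1)[OF x(1) 2(2)] p[of "unit_vec N k'"] by simp
    next
      case (3 c)
      then show ?thesis
        using polar_unit(3,4)[OF x(1)] p[of "unit_vec N (2 * m)"] p[of "unit_vec N (Suc (2 * m))"] less_2_cases[of c] by auto
    qed
    then have "x = 0\<^sub>v N" using x(1) by (intro eq_vecI) auto
    then show False using x(2) by blast
  qed
  then show ?thesis using g(1) by (simp add: GL_iff)
qed

lemma O_minus_iff: "g \<in> O_minus \<kappa> (Suc m) \<longleftrightarrow> g \<in> carrier_mat N N \<and> (\<forall>x\<in>carrier_vec N. \<theta> (g *\<^sub>v x) = \<theta> x)"
proof -
  have e: "2 * Suc m = N" by simp
  show ?thesis unfolding O_minus_def mem_Collect_eq e
  proof (intro iffI conjI; elim conjE)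
    assume g: "g \<in> carrier_mat N N" "\<forall>x\<in>carrier_vec N. \<theta> (g *\<^sub>v x) = \<theta> x"
    show "g \<in> GL N" by (rule preserve_GL[OF g(1) bspec[OF g(2)]])
  qed (simp add: GL_iff)
qed

lemma O_minus_mult:
  assumes "g \<in> O_minus \<kappa> (Suc m)" "h \<in> O_minus \<kappa> (Suc m)"
  shows "g * h \<in> O_minus \<kappa> (Suc m)"
proof -
  have c: "g \<in> carrier_mat N N" "h \<in> carrier_mat N N" using assms O_minus_iff by auto
  have "\<theta> ((g * h) *\<^sub>v x) = \<theta> x" if "x \<in> carrier_vec N" for x
  proof -
    have "(g * h) *\<^sub>v x = g *\<^sub>v (h *\<^sub>v x)" by (rule assoc_mult_mat_vec[OF c that])
    moreover have "h *\<^sub>v x \<in> carrier_vec N" using c that by (intro mult_mat_vec_carrier)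
    ultimately show ?thesis using assms O_minus_iff that by auto
  qed
  then show ?thesis using c O_minus_iff by auto
qed

section \<open>The anisotropic plane\<close>

text \<open>Multiplication by d1 + d2 w in the basis 1, w of the quadratic extension, where w^2 = w
  + \<kappa>. The elements of \<open>SO2\<close> are those of norm 1, and (d1 + d2, d2) is the
  conjugate, hence the inverse.\<close>

definition so2 :: "'a \<Rightarrow> 'a \<Rightarrow> 'a mat" where
  "so2 d1 d2 = mat_of_rows_list 2 [[d1, \<kappa> * d2], [d2, d1 + d2]]"

lemma so2_index [simp]:
  "so2 d1 d2 $$ (0, 0) = d1" "so2 d1 d2 $$ (0, Suc 0) = \<kappa> * d2"
  "so2 d1 d2 $$ (Suc 0, 0) = d2" "so2 d1 d2 $$ (Suc 0, Suc 0) = d1 + d2"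
  by (simp_all add: so2_def mat_of_rows_list_def)

lemma so2_carrier [simp]: "so2 d1 d2 \<in> carrier_mat 2 2" "dim_row (so2 d1 d2) = 2" "dim_col (so2 d1 d2) = 2"
proof -
  show d: "dim_row (so2 d1 d2) = 2" "dim_col (so2 d1 d2) = 2"
    by (simp_all add: so2_def mat_of_rows_list_def)
  show "so2 d1 d2 \<in> carrier_mat 2 2" by (rule carrier_matI[OF d])
qed

definition SO2 :: "('a \<times> 'a) set" where
  "SO2 = {(d1, d2). d1\<^sup>2 + d1 * d2 + \<kappa> * d2\<^sup>2 = 1}"

lemma SO_minus_2_eq: "SO_minus_2 \<kappa> = (\<lambda>(d1, d2). so2 d1 d2) ` SO2"
  by (auto simp: SO_minus_2_def SO2_def so2_def)

lemma sum_2: "(\<Sum>c<2. f c) = f 0 + f (Suc 0)" for f :: "nat \<Rightarrow> 'b::comm_monoid_add"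
  by (simp add: numeral_2_eq_2)

lemma mat2_eqI:
  assumes "A \<in> carrier_mat 2 2" "B \<in> carrier_mat 2 2"
    "A $$ (0, 0) = B $$ (0, 0)" "A $$ (0, Suc 0) = B $$ (0, Suc 0)"
    "A $$ (Suc 0, 0) = B $$ (Suc 0, 0)" "A $$ (Suc 0, Suc 0) = B $$ (Suc 0, Suc 0)"
  shows "A = B"
proof (rule eq_matI)
  fix i j assume "i < dim_row B" "j < dim_col B"
  then have "i < 2" "j < 2" using assms by auto
  then show "A $$ (i, j) = B $$ (i, j)" using assms(3-6) by (auto dest!: less_2_cases)
qed (use assms in auto)

lemma so2_norm_mult:
  "(d1 * w0 + \<kappa> * d2 * w1)\<^sup>2 + (d1 * w0 + \<kappa> * d2 * w1) * (d2 * w0 + (d1 + d2) * w1) + \<kappa> * (d2 * w0 + (d1 + d2) * w1)\<^sup>2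
    = (d1\<^sup>2 + d1 * d2 + \<kappa> * d2\<^sup>2) * (w0\<^sup>2 + w0 * w1 + \<kappa> * w1\<^sup>2)"
  by (simp add: power2_eq_square algebra_simps char2)

lemma so2_polar_mult:
  "(d1 * w0 + \<kappa> * d2 * w1) * (d2 * v0 + (d1 + d2) * v1) + (d2 * w0 + (d1 + d2) * w1) * (d1 * v0 + \<kappa> * d2 * v1)
    = (d1\<^sup>2 + d1 * d2 + \<kappa> * d2\<^sup>2) * (w0 * v1 + w1 * v0)"
  by (simp add: power2_eq_square algebra_simps char2)

lemma so2_mult: "so2 d1 d2 * so2 e1 e2 = so2 (d1 * e1 + \<kappa> * d2 * e2) (d2 * e1 + (d1 + d2) * e2)"
  by (rule mat2_eqI)
     (auto simp: mult_mat_index[of _ 2 2 _ 2] sum_2 algebra_simps char2 simp del: index_mult_mat(1) intro!: mult_carrier_mat[of _ 2 2 _ 2])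

lemma SO2_mult: "(d1, d2) \<in> SO2 \<Longrightarrow> (e1, e2) \<in> SO2 \<Longrightarrow> (d1 * e1 + \<kappa> * d2 * e2, d2 * e1 + (d1 + d2) * e2) \<in> SO2"
  unfolding SO2_def mem_Collect_eq prod.case so2_norm_mult by simp

lemma SO2_inv: "(d1, d2) \<in> SO2 \<Longrightarrow> (d1 + d2, d2) \<in> SO2 \<and> so2 d1 d2 * so2 (d1 + d2) d2 = 1\<^sub>m 2"
proof
  assume a: "(d1, d2) \<in> SO2"
  have "(d1 + d2)\<^sup>2 + (d1 + d2) * d2 + \<kappa> * d2\<^sup>2 = d1\<^sup>2 + d1 * d2 + \<kappa> * d2\<^sup>2"
    by (simp add: power2_eq_square algebra_simps char2)
  then show "(d1 + d2, d2) \<in> SO2" using a by (simp add: SO2_def)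
  have "d1 * (d1 + d2) + \<kappa> * d2 * d2 = 1" using a by (simp add: SO2_def power2_eq_square algebra_simps)
  then show "so2 d1 d2 * so2 (d1 + d2) d2 = 1\<^sub>m 2"
    unfolding so2_mult by (intro mat2_eqI) (auto simp: algebra_simps char2)
qed

lemma so2_inj: "so2 d1 d2 = so2 e1 e2 \<longleftrightarrow> d1 = e1 \<and> d2 = e2"
  by (metis so2_index(1) so2_index(3))

section \<open>The group Q in block coordinates\<close>

definition minv :: "'b::field mat \<Rightarrow> 'b mat" where "minv A = the (mat_inverse A)"

lemma minv:
  assumes "A \<in> GL k"
  shows "minv A \<in> carrier_mat k k" "A * minv A = 1\<^sub>m k" "minv A * A = 1\<^sub>m k"
proof -
  have A: "A \<in> carrier_mat k k" "det A \<noteq> 0" using assms by (auto simp: GL_iff)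
  obtain B where B: "mat_inverse A = Some B"
    using mat_inverse(1)[OF A(1), of "()"] det_non_zero_imp_unit[OF A, of "()"] by (cases "mat_inverse A") auto
  then show "minv A \<in> carrier_mat k k" "A * minv A = 1\<^sub>m k" "minv A * A = 1\<^sub>m k"
    using mat_inverse(2)[OF A(1) B] by (simp_all add: minv_def)
qed

lemma minv_unique: "A \<in> GL k \<Longrightarrow> B \<in> carrier_mat k k \<Longrightarrow> A * B = 1\<^sub>m k \<Longrightarrow> minv A = B"
  by (rule GL_mult_cancel[of A k _ k]) (simp_all add: minv)

lemma minv_index:
  assumes "A \<in> GL k" "i < k" "j < k"
  shows "(\<Sum>l<k. A $$ (i, l) * minv A $$ (l, j)) = (if i = j then 1 else 0)"
    and "(\<Sum>l<k. minv A $$ (i, l) * A $$ (l, j)) = (if i = j then 1 else 0)"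
proof -
  have c: "A \<in> carrier_mat k k" using assms by (simp add: GL_iff)
  show "(\<Sum>l<k. A $$ (i, l) * minv A $$ (l, j)) = (if i = j then 1 else 0)"
    using mult_mat_index[OF c minv(1)[OF assms(1)] assms(2,3)] minv(2)[OF assms(1)] assms by simp
  show "(\<Sum>l<k. minv A $$ (i, l) * A $$ (l, j)) = (if i = j then 1 else 0)"
    using mult_mat_index[OF minv(1)[OF assms(1)] c assms(2,3)] minv(3)[OF assms(1)] assms by simp
qed

text \<open>The nine blocks of an element of \<open>Q\<close>. Since \<open>i\<close> preserves the polar form, the block
  \<open>h\<^sup>T i\<^sup>T \<eta> i\<close> is \<open>h\<^sup>T \<eta>\<close>.\<close>

definition Qel :: "'a mat \<Rightarrow> 'a mat \<Rightarrow> 'a mat \<Rightarrow> 'a mat \<Rightarrow> 'a mat" where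
  "Qel A i B h = mat N N (\<lambda>(k, l).
     if k < m then (if l < m then A $$ (k, l) else if l < 2 * m then (A * B) $$ (k, l - m)
         else (\<Sum>j<m. A $$ (k, j) * h $$ (Suc (2 * m) - l, j)))
     else if k < 2 * m then (if l < m then 0 else if l < 2 * m then minv A $$ (l - m, k - m) else 0)
     else (if l < m then 0 else if l < 2 * m then (i * h) $$ (k - 2 * m, l - m) else i $$ (k - 2 * m, l - 2 * m)))"

lemma Qel_carrier [simp]: "Qel A i B h \<in> carrier_mat N N"
  by (simp add: Qel_def)

lemma Qel_index:
  assumes "k < m" "l < m" "c < 2" "d < 2"
  shows "Qel A i B h $$ (k, l) = A $$ (k, l)"
    "Qel A i B h $$ (k, m + l) = (A * B) $$ (k, l)"
    "Qel A i B h $$ (k, 2 * m + c) = (\<Sum>j<m. A $$ (k, j) * h $$ (1 - c, j))"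
    "Qel A i B h $$ (m + k, l) = 0"
    "Qel A i B h $$ (m + k, m + l) = minv A $$ (l, k)"
    "Qel A i B h $$ (m + k, 2 * m + c) = 0"
    "Qel A i B h $$ (2 * m + c, l) = 0"
    "Qel A i B h $$ (2 * m + c, m + l) = (i * h) $$ (c, l)"
    "Qel A i B h $$ (2 * m + c, 2 * m + d) = i $$ (c, d)"
  using assms by (auto simp: Qel_def)

lemma Qel_corner [simp]: "c < 2 \<Longrightarrow> d < 2 \<Longrightarrow> Qel A i B h $$ (2 * m + c, 2 * m + d) = i $$ (c, d)"
  by (simp add: Qel_def)

lemma mat_eq_blocks:
  assumes "g \<in> carrier_mat N N" "g' \<in> carrier_mat N N"
    and "\<And>k l. k < m \<Longrightarrow> l < m \<Longrightarrow> g $$ (k, l) = g' $$ (k, l) \<and> g $$ (k, m + l) = g' $$ (k, m + l)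
        \<and> g $$ (m + k, l) = g' $$ (m + k, l) \<and> g $$ (m + k, m + l) = g' $$ (m + k, m + l)"
    and "\<And>k c. k < m \<Longrightarrow> c < 2 \<Longrightarrow> g $$ (k, 2 * m + c) = g' $$ (k, 2 * m + c) \<and> g $$ (m + k, 2 * m + c) = g' $$ (m + k, 2 * m + c)
        \<and> g $$ (2 * m + c, k) = g' $$ (2 * m + c, k) \<and> g $$ (2 * m + c, m + k) = g' $$ (2 * m + c, m + k)"
    and "\<And>c d. c < 2 \<Longrightarrow> d < 2 \<Longrightarrow> g $$ (2 * m + c, 2 * m + d) = g' $$ (2 * m + c, 2 * m + d)"
  shows "g = g'"
proof (rule eq_matI)
  fix k l assume "k < dim_row g'" "l < dim_col g'"
  then have k: "k < N" and l: "l < N" using assms by auto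
  from k show "g $$ (k, l) = g' $$ (k, l)"
  proof (cases rule: index_cases)
    case 1
    from l show ?thesis by (cases rule: index_cases) (use 1 assms(3-5) in auto)
  next
    case (2 k')
    from l show ?thesis by (cases rule: index_cases) (use 2 assms(3-5) in auto)
  next
    case (3 c)
    from l show ?thesis by (cases rule: index_cases) (use 3 assms(3-5) in auto)
  qed
qed (use assms in auto)

lemma block33_index:
  fixes M11 :: "'a mat"
  assumes c: "M11 \<in> carrier_mat m m" "M12 \<in> carrier_mat m m" "M13 \<in> carrier_mat m 2"
    "M21 \<in> carrier_mat m m" "M22 \<in> carrier_mat m m" "M23 \<in> carrier_mat m 2"
    "M31 \<in> carrier_mat 2 m" "M32 \<in> carrier_mat 2 m" "M33 \<in> carrier_mat 2 2"
  defines "g \<equiv> block33 M11 M12 M13 M21 M22 M23 M31 M32 M33"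
  shows "g \<in> carrier_mat N N"
    and "k < m \<Longrightarrow> l < m \<Longrightarrow> g $$ (k, l) = M11 $$ (k, l)"
    and "k < m \<Longrightarrow> l < m \<Longrightarrow> g $$ (k, m + l) = M12 $$ (k, l)"
    and "k < m \<Longrightarrow> l < 2 \<Longrightarrow> g $$ (k, 2 * m + l) = M13 $$ (k, l)"
    and "k < m \<Longrightarrow> l < m \<Longrightarrow> g $$ (m + k, l) = M21 $$ (k, l)"
    and "k < m \<Longrightarrow> l < m \<Longrightarrow> g $$ (m + k, m + l) = M22 $$ (k, l)"
    and "k < m \<Longrightarrow> l < 2 \<Longrightarrow> g $$ (m + k, 2 * m + l) = M23 $$ (k, l)"
    and "k < 2 \<Longrightarrow> l < m \<Longrightarrow> g $$ (2 * m + k, l) = M31 $$ (k, l)"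
    and "k < 2 \<Longrightarrow> l < m \<Longrightarrow> g $$ (2 * m + k, m + l) = M32 $$ (k, l)"
    and "k < 2 \<Longrightarrow> l < 2 \<Longrightarrow> g $$ (2 * m + k, 2 * m + l) = M33 $$ (k, l)"
proof -
  have d: "dim_row M11 = m" "dim_col M11 = m" "dim_row M12 = m" "dim_col M12 = m" "dim_row M13 = m" "dim_col M13 = 2"
    "dim_row M21 = m" "dim_col M21 = m" "dim_row M22 = m" "dim_col M22 = m" "dim_row M23 = m" "dim_col M23 = 2"
    "dim_row M31 = 2" "dim_col M31 = m" "dim_row M32 = 2" "dim_col M32 = m" "dim_row M33 = 2" "dim_col M33 = 2"
    using c by auto
  show "g \<in> carrier_mat N N" unfolding g_def block33_def by (rule carrier_matI) (simp_all add: d)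
  have ix: "g $$ (k, l) = (if k < m then (if l < m then M11 $$ (k, l) else if l < m + m then M12 $$ (k, l - m) else M13 $$ (k, l - (m + m)))
     else if k < m + m then (if l < m then M21 $$ (k - m, l) else if l < m + m then M22 $$ (k - m, l - m) else M23 $$ (k - m, l - (m + m)))
     else (if l < m then M31 $$ (k - (m + m), l) else if l < m + m then M32 $$ (k - (m + m), l - m) else M33 $$ (k - (m + m), l - (m + m))))"
    if "k < m + m + 2" "l < m + m + 2" for k l
    using that unfolding g_def block33_def append_rows_def by (simp add: d) auto
  have t: "2 * m = m + m" by simp
  show "k < m \<Longrightarrow> l < m \<Longrightarrow> g $$ (k, l) = M11 $$ (k, l)"
    "k < m \<Longrightarrow> l < m \<Longrightarrow> g $$ (k, m + l) = M12 $$ (k, l)"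
    "k < m \<Longrightarrow> l < m \<Longrightarrow> g $$ (m + k, l) = M21 $$ (k, l)"
    "k < m \<Longrightarrow> l < m \<Longrightarrow> g $$ (m + k, m + l) = M22 $$ (k, l)"
    by (simp_all add: ix)
  show "k < m \<Longrightarrow> l < 2 \<Longrightarrow> g $$ (k, 2 * m + l) = M13 $$ (k, l)"
    "k < m \<Longrightarrow> l < 2 \<Longrightarrow> g $$ (m + k, 2 * m + l) = M23 $$ (k, l)"
    "k < 2 \<Longrightarrow> l < m \<Longrightarrow> g $$ (2 * m + k, l) = M31 $$ (k, l)"
    "k < 2 \<Longrightarrow> l < m \<Longrightarrow> g $$ (2 * m + k, m + l) = M32 $$ (k, l)"
    "k < 2 \<Longrightarrow> l < 2 \<Longrightarrow> g $$ (2 * m + k, 2 * m + l) = M33 $$ (k, l)"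
    unfolding t by (simp_all add: ix)
qed

lemma eta_carrier: "(eta_mat :: 'a mat) \<in> carrier_mat 2 2"
  by (rule carrier_matI) (simp_all add: eta_mat_def mat_of_rows_list_def)

lemma eta_index: "eta_mat $$ (0, 0) = (0::'a)" "eta_mat $$ (0, Suc 0) = (1::'a)"
    "eta_mat $$ (Suc 0, 0) = (1::'a)" "eta_mat $$ (Suc 0, Suc 0) = (0::'a)"
  by (simp_all add: eta_mat_def mat_of_rows_list_def)

lemma delta_carrier: "delta_mat \<kappa> \<in> carrier_mat 2 2"
  by (rule carrier_matI) (simp_all add: delta_mat_def mat_of_rows_list_def)

lemma delta_index: "delta_mat \<kappa> $$ (0, 0) = 1" "delta_mat \<kappa> $$ (0, Suc 0) = 1"
    "delta_mat \<kappa> $$ (Suc 0, 0) = 0" "delta_mat \<kappa> $$ (Suc 0, Suc 0) = \<kappa>"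
  by (simp_all add: delta_mat_def mat_of_rows_list_def)

lemma so2_eta:
  assumes "(d1, d2) \<in> SO2" "h \<in> carrier_mat 2 m" "j < m" "c < 2"
  defines "i \<equiv> so2 d1 d2"
  shows "(transpose_mat h * transpose_mat i * eta_mat * i) $$ (j, c) = h $$ (1 - c, j)"
proof -
  note e = eta_carrier eta_index
  have ic: "i \<in> carrier_mat 2 2" "transpose_mat i \<in> carrier_mat 2 2" by (simp_all add: i_def)
  have hc: "transpose_mat h \<in> carrier_mat m 2" using assms by simp
  have N: "d1 * d1 + d1 * d2 + \<kappa> * (d2 * d2) = 1" using assms(1) by (simp add: SO2_def power2_eq_square)
  have "transpose_mat i * eta_mat * i = eta_mat"
  proof (rule mat2_eqI)
    have te: "transpose_mat i * eta_mat \<in> carrier_mat 2 2" by (rule mult_carrier_mat[OF ic(2) e(1)])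
    show "transpose_mat i * eta_mat * i \<in> carrier_mat 2 2" by (rule mult_carrier_mat[OF te ic(1)])
    note ix = mult_mat_index[OF te ic(1)] mult_mat_index[OF ic(2) e(1)]
    have t: "transpose_mat i $$ (0, 0) = d1" "transpose_mat i $$ (0, Suc 0) = d2"
      "transpose_mat i $$ (Suc 0, 0) = \<kappa> * d2" "transpose_mat i $$ (Suc 0, Suc 0) = d1 + d2"
      by (simp_all add: i_def)
    show "(transpose_mat i * eta_mat * i) $$ (0, 0) = eta_mat $$ (0, 0)"
      by (simp add: ix sum_2 t e del: index_mult_mat(1)) (simp add: i_def algebra_simps char2)
    show "(transpose_mat i * eta_mat * i) $$ (0, Suc 0) = eta_mat $$ (0, Suc 0)"
      using N by (simp add: ix sum_2 t e del: index_mult_mat(1)) (simp add: i_def algebra_simps char2)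
    show "(transpose_mat i * eta_mat * i) $$ (Suc 0, 0) = eta_mat $$ (Suc 0, 0)"
      using N by (simp add: ix sum_2 t e del: index_mult_mat(1)) (simp add: i_def algebra_simps char2)
    show "(transpose_mat i * eta_mat * i) $$ (Suc 0, Suc 0) = eta_mat $$ (Suc 0, Suc 0)"
      by (simp add: ix sum_2 t e del: index_mult_mat(1)) (simp add: i_def algebra_simps char2)
  qed (rule e)
  moreover have "transpose_mat h * transpose_mat i * eta_mat * i = transpose_mat h * (transpose_mat i * eta_mat * i)"
    using hc ic e by (simp add: assoc_mult_mat[of _ m 2 _ 2 _ 2] assoc_mult_mat[of _ 2 2 _ 2 _ 2])
  ultimately have "transpose_mat h * transpose_mat i * eta_mat * i = transpose_mat h * eta_mat" by simp
  then show ?thesis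
    using assms(2-4) e less_2_cases[OF assms(4)] by (auto simp: mult_mat_index[OF hc e(1)] sum_2 simp del: index_mult_mat(1))
qed

definition dmat :: "'a mat \<Rightarrow> 'a mat" where
  "dmat h = mat m m (\<lambda>(k, l). h $$ (0, k) * h $$ (0, l) + h $$ (0, k) * h $$ (Suc 0, l) + \<kappa> * (h $$ (Suc 0, k) * h $$ (Suc 0, l)))"

lemma dmat_carrier [simp]: "dmat h \<in> carrier_mat m m" by (simp add: dmat_def)

lemma dmat_eq:
  assumes "h \<in> carrier_mat 2 m"
  shows "transpose_mat h * delta_mat \<kappa> * h = dmat h"
proof (rule eq_matI)
  note d = delta_carrier delta_index
  have hc: "transpose_mat h \<in> carrier_mat m 2" using assms by simp
  have hd: "transpose_mat h * delta_mat \<kappa> \<in> carrier_mat m 2" by (rule mult_carrier_mat[OF hc d(1)])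
  fix k l assume "k < dim_row (dmat h)" "l < dim_col (dmat h)"
  then have kl: "k < m" "l < m" by (simp_all add: dmat_def)
  show "(transpose_mat h * delta_mat \<kappa> * h) $$ (k, l) = dmat h $$ (k, l)"
    unfolding mult_mat_index[OF hd assms kl] sum_2 using kl assms d
    by (simp add: mult_mat_index[OF hc d(1)] sum_2 dmat_def algebra_simps del: index_mult_mat(1))
qed (use assms in \<open>auto simp: dmat_def\<close>)

definition Qpar :: "'a mat \<Rightarrow> 'a mat \<Rightarrow> 'a mat \<Rightarrow> 'a mat \<Rightarrow> bool" where
  "Qpar A i B h \<longleftrightarrow> A \<in> GL m \<and> i \<in> SO_minus_2 \<kappa> \<and> B \<in> carrier_mat m m \<and> h \<in> carrier_mat 2 m
     \<and> alternating_mat (transpose_mat B + dmat h)"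

lemma product_eq_Qel:
  assumes "Qpar A i B h"
  shows "block33 A (0\<^sub>m m m) (0\<^sub>m m 2) (0\<^sub>m m m) (transpose_mat (minv A)) (0\<^sub>m m 2) (0\<^sub>m 2 m) (0\<^sub>m 2 m) i
     * block33 (1\<^sub>m m) B (transpose_mat h * transpose_mat i * eta_mat * i) (0\<^sub>m m m) (1\<^sub>m m) (0\<^sub>m m 2) (0\<^sub>m 2 m) h (1\<^sub>m 2)
     = Qel A i B h" (is "?D * ?U = _")
proof -
  obtain d1 d2 where d: "(d1, d2) \<in> SO2" "i = so2 d1 d2" using assms by (auto simp: Qpar_def SO_minus_2_eq)
  have c: "A \<in> GL m" "A \<in> carrier_mat m m" "i \<in> carrier_mat 2 2" "B \<in> carrier_mat m m" "h \<in> carrier_mat 2 m"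
    using assms d by (auto simp: Qpar_def GL_iff)
  have mt: "transpose_mat (minv A) \<in> carrier_mat m m" using minv(1)[OF c(1)] by simp
  have X: "transpose_mat h * transpose_mat i * eta_mat * i \<in> carrier_mat m 2"
    using c by (auto simp: eta_mat_def mat_of_rows_list_def)
  note D = block33_index[OF c(2) zero_carrier_mat zero_carrier_mat zero_carrier_mat mt zero_carrier_mat zero_carrier_mat zero_carrier_mat c(3)]
  note U = block33_index[OF one_carrier_mat c(4) X zero_carrier_mat one_carrier_mat zero_carrier_mat zero_carrier_mat c(5) one_carrier_mat]
  have D1: "?D $$ (k, 2 * m) = 0" "?D $$ (k, Suc (2 * m)) = 0" "?D $$ (m + k, 2 * m) = 0" "?D $$ (m + k, Suc (2 * m)) = 0" if "k < m" for k
    using D(4)[OF that, of 0] D(4)[OF that, of 1] D(7)[OF that, of 0] D(7)[OF that, of 1] that by simp_all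
  have U1: "?U $$ (2 * m + c, k) = 0" "?U $$ (2 * m + c, m + k) = h $$ (c, k)" if "c < 2" "k < m" for k c
    using U(8,9)[OF that] that by simp_all
  have P: "(?D * ?U) $$ (k, l) = (\<Sum>j<m. ?D $$ (k, j) * ?U $$ (j, l)) + (\<Sum>j<m. ?D $$ (k, m + j) * ?U $$ (m + j, l))
     + (?D $$ (k, 2 * m) * ?U $$ (2 * m, l) + ?D $$ (k, Suc (2 * m)) * ?U $$ (Suc (2 * m), l))" if "k < N" "l < N" for k l
    using mult_mat_index[OF D(1) U(1) that] by (simp only: sum_split3)
  have P1: "(?D * ?U) $$ (k, l) = (\<Sum>j<m. A $$ (k, j) * ?U $$ (j, l))" if "k < m" "l < N" for k l
    using P[of k l] that by (simp add: D D1 del: index_mult_mat(1))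
  have P2: "(?D * ?U) $$ (m + k, l) = (\<Sum>j<m. minv A $$ (j, k) * ?U $$ (m + j, l))" if "k < m" "l < N" for k l
    using P[of "m + k" l] that mt minv(1)[OF c(1)] by (simp add: D D1 del: index_mult_mat(1))
  have P3: "(?D * ?U) $$ (2 * m + k, l) = i $$ (k, 0) * ?U $$ (2 * m, l) + i $$ (k, Suc 0) * ?U $$ (Suc (2 * m), l)" if "k < 2" "l < N" for k l
    using P[of "2 * m + k" l] that D(10)[of k 0] D(10)[of k 1] by (simp add: D del: index_mult_mat(1))
  have dl: "(\<Sum>j<m. f j * (1\<^sub>m m $$ (j, l))) = f l" if "l < m" for f :: "nat \<Rightarrow> 'a" and l
  proof -
    have "(\<Sum>j<m. f j * (1\<^sub>m m $$ (j, l))) = (\<Sum>j<m. if j = l then f l else 0)"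
      using that by (intro sum.cong) auto
    then show ?thesis using that by simp
  qed
  have dl': "(\<Sum>j<m. f j * (if j = l then 1 else 0)) = f l" if "l < m" for f :: "nat \<Rightarrow> 'a" and l
    using that by (simp add: if_distrib sum.delta cong: if_cong)
  show ?thesis
  proof (rule mat_eq_blocks)
    show "?D * ?U \<in> carrier_mat N N" by (rule mult_carrier_mat[OF D(1) U(1)])
    fix k l assume kl: "k < m" "l < m"
    show "(?D * ?U) $$ (k, l) = Qel A i B h $$ (k, l) \<and> (?D * ?U) $$ (k, m + l) = Qel A i B h $$ (k, m + l)
        \<and> (?D * ?U) $$ (m + k, l) = Qel A i B h $$ (m + k, l) \<and> (?D * ?U) $$ (m + k, m + l) = Qel A i B h $$ (m + k, m + l)"
      using kl by (simp add: P1 P2 U Qel_index[OF kl, of 0 0] dl dl' mult_mat_index[OF c(2,4)] del: index_mult_mat(1))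
  next
    fix k c' assume kc: "k < m" "c' < (2::nat)"
    have "(?D * ?U) $$ (2 * m + c', m + k) = (i * h) $$ (c', k)"
      using kc P3[of c' "m + k"] U1(2)[of 0 k] U1(2)[of 1 k] by (simp add: mult_mat_index[OF c(3,5)] sum_2 del: index_mult_mat(1))
    moreover have "(?D * ?U) $$ (2 * m + c', k) = 0"
      using kc P3[of c' k] U1(1)[of 0 k] U1(1)[of 1 k] by (simp del: index_mult_mat(1))
    moreover have "(?D * ?U) $$ (k, 2 * m + c') = (\<Sum>j<m. A $$ (k, j) * h $$ (1 - c', j))"
      using kc by (simp add: P1 U so2_eta[OF d(1) c(5), folded d(2)] del: index_mult_mat(1))
    moreover have "(?D * ?U) $$ (m + k, 2 * m + c') = 0" using kc by (simp add: P2 U del: index_mult_mat(1))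
    ultimately show "(?D * ?U) $$ (k, 2 * m + c') = Qel A i B h $$ (k, 2 * m + c') \<and> (?D * ?U) $$ (m + k, 2 * m + c') = Qel A i B h $$ (m + k, 2 * m + c')
        \<and> (?D * ?U) $$ (2 * m + c', k) = Qel A i B h $$ (2 * m + c', k) \<and> (?D * ?U) $$ (2 * m + c', m + k) = Qel A i B h $$ (2 * m + c', m + k)"
      using kc Qel_index[OF kc(1) kc(1) kc(2) kc(2)] by (simp del: index_mult_mat(1))
  next
    fix c' d' assume cd: "c' < (2::nat)" "d' < (2::nat)"
    have "(?D * ?U) $$ (2 * m + c', 2 * m + d') = i $$ (c', 0) * (if d' = 0 then 1 else 0) + i $$ (c', Suc 0) * (if d' = 1 then 1 else 0)"
      using cd P3[of c' "2 * m + d'"] U(10)[of 0 d'] U(10)[of 1 d'] by (simp del: index_mult_mat(1))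
    then show "(?D * ?U) $$ (2 * m + c', 2 * m + d') = Qel A i B h $$ (2 * m + c', 2 * m + d')"
      using cd less_2_cases[of d'] by auto
  qed simp
qed

text \<open>On the hyperbolic part A meets its inverse transpose and cancels. What remains of B is a
  quadratic form in the middle coordinates: its alternating part vanishes, and \<open>dmat h\<close>
  contributes the norm form of the plane evaluated at p. The plane itself contributes the norm of p
  plus the old coordinates, since i preserves norms; the two norms of p cancel and the cross terms
  cancel against those from the columns of h.\<close>

lemma Qel_theta:
  assumes "Qpar A i B h" "x \<in> carrier_vec N"
  shows "\<theta> (Qel A i B h *\<^sub>v x) = \<theta> x"
proof -
  obtain d1 d2 where d: "(d1, d2) \<in> SO2" "i = so2 d1 d2" using assms by (auto simp: Qpar_def SO_minus_2_eq)
  have c: "A \<in> GL m" "A \<in> carrier_mat m m" "i \<in> carrier_mat 2 2" "B \<in> carrier_mat m m" "h \<in> carrier_mat 2 m"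
    using assms d by (auto simp: Qpar_def GL_iff)
  let ?g = "Qel A i B h"
  \<comment> \<open>p is the image of the middle coordinates under h, w the plane coordinates before
    i acts, and z the first coordinates before A acts.\<close>
  define p where "p c = (\<Sum>l<m. h $$ (c, l) * x $ (m + l))" for c
  define w where "w c = p c + x $ (2 * m + c)" for c
  define z where "z j = x $ j + (\<Sum>l<m. B $$ (j, l) * x $ (m + l)) + (h $$ (Suc 0, j) * x $ (2 * m) + h $$ (0, j) * x $ (Suc (2 * m)))" for j
  have y: "(?g *\<^sub>v x) $ k = (\<Sum>j<m. ?g $$ (k, j) * x $ j) + (\<Sum>j<m. ?g $$ (k, m + j) * x $ (m + j))
     + (?g $$ (k, 2 * m) * x $ (2 * m) + ?g $$ (k, Suc (2 * m)) * x $ (Suc (2 * m)))" if "k < N" for k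
    using mult_mat_vec_index[OF Qel_carrier assms(2) that] by (simp only: sum_split3)
  have y1: "(?g *\<^sub>v x) $ k = (\<Sum>j<m. A $$ (k, j) * z j)" if k: "k < m" for k
  proof -
    have e: "?g $$ (k, 2 * m) = (\<Sum>j<m. A $$ (k, j) * h $$ (Suc 0, j))" "?g $$ (k, Suc (2 * m)) = (\<Sum>j<m. A $$ (k, j) * h $$ (0, j))"
      using Qel_index(3)[OF k k, of 0 0] Qel_index(3)[OF k k, of 1 0] by simp_all
    have "(\<Sum>l<m. (A * B) $$ (k, l) * x $ (m + l)) = (\<Sum>l<m. \<Sum>j<m. A $$ (k, j) * (B $$ (j, l) * x $ (m + l)))"
      using k by (simp add: mult_mat_index[OF c(2,4)] sum_distrib_right mult.assoc del: index_mult_mat(1))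
    also have "\<dots> = (\<Sum>j<m. A $$ (k, j) * (\<Sum>l<m. B $$ (j, l) * x $ (m + l)))"
      by (subst sum.swap) (simp add: sum_distrib_left)
    finally have ab: "(\<Sum>l<m. (A * B) $$ (k, l) * x $ (m + l)) = (\<Sum>j<m. A $$ (k, j) * (\<Sum>l<m. B $$ (j, l) * x $ (m + l)))" .
    have "(?g *\<^sub>v x) $ k = (\<Sum>j<m. A $$ (k, j) * x $ j) + (\<Sum>l<m. (A * B) $$ (k, l) * x $ (m + l))
       + ((\<Sum>j<m. A $$ (k, j) * h $$ (Suc 0, j)) * x $ (2 * m) + (\<Sum>j<m. A $$ (k, j) * h $$ (0, j)) * x $ (Suc (2 * m)))"
      using y[of k] k by (simp only: e) (simp add: Qel_index[OF k _, of _ 0 0])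
    also have "\<dots> = (\<Sum>j<m. A $$ (k, j) * z j)"
      unfolding ab z_def distrib_left sum.distrib by (simp add: sum_distrib_right mult.assoc)
    finally show ?thesis .
  qed
  have y2: "(?g *\<^sub>v x) $ (m + k) = (\<Sum>l<m. minv A $$ (l, k) * x $ (m + l))" if k: "k < m" for k
  proof -
    have "?g $$ (m + k, 2 * m) = 0" "?g $$ (m + k, Suc (2 * m)) = 0"
      using Qel_index(6)[OF k k, of 0 0] Qel_index(6)[OF k k, of 1 0] by simp_all
    then show ?thesis using y[of "m + k"] k by (simp only: ) (simp add: Qel_index[OF k _, of _ 0 0])
  qed
  have y3: "(?g *\<^sub>v x) $ (2 * m + k) = i $$ (k, 0) * w 0 + i $$ (k, Suc 0) * w (Suc 0)" if k: "k < 2" for k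
  proof -
    have e: "?g $$ (2 * m + k, 2 * m) = i $$ (k, 0)" "?g $$ (2 * m + k, Suc (2 * m)) = i $$ (k, Suc 0)"
      using Qel_corner[OF k, of 0] Qel_corner[OF k, of 1] by simp_all
    have e': "?g $$ (2 * m + k, j) = 0" "?g $$ (2 * m + k, m + j) = i $$ (k, 0) * h $$ (0, j) + i $$ (k, Suc 0) * h $$ (Suc 0, j)" if "j < m" for j
      using Qel_index(7,8)[OF that that k k] k that by (simp_all add: mult_mat_index[OF c(3,5)] sum_2)
    have "(?g *\<^sub>v x) $ (2 * m + k) = (\<Sum>j<m. (i $$ (k, 0) * h $$ (0, j) + i $$ (k, Suc 0) * h $$ (Suc 0, j)) * x $ (m + j))
       + (i $$ (k, 0) * x $ (2 * m) + i $$ (k, Suc 0) * x $ (Suc (2 * m)))"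
      using y[of "2 * m + k"] k by (simp only: e) (simp add: e')
    also have "\<dots> = i $$ (k, 0) * w 0 + i $$ (k, Suc 0) * w (Suc 0)"
      unfolding w_def p_def by (simp add: sum_distrib_left sum.distrib algebra_simps)
    finally show ?thesis .
  qed
  have "(\<Sum>k<m. (?g *\<^sub>v x) $ k * (?g *\<^sub>v x) $ (m + k)) = (\<Sum>k<m. \<Sum>j<m. \<Sum>l<m. A $$ (k, j) * z j * (minv A $$ (l, k) * x $ (m + l)))"
    by (intro sum.cong refl) (simp add: y1 y2 sum_product)
  also have "\<dots> = (\<Sum>j<m. \<Sum>l<m. z j * x $ (m + l) * (\<Sum>k<m. minv A $$ (l, k) * A $$ (k, j)))"
    unfolding sum_distrib_left by (subst sum.swap, rule sum.cong[OF refl], subst sum.swap) (simp add: mult_ac)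
  also have "\<dots> = (\<Sum>j<m. \<Sum>l<m. if l = j then z j * x $ (m + j) else 0)"
    by (intro sum.cong refl) (simp add: minv_index(2)[OF c(1)])
  also have "\<dots> = (\<Sum>j<m. z j * x $ (m + j))" by (intro sum.cong) auto
  also have "\<dots> = (\<Sum>j<m. x $ j * x $ (m + j)) + (\<Sum>j<m. \<Sum>l<m. B $$ (j, l) * x $ (m + l) * x $ (m + j))
      + (p 1 * x $ (2 * m) + p 0 * x $ (Suc (2 * m)))"
    unfolding z_def p_def distrib_right sum.distrib sum_distrib_right by (simp add: mult_ac)
  also have "(\<Sum>j<m. \<Sum>l<m. B $$ (j, l) * x $ (m + l) * x $ (m + j)) = (p 0)\<^sup>2 + p 0 * p 1 + \<kappa> * (p 1)\<^sup>2"
  proof -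
    define T where "T = transpose_mat B + dmat h"
    have Tc: "T \<in> carrier_mat m m" using c by (simp add: T_def)
    have alt: "T $$ (i, j) = T $$ (j, i)" "T $$ (i, i) = 0" if "i < m" "j < m" for i j
      using assms(1) alternating_mat_iff[OF Tc] that by (auto simp: Qpar_def T_def)
    have B: "B $$ (l, j) = T $$ (j, l) + dmat h $$ (j, l)" if "j < m" "l < m" for j l
      using that c by (simp add: T_def dmat_def char2 add_ac)
    have t0: "(\<Sum>(j, l)\<in>{..<m} \<times> {..<m}. T $$ (j, l) * x $ (m + l) * x $ (m + j)) = 0"
      by (rule sum_involution[where \<iota> = "\<lambda>(j, l). (l, j)"]) (auto simp: alt mult_ac)
    have "(\<Sum>j<m. \<Sum>l<m. B $$ (j, l) * x $ (m + l) * x $ (m + j)) = (\<Sum>l<m. \<Sum>j<m. B $$ (j, l) * x $ (m + l) * x $ (m + j))"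
      by (rule sum.swap)
    also have "\<dots> = (\<Sum>l<m. \<Sum>j<m. T $$ (l, j) * x $ (m + j) * x $ (m + l)) + (\<Sum>l<m. \<Sum>j<m. dmat h $$ (l, j) * x $ (m + j) * x $ (m + l))"
      unfolding sum.distrib[symmetric] by (intro sum.cong refl) (simp add: B algebra_simps)
    also have "(\<Sum>l<m. \<Sum>j<m. T $$ (l, j) * x $ (m + j) * x $ (m + l)) = 0"
      using t0 by (simp add: sum.cartesian_product)
    also have "(\<Sum>l<m. \<Sum>j<m. dmat h $$ (l, j) * x $ (m + j) * x $ (m + l)) = (p 0)\<^sup>2 + p 0 * p 1 + \<kappa> * (p 1)\<^sup>2"
    proof -
      have pp: "p a * p b = (\<Sum>l<m. \<Sum>j<m. (h $$ (a, l) * x $ (m + l)) * (h $$ (b, j) * x $ (m + j)))" for a b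
        unfolding p_def by (rule sum_product)
      show ?thesis unfolding power2_eq_square pp sum_distrib_left sum.distrib[symmetric]
        by (intro sum.cong refl) (simp add: dmat_def algebra_simps)
    qed
    finally show ?thesis by simp
  qed
  finally have s12: "(\<Sum>k<m. (?g *\<^sub>v x) $ k * (?g *\<^sub>v x) $ (m + k)) = (\<Sum>j<m. x $ j * x $ (m + j)) + ((p 0)\<^sup>2 + p 0 * p 1 + \<kappa> * (p 1)\<^sup>2)
      + (p 1 * x $ (2 * m) + p 0 * x $ (Suc (2 * m)))" .
  have "((?g *\<^sub>v x) $ (2 * m))\<^sup>2 + (?g *\<^sub>v x) $ (2 * m) * (?g *\<^sub>v x) $ (Suc (2 * m)) + \<kappa> * ((?g *\<^sub>v x) $ (Suc (2 * m)))\<^sup>2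
     = (w 0)\<^sup>2 + w 0 * w 1 + \<kappa> * (w 1)\<^sup>2"
    using y3[of 0] y3[of 1] so2_norm_mult[of d1 "w 0" d2 "w 1"] d by (simp add: SO2_def)
  then have "\<theta> (?g *\<^sub>v x) = (\<Sum>k<m. (?g *\<^sub>v x) $ k * (?g *\<^sub>v x) $ (m + k)) + ((w 0)\<^sup>2 + w 0 * w 1 + \<kappa> * (w 1)\<^sup>2)"
    unfolding theta_eq by (simp add: add.assoc)
  also have "\<dots> = \<theta> x"
    unfolding s12 theta_eq w_def by (simp add: power2_eq_square algebra_simps char2)
  finally show ?thesis .
qed

lemma Qel_in_Q: "Qpar A i B h \<Longrightarrow> Qel A i B h \<in> Q"
proof -
  assume p: "Qpar A i B h"
  have O: "Qel A i B h \<in> O_minus \<kappa> (Suc m)" using Qel_theta[OF p] by (simp add: O_minus_iff)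
  have c: "A \<in> GL m" "i \<in> SO_minus_2 \<kappa>" "B \<in> carrier_mat m m" "h \<in> carrier_mat 2 m"
    using p by (simp_all add: Qpar_def)
  have al: "alternating_mat (transpose_mat B + transpose_mat h * delta_mat \<kappa> * h)"
    using p dmat_eq[OF c(4)] by (simp add: Qpar_def)
  show ?thesis
    unfolding Q_minus_def mem_Collect_eq diff_Suc_1
    by (rule conjI[OF O], rule exI[of _ A], rule exI[of _ i], rule exI[of _ B], rule exI[of _ h])
       (intro conjI c al product_eq_Qel[OF p, unfolded minv_def, symmetric])
qed

lemma Q_imp_Qel:
  assumes "g \<in> Q"
  obtains A i B h where "Qpar A i B h" "g = Qel A i B h"
proof -
  from assms[unfolded Q_minus_def diff_Suc_1 mem_Collect_eq, THEN conjunct2] obtain A i B h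
    where *: "A \<in> GL m \<and> i \<in> SO_minus_2 \<kappa> \<and> B \<in> carrier_mat m m \<and> h \<in> carrier_mat 2 m \<and>
      alternating_mat (transpose_mat B + transpose_mat h * delta_mat \<kappa> * h) \<and>
      g = block33 A (0\<^sub>m m m) (0\<^sub>m m 2) (0\<^sub>m m m) (transpose_mat (the (mat_inverse A))) (0\<^sub>m m 2) (0\<^sub>m 2 m) (0\<^sub>m 2 m) i
     * block33 (1\<^sub>m m) B (transpose_mat h * transpose_mat i * eta_mat * i) (0\<^sub>m m m) (1\<^sub>m m) (0\<^sub>m m 2) (0\<^sub>m 2 m) h (1\<^sub>m 2)"
    by (elim exE)
  then have p: "Qpar A i B h" using dmat_eq[of h] by (simp add: Qpar_def)
  show ?thesis
    by (rule that[OF p], rule trans[OF _ product_eq_Qel[OF p, unfolded minv_def]])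
       (use * in blast)
qed

lemma Q_subset_O: "Q \<subseteq> O_minus \<kappa> (Suc m)"
  by (auto simp: Q_minus_def)

lemma Q_carrier: "g \<in> Q \<Longrightarrow> g \<in> carrier_mat N N"
  using Q_subset_O O_minus_iff by blast

section \<open>Membership in Q and closure under products\<close>

definition corner :: "'a mat \<Rightarrow> 'a mat" where
  "corner g = mat 2 2 (\<lambda>(c, d). g $$ (2 * m + c, 2 * m + d))"

lemma corner_Qel: "i \<in> carrier_mat 2 2 \<Longrightarrow> corner (Qel A i B h) = i"
  by (rule eq_matI) (auto simp: corner_def)

text \<open>An isometry that stabilizes the span of the first m unit vectors already has all its
  blocks of the required form: the parameters A, B, h are recovered from the values of \<theta> and
  of its polar form on the columns. Only the corner needs a separate condition, which excludes the
  improper isometries of the plane. Closure of Q under products, conjugation by \<rho> and the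
  description of the stabilizer are all obtained through this criterion.\<close>

lemma O_in_Q:
  assumes g: "g \<in> O_minus \<kappa> (Suc m)" and z: "\<And>k l. m \<le> k \<Longrightarrow> k < N \<Longrightarrow> l < m \<Longrightarrow> g $$ (k, l) = 0"
    and i: "corner g \<in> SO_minus_2 \<kappa>"
  shows "g \<in> Q"
proof -
  note gO = g[unfolded O_minus_iff]
  have gc: "g \<in> carrier_mat N N" using gO by (rule conjunct1)
  have th: "\<theta> (g *\<^sub>v x) = \<theta> x" if "x \<in> carrier_vec N" for x using conjunct2[OF gO] that by (rule bspec)
  obtain d1 d2 where d: "(d1, d2) \<in> SO2" "corner g = so2 d1 d2" using i by (auto simp: SO_minus_2_eq)
  have nrm: "d1\<^sup>2 + d1 * d2 + \<kappa> * d2\<^sup>2 = 1" using d by (simp add: SO2_def)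
  let ?i = "so2 d1 d2"
  have ig: "g $$ (2 * m + c, 2 * m + c') = ?i $$ (c, c')" if "c < 2" "c' < 2" for c c'
    using arg_cong[OF d(2), of "\<lambda>M. M $$ (c, c')"] that by (simp add: corner_def)
  have z': "g $$ (m + j, l) = 0" "g $$ (2 * m, l) = 0" "g $$ (Suc (2 * m), l) = 0" if "j < m" "l < m" for j l
    using z[of "m + j" l] z[of "2 * m" l] z[of "Suc (2 * m)" l] that by auto
  have pol: "(\<Sum>j<m. g $$ (j, k) * g $$ (m + j, l) + g $$ (m + j, k) * g $$ (j, l))
      + (g $$ (2 * m, k) * g $$ (Suc (2 * m), l) + g $$ (Suc (2 * m), k) * g $$ (2 * m, l)) = polar (unit_vec N k) (unit_vec N l)"
    if kl: "k < N" "l < N" for k l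
  proof -
    have "polar (unit_vec N k) (unit_vec N l) = polar (g *\<^sub>v unit_vec N k) (g *\<^sub>v unit_vec N l)"
      by (rule preserve_polar[OF gc th, symmetric]) auto
    also have "\<dots> = (\<Sum>j<m. g $$ (j, k) * g $$ (m + j, l) + g $$ (m + j, k) * g $$ (j, l))
      + (g $$ (2 * m, k) * g $$ (Suc (2 * m), l) + g $$ (Suc (2 * m), k) * g $$ (2 * m, l))"
      unfolding polar_def using kl by (simp add: col_index[OF gc])
    finally show ?thesis ..
  qed
  define A where "A = mat m m (\<lambda>(k, l). g $$ (k, l))"
  define D where "D = mat m m (\<lambda>(k, l). g $$ (m + k, m + l))"
  define E where "E = mat m m (\<lambda>(k, l). g $$ (k, m + l))"
  define H where "H = mat 2 m (\<lambda>(c, l). g $$ (2 * m + c, m + l))"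
  \<comment> \<open>Both choices are forced: i h must be H and A B must be E, while
    \<open>so2 (d1 + d2) d2\<close> is the inverse of i and the transpose of D will turn out to be
    the inverse of A.\<close>
  define h where "h = so2 (d1 + d2) d2 * H"
  define B where "B = transpose_mat D * E"
  have c: "A \<in> carrier_mat m m" "D \<in> carrier_mat m m" "E \<in> carrier_mat m m" "H \<in> carrier_mat 2 m"
    "h \<in> carrier_mat 2 m" "B \<in> carrier_mat m m" "transpose_mat D \<in> carrier_mat m m" "transpose_mat A \<in> carrier_mat m m"
    by (auto simp: A_def D_def E_def H_def h_def B_def intro!: mult_carrier_mat[of _ 2 2 _ m] mult_carrier_mat[of _ m m _ m])
  have AD: "transpose_mat A * D = 1\<^sub>m m"
  proof (rule eq_matI)
    fix k l assume "k < dim_row (1\<^sub>m m :: 'a mat)" "l < dim_col (1\<^sub>m m :: 'a mat)"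
    then have kl: "k < m" "l < m" by auto
    have "(transpose_mat A * D) $$ (k, l) = (\<Sum>j<m. g $$ (j, k) * g $$ (m + j, m + l))"
      using kl by (simp add: mult_mat_index[OF c(8,2)] del: index_mult_mat(1)) (simp add: A_def D_def)
    also have "\<dots> = polar (unit_vec N k) (unit_vec N (m + l))"
      using pol[of k "m + l"] kl by (simp add: z')
    also have "\<dots> = 1\<^sub>m m $$ (k, l)" using polar_unit(2)[of "unit_vec N k" l] kl by auto
    finally show "(transpose_mat A * D) $$ (k, l) = 1\<^sub>m m $$ (k, l)" .
  qed (use c in auto)
  have "det A * det D = 1" using arg_cong[OF AD, of det] c by (simp add: det_mult[of _ m] det_transpose)
  then have AG: "A \<in> GL m" and DG: "D \<in> GL m" using c by (auto simp: GL_iff)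
  have ATG: "transpose_mat A \<in> GL m" using AG by (rule GL_transpose)
  have "transpose_mat D * A = 1\<^sub>m m"
    using arg_cong[OF AD, of transpose_mat] c by (simp add: transpose_mult[OF c(8,2)])
  then have ADT: "A * transpose_mat D = 1\<^sub>m m" by (rule mat_mult_left_right_inverse[OF c(7,1)])
  have mA: "minv A = transpose_mat D" by (rule minv_unique[OF AG c(7) ADT])
  have Z: "g $$ (m + k, 2 * m + c') = 0" if "k < m" "c' < 2" for k c'
  proof (rule det_nonzero_kernel[of "transpose_mat A" m "\<lambda>k. g $$ (m + k, 2 * m + c')"])
    fix l assume l: "l < m"
    have "(\<Sum>j<m. transpose_mat A $$ (l, j) * g $$ (m + j, 2 * m + c')) = (\<Sum>j<m. g $$ (j, l) * g $$ (m + j, 2 * m + c'))"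
      using l by (intro sum.cong) (auto simp: A_def)
    also have "\<dots> = polar (unit_vec N l) (unit_vec N (2 * m + c'))"
      using pol[of l "2 * m + c'"] l that by (simp add: z')
    also have "\<dots> = 0" using polar_unit(3,4)[of "unit_vec N l"] l less_2_cases[OF that(2)] by auto
    finally show "(\<Sum>j<m. transpose_mat A $$ (l, j) * g $$ (m + j, 2 * m + c')) = 0" .
  qed (use ATG that GL_iff in blast)+
  have iH: "?i * h = H"
  proof -
    have "?i * h = (?i * so2 (d1 + d2) d2) * H" unfolding h_def using c by (simp add: assoc_mult_mat[of _ 2 2 _ 2 _ m])
    then show ?thesis using SO2_inv[OF d(1)] c by simp
  qed
  have H0: "g $$ (2 * m, m + k) = d1 * h $$ (0, k) + \<kappa> * d2 * h $$ (Suc 0, k)"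
    and H1: "g $$ (Suc (2 * m), m + k) = d2 * h $$ (0, k) + (d1 + d2) * h $$ (Suc 0, k)" if "k < m" for k
  proof -
    have ix: "g $$ (2 * m + c', m + k) = ?i $$ (c', 0) * h $$ (0, k) + ?i $$ (c', Suc 0) * h $$ (Suc 0, k)" if "c' < 2" for c'
    proof -
      have "g $$ (2 * m + c', m + k) = H $$ (c', k)" using that \<open>k < m\<close> by (simp add: H_def)
      also have "\<dots> = (?i * h) $$ (c', k)" by (simp add: iH)
      finally show ?thesis using that \<open>k < m\<close> by (simp add: mult_mat_index[OF so2_carrier(1) c(5)] sum_2 del: index_mult_mat(1))
    qed
    show "g $$ (2 * m, m + k) = d1 * h $$ (0, k) + \<kappa> * d2 * h $$ (Suc 0, k)" using ix[of 0] by simp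
    show "g $$ (Suc (2 * m), m + k) = d2 * h $$ (0, k) + (d1 + d2) * h $$ (Suc 0, k)" using ix[of 1] by simp
  qed
  have DY: "(\<Sum>j<m. g $$ (m + j, m + k) * g $$ (j, 2 * m + c')) = h $$ (1 - c', k)" if k: "k < m" "c' < 2" for k c'
  proof -
    have "(\<Sum>j<m. g $$ (m + j, m + k) * g $$ (j, 2 * m + c'))
       + (g $$ (2 * m, m + k) * g $$ (Suc (2 * m), 2 * m + c') + g $$ (Suc (2 * m), m + k) * g $$ (2 * m, 2 * m + c')) = polar (unit_vec N (m + k)) (unit_vec N (2 * m + c'))"
      using pol[of "m + k" "2 * m + c'"] k by (simp add: Z)
    also have "\<dots> = 0" using polar_unit(3,4)[of "unit_vec N (m + k)"] k less_2_cases[OF k(2)] by auto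
    finally have 1: "(\<Sum>j<m. g $$ (m + j, m + k) * g $$ (j, 2 * m + c')) = g $$ (2 * m, m + k) * g $$ (Suc (2 * m), 2 * m + c') + g $$ (Suc (2 * m), m + k) * g $$ (2 * m, 2 * m + c')"
      by (simp only: add_eq_0)
    from k(2) have "c' = 0 \<or> c' = 1" by auto
    then show ?thesis
    proof
      assume c0: "c' = 0"
      have "g $$ (Suc (2 * m), 2 * m) = d2" "g $$ (2 * m, 2 * m) = d1" using ig[of 1 0] ig[of 0 0] by simp_all
      then show ?thesis using 1 so2_polar_mult[of d1 "h $$ (0, k)" d2 "h $$ (Suc 0, k)" 1 0] nrm
        by (simp add: c0 H0[OF k(1)] H1[OF k(1)] del: index_mult_mat(1))
    next
      assume c1: "c' = 1"
      have "g $$ (Suc (2 * m), Suc (2 * m)) = d1 + d2" "g $$ (2 * m, Suc (2 * m)) = \<kappa> * d2" using ig[of 1 1] ig[of 0 1] by simp_all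
      then show ?thesis using 1 so2_polar_mult[of d1 "h $$ (0, k)" d2 "h $$ (Suc 0, k)" 0 1] nrm
        by (simp add: c1 H0[OF k(1)] H1[OF k(1)] del: index_mult_mat(1))
    qed
  qed
  have Y: "g $$ (l, 2 * m + c') = (\<Sum>k<m. A $$ (l, k) * h $$ (1 - c', k))" if l: "l < m" "c' < 2" for l c'
  proof -
    have "(\<Sum>k<m. A $$ (l, k) * h $$ (1 - c', k)) = (\<Sum>k<m. \<Sum>j<m. A $$ (l, k) * (transpose_mat D $$ (k, j) * g $$ (j, 2 * m + c')))"
    proof (rule sum.cong[OF refl])
      fix k assume "k \<in> {..<m}"
      then have k: "k < m" by simp
      show "A $$ (l, k) * h $$ (1 - c', k) = (\<Sum>j<m. A $$ (l, k) * (transpose_mat D $$ (k, j) * g $$ (j, 2 * m + c')))"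
        unfolding DY[OF k l(2), symmetric] sum_distrib_left using k by (intro sum.cong) (auto simp: D_def)
    qed
    also have "\<dots> = (\<Sum>j<m. (\<Sum>k<m. A $$ (l, k) * minv A $$ (k, j)) * g $$ (j, 2 * m + c'))"
      unfolding mA by (subst sum.swap) (simp add: sum_distrib_right mult.assoc)
    also have "\<dots> = (\<Sum>j<m. if j = l then g $$ (l, 2 * m + c') else 0)"
      using l by (intro sum.cong) (auto simp: minv_index[OF AG])
    finally show ?thesis using l by simp
  qed
  have AB: "A * B = E"
  proof -
    have "A * B = (A * transpose_mat D) * E" unfolding B_def using c by (simp add: assoc_mult_mat[of _ m m _ m _ m])
    then show ?thesis using ADT c by simp
  qed
  have Bix: "B $$ (l, k) = (\<Sum>j<m. g $$ (m + j, m + l) * g $$ (j, m + k))" if "l < m" "k < m" for l k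
    using that unfolding B_def by (simp add: mult_mat_index[OF c(7,3)] del: index_mult_mat(1)) (simp add: D_def E_def)
  \<comment> \<open>Symmetry is the orthogonality of the columns m + k and m + l. The zero diagonal
    is finer and comes from \<theta> itself, which vanishes on the columns m + k.\<close>
  have alt: "alternating_mat (transpose_mat B + dmat h)"
  proof -
    have Tc: "transpose_mat B + dmat h \<in> carrier_mat m m" using c by simp
    have T: "(transpose_mat B + dmat h) $$ (k, l) = B $$ (l, k) + dmat h $$ (k, l)" if "k < m" "l < m" for k l
      using c that by (simp add: dmat_def)
    have diag: "B $$ (k, k) + dmat h $$ (k, k) = 0" if k: "k < m" for k
    proof -
      have "\<theta> (g *\<^sub>v unit_vec N (m + k)) = \<theta> (unit_vec N (m + k))" by (rule th) simp
      also have "\<dots> = 0" unfolding theta_eq using k by simp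
      finally have "(\<Sum>j<m. g $$ (j, m + k) * g $$ (m + j, m + k)) + (g $$ (2 * m, m + k))\<^sup>2
         + g $$ (2 * m, m + k) * g $$ (Suc (2 * m), m + k) + \<kappa> * (g $$ (Suc (2 * m), m + k))\<^sup>2 = 0"
        unfolding theta_eq using k by (simp add: col_index[OF gc])
      then have "B $$ (k, k) + ((g $$ (2 * m, m + k))\<^sup>2
         + g $$ (2 * m, m + k) * g $$ (Suc (2 * m), m + k) + \<kappa> * (g $$ (Suc (2 * m), m + k))\<^sup>2) = 0"
        using k by (simp add: Bix add.assoc mult.commute)
      then have "B $$ (k, k) + ((h $$ (0, k))\<^sup>2 + h $$ (0, k) * h $$ (Suc 0, k) + \<kappa> * (h $$ (Suc 0, k))\<^sup>2) = 0"
        unfolding H0[OF k] H1[OF k] so2_norm_mult nrm by simp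
      then show ?thesis using k by (simp add: dmat_def power2_eq_square)
    qed
    have sym: "B $$ (l, k) + dmat h $$ (k, l) = B $$ (k, l) + dmat h $$ (l, k)" if kl: "k < m" "l < m" for k l
    proof -
      have "(\<Sum>j<m. g $$ (j, m + k) * g $$ (m + j, m + l) + g $$ (m + j, m + k) * g $$ (j, m + l))
      + (g $$ (2 * m, m + k) * g $$ (Suc (2 * m), m + l) + g $$ (Suc (2 * m), m + k) * g $$ (2 * m, m + l)) = polar (unit_vec N (m + k)) (unit_vec N (m + l))"
        using kl by (intro pol) auto
      also have "\<dots> = 0" using polar_unit(2)[of "unit_vec N (m + k)" l] kl by simp
      finally have "B $$ (l, k) + B $$ (k, l) + (g $$ (2 * m, m + k) * g $$ (Suc (2 * m), m + l) + g $$ (Suc (2 * m), m + k) * g $$ (2 * m, m + l)) = 0"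
        using kl by (simp add: Bix sum.distrib mult.commute)
      then have e: "B $$ (l, k) + B $$ (k, l) + (h $$ (0, k) * h $$ (Suc 0, l) + h $$ (Suc 0, k) * h $$ (0, l)) = 0"
        unfolding H0[OF kl(1)] H1[OF kl(1)] H0[OF kl(2)] H1[OF kl(2)] so2_polar_mult nrm by simp
      have "B $$ (l, k) + dmat h $$ (k, l) + (B $$ (k, l) + dmat h $$ (l, k))
         = B $$ (l, k) + B $$ (k, l) + (h $$ (0, k) * h $$ (Suc 0, l) + h $$ (Suc 0, k) * h $$ (0, l))"
        using kl by (simp add: dmat_def algebra_simps char2)
      then show ?thesis using e add_eq_0 by metis
    qed
    show ?thesis unfolding alternating_mat_iff[OF Tc] using T diag sym by auto
  qed
  have par: "Qpar A ?i B h"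
    unfolding Qpar_def using AG d(1) c alt by (auto simp: SO_minus_2_eq)
  have "g = Qel A ?i B h"
  proof (rule mat_eq_blocks[OF gc Qel_carrier])
    fix k l assume kl: "k < m" "l < m"
    show "g $$ (k, l) = Qel A ?i B h $$ (k, l) \<and> g $$ (k, m + l) = Qel A ?i B h $$ (k, m + l)
        \<and> g $$ (m + k, l) = Qel A ?i B h $$ (m + k, l) \<and> g $$ (m + k, m + l) = Qel A ?i B h $$ (m + k, m + l)"
      using kl Qel_index[OF kl, of 0 0] by (simp add: AB mA z') (simp add: A_def D_def E_def)
  next
    fix k c' assume kc: "k < m" "c' < (2::nat)"
    have "g $$ (2 * m + c', k) = 0" using z[of "2 * m + c'" k] kc by simp
    then show "g $$ (k, 2 * m + c') = Qel A ?i B h $$ (k, 2 * m + c') \<and> g $$ (m + k, 2 * m + c') = Qel A ?i B h $$ (m + k, 2 * m + c')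
        \<and> g $$ (2 * m + c', k) = Qel A ?i B h $$ (2 * m + c', k) \<and> g $$ (2 * m + c', m + k) = Qel A ?i B h $$ (2 * m + c', m + k)"
      using kc Qel_index[OF kc(1) kc(1) kc(2) kc(2)] by (simp add: Y Z iH) (simp add: H_def)
  next
    fix c' d' assume "c' < (2::nat)" "d' < (2::nat)"
    then show "g $$ (2 * m + c', 2 * m + d') = Qel A ?i B h $$ (2 * m + c', 2 * m + d')" by (simp add: ig)
  qed
  then show ?thesis using Qel_in_Q[OF par] by simp
qed

lemma Q_blocks:
  assumes "g \<in> Q"
  shows "m \<le> k \<Longrightarrow> k < N \<Longrightarrow> l < m \<Longrightarrow> g $$ (k, l) = 0"
    and "k < m \<Longrightarrow> c < 2 \<Longrightarrow> g $$ (m + k, 2 * m + c) = 0"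
    and "corner g \<in> SO_minus_2 \<kappa>"
proof -
  obtain A i B h where p: "Qpar A i B h" "g = Qel A i B h" using Q_imp_Qel[OF assms] .
  show "g $$ (k, l) = 0" if "m \<le> k" "k < N" "l < m" using that by (auto simp: p(2) Qel_def)
  show "g $$ (m + k, 2 * m + c) = 0" if "k < m" "c < 2" using Qel_index(6)[OF that(1) that(1) that(2) that(2)] p by simp
  show "corner g \<in> SO_minus_2 \<kappa>" using p corner_Qel[of i] by (auto simp: Qpar_def SO_minus_2_eq)
qed

lemma corner_mult:
  assumes "g \<in> carrier_mat N N" "g' \<in> carrier_mat N N"
    and "\<And>k c. k < m \<Longrightarrow> c < 2 \<Longrightarrow> g $$ (2 * m + c, k) = 0" "\<And>k c. k < m \<Longrightarrow> c < 2 \<Longrightarrow> g' $$ (m + k, 2 * m + c) = 0"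
  shows "corner (g * g') = corner g * corner g'"
proof (rule eq_matI)
  fix c d assume "c < dim_row (corner g * corner g')" "d < dim_col (corner g * corner g')"
  then have cd: "c < 2" "d < 2" by (simp_all add: corner_def)
  have "(g * g') $$ (2 * m + c, 2 * m + d) = g $$ (2 * m + c, 2 * m) * g' $$ (2 * m, 2 * m + d) + g $$ (2 * m + c, Suc (2 * m)) * g' $$ (Suc (2 * m), 2 * m + d)"
  proof -
    have "(g * g') $$ (2 * m + c, 2 * m + d) = (\<Sum>k<N. g $$ (2 * m + c, k) * g' $$ (k, 2 * m + d))"
      by (rule mult_mat_index[OF assms(1,2)]) (use cd in auto)
    also have "\<dots> = g $$ (2 * m + c, 2 * m) * g' $$ (2 * m, 2 * m + d) + g $$ (2 * m + c, Suc (2 * m)) * g' $$ (Suc (2 * m), 2 * m + d)"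
      unfolding sum_split3 using cd assms(3,4) by simp
    finally show ?thesis .
  qed
  then show "corner (g * g') $$ (c, d) = (corner g * corner g') $$ (c, d)"
    using cd by (simp add: corner_def mult_mat_index[of _ 2 2 _ 2] sum_2 del: index_mult_mat(1))
qed (simp_all add: corner_def)

lemma SO_minus_2_mult: "i \<in> SO_minus_2 \<kappa> \<Longrightarrow> j \<in> SO_minus_2 \<kappa> \<Longrightarrow> i * j \<in> SO_minus_2 \<kappa>"
proof -
  assume "i \<in> SO_minus_2 \<kappa>" "j \<in> SO_minus_2 \<kappa>"
  then obtain d1 d2 e1 e2 where d: "(d1, d2) \<in> SO2" "(e1, e2) \<in> SO2" "i = so2 d1 d2" "j = so2 e1 e2"
    by (auto simp: SO_minus_2_eq)
  show ?thesis unfolding SO_minus_2_eq d(3,4) so2_mult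
    by (rule image_eqI[OF _ SO2_mult[OF d(1,2)]]) simp
qed

lemma Q_mult:
  assumes "g \<in> Q" "g' \<in> Q"
  shows "g * g' \<in> Q"
proof (rule O_in_Q)
  have c: "g \<in> carrier_mat N N" "g' \<in> carrier_mat N N" using assms Q_carrier by auto
  show "g * g' \<in> O_minus \<kappa> (Suc m)" using assms O_minus_mult Q_subset_O by blast
  show "(g * g') $$ (k, l) = 0" if kl: "m \<le> k" "k < N" "l < m" for k l
  proof -
    have "g $$ (k, j) * g' $$ (j, l) = 0" if "j < N" for j
      using Q_blocks(1)[OF assms(1), of k j] Q_blocks(1)[OF assms(2), of j l] that kl by (cases "j < m") auto
    then show ?thesis using mult_mat_index[OF c, of k l] kl by (simp only: ) (simp add: sum.neutral del: sum.lessThan_Suc)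
  qed
  have "corner (g * g') = corner g * corner g'"
    by (rule corner_mult[OF c]) (use Q_blocks(1)[OF assms(1)] Q_blocks(2)[OF assms(2)] in auto)
  then show "corner (g * g') \<in> SO_minus_2 \<kappa>" using Q_blocks(3) assms SO_minus_2_mult by simp
qed

end

lemma mat_trace_mult_commute:
  assumes "A \<in> carrier_mat k k" "B \<in> carrier_mat k k"
  shows "mat_trace (A * B) = mat_trace (B * (A :: 'b::comm_semiring_0 mat))"
proof -
  have "mat_trace (A * B) = (\<Sum>i<k. \<Sum>j<k. A $$ (i, j) * B $$ (j, i))"
    unfolding mat_trace_def using assms by (intro sum.cong) (auto simp: scalar_prod_def atLeast0LessThan)
  also have "\<dots> = (\<Sum>j<k. \<Sum>i<k. B $$ (j, i) * A $$ (i, j))"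
    by (subst sum.swap) (simp add: mult.commute)
  also have "\<dots> = mat_trace (B * A)"
    unfolding mat_trace_def using assms by (intro sum.cong) (auto simp: scalar_prod_def atLeast0LessThan)
  finally show ?thesis .
qed

context minus_form
begin

section \<open>The matrices sigma and rho\<close>

abbreviation \<sigma> :: "nat \<Rightarrow> 'a mat" where "\<sigma> \<equiv> sigma_mat (Suc m)"
abbreviation sp :: "nat \<Rightarrow> nat \<Rightarrow> nat" where "sp \<equiv> sigma_perm (Suc m)"
abbreviation \<rho> :: "'a mat" where "\<rho> \<equiv> rho_mat (Suc m)"

lemma sp_eq: "sp s j = (if j < s then m + j else if m \<le> j \<and> j < m + s then j - m else j)"
  by (simp add: sigma_perm_def)

lemma sp_less: "s \<le> m \<Longrightarrow> k < N \<Longrightarrow> sp s k < N"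
  by (auto simp: sp_eq)

lemma sp_sp: "s \<le> m \<Longrightarrow> sp s (sp s k) = k"
  by (auto simp: sp_eq)

lemma sigma_carrier [simp]: "\<sigma> s \<in> carrier_mat N N"
  by (simp add: sigma_mat_def)

lemma sigma_index: "k < N \<Longrightarrow> l < N \<Longrightarrow> \<sigma> s $$ (k, l) = (if k = sp s l then 1 else 0)"
  by (simp add: sigma_mat_def)

lemma sum_delta_mult: "k < n \<Longrightarrow> (\<Sum>j<n. f j * (if j = k then 1 else 0)) = f k" for f :: "nat \<Rightarrow> 'a"
proof -
  assume "k < n"
  have "(\<Sum>j<n. f j * (if j = k then 1 else 0)) = (\<Sum>j<n. if j = k then f k else 0)"
    by (rule sum.cong) auto
  then show ?thesis using \<open>k < n\<close> by simp
qed

lemma mult_sigma_right: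
  assumes "s \<le> m" "g \<in> carrier_mat N N" "k < N" "l < N"
  shows "(g * \<sigma> s) $$ (k, l) = g $$ (k, sp s l)"
proof -
  have "(g * \<sigma> s) $$ (k, l) = (\<Sum>j<N. g $$ (k, j) * \<sigma> s $$ (j, l))"
    by (rule mult_mat_index[OF assms(2) sigma_carrier assms(3,4)])
  also have "\<dots> = (\<Sum>j<N. g $$ (k, j) * (if j = sp s l then 1 else 0))"
    using assms(4) by (intro sum.cong) (auto simp: sigma_index)
  also have "\<dots> = g $$ (k, sp s l)" by (rule sum_delta_mult[OF sp_less[OF assms(1,4)]])
  finally show ?thesis .
qed

lemma mult_sigma_left:
  assumes "s \<le> m" "g \<in> carrier_mat N N" "k < N" "l < N"
  shows "(\<sigma> s * g) $$ (k, l) = g $$ (sp s k, l)"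
proof -
  have "(\<sigma> s * g) $$ (k, l) = (\<Sum>j<N. \<sigma> s $$ (k, j) * g $$ (j, l))"
    by (rule mult_mat_index[OF sigma_carrier assms(2,3,4)])
  also have "\<dots> = (\<Sum>j<N. g $$ (j, l) * (if j = sp s k then 1 else 0))"
    using assms(3) sp_sp[OF assms(1)] by (intro sum.cong) (auto simp: sigma_index)
  also have "\<dots> = g $$ (sp s k, l)" by (rule sum_delta_mult[OF sp_less[OF assms(1,3)]])
  finally show ?thesis .
qed

lemma sigma_conj_index:
  assumes "s \<le> m" "g \<in> carrier_mat N N" "k < N" "l < N"
  shows "(\<sigma> s * g * \<sigma> s) $$ (k, l) = g $$ (sp s k, sp s l)"
proof -
  have "\<sigma> s * g \<in> carrier_mat N N" by (rule mult_carrier_mat[OF sigma_carrier assms(2)])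
  then show ?thesis using mult_sigma_right[OF assms(1) _ assms(3,4)] mult_sigma_left[OF assms(1,2,3) sp_less[OF assms(1,4)]] by simp
qed

lemma sigma_sq:
  assumes "s \<le> m"
  shows "\<sigma> s * \<sigma> s = 1\<^sub>m N"
proof (rule eq_matI)
  fix k l assume "k < dim_row (1\<^sub>m N :: 'a mat)" "l < dim_col (1\<^sub>m N :: 'a mat)"
  then have kl: "k < N" "l < N" by simp_all
  show "(\<sigma> s * \<sigma> s) $$ (k, l) = 1\<^sub>m N $$ (k, l)"
    unfolding mult_sigma_right[OF assms sigma_carrier kl] sigma_index[OF kl(1) sp_less[OF assms kl(2)]] sp_sp[OF assms]
    using kl by simp
qed (simp_all add: sigma_mat_def)

lemma sigma_O:
  assumes "s \<le> m"
  shows "\<sigma> s \<in> O_minus \<kappa> (Suc m)"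
  unfolding O_minus_iff
proof (intro conjI ballI)
  fix x :: "'a vec" assume x: "x \<in> carrier_vec N"
  have ix: "(\<sigma> s *\<^sub>v x) $ k = x $ sp s k" if "k < N" for k
  proof -
    have "(\<sigma> s *\<^sub>v x) $ k = (\<Sum>j<N. \<sigma> s $$ (k, j) * x $ j)" by (rule mult_mat_vec_index[OF sigma_carrier x that])
    also have "\<dots> = (\<Sum>j<N. x $ j * (if j = sp s k then 1 else 0))"
      using that sp_sp[OF assms] by (intro sum.cong) (auto simp: sigma_index)
    also have "\<dots> = x $ sp s k" by (rule sum_delta_mult[OF sp_less[OF assms that]])
    finally show ?thesis .
  qed
  have c: "sp s (2 * m) = 2 * m" "sp s (Suc (2 * m)) = Suc (2 * m)" using assms by (auto simp: sp_eq)
  have "(\<Sum>k<m. (\<sigma> s *\<^sub>v x) $ k * (\<sigma> s *\<^sub>v x) $ (m + k)) = (\<Sum>k<m. x $ k * x $ (m + k))"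
  proof (rule sum.cong[OF refl])
    fix k assume "k \<in> {..<m}"
    then have "k < N" "m + k < N" "k < m" by auto
    then show "(\<sigma> s *\<^sub>v x) $ k * (\<sigma> s *\<^sub>v x) $ (m + k) = x $ k * x $ (m + k)"
      unfolding ix[OF \<open>k < N\<close>] ix[OF \<open>m + k < N\<close>] using assms by (cases "k < s") (simp_all add: sp_eq mult.commute)
  qed
  then show "\<theta> (\<sigma> s *\<^sub>v x) = \<theta> x"
    unfolding theta_eq by (simp only: ix[of "2 * m"] ix[of "Suc (2 * m)"] c lessI less_SucI)
qed simp

lemma rho_eq: "\<rho> = mat N N (\<lambda>(k, l). if k = l then 1 else if k = 2 * m \<and> l = Suc (2 * m) then 1 else 0)"
proof (rule eq_matI)
  have d: "\<rho> = four_block_mat (1\<^sub>m (2 * m)) (0\<^sub>m (2 * m) 2) (0\<^sub>m 2 (2 * m)) (mat_of_rows_list 2 [[1, 1], [0, 1]])"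
  proof -
    let ?B = "mat_of_rows_list 2 [[1, 1], [0, 1]] :: 'a mat"
    have "diag_block_mat [?B] = ?B"
      by (rule eq_matI) (simp_all add: Let_def mat_of_rows_list_def)
    then show ?thesis unfolding rho_mat_def by (simp add: Let_def mat_of_rows_list_def numeral_2_eq_2)
  qed
  show "dim_row \<rho> = dim_row (mat N N (\<lambda>(k, l). if k = l then 1 else if k = 2 * m \<and> l = Suc (2 * m) then 1 else 0 :: 'a))"
    "dim_col \<rho> = dim_col (mat N N (\<lambda>(k, l). if k = l then 1 else if k = 2 * m \<and> l = Suc (2 * m) then 1 else 0 :: 'a))"
    unfolding d by (simp_all add: mat_of_rows_list_def)
  fix k l assume "k < dim_row (mat N N (\<lambda>(k, l). if k = l then 1 else if k = 2 * m \<and> l = Suc (2 * m) then 1 else 0 :: 'a))"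
    "l < dim_col (mat N N (\<lambda>(k, l). if k = l then 1 else if k = 2 * m \<and> l = Suc (2 * m) then 1 else 0 :: 'a))"
  then have kl: "k < N" "l < N" by simp_all
  have bl: "mat_of_rows_list 2 [[1, 1], [0, 1]] $$ (c, e) = (if c = e then 1 else if c = 0 then 1 else (0::'a))" if "c < 2" "e < 2" for c e
    using that by (auto dest!: less_2_cases simp: mat_of_rows_list_def)
  show "\<rho> $$ (k, l) = mat N N (\<lambda>(k, l). if k = l then 1 else if k = 2 * m \<and> l = Suc (2 * m) then 1 else 0) $$ (k, l)"
  proof (cases "k < 2 * m \<or> l < 2 * m")
    case True
    then show ?thesis using kl unfolding d by (auto simp: mat_of_rows_list_def)
  next
    case False
    then have kl': "k = 2 * m \<or> k = Suc (2 * m)" "l = 2 * m \<or> l = Suc (2 * m)" using kl by auto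
    then show ?thesis unfolding d by (auto simp: mat_of_rows_list_def)
  qed
qed

lemma rho_carrier [simp]: "\<rho> \<in> carrier_mat N N"
  by (simp add: rho_eq)

lemma mult_rho_left:
  assumes "g \<in> carrier_mat N N" "k < N" "l < N"
  shows "(\<rho> * g) $$ (k, l) = g $$ (k, l) + (if k = 2 * m then g $$ (Suc (2 * m), l) else 0)"
proof -
  have "(\<rho> * g) $$ (k, l) = (\<Sum>j<N. \<rho> $$ (k, j) * g $$ (j, l))" by (rule mult_mat_index[OF rho_carrier assms])
  also have "\<dots> = (\<Sum>j<N. g $$ (j, l) * (if j = k then 1 else 0) + (if k = 2 * m then g $$ (j, l) else 0) * (if j = Suc (2 * m) then 1 else 0))"
    using assms(2) by (intro sum.cong) (auto simp: rho_eq)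
  also have "\<dots> = g $$ (k, l) + (if k = 2 * m then g $$ (Suc (2 * m), l) else 0)"
    unfolding sum.distrib sum_delta_mult[OF assms(2)] using sum_delta_mult[of "Suc (2 * m)" N "\<lambda>j. if k = 2 * m then g $$ (j, l) else 0"] by (simp only: lessI)
  finally show ?thesis .
qed

lemma mult_rho_right:
  assumes "g \<in> carrier_mat N N" "k < N" "l < N"
  shows "(g * \<rho>) $$ (k, l) = g $$ (k, l) + (if l = Suc (2 * m) then g $$ (k, 2 * m) else 0)"
proof -
  have "(g * \<rho>) $$ (k, l) = (\<Sum>j<N. g $$ (k, j) * \<rho> $$ (j, l))" by (rule mult_mat_index[OF assms(1) rho_carrier assms(2,3)])
  also have "\<dots> = (\<Sum>j<N. g $$ (k, j) * (if j = l then 1 else 0) + (if l = Suc (2 * m) then g $$ (k, j) else 0) * (if j = 2 * m then 1 else 0))"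
    using assms(3) by (intro sum.cong) (auto simp: rho_eq)
  also have "\<dots> = g $$ (k, l) + (if l = Suc (2 * m) then g $$ (k, 2 * m) else 0)"
    unfolding sum.distrib sum_delta_mult[OF assms(3)] using sum_delta_mult[of "2 * m" N "\<lambda>j. if l = Suc (2 * m) then g $$ (k, j) else 0"] by (simp only: lessI less_SucI)
  finally show ?thesis .
qed

lemma rho_sq: "\<rho> * \<rho> = 1\<^sub>m N"
proof (rule eq_matI)
  fix k l assume "k < dim_row (1\<^sub>m N :: 'a mat)" "l < dim_col (1\<^sub>m N :: 'a mat)"
  then have kl: "k < N" "l < N" by simp_all
  show "(\<rho> * \<rho>) $$ (k, l) = 1\<^sub>m N $$ (k, l)"
    unfolding mult_rho_left[OF rho_carrier kl] using kl by (auto simp: rho_eq add_self[of 1, simplified])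
qed (simp_all add: rho_eq)

lemma rho_O: "\<rho> \<in> O_minus \<kappa> (Suc m)"
  unfolding O_minus_iff
proof (intro conjI ballI)
  fix x :: "'a vec" assume x: "x \<in> carrier_vec N"
  have ix: "(\<rho> *\<^sub>v x) $ k = x $ k + (if k = 2 * m then x $ Suc (2 * m) else 0)" if "k < N" for k
  proof -
    have "(\<rho> *\<^sub>v x) $ k = (\<Sum>j<N. \<rho> $$ (k, j) * x $ j)" by (rule mult_mat_vec_index[OF rho_carrier x that])
    also have "\<dots> = (\<Sum>j<N. x $ j * (if j = k then 1 else 0) + (if k = 2 * m then x $ j else 0) * (if j = Suc (2 * m) then 1 else 0))"
      using that by (intro sum.cong) (auto simp: rho_eq)
    also have "\<dots> = x $ k + (if k = 2 * m then x $ Suc (2 * m) else 0)"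
      unfolding sum.distrib sum_delta_mult[OF that] using sum_delta_mult[of "Suc (2 * m)" N "\<lambda>j. if k = 2 * m then x $ j else 0"] by (simp only: lessI)
    finally show ?thesis .
  qed
  have "(\<Sum>k<m. (\<rho> *\<^sub>v x) $ k * (\<rho> *\<^sub>v x) $ (m + k)) = (\<Sum>k<m. x $ k * x $ (m + k))"
  proof (rule sum.cong[OF refl])
    fix k assume "k \<in> {..<m}"
    then have k: "k < N" "m + k < N" "k \<noteq> 2 * m" "m + k \<noteq> 2 * m" by auto
    then show "(\<rho> *\<^sub>v x) $ k * (\<rho> *\<^sub>v x) $ (m + k) = x $ k * x $ (m + k)"
      unfolding ix[OF k(1)] ix[OF k(2)] by simp
  qed
  moreover have "(\<rho> *\<^sub>v x) $ (2 * m) = x $ (2 * m) + x $ Suc (2 * m)" "(\<rho> *\<^sub>v x) $ Suc (2 * m) = x $ Suc (2 * m)"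
    using ix[of "2 * m"] ix[of "Suc (2 * m)"] by simp_all
  ultimately show "\<theta> (\<rho> *\<^sub>v x) = \<theta> x"
    unfolding theta_eq by (simp only: ) (simp add: power2_eq_square algebra_simps char2)
qed simp

text \<open>On the plane \<rho> is Galois conjugation of the quadratic extension, so conjugation by
  \<rho> replaces the corner by its inverse.\<close>

lemma rho_normalizes:
  assumes "g \<in> Q"
  shows "\<rho> * g * \<rho> \<in> Q"
proof (rule O_in_Q)
  have gc: "g \<in> carrier_mat N N" using assms Q_carrier by auto
  have rg: "\<rho> * g \<in> carrier_mat N N" by (rule mult_carrier_mat[OF rho_carrier gc])
  have ix: "(\<rho> * g * \<rho>) $$ (k, l) = g $$ (k, l) + (if k = 2 * m then g $$ (Suc (2 * m), l) else 0)
    + (if l = Suc (2 * m) then g $$ (k, 2 * m) + (if k = 2 * m then g $$ (Suc (2 * m), 2 * m) else 0) else 0)" if kl: "k < N" "l < N" for k l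
    unfolding mult_rho_right[OF rg kl] mult_rho_left[OF gc kl] using mult_rho_left[OF gc kl(1), of "2 * m"] by simp
  show "\<rho> * g * \<rho> \<in> O_minus \<kappa> (Suc m)"
    using O_minus_mult[OF O_minus_mult[OF rho_O] rho_O] assms Q_subset_O by blast
  show "(\<rho> * g * \<rho>) $$ (k, l) = 0" if kl: "m \<le> k" "k < N" "l < m" for k l
  proof -
    have "l < N" "l \<noteq> Suc (2 * m)" using kl by auto
    then show ?thesis unfolding ix[OF kl(2) \<open>l < N\<close>] using Q_blocks(1)[OF assms kl] Q_blocks(1)[OF assms, of "Suc (2 * m)" l] kl by auto
  qed
  obtain d1 d2 where d: "(d1, d2) \<in> SO2" "corner g = so2 d1 d2" using Q_blocks(3)[OF assms] by (auto simp: SO_minus_2_eq)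
  have ig: "g $$ (2 * m + c, 2 * m + c') = so2 d1 d2 $$ (c, c')" if "c < 2" "c' < 2" for c c'
    using arg_cong[OF d(2), of "\<lambda>M. M $$ (c, c')"] that by (simp add: corner_def)
  have i4: "g $$ (2 * m, 2 * m) = d1" "g $$ (2 * m, Suc (2 * m)) = \<kappa> * d2" "g $$ (Suc (2 * m), 2 * m) = d2" "g $$ (Suc (2 * m), Suc (2 * m)) = d1 + d2"
    using ig[of 0 0] ig[of 0 1] ig[of 1 0] ig[of 1 1] by simp_all
  have "corner (\<rho> * g * \<rho>) = so2 (d1 + d2) d2"
  proof (rule mat2_eqI)
    show "corner (\<rho> * g * \<rho>) \<in> carrier_mat 2 2" by (simp add: corner_def)
    have i0: "corner h $$ (0, 0) = h $$ (2 * m, 2 * m)" "corner h $$ (0, Suc 0) = h $$ (2 * m, Suc (2 * m))"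
      "corner h $$ (Suc 0, 0) = h $$ (Suc (2 * m), 2 * m)" "corner h $$ (Suc 0, Suc 0) = h $$ (Suc (2 * m), Suc (2 * m))" for h
      by (simp_all add: corner_def)
    have l: "2 * m < N" "Suc (2 * m) < N" by simp_all
    show "corner (\<rho> * g * \<rho>) $$ (0, 0) = so2 (d1 + d2) d2 $$ (0, 0)"
      unfolding i0 ix[OF l(1) l(1)] i4 by simp
    show "corner (\<rho> * g * \<rho>) $$ (0, Suc 0) = so2 (d1 + d2) d2 $$ (0, Suc 0)"
      unfolding i0 ix[OF l] i4 by (simp add: algebra_simps char2)
    show "corner (\<rho> * g * \<rho>) $$ (Suc 0, 0) = so2 (d1 + d2) d2 $$ (Suc 0, 0)"
      unfolding i0 ix[OF l(2,1)] i4 by simp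
    show "corner (\<rho> * g * \<rho>) $$ (Suc 0, Suc 0) = so2 (d1 + d2) d2 $$ (Suc 0, Suc 0)"
      unfolding i0 ix[OF l(2,2)] i4 by (simp add: algebra_simps char2)
  qed simp
  then show "corner (\<rho> * g * \<rho>) \<in> SO_minus_2 \<kappa>" using SO2_inv[OF d(1)] by (auto simp: SO_minus_2_eq)
qed

section \<open>Double cosets\<close>

lemma Q_GL: "g \<in> Q \<Longrightarrow> g \<in> GL N"
  using Q_subset_O by (auto simp: O_minus_def)

lemma finite_Q: "finite Q"
  by (rule finite_subset[OF _ finite_carrier_mat[of N N]]) (use Q_carrier in blast)

lemma one_Q: "1\<^sub>m N \<in> Q"
proof (rule O_in_Q)
  show "1\<^sub>m N \<in> O_minus \<kappa> (Suc m)" unfolding O_minus_iff by simp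
  have "corner (1\<^sub>m N) = so2 1 0" by (rule mat2_eqI) (simp_all add: corner_def)
  moreover have "(1, 0) \<in> SO2" by (simp add: SO2_def)
  ultimately show "corner (1\<^sub>m N) \<in> SO_minus_2 \<kappa>" by (auto simp: SO_minus_2_eq)
qed auto

text \<open>An injective self-map of a finite set is onto. Since Q contains the unit matrix, this
  also supplies inverses in Q.\<close>

lemma left_mult_Q: "x \<in> Q \<Longrightarrow> bij_betw (\<lambda>y. x * y) Q Q"
proof -
  assume x: "x \<in> Q"
  have "inj_on (\<lambda>y. x * y) Q"
  proof (rule inj_onI)
    fix y z assume yz: "y \<in> Q" "z \<in> Q" "x * y = x * z"
    show "y = z" by (rule GL_mult_cancel[OF Q_GL[OF x] Q_carrier[OF yz(1)] Q_carrier[OF yz(2)] yz(3)])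
  qed
  moreover have "(\<lambda>y. x * y) ` Q \<subseteq> Q" using Q_mult[OF x] by blast
  ultimately show ?thesis unfolding bij_betw_def using endo_inj_surj[OF finite_Q] by blast
qed

lemma minv_Q: "x \<in> Q \<Longrightarrow> minv x \<in> Q"
proof -
  assume x: "x \<in> Q"
  then obtain y where "y \<in> Q" "x * y = 1\<^sub>m N" using left_mult_Q[OF x] one_Q unfolding bij_betw_def by (metis imageE)
  then show ?thesis using minv_unique[OF Q_GL[OF x] Q_carrier] by metis
qed

lemma assocN: "A \<in> carrier_mat N N \<Longrightarrow> B \<in> carrier_mat N N \<Longrightarrow> C \<in> carrier_mat N N \<Longrightarrow> (A * B) * C = A * (B * C)" for A :: "'a mat"
  by (rule assoc_mult_mat)

lemma multN: "A \<in> carrier_mat N N \<Longrightarrow> B \<in> carrier_mat N N \<Longrightarrow> A * B \<in> carrier_mat N N" for A :: "'a mat"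
  by (rule mult_carrier_mat)

definition stab :: "nat \<Rightarrow> 'a mat set" where
  "stab s = {u \<in> Q. \<sigma> s * u * \<sigma> s \<in> Q}"

text \<open>The pairs with the same product are exactly (x u, v y) with u in the stabilizer and v
  the inverse of \<sigma> u \<sigma>. So all fibres of the product map onto the double coset have
  the same size.\<close>

lemma double_coset_fibre:
  assumes s: "s \<le> m" and xy: "x \<in> Q" "y \<in> Q"
  shows "card {(x', y') \<in> Q \<times> Q. x' * \<sigma> s * y' = x * \<sigma> s * y} = card (stab s)"
proof (rule bij_betw_same_card[of "\<lambda>(x', y'). minv x * x'"])
  let ?F = "{(x', y') \<in> Q \<times> Q. x' * \<sigma> s * y' = x * \<sigma> s * y}"
  let ?S = "\<sigma> s"
  have c: "x \<in> carrier_mat N N" "y \<in> carrier_mat N N" "minv x \<in> carrier_mat N N"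
    using xy Q_carrier minv_Q by auto
  have S: "?S \<in> carrier_mat N N" "?S * ?S = 1\<^sub>m N" using sigma_sq[OF s] by simp_all
  have xi: "x * minv x = 1\<^sub>m N" "minv x * x = 1\<^sub>m N" using minv[OF Q_GL[OF xy(1)]] by auto
  have SS: "?S * (?S * A) = A" if "A \<in> carrier_mat N N" for A
    using assocN[OF S(1) S(1) that] S(2) that by simp
  have xx: "minv x * (x * A) = A" "x * (minv x * A) = A" if "A \<in> carrier_mat N N" for A
    using assocN[OF c(3) c(1) that] assocN[OF c(1) c(3) that] xi that by simp_all
  show "bij_betw (\<lambda>(x', y'). minv x * x') ?F (stab s)"
    unfolding bij_betw_def
  proof (intro conjI subset_antisym)
    show "inj_on (\<lambda>(x', y'). minv x * x') ?F"
    proof (rule inj_onI)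
      fix p p' assume p: "p \<in> ?F" "p' \<in> ?F" "(case p of (x', y') \<Rightarrow> minv x * x') = (case p' of (x', y') \<Rightarrow> minv x * x')"
      obtain a b a' b' where pp: "p = (a, b)" "p' = (a', b')" by (cases p, cases p')
      have ab: "a \<in> Q" "b \<in> Q" "a' \<in> Q" "b' \<in> Q" "a * ?S * b = x * ?S * y" "a' * ?S * b' = x * ?S * y" "minv x * a = minv x * a'"
        using p by (auto simp: pp)
      have "a = a'" using ab(7) by (rule GL_mult_cancel[OF Q_GL[OF minv_Q[OF xy(1)]] Q_carrier[OF ab(1)] Q_carrier[OF ab(3)]])
      moreover have "b = b'"
      proof (rule GL_mult_cancel[OF _ Q_carrier[OF ab(2)] Q_carrier[OF ab(4)]])
        have "?S \<in> GL N" using sigma_O[OF s] by (auto simp: O_minus_def)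
        then show "a * ?S \<in> GL N" using GL_mult Q_GL[OF ab(1)] by blast
        show "a * ?S * b = a * ?S * b'" using ab(5,6) \<open>a = a'\<close> by simp
      qed
      ultimately show "p = p'" using pp by simp
    qed
    show "(\<lambda>(x', y'). minv x * x') ` ?F \<subseteq> stab s"
    proof (rule image_subsetI)
      fix p assume "p \<in> ?F"
      then obtain a b where p: "p = (a, b)" "a \<in> Q" "b \<in> Q" "a * ?S * b = x * ?S * y" by auto
      have ac: "a \<in> carrier_mat N N" "b \<in> carrier_mat N N" using p Q_carrier by auto
      define u where "u = minv x * a"
      have u: "u \<in> Q" unfolding u_def using Q_mult minv_Q xy p by blast
      have uc: "u \<in> carrier_mat N N" using u Q_carrier by auto
      have au: "a = x * u" unfolding u_def using xx(2)[OF ac(1)] by simp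
      have "x * (u * (?S * b)) = x * (?S * y)"
        using p(4) unfolding au by (simp only: assocN multN c S uc ac)
      then have "u * (?S * b) = ?S * y"
        by (rule GL_mult_cancel[OF Q_GL[OF xy(1)] multN[OF uc multN[OF S(1) ac(2)]] multN[OF S(1) c(2)]])
      then have "?S * (u * (?S * b)) = y" using SS[OF c(2)] by simp
      then have y: "(?S * u * ?S) * b = y" by (simp only: assocN multN S uc ac)
      have bi: "b * minv b = 1\<^sub>m N" "minv b \<in> carrier_mat N N" using minv[OF Q_GL[OF p(3)]] by auto
      have W: "?S * u * ?S \<in> carrier_mat N N" by (intro multN S uc)
      have "y * minv b = (?S * u * ?S) * (b * minv b)" unfolding y[symmetric] by (rule assocN[OF W ac(2) bi(2)])
      then have "?S * u * ?S = y * minv b" unfolding bi(1) right_mult_one_mat[OF W] by (rule sym)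
      then have "?S * u * ?S \<in> Q" using Q_mult[OF xy(2) minv_Q[OF p(3)]] by simp
      then show "(case p of (x', y') \<Rightarrow> minv x * x') \<in> stab s" using u by (simp add: p stab_def u_def)
    qed
    show "stab s \<subseteq> (\<lambda>(x', y'). minv x * x') ` ?F"
    proof
      fix u assume "u \<in> stab s"
      then have u: "u \<in> Q" "?S * u * ?S \<in> Q" by (auto simp: stab_def)
      have uc: "u \<in> carrier_mat N N" using u Q_carrier by auto
      define v where "v = minv (?S * u * ?S)"
      have v: "v \<in> Q" unfolding v_def by (rule minv_Q[OF u(2)])
      have vc: "v \<in> carrier_mat N N" using v Q_carrier by auto
      have "(?S * u * ?S) * v = 1\<^sub>m N" unfolding v_def using minv(2)[OF Q_GL[OF u(2)]] .
      then have "?S * (u * (?S * v)) = 1\<^sub>m N" by (simp only: assocN multN S uc vc)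
      then have "u * (?S * v) = ?S" using SS[OF multN[OF uc multN[OF S(1) vc]]] S(1) by simp
      then have "x * u * ?S * (v * y) = x * ?S * y"
      proof -
        assume a: "u * (?S * v) = ?S"
        have "x * u * ?S * (v * y) = x * ((u * (?S * v)) * y)" by (simp only: assocN multN c S uc vc)
        then show ?thesis unfolding a by (simp only: assocN c S)
      qed
      then have "(x * u, v * y) \<in> ?F" using Q_mult xy u v by simp
      moreover have "minv x * (x * u) = u" by (rule xx(1)[OF uc])
      ultimately show "u \<in> (\<lambda>(x', y'). minv x * x') ` ?F" by (intro image_eqI[of _ _ "(x * u, v * y)"]) simp_all
    qed
  qed
qed

lemma double_coset_eq: "double_coset Q (\<sigma> s) Q = (\<lambda>(x, y). x * \<sigma> s * y) ` (Q \<times> Q)"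
  by (auto simp: double_coset_def)

lemma double_coset_sum:
  fixes f :: "'a mat \<Rightarrow> int"
  assumes s: "s \<le> m"
  shows "(\<Sum>x\<in>Q. \<Sum>y\<in>Q. f (x * \<sigma> s * y)) = int (card (stab s)) * (\<Sum>g\<in>double_coset Q (\<sigma> s) Q. f g)"
proof -
  let ?h = "\<lambda>(x, y). x * \<sigma> s * y"
  have "(\<Sum>x\<in>Q. \<Sum>y\<in>Q. f (x * \<sigma> s * y)) = (\<Sum>p\<in>Q \<times> Q. f (?h p))"
    unfolding sum.cartesian_product by (rule sum.cong) auto
  also have "\<dots> = (\<Sum>g\<in>?h ` (Q \<times> Q). \<Sum>p\<in>{p \<in> Q \<times> Q. ?h p = g}. f (?h p))"
    by (rule sum.image_gen) (simp add: finite_Q)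
  also have "\<dots> = (\<Sum>g\<in>?h ` (Q \<times> Q). int (card (stab s)) * f g)"
  proof (rule sum.cong[OF refl])
    fix g assume "g \<in> ?h ` (Q \<times> Q)"
    then obtain x y where xy: "x \<in> Q" "y \<in> Q" "g = x * \<sigma> s * y" by auto
    have "{p \<in> Q \<times> Q. ?h p = g} = {(x', y') \<in> Q \<times> Q. x' * \<sigma> s * y' = x * \<sigma> s * y}"
      unfolding xy(3) by auto
    then have fib: "card {p \<in> Q \<times> Q. ?h p = g} = card (stab s)"
      using double_coset_fibre[OF s xy(1,2)] by simp
    have "(\<Sum>p\<in>{p \<in> Q \<times> Q. ?h p = g}. f (?h p)) = (\<Sum>p\<in>{p \<in> Q \<times> Q. ?h p = g}. f g)"
      by (rule sum.cong) auto
    also have "\<dots> = int (card (stab s)) * f g" unfolding sum_constant fib ..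
    finally show "(\<Sum>p\<in>{p \<in> Q \<times> Q. ?h p = g}. f (?h p)) = int (card (stab s)) * f g" .
  qed
  finally show ?thesis unfolding double_coset_eq sum_distrib_left .
qed

text \<open>Taking \<open>R = 1\<close> or \<open>R = \<rho>\<close> covers all the double cosets of the statement.\<close>

lemma double_coset_trace_sum:
  assumes s: "s \<le> m" and R: "R \<in> carrier_mat N N" "R * R = 1\<^sub>m N" "\<And>g. g \<in> Q \<Longrightarrow> R * g * R \<in> Q"
  shows "int (card (stab s)) * (\<Sum>g\<in>(\<lambda>g. R * g) ` double_coset Q (\<sigma> s) Q. \<chi> (a * mat_trace g))
     = int (card Q) * (\<Sum>w\<in>Q. \<chi> (a * mat_trace (R * w * \<sigma> s)))"
    and "card (stab s) * card ((\<lambda>g. R * g) ` double_coset Q (\<sigma> s) Q) = card Q * card Q"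
proof -
  let ?D = "double_coset Q (\<sigma> s) Q" and ?S = "\<sigma> s"
  have Dc: "g \<in> carrier_mat N N" if gD: "g \<in> ?D" for g
  proof -
    obtain x y where xy: "g = x * ?S * y" "x \<in> Q" "y \<in> Q" using gD unfolding double_coset_def by blast
    show ?thesis unfolding xy(1) by (rule multN[OF multN[OF Q_carrier[OF xy(2)] sigma_carrier] Q_carrier[OF xy(3)]])
  qed
  have inj: "inj_on (\<lambda>g. R * g) ?D"
  proof (rule inj_onI)
    fix g g' assume g: "g \<in> ?D" "g' \<in> ?D" "R * g = R * g'"
    have "det R * det R = 1" using arg_cong[OF R(2), of det] det_mult[OF R(1) R(1)] by simp
    then have "R \<in> GL N" using R(1) by (auto simp: GL_iff)
    then show "g = g'" by (rule GL_mult_cancel[OF _ Dc[OF g(1)] Dc[OF g(2)] g(3)])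
  qed
  \<comment> \<open>Cyclicity of the trace moves y to the left, and inserting R R = 1 makes it R y
    R, an element of Q. For fixed y the product (R y R) x runs through Q along with x, so y
    contributes only the factor card Q.\<close>
  have tr: "mat_trace (R * (x * ?S * y)) = mat_trace (R * ((R * y * R) * x) * ?S)" if xy: "x \<in> Q" "y \<in> Q" for x y
  proof -
    have c: "x \<in> carrier_mat N N" "y \<in> carrier_mat N N" "?S \<in> carrier_mat N N" using xy Q_carrier by auto
    have "mat_trace (R * (x * ?S * y)) = mat_trace ((R * (x * ?S)) * y)" by (simp only: assocN multN R(1) c)
    also have "\<dots> = mat_trace (y * (R * (x * ?S)))" by (rule mat_trace_mult_commute[OF multN[OF R(1) multN[OF c(1,3)]] c(2)])
    also have "y * (R * (x * ?S)) = (R * R) * (y * (R * (x * ?S)))" 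
      unfolding R(2) by (rule left_mult_one_mat[symmetric, of _ N N]) (intro multN c R(1))
    also have "\<dots> = R * ((R * y * R) * x) * ?S" by (simp only: assocN multN R(1) c)
    finally show ?thesis .
  qed
  have "int (card (stab s)) * (\<Sum>g\<in>(\<lambda>g. R * g) ` ?D. \<chi> (a * mat_trace g)) = int (card (stab s)) * (\<Sum>g\<in>?D. \<chi> (a * mat_trace (R * g)))"
    by (simp add: sum.reindex[OF inj])
  also have "\<dots> = (\<Sum>x\<in>Q. \<Sum>y\<in>Q. \<chi> (a * mat_trace (R * (x * ?S * y))))"
    by (rule double_coset_sum[OF s, symmetric])
  also have "\<dots> = (\<Sum>y\<in>Q. \<Sum>x\<in>Q. \<chi> (a * mat_trace (R * ((R * y * R) * x) * ?S)))"
    by (subst sum.swap) (intro sum.cong refl, simp only: tr)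
  also have "\<dots> = (\<Sum>y\<in>Q. \<Sum>w\<in>Q. \<chi> (a * mat_trace (R * w * ?S)))"
  proof (rule sum.cong[OF refl])
    fix y assume "y \<in> Q"
    then show "(\<Sum>x\<in>Q. \<chi> (a * mat_trace (R * ((R * y * R) * x) * ?S))) = (\<Sum>w\<in>Q. \<chi> (a * mat_trace (R * w * ?S)))"
      by (rule sum.reindex_bij_betw[OF left_mult_Q[OF R(3)], of y "\<lambda>w. \<chi> (a * mat_trace (R * w * ?S))"])
  qed
  finally show "int (card (stab s)) * (\<Sum>g\<in>(\<lambda>g. R * g) ` ?D. \<chi> (a * mat_trace g)) = int (card Q) * (\<Sum>w\<in>Q. \<chi> (a * mat_trace (R * w * ?S)))"
    by simp
  have "int (card Q) * int (card Q) = int (card (stab s)) * int (card ?D)"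
    using double_coset_sum[OF s, of "\<lambda>_. 1"] by simp
  then have "int (card Q * card Q) = int (card (stab s) * card ?D)" by simp
  then have "card Q * card Q = card (stab s) * card ?D" by (simp only: of_nat_eq_iff)
  then show "card (stab s) * card ((\<lambda>g. R * g) ` ?D) = card Q * card Q" by (simp add: card_image[OF inj])
qed

end

context minus_form
begin

section \<open>Exponential sums over small general linear groups\<close>

definition KGL :: "nat \<Rightarrow> 'a \<Rightarrow> int" where
  "KGL t a = (\<Sum>A\<in>GL t. \<chi> (a * (\<Sum>k<t. A $$ (k, k) + minv A $$ (k, k))))"

lemma KGL_0: "KGL 0 a = 1"
  using card_GL_0[where 'b = 'a] by (simp add: KGL_def)

lemma KGL_1:
  assumes "a \<noteq> 0"
  shows "KGL 1 a = K a"
proof -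
  have b: "bij_betw (\<lambda>x. mat 1 1 (\<lambda>_. x)) (UNIV - {0}) (GL 1 :: 'a mat set)"
  proof (rule bij_betw_byWitness[where f' = "\<lambda>A. A $$ (0, 0)"])
    have det1: "det A = A $$ (0, 0)" if "A \<in> carrier_mat 1 1" for A :: "'a mat" using det_single[OF that] .
    show "\<forall>A\<in>GL 1. mat 1 1 (\<lambda>_. A $$ (0, 0)) = (A :: 'a mat)"
      by (auto simp: GL_iff intro!: eq_matI)
    show "(\<lambda>x. mat 1 1 (\<lambda>_. x)) ` (UNIV - {0}) \<subseteq> (GL 1 :: 'a mat set)"
      by (auto simp: GL_iff det1)
    show "(\<lambda>A. A $$ (0, 0)) ` (GL 1 :: 'a mat set) \<subseteq> UNIV - {0}"
      using det1 by (auto simp: GL_iff)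
  qed simp
  have inv: "minv (mat 1 1 (\<lambda>_. x)) = mat 1 1 (\<lambda>_. inverse x)" if x: "x \<noteq> 0" for x :: 'a
  proof (rule minv_unique[of _ 1])
    show "mat 1 1 (\<lambda>_. x) \<in> GL 1" using b x unfolding bij_betw_def by blast
    show "mat 1 1 (\<lambda>_. x) * mat 1 1 (\<lambda>_. inverse x) = 1\<^sub>m 1"
      using x by (intro eq_matI) (auto simp: scalar_prod_def)
  qed simp
  have "KGL 1 a = (\<Sum>x\<in>UNIV - {0}. \<chi> (a * (x + inverse x)))"
    unfolding KGL_def sum.reindex_bij_betw[OF b, symmetric] by (intro sum.cong) (auto simp: inv[unfolded One_nat_def])
  then show ?thesis using kloosterman_scaled[OF assms] by simp
qed

definition mat2 :: "'a \<Rightarrow> 'a \<Rightarrow> 'a \<Rightarrow> 'a \<Rightarrow> 'a mat" where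
  "mat2 x y z w = mat 2 2 (\<lambda>(i, j). if i = 0 then (if j = 0 then x else y) else (if j = 0 then z else w))"

lemma mat2_simps [simp]:
  "mat2 x y z w \<in> carrier_mat 2 2"
  "mat2 x y z w $$ (0, 0) = x" "mat2 x y z w $$ (0, Suc 0) = y"
  "mat2 x y z w $$ (Suc 0, 0) = z" "mat2 x y z w $$ (Suc 0, Suc 0) = w"
  by (simp_all add: mat2_def)

lemma det_mat2: "A \<in> carrier_mat 2 2 \<Longrightarrow> det A = A $$ (0, 0) * A $$ (Suc 0, Suc 0) + A $$ (0, Suc 0) * A $$ (Suc 0, 0)" for A :: "'a mat"
proof -
  assume A: "A \<in> carrier_mat 2 2"
  have "det A = (\<Sum>i<2. A $$ (i, 0) * cofactor A i 0)" by (rule laplace_expansion_column[OF A]) simp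
  also have "\<dots> = A $$ (0, 0) * cofactor A 0 0 + A $$ (Suc 0, 0) * cofactor A (Suc 0) 0" by (rule sum_2)
  also have "cofactor A 0 0 = A $$ (Suc 0, Suc 0)"
    unfolding cofactor_def using A by (subst det_single) (auto simp: mat_delete_def)
  also have "cofactor A (Suc 0) 0 = A $$ (0, Suc 0)"
    unfolding cofactor_def using A by (subst det_single) (auto simp: mat_delete_def uminus_self)
  finally show ?thesis by (simp add: mult.commute)
qed

lemma minv_mat2:
  assumes "x * w + y * z \<noteq> 0"
  defines "d \<equiv> inverse (x * w + y * z)"
  shows "minv (mat2 x y z w) = mat2 (w * d) (y * d) (z * d) (x * d)"
proof (rule minv_unique[of _ 2])
  show "mat2 x y z w \<in> GL 2" using assms by (simp add: GL_iff det_mat2)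
  have d: "(x * w + y * z) * d = 1" using assms by simp
  then have d': "x * (w * d) + y * (z * d) = 1" "z * (y * d) + w * (x * d) = 1" by (simp_all add: algebra_simps)
  show "mat2 x y z w * mat2 (w * d) (y * d) (z * d) (x * d) = 1\<^sub>m 2"
    by (rule mat2_eqI)
       (use d' in \<open>auto simp: mult_mat_index[of _ 2 2 _ 2] sum_2 algebra_simps char2 simp del: index_mult_mat(1) intro!: mult_carrier_mat[of _ 2 2 _ 2]\<close>)
qed simp

lemma card_prod_eq: "int (card {(y, z). y * z = (c::'a)}) = (if c = 0 then 2 * int q - 1 else int q - 1)"
proof (cases "c = 0")
  case True
  have "{(y, z). y * z = (0::'a)} = ({0} \<times> UNIV) \<union> ((UNIV - {0}) \<times> {0})" by auto
  then have "card {(y, z). y * z = (0::'a)} = card (({0::'a} \<times> (UNIV :: 'a set)) \<union> ((UNIV - {0}) \<times> {0}))" by (simp only:)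
  also have "\<dots> = card ({0::'a} \<times> (UNIV :: 'a set)) + card ((UNIV - {0::'a}) \<times> {0::'a})"
    by (rule card_Un_disjoint) auto
  also have "\<dots> = q + (q - 1)"
    unfolding card_cartesian_product card_nz card_UNIV by simp
  finally have "card {(y, z). y * z = (0::'a)} = q + (q - 1)" .
  then show ?thesis using True q_ge_2 by simp
next
  case False
  have "card {(y, z). y * z = c} = card (UNIV - {0::'a})"
  proof (rule bij_betw_same_card[of fst], rule bij_betw_byWitness[where f' = "\<lambda>y. (y, c / y)"])
  qed (use False in auto)
  then show ?thesis using False q_ge_2 by (simp add: card_nz)
qed

text \<open>With diagonal x, w and determinant d, the trace of a matrix plus its inverse is (x +
  w)(1 + 1/d). The number of off-diagonal pairs, those with y z = x w + d, is q - 1, plus q if d = x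
  w. In the first part the sums over x and w force d = 1 and give q^2; in the second (x + w)(1 +
  1/(x w)) separates into x + 1/x and w + 1/w and gives (K a)^2.\<close>

lemma KGL_2:
  assumes "a \<noteq> 0"
  shows "KGL 2 a = int q * (K a)\<^sup>2 + int q ^ 2 * (int q - 1)"
proof -
  let ?X = "{(x, w, y, z). x * w + y * z \<noteq> (0::'a)}"
  have b: "bij_betw (\<lambda>(x, w, y, z). mat2 x y z w) ?X (GL 2)"
  proof (rule bij_betw_byWitness[where f' = "\<lambda>A. (A $$ (0, 0), A $$ (Suc 0, Suc 0), A $$ (0, Suc 0), A $$ (Suc 0, 0))"])
    show "\<forall>A\<in>GL 2. (\<lambda>(x, w, y, z). mat2 x y z w) (A $$ (0, 0), A $$ (Suc 0, Suc 0), A $$ (0, Suc 0), A $$ (Suc 0, 0)) = A"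
      by (auto simp: GL_iff intro!: mat2_eqI)
    show "(\<lambda>(x, w, y, z). mat2 x y z w) ` ?X \<subseteq> GL 2" by (auto simp: GL_iff det_mat2)
    show "(\<lambda>A. (A $$ (0, 0), A $$ (Suc 0, Suc 0), A $$ (0, Suc 0), A $$ (Suc 0, 0))) ` GL 2 \<subseteq> ?X"
      by (auto simp: GL_iff det_mat2)
  qed auto
  let ?g = "\<lambda>x w d. \<chi> (a * ((x + w) * (1 + inverse d)))"
  have "KGL 2 a = (\<Sum>(x, w, y, z)\<in>?X. ?g x w (x * w + y * z))"
    unfolding KGL_def sum.reindex_bij_betw[OF b, symmetric]
    by (intro sum.cong) (auto simp: minv_mat2 sum_2 algebra_simps)
  also have "\<dots> = (\<Sum>(x, w, y, z)\<in>UNIV. if x * w + y * z = 0 then 0 else ?g x w (x * w + y * z))"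
    by (rule sum.mono_neutral_cong_left) auto
  also have "\<dots> = (\<Sum>x\<in>UNIV. \<Sum>w\<in>UNIV. \<Sum>(y, z)\<in>UNIV. if x * w + y * z = 0 then 0 else ?g x w (x * w + y * z))"
    by (simp add: sum.cartesian_product case_prod_unfold)
  also have "\<dots> = (\<Sum>x\<in>UNIV. \<Sum>w\<in>UNIV. \<Sum>d\<in>UNIV - {0}. int (card {(y, z). y * z = x * w + d}) * ?g x w d)"
  proof (intro sum.cong refl)
    fix x w :: 'a
    let ?f = "\<lambda>d. if d = 0 then 0 else ?g x w d"
    have "(\<Sum>(y, z)\<in>UNIV. if x * w + y * z = 0 then 0 else ?g x w (x * w + y * z)) = (\<Sum>p\<in>UNIV. ?f (x * w + fst p * snd p))"
      by (rule sum.cong) auto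
    also have "\<dots> = (\<Sum>d\<in>UNIV. \<Sum>p\<in>{p. x * w + fst p * snd p = d}. ?f (x * w + fst p * snd p))"
      using sum.group[of "UNIV :: ('a \<times> 'a) set" UNIV "\<lambda>p. x * w + fst p * snd p" "\<lambda>p. ?f (x * w + fst p * snd p)"] by simp
    also have "\<dots> = (\<Sum>d\<in>UNIV. int (card {p. x * w + fst p * snd p = d}) * ?f d)"
      by (rule sum.cong) auto
    also have "\<dots> = (\<Sum>d\<in>UNIV - {0}. int (card {(y, z). y * z = x * w + d}) * ?g x w d)"
    proof (rule sum.mono_neutral_cong_right)
      fix d :: 'a assume "d \<in> UNIV - {0}"
      have eqv: "x * w + c = d \<longleftrightarrow> c = x * w + d" for c by (metis add_left_self)
      have "{p. x * w + fst p * snd p = d} = {(y, z). y * z = x * w + d}"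
        unfolding case_prod_unfold by (rule Collect_cong) (rule eqv)
      then show "int (card {p. x * w + fst p * snd p = d}) * ?f d = int (card {(y, z). y * z = x * w + d}) * ?g x w d"
        using \<open>d \<in> UNIV - {0}\<close> by simp
    qed auto
    finally show "(\<Sum>(y, z)\<in>UNIV. if x * w + y * z = 0 then 0 else ?g x w (x * w + y * z)) = (\<Sum>d\<in>UNIV - {0}. int (card {(y, z). y * z = x * w + d}) * ?g x w d)" .
  qed
  also have "\<dots> = (\<Sum>x\<in>UNIV. \<Sum>w\<in>UNIV. \<Sum>d\<in>UNIV - {0}. (int q - 1) * ?g x w d + (if d = x * w then int q * ?g x w d else 0))"
    by (intro sum.cong refl) (auto simp: card_prod_eq add_eq_0 algebra_simps add_self)
  also have "\<dots> = (int q - 1) * (\<Sum>x\<in>UNIV. \<Sum>w\<in>UNIV. \<Sum>d\<in>UNIV - {0}. ?g x w d)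
     + (\<Sum>x\<in>UNIV. \<Sum>w\<in>UNIV. \<Sum>d\<in>UNIV - {0}. if d = x * w then int q * ?g x w d else 0)"
    by (simp add: sum.distrib sum_distrib_left)
  also have "(\<Sum>x\<in>UNIV. \<Sum>w\<in>UNIV. \<Sum>d\<in>UNIV - {0}. ?g x w d) = int q ^ 2"
  proof -
    have "(\<Sum>x\<in>UNIV. \<Sum>w\<in>UNIV. \<Sum>d\<in>UNIV - {0}. ?g x w d)
      = (\<Sum>d\<in>UNIV - {0}. \<Sum>x\<in>UNIV. \<Sum>w\<in>UNIV. ?g x w d)"
      by (subst sum.swap, subst (2) sum.swap) (rule refl)
    also have "\<dots> = (\<Sum>d\<in>UNIV - {0}. (\<Sum>x\<in>UNIV. \<chi> (a * (1 + inverse d) * x)) * (\<Sum>w\<in>UNIV. \<chi> (a * (1 + inverse d) * w)))"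
      unfolding sum_product by (intro sum.cong refl) (simp add: lam_add[symmetric] algebra_simps)
    also have "\<dots> = (\<Sum>d\<in>UNIV - {0 :: 'a}. if d = 1 then int q ^ 2 else 0)"
    proof (rule sum.cong[OF refl])
      fix d :: 'a assume d: "d \<in> UNIV - {0}"
      have "a * (1 + inverse d) = 0 \<longleftrightarrow> d = 1" using assms d add_eq_0[of 1 "inverse d"] by auto
      then show "(\<Sum>x\<in>UNIV. \<chi> (a * (1 + inverse d) * x)) * (\<Sum>w\<in>UNIV. \<chi> (a * (1 + inverse d) * w)) = (if d = 1 then int q ^ 2 else 0)"
        unfolding sum_lam by (simp add: power2_eq_square)
    qed
    also have "\<dots> = int q ^ 2" by simp
    finally show ?thesis .
  qed
  also have "(\<Sum>x\<in>UNIV. \<Sum>w\<in>UNIV. \<Sum>d\<in>UNIV - {0}. if d = x * w then int q * ?g x w d else 0)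
     = int q * (K a)\<^sup>2"
  proof -
    have "(\<Sum>x\<in>UNIV. \<Sum>w\<in>UNIV. \<Sum>d\<in>UNIV - {0}. if d = x * w then int q * ?g x w d else 0)
       = (\<Sum>x\<in>UNIV. \<Sum>w\<in>UNIV. if x * w \<noteq> 0 then int q * ?g x w (x * w) else 0)"
      by (intro sum.cong refl) (subst sum.delta, auto)
    also have "\<dots> = (\<Sum>x\<in>UNIV - {0}. \<Sum>w\<in>UNIV. if x * w \<noteq> 0 then int q * ?g x w (x * w) else 0)"
      by (rule sum.mono_neutral_right) auto
    also have "\<dots> = (\<Sum>x\<in>UNIV - {0}. \<Sum>w\<in>UNIV - {0}. int q * (\<chi> (a * (x + inverse x)) * \<chi> (a * (w + inverse w))))"
    proof (intro sum.cong[OF refl] sum.mono_neutral_cong_right)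
      fix x w :: 'a assume xw: "x \<in> UNIV - {0}" "w \<in> UNIV - {0}"
      then have "(x + w) * (1 + inverse (x * w)) = (x + inverse x) + (w + inverse w)"
        by (simp add: field_simps)
      then show "(if x * w \<noteq> 0 then int q * ?g x w (x * w) else 0) = int q * (\<chi> (a * (x + inverse x)) * \<chi> (a * (w + inverse w)))"
        using xw by (simp add: lam_add[symmetric] distrib_left[symmetric])
    qed auto
    also have "\<dots> = int q * (K a)\<^sup>2"
      unfolding power2_eq_square kloosterman_scaled[OF assms, symmetric] sum_product
      by (simp only: sum_distrib_left)
    finally show ?thesis .
  qed
  finally show ?thesis by (simp add: algebra_simps)
qed

section \<open>The anisotropic torus\<close>

text \<open>The trace of \<open>so2 d1 d2\<close> is d2, so functions of d2 suffice. For d2 = d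
  nonzero, v = d1/d satisfies v^2 + v = \<kappa> + 1/d^2, and \<chi> \<kappa> = -1 turns the
  Artin-Schreier count into 1 - \<chi> (1/d).\<close>

lemma sum_SO2:
  fixes f :: "'a \<Rightarrow> int"
  shows "(\<Sum>(d1, d2)\<in>SO2. f d2) = f 0 + (\<Sum>d\<in>UNIV - {0}. (1 - \<chi> (inverse d)) * f d)"
proof -
  have cnt: "int (card {d1. (d1, d) \<in> SO2}) = (if d = 0 then 1 else 1 - \<chi> (inverse d))" for d
  proof (cases "d = 0")
    case True
    have "{d1. (d1, 0) \<in> SO2} = {1}" using sq_inj[of _ 1] by (auto simp: SO2_def)
    then show ?thesis using True by simp
  next
    case False
    have "card {d1. (d1, d) \<in> SO2} = card {v. v\<^sup>2 + v = \<kappa> + (inverse d)\<^sup>2}"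
    proof (rule bij_betw_same_card[of "\<lambda>d1. d1 / d"], rule bij_betw_byWitness[where f' = "\<lambda>v. v * d"])
      have eq: "(v * d)\<^sup>2 + v * d * d + \<kappa> * d\<^sup>2 = 1 \<longleftrightarrow> v\<^sup>2 + v = \<kappa> + (inverse d)\<^sup>2" for v
      proof -
        have "(v * d)\<^sup>2 + v * d * d + \<kappa> * d\<^sup>2 = (v\<^sup>2 + v + \<kappa>) * d\<^sup>2" by (simp add: power2_eq_square algebra_simps)
        moreover have "(v\<^sup>2 + v + \<kappa>) * d\<^sup>2 = 1 \<longleftrightarrow> v\<^sup>2 + v + \<kappa> = (inverse d)\<^sup>2"
          using False by (simp add: field_simps)
        moreover have "v\<^sup>2 + v + \<kappa> = (inverse d)\<^sup>2 \<longleftrightarrow> v\<^sup>2 + v = \<kappa> + (inverse d)\<^sup>2"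
          by (metis add.commute add_left_self)
        ultimately show ?thesis by simp
      qed
      show "(\<lambda>v. v * d) ` {v. v\<^sup>2 + v = \<kappa> + (inverse d)\<^sup>2} \<subseteq> {d1. (d1, d) \<in> SO2}"
        using eq by (auto simp: SO2_def)
      show "(\<lambda>d1. d1 / d) ` {d1. (d1, d) \<in> SO2} \<subseteq> {v. v\<^sup>2 + v = \<kappa> + (inverse d)\<^sup>2}"
      proof (rule image_subsetI)
        fix d1 assume "d1 \<in> {d1. (d1, d) \<in> SO2}"
        then show "d1 / d \<in> {v. v\<^sup>2 + v = \<kappa> + (inverse d)\<^sup>2}" using eq[of "d1 / d"] False by (simp add: SO2_def)
      qed
    qed (use False in auto)
    then show ?thesis using False card_artin_schreier[of "\<kappa> + (inverse d)\<^sup>2"] lam_kappa by (simp add: lam_add lam_sq)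
  qed
  have "(\<Sum>(d1, d2)\<in>SO2. f d2) = (\<Sum>p\<in>SO2. f (snd p))" by (rule sum.cong) auto
  also have "\<dots> = (\<Sum>d\<in>UNIV. \<Sum>p\<in>{p \<in> SO2. snd p = d}. f (snd p))"
    using sum.group[of SO2 UNIV snd "\<lambda>p. f (snd p)"] by simp
  also have "\<dots> = (\<Sum>d\<in>UNIV. int (card {d1. (d1, d) \<in> SO2}) * f d)"
  proof (rule sum.cong[OF refl])
    fix d
    have "{p \<in> SO2. snd p = d} = (\<lambda>d1. (d1, d)) ` {d1. (d1, d) \<in> SO2}" by auto
    then have "card {p \<in> SO2. snd p = d} = card {d1. (d1, d) \<in> SO2}" by (simp add: card_image inj_on_def)
    moreover have "(\<Sum>p\<in>{p \<in> SO2. snd p = d}. f (snd p)) = (\<Sum>p\<in>{p \<in> SO2. snd p = d}. f d)" by (rule sum.cong) auto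
    ultimately show "(\<Sum>p\<in>{p \<in> SO2. snd p = d}. f (snd p)) = int (card {d1. (d1, d) \<in> SO2}) * f d" by simp
  qed
  also have "\<dots> = f 0 + (\<Sum>d\<in>UNIV - {0}. (1 - \<chi> (inverse d)) * f d)"
    unfolding cnt by (subst sum.remove[of _ 0]) (auto intro!: sum.cong)
  finally show ?thesis .
qed

lemma sum_lam_inverse: "(\<Sum>d\<in>UNIV - {0}. \<chi> (inverse d)) = - 1"
  using sum_nz_reindex_inverse[of 1 \<chi>] sum_lam_nz' by simp

lemma card_SO2: "int (card SO2) = int q + 1"
proof -
  have "int (card SO2) = (\<Sum>(d1, d2)\<in>SO2. 1)" by simp
  also have "\<dots> = int q + 1"
    using sum_SO2[of "\<lambda>_. 1"] sum_lam_inverse q_ge_2 by (simp add: sum_subtractf card_nz)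
  finally show ?thesis .
qed

lemma sum_lam_SO2:
  assumes "a \<noteq> 0"
  shows "(\<Sum>(d1, d2)\<in>SO2. \<chi> (a * d2)) = - K a"
proof -
  have "(\<Sum>(d1, d2)\<in>SO2. \<chi> (a * d2)) = 1 + (\<Sum>d\<in>UNIV - {0}. \<chi> (a * d) - \<chi> (a * d + inverse d))"
    unfolding sum_SO2 by (simp add: lam_add algebra_simps)
  then show ?thesis unfolding sum_subtractf kloosterman_scaled'[OF assms] sum_lam_nz using assms by simp
qed

section \<open>Summation over alternating matrices and over h\<close>

lemma quad_diag:
  fixes A :: "'a mat"
  assumes "\<And>k j. k < s \<Longrightarrow> j < s \<Longrightarrow> A $$ (k, j) = A $$ (j, k)"
  shows "(\<Sum>k<s. \<Sum>j<s. A $$ (k, j) * (u k * u j)) = (\<Sum>k<s. A $$ (k, k) * (u k)\<^sup>2)"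
proof -
  have off: "(\<Sum>(k, j)\<in>{..<s} \<times> {..<s}. if k = j then 0 else A $$ (k, j) * (u k * u j)) = 0"
    by (rule sum_involution[where \<iota> = "\<lambda>(k, j). (j, k)"]) (use assms in \<open>auto simp: mult_ac\<close>)
  have off': "(\<Sum>k<s. \<Sum>j<s. if k = j then 0 else A $$ (k, j) * (u k * u j)) = 0"
    unfolding sum.cartesian_product by (rule off)
  have "(\<Sum>k<s. \<Sum>j<s. A $$ (k, j) * (u k * u j)) = (\<Sum>k<s. \<Sum>j<s. (if j = k then A $$ (k, k) * (u k)\<^sup>2 else 0) + (if k = j then 0 else A $$ (k, j) * (u k * u j)))"
    by (intro sum.cong refl) (auto simp: power2_eq_square)
  also have "\<dots> = (\<Sum>k<s. \<Sum>j<s. (if j = k then A $$ (k, k) * (u k)\<^sup>2 else 0))"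
    unfolding sum.distrib off' by (rule add_0_right)
  also have "\<dots> = (\<Sum>k<s. A $$ (k, k) * (u k)\<^sup>2)" by (intro sum.cong refl) (simp add: sum.delta)
  finally show ?thesis .
qed

lemma alt_pairing:
  fixes A T :: "'a mat"
  assumes "\<And>k j. k < s \<Longrightarrow> j < s \<Longrightarrow> A $$ (k, j) = A $$ (j, k)"
    and "\<And>k j. k < s \<Longrightarrow> j < s \<Longrightarrow> T $$ (k, j) = T $$ (j, k)" "\<And>k. k < s \<Longrightarrow> T $$ (k, k) = 0"
  shows "(\<Sum>k<s. \<Sum>j<s. A $$ (k, j) * T $$ (j, k)) = 0"
proof -
  have "(\<Sum>(k, j)\<in>{..<s} \<times> {..<s}. A $$ (k, j) * T $$ (j, k)) = 0"
    by (rule sum_involution[where \<iota> = "\<lambda>(k, j). (j, k)"]) (use assms in auto)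
  then show ?thesis by (simp add: sum.cartesian_product)
qed

text \<open>The first s rows of A form a symmetric block followed by zeros. This describes exactly
  the A whose first s rows pair to zero with every alternating matrix.\<close>

definition sym_tri :: "nat \<Rightarrow> 'a mat \<Rightarrow> bool" where
  "sym_tri s A \<longleftrightarrow> (\<forall>k<s. \<forall>j<s. A $$ (k, j) = A $$ (j, k)) \<and> (\<forall>k<s. \<forall>j. s \<le> j \<longrightarrow> j < m \<longrightarrow> A $$ (k, j) = 0)"

lemma sum_sym_tri:
  assumes "s \<le> m" "sym_tri s A"
  shows "(\<Sum>k<s. \<Sum>j<m. A $$ (k, j) * f k j) = (\<Sum>k<s. \<Sum>j<s. A $$ (k, j) * f k j)"
  by (intro sum.cong refl sum.mono_neutral_right) (use assms in \<open>auto simp: sym_tri_def\<close>)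

text \<open>The summand is a character of the additive group of alternating matrices. It is trivial
  if \<open>sym_tri s A\<close> holds, and otherwise some T0 with a single pair of nonzero entries
  gives it the value -1; adding T0 then flips the sign of the whole sum.\<close>

lemma sum_alt_mats:
  assumes "s \<le> m" "a \<noteq> 0"
  shows "(\<Sum>T\<in>alt_mats m 0. \<chi> (a * (\<Sum>k<s. \<Sum>j<m. A $$ (k, j) * T $$ (j, k)))) = (if sym_tri s A then int q ^ (\<Sum>j<m. j) else 0)"
    (is "(\<Sum>T\<in>_. \<chi> (a * ?l T)) = _")
proof -
  have altD: "T \<in> carrier_mat m m" "k < m \<Longrightarrow> T $$ (k, k) = 0" "k < m \<Longrightarrow> j < m \<Longrightarrow> T $$ (k, j) = T $$ (j, k)"
    if "T \<in> alt_mats m 0" for T :: "'a mat" and k j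
    using that alternating_mat_iff[of T m] by (auto simp: alt_mats_def)
  show ?thesis
  proof (cases "sym_tri s A")
    case True
    have "?l T = 0" if T: "T \<in> alt_mats m 0" for T
      unfolding sum_sym_tri[OF assms(1) True]
      by (rule alt_pairing) (use True assms(1) altD[OF T] in \<open>auto simp: sym_tri_def\<close>)
    then have "(\<Sum>T\<in>alt_mats m 0. \<chi> (a * ?l T)) = int (card (alt_mats m 0 :: 'a mat set))" by simp
    then show ?thesis using True card_alt_mats[of 0 m, where 'b = 'a] by (simp add: card_UNIV lessThan_atLeast0)
  next
    case False
    \<comment> \<open>c is the coefficient with which the entry of T at the places (k0, j0) and (j0,
      k0) enters the pairing; the second place is seen only if j0 is also among the first s
      rows.\<close>
    obtain k0 j0 c where kj: "k0 < s" "j0 < m" "k0 \<noteq> j0" "c \<noteq> 0"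
      and c: "c = A $$ (k0, j0) + (if j0 < s then A $$ (j0, k0) else 0)"
    proof -
      from False consider k j where "k < s" "j < s" "A $$ (k, j) \<noteq> A $$ (j, k)" | k j where "k < s" "s \<le> j" "j < m" "A $$ (k, j) \<noteq> 0"
        unfolding sym_tri_def by blast
      then show ?thesis
      proof cases
        case (1 k j)
        have nz: "A $$ (k, j) + A $$ (j, k) \<noteq> 0" using 1(3) add_eq_0[of "A $$ (k, j)" "A $$ (j, k)"] by metis
        have "k \<noteq> j" using 1(3) by metis
        moreover have "j < m" using 1(2) assms(1) by linarith
        moreover have "A $$ (k, j) + A $$ (j, k) = A $$ (k, j) + (if j < s then A $$ (j, k) else 0)" using 1(2) by metis
        ultimately show ?thesis using that[OF 1(1) _ _ nz] by metis
      next
        case (2 k j)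
        have "k \<noteq> j" using 2(1,2) by linarith
        moreover have "A $$ (k, j) = A $$ (k, j) + (if j < s then A $$ (j, k) else 0)" using 2(2) by simp
        ultimately show ?thesis using that[OF 2(1,3) _ 2(4)] by metis
      qed
    qed
    have "a * c \<noteq> 0" using assms kj by simp
    then obtain x where x: "\<chi> (a * c * x) = - 1" using lam_mult_nontrivial by blast
    define T0 where "T0 = mat m m (\<lambda>(i, j). if i = k0 \<and> j = j0 \<or> i = j0 \<and> j = k0 then x else 0)"
    have T0: "T0 \<in> alt_mats m 0"
      unfolding alt_mats_def using alternating_mat_iff[of T0 m] kj(3) by (auto simp: T0_def)
    have add: "T + T' \<in> alt_mats m 0" if "T \<in> alt_mats m 0" "T' \<in> alt_mats m 0" for T T' :: "'a mat"
    proof -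
      have c: "T + T' \<in> carrier_mat m m" using altD(1)[OF that(1)] altD(1)[OF that(2)] by simp
      show ?thesis unfolding alt_mats_def using c alternating_mat_iff[OF c] altD[OF that(1)] altD[OF that(2)] by auto
    qed
    have T00: "T + T0 + T0 = T" if T: "T \<in> alt_mats m 0" for T
      using altD(1)[OF T] by (intro eq_matI) (auto simp: T0_def add.assoc add_self)
    have lT0: "?l T0 = c * x"
    proof -
      have k0m: "k0 < m" using kj assms by simp
      have "?l T0 = (\<Sum>k<s. \<Sum>j<m. (if j = j0 then if k = k0 then A $$ (k0, j0) * x else 0 else 0) + (if j = k0 then if k = j0 then A $$ (j0, k0) * x else 0 else 0))"
        using assms kj by (intro sum.cong refl) (auto simp: T0_def)
      also have "\<dots> = (\<Sum>k<s. (if k = k0 then A $$ (k0, j0) * x else 0) + (if k = j0 then A $$ (j0, k0) * x else 0))"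
        using kj k0m by (simp add: sum.distrib)
      also have "\<dots> = c * x" using kj by (simp add: sum.distrib c distrib_right)
      finally show ?thesis .
    qed
    have lin: "?l (T + T0) = ?l T + ?l T0" if T: "T \<in> alt_mats m 0" for T
    proof -
      have "(T + T0) $$ (j, k) = T $$ (j, k) + T0 $$ (j, k)" if "j < m" "k < m" for j k
        using altD(1)[OF T] altD(1)[OF T0] that by simp
      then show ?thesis unfolding sum.distrib[symmetric] using assms by (intro sum.cong refl) (auto simp: distrib_left)
    qed
    have "(\<Sum>T\<in>alt_mats m 0. \<chi> (a * ?l T)) = (\<Sum>T\<in>alt_mats m 0. \<chi> (a * ?l (T + T0)))"
      by (rule sum.reindex_bij_witness[of _ "\<lambda>T. T + T0" "\<lambda>T. T + T0"]) (auto simp: T00 add T0)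
    also have "\<dots> = (\<Sum>T\<in>alt_mats m 0. - \<chi> (a * ?l T))"
    proof (rule sum.cong[OF refl])
      fix T :: "'a mat" assume T: "T \<in> alt_mats m 0"
      show "\<chi> (a * ?l (T + T0)) = - \<chi> (a * ?l T)"
        unfolding lin[OF T] lT0 using x by (simp add: distrib_left lam_add mult.assoc)
    qed
    finally show ?thesis using False by (simp add: sum_negf)
  qed
qed

lemma sum_lam_vec:
  assumes "s \<le> m"
  shows "(\<Sum>v\<in>carrier_vec m. \<chi> (\<Sum>k<s. c k * v $ k)) = (if \<forall>k<s. c k = 0 then int q ^ m else 0)"
proof (cases "\<forall>k<s. c k = 0")
  case True
  then have "(\<Sum>v\<in>carrier_vec m. \<chi> (\<Sum>k<s. c k * v $ k)) = int (card (carrier_vec m :: 'a vec set))" by simp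
  then show ?thesis using True by (simp add: card_carrier_vec card_UNIV)
next
  case False
  then obtain k0 where k0: "k0 < s" "c k0 \<noteq> 0" by blast
  then obtain x where x: "\<chi> (c k0 * x) = - 1" using lam_mult_nontrivial by blast
  let ?e = "x \<cdot>\<^sub>v unit_vec m k0"
  have "(\<Sum>v\<in>carrier_vec m. \<chi> (\<Sum>k<s. c k * v $ k)) = (\<Sum>v\<in>carrier_vec m. \<chi> (\<Sum>k<s. c k * (v + ?e) $ k))"
  proof (rule sum.reindex_bij_witness[of _ "\<lambda>v. v + ?e" "\<lambda>v. v + ?e"])
    fix v :: "'a vec" assume v: "v \<in> carrier_vec m"
    show e: "v + ?e + ?e = v" "v + ?e + ?e = v" using v by (intro eq_vecI; simp add: add.assoc add_self)+
    show "v + ?e \<in> carrier_vec m" "v + ?e \<in> carrier_vec m" using v by simp_all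
    show "\<chi> (\<Sum>k<s. c k * (v + ?e + ?e) $ k) = \<chi> (\<Sum>k<s. c k * v $ k)" unfolding e(1) ..
  qed
  also have "\<dots> = (\<Sum>v\<in>carrier_vec m. - \<chi> (\<Sum>k<s. c k * v $ k))"
  proof (rule sum.cong[OF refl])
    fix v :: "'a vec" assume v: "v \<in> carrier_vec m"
    have "(\<Sum>k<s. c k * (v + ?e) $ k) = (\<Sum>k<s. c k * v $ k + (if k = k0 then c k0 * x else 0))"
      using v assms k0 by (intro sum.cong refl) (auto simp: distrib_left)
    also have "\<dots> = (\<Sum>k<s. c k * v $ k) + c k0 * x" using k0 by (simp add: sum.distrib)
    finally show "\<chi> (\<Sum>k<s. c k * (v + ?e) $ k) = - \<chi> (\<Sum>k<s. c k * v $ k)" using x by (simp add: lam_add)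
  qed
  finally have "(\<Sum>v\<in>carrier_vec m. \<chi> (\<Sum>k<s. c k * v $ k)) = 0" by (simp add: sum_negf)
  then show ?thesis by (simp only: False if_False)
qed

lemma card_vec_prefix:
  fixes w :: "nat \<Rightarrow> 'a"
  assumes "s \<le> m"
  shows "card {v \<in> carrier_vec m. \<forall>k<s. v $ k = w k} = q ^ (m - s)"
proof -
  have "card {v \<in> carrier_vec m. \<forall>k<s. v $ k = w k} = card (carrier_vec (m - s) :: 'a vec set)"
  proof (rule bij_betw_same_card[of "\<lambda>v. vec (m - s) (\<lambda>k. v $ (s + k))"],
      rule bij_betw_byWitness[where f' = "\<lambda>u. vec m (\<lambda>k. if k < s then w k else u $ (k - s))"])
  qed (use assms in \<open>auto intro!: eq_vecI\<close>)
  then show ?thesis by (simp add: card_carrier_vec card_UNIV)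
qed

text \<open>Let u and v be the rows of h. The off-diagonal part of the quadratic form in u cancels
  by symmetry, and its diagonal part is the square of a linear form, which \<chi> replaces by the
  form itself; so u enters linearly. Summing over u forces the first s coordinates of v to solve a A
  v = b, where the squares of b are a times the diagonal of A. What remains is \<chi> (\<kappa>
  (b.w)^2), and b.w is the parity of s. The count is q^m choices of u and q^(m-s) of v.\<close>

lemma sum_h:
  assumes s: "s \<le> m" and a: "a \<noteq> 0" and A: "sym_tri s A" and A1: "mat s s (\<lambda>(k, j). A $$ (k, j)) \<in> GL s"
  shows "(\<Sum>h\<in>carrier_mat 2 m. \<chi> (a * (\<Sum>k<s. \<Sum>j<m. A $$ (k, j) * dmat h $$ (k, j)))) = (- 1) ^ s * int q ^ (m + (m - s))"
proof -
  let ?A1 = "mat s s (\<lambda>(k, j). A $$ (k, j))"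
  have sym: "A $$ (k, j) = A $$ (j, k)" if "k < s" "j < s" for k j using A that by (simp add: sym_tri_def)
  have A1S: "?A1 \<in> SymGL s" using A1 sym symmetric_index[of ?A1 s] by (auto simp: SymGL_def GL_iff)
  have A1c: "?A1 \<in> carrier_mat s s" "det ?A1 \<noteq> 0" using A1 by (auto simp: GL_iff)
  have "\<forall>k. \<exists>y. y\<^sup>2 = a * A $$ (k, k)" using ex_sqrt by blast
  then obtain b where b: "\<And>k. (b k)\<^sup>2 = a * A $$ (k, k)" by metis
  obtain ra where ra: "ra\<^sup>2 = a" using ex_sqrt by blast
  have ra0: "ra \<noteq> 0" using ra a by auto
  obtain w where w: "\<And>i. i < s \<Longrightarrow> (\<Sum>j<s. ?A1 $$ (i, j) * w j) = b i / a"
    using det_nonzero_solve[OF A1c, of "\<lambda>i. b i / a"] by blast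
  have w': "(\<Sum>j<s. A $$ (i, j) * w j) = b i / a" if "i < s" for i
  proof -
    have "(\<Sum>j<s. A $$ (i, j) * w j) = (\<Sum>j<s. ?A1 $$ (i, j) * w j)" using that by (intro sum.cong) auto
    then show ?thesis using w[OF that] by simp
  qed
  \<comment> \<open>The parity statement asks for square roots of the diagonal of A, whereas b has
    roots of a times the diagonal. Dividing b and multiplying w by the root of a restores its form
    and does not change the product.\<close>
  have par: "(\<Sum>k<s. b k * w k) = of_nat s"
  proof -
    have "(\<Sum>k<s. (b k / ra) * (ra * w k)) = of_nat s"
    proof (rule symmetric_diag_parity[OF A1S])
      fix k assume k: "k < s"
      show "(b k / ra)\<^sup>2 = ?A1 $$ (k, k)" using k b[of k] ra a by (simp add: power_divide)
      have "(\<Sum>j<s. ?A1 $$ (k, j) * (ra * w j)) = ra * (\<Sum>j<s. ?A1 $$ (k, j) * w j)"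
        by (simp add: sum_distrib_left mult_ac)
      also have "\<dots> = b k / ra" unfolding w[OF k] using ra0 by (simp add: ra[symmetric] power2_eq_square)
      finally show "(\<Sum>j<s. ?A1 $$ (k, j) * (ra * w j)) = b k / ra" .
    qed
    moreover have "(b k / ra) * (ra * w k) = b k * w k" for k using ra0 by simp
    ultimately show ?thesis by simp
  qed
  have uniq: "(\<forall>k<s. b k + a * (\<Sum>j<s. A $$ (k, j) * v $ j) = 0) \<longleftrightarrow> (\<forall>k<s. v $ k = w k)" for v :: "'a vec"
  proof
    assume *: "\<forall>k<s. b k + a * (\<Sum>j<s. A $$ (k, j) * v $ j) = 0"
    show "\<forall>k<s. v $ k = w k"
    proof (intro allI impI)
      fix k assume k: "k < s"
      have "v $ k - w k = 0"
      proof (rule det_nonzero_kernel[OF A1c _ k, of "\<lambda>k. v $ k - w k"])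
        fix i assume i: "i < s"
        have "(\<Sum>j<s. ?A1 $$ (i, j) * (v $ j - w j)) = (\<Sum>j<s. A $$ (i, j) * v $ j) - (\<Sum>j<s. A $$ (i, j) * w j)"
          unfolding sum_subtractf[symmetric] using i by (intro sum.cong) (auto simp: right_diff_distrib)
        moreover have "b i = a * (\<Sum>j<s. A $$ (i, j) * v $ j)" using * i add_eq_0 by blast
        then have "(\<Sum>j<s. A $$ (i, j) * v $ j) = b i / a" using a by simp
        ultimately show "(\<Sum>j<s. ?A1 $$ (i, j) * (v $ j - w j)) = 0" using w'[OF i] by simp
      qed
      then show "v $ k = w k" by simp
    qed
  next
    assume "\<forall>k<s. v $ k = w k"
    then have "(\<Sum>j<s. A $$ (k, j) * v $ j) = (\<Sum>j<s. A $$ (k, j) * w j)" for k by (intro sum.cong) auto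
    then show "\<forall>k<s. b k + a * (\<Sum>j<s. A $$ (k, j) * v $ j) = 0" using w' a by (simp add: add_self)
  qed
  let ?H = "\<lambda>(u, v). mat 2 m (\<lambda>(c, l). if c = 0 then u $ l else v $ l) :: 'a mat"
  have bij: "bij_betw ?H (carrier_vec m \<times> carrier_vec m) (carrier_mat 2 m)"
  proof (rule bij_betw_byWitness[where f' = "\<lambda>h. (vec m (\<lambda>l. h $$ (0, l)), vec m (\<lambda>l. h $$ (1, l)))"])
    show "\<forall>h\<in>carrier_mat 2 m. ?H (vec m (\<lambda>l. h $$ (0, l)), vec m (\<lambda>l. h $$ (1, l))) = h"
      by (auto intro!: eq_matI dest!: less_2_cases)
  qed (auto intro!: eq_vecI)
  have val: "\<chi> (a * (\<Sum>k<s. \<Sum>j<m. A $$ (k, j) * dmat (?H (u, v)) $$ (k, j)))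
     = \<chi> (\<kappa> * (\<Sum>k<s. b k * v $ k)\<^sup>2) * \<chi> (\<Sum>k<s. (b k + a * (\<Sum>j<s. A $$ (k, j) * v $ j)) * u $ k)"
    if uv: "u \<in> carrier_vec m" "v \<in> carrier_vec m" for u v
  proof -
    have d: "dmat (?H (u, v)) $$ (k, j) = u $ k * u $ j + u $ k * v $ j + \<kappa> * (v $ k * v $ j)" if "k < m" "j < m" for k j
      using that by (simp add: dmat_def)
    have "(\<Sum>k<s. \<Sum>j<m. A $$ (k, j) * dmat (?H (u, v)) $$ (k, j)) = (\<Sum>k<s. \<Sum>j<s. A $$ (k, j) * dmat (?H (u, v)) $$ (k, j))"
      by (rule sum_sym_tri[OF s A])
    also have "\<dots> = (\<Sum>k<s. \<Sum>j<s. A $$ (k, j) * (u $ k * u $ j) + u $ k * (A $$ (k, j) * v $ j) + \<kappa> * (A $$ (k, j) * (v $ k * v $ j)))"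
    proof (intro sum.cong refl)
      fix k j assume "k \<in> {..<s}" "j \<in> {..<s}"
      then have kj: "k < m" "j < m" using s by auto
      show "A $$ (k, j) * dmat (?H (u, v)) $$ (k, j) = A $$ (k, j) * (u $ k * u $ j) + u $ k * (A $$ (k, j) * v $ j) + \<kappa> * (A $$ (k, j) * (v $ k * v $ j))"
        unfolding d[OF kj] by (simp only: distrib_left mult_ac)
    qed
    also have "\<dots> = (\<Sum>k<s. \<Sum>j<s. A $$ (k, j) * (u $ k * u $ j)) + (\<Sum>k<s. u $ k * (\<Sum>j<s. A $$ (k, j) * v $ j))
        + \<kappa> * (\<Sum>k<s. \<Sum>j<s. A $$ (k, j) * (v $ k * v $ j))"
      by (simp add: sum.distrib sum_distrib_left)
    also have "\<dots> = (\<Sum>k<s. A $$ (k, k) * (u $ k)\<^sup>2) + (\<Sum>k<s. u $ k * (\<Sum>j<s. A $$ (k, j) * v $ j)) + \<kappa> * (\<Sum>k<s. A $$ (k, k) * (v $ k)\<^sup>2)"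
      using quad_diag[of s A "\<lambda>k. u $ k"] quad_diag[of s A "\<lambda>k. v $ k"] sym by simp
    finally have e: "(\<Sum>k<s. \<Sum>j<m. A $$ (k, j) * dmat (?H (u, v)) $$ (k, j)) = \<dots>" .
    have sq: "a * (\<Sum>k<s. A $$ (k, k) * (z $ k)\<^sup>2) = (\<Sum>k<s. b k * z $ k)\<^sup>2" for z
      unfolding sum_sq sum_distrib_left power_mult_distrib b by (simp add: mult_ac)
    have "a * (\<Sum>k<s. \<Sum>j<m. A $$ (k, j) * dmat (?H (u, v)) $$ (k, j))
       = (\<Sum>k<s. b k * u $ k)\<^sup>2 + a * (\<Sum>k<s. u $ k * (\<Sum>j<s. A $$ (k, j) * v $ j)) + \<kappa> * (\<Sum>k<s. b k * v $ k)\<^sup>2"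
      unfolding e sq[symmetric] by (simp add: algebra_simps)
    then have "\<chi> (a * (\<Sum>k<s. \<Sum>j<m. A $$ (k, j) * dmat (?H (u, v)) $$ (k, j)))
       = \<chi> (\<kappa> * (\<Sum>k<s. b k * v $ k)\<^sup>2) * \<chi> ((\<Sum>k<s. b k * u $ k) + a * (\<Sum>k<s. u $ k * (\<Sum>j<s. A $$ (k, j) * v $ j)))"
      by (simp only: lam_add lam_sq mult_ac)
    also have "(\<Sum>k<s. b k * u $ k) + a * (\<Sum>k<s. u $ k * (\<Sum>j<s. A $$ (k, j) * v $ j)) = (\<Sum>k<s. (b k + a * (\<Sum>j<s. A $$ (k, j) * v $ j)) * u $ k)"
      unfolding sum_distrib_left[of a "\<lambda>k. u $ k * _ k"] sum.distrib[symmetric] by (simp only: distrib_left mult_ac)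
    finally show ?thesis .
  qed
  let ?V = "{v \<in> carrier_vec m. \<forall>k<s. v $ k = w k}"
  have "(\<Sum>h\<in>carrier_mat 2 m. \<chi> (a * (\<Sum>k<s. \<Sum>j<m. A $$ (k, j) * dmat h $$ (k, j))))
     = (\<Sum>p\<in>carrier_vec m \<times> carrier_vec m. \<chi> (a * (\<Sum>k<s. \<Sum>j<m. A $$ (k, j) * dmat (?H p) $$ (k, j))))"
    by (rule sum.reindex_bij_betw[OF bij, symmetric])
  also have "\<dots> = (\<Sum>(u, v)\<in>carrier_vec m \<times> carrier_vec m. \<chi> (\<kappa> * (\<Sum>k<s. b k * v $ k)\<^sup>2) * \<chi> (\<Sum>k<s. (b k + a * (\<Sum>j<s. A $$ (k, j) * v $ j)) * u $ k))"
  proof (rule sum.cong[OF refl])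
    fix p :: "'a vec \<times> 'a vec" assume p: "p \<in> carrier_vec m \<times> carrier_vec m"
    obtain u v where uv: "p = (u, v)" by force
    show "\<chi> (a * (\<Sum>k<s. \<Sum>j<m. A $$ (k, j) * dmat (?H p) $$ (k, j)))
      = (case p of (u, v) \<Rightarrow> \<chi> (\<kappa> * (\<Sum>k<s. b k * v $ k)\<^sup>2) * \<chi> (\<Sum>k<s. (b k + a * (\<Sum>j<s. A $$ (k, j) * v $ j)) * u $ k))"
      using val[of u v] p unfolding uv by simp
  qed
  also have "\<dots> = (\<Sum>u\<in>carrier_vec m. \<Sum>v\<in>carrier_vec m. \<chi> (\<kappa> * (\<Sum>k<s. b k * v $ k)\<^sup>2) * \<chi> (\<Sum>k<s. (b k + a * (\<Sum>j<s. A $$ (k, j) * v $ j)) * u $ k))"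
    by (rule sum.cartesian_product[symmetric])
  also have "\<dots> = (\<Sum>v\<in>carrier_vec m. \<chi> (\<kappa> * (\<Sum>k<s. b k * v $ k)\<^sup>2) * (\<Sum>u\<in>carrier_vec m. \<chi> (\<Sum>k<s. (b k + a * (\<Sum>j<s. A $$ (k, j) * v $ j)) * u $ k)))"
    by (subst sum.swap) (simp add: sum_distrib_left)
  also have "\<dots> = (\<Sum>v\<in>carrier_vec m. if v \<in> ?V then \<chi> (\<kappa> * (\<Sum>k<s. b k * w k)\<^sup>2) * int q ^ m else 0)"
  proof (rule sum.cong[OF refl])
    fix v :: "'a vec" assume v: "v \<in> carrier_vec m"
    have "(\<Sum>k<s. b k * v $ k) = (\<Sum>k<s. b k * w k)" if "\<forall>k<s. v $ k = w k" using that by (intro sum.cong) auto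
    then show "\<chi> (\<kappa> * (\<Sum>k<s. b k * v $ k)\<^sup>2) * (\<Sum>u\<in>carrier_vec m. \<chi> (\<Sum>k<s. (b k + a * (\<Sum>j<s. A $$ (k, j) * v $ j)) * u $ k))
      = (if v \<in> ?V then \<chi> (\<kappa> * (\<Sum>k<s. b k * w k)\<^sup>2) * int q ^ m else 0)"
      unfolding sum_lam_vec[OF s] uniq using v by auto
  qed
  also have "\<dots> = \<chi> (\<kappa> * (\<Sum>k<s. b k * w k)\<^sup>2) * int q ^ m * int (card ?V)"
    by (subst sum.inter_filter[symmetric]) (simp_all add: finite_carrier_vec Int_def)
  also have "\<chi> (\<kappa> * (\<Sum>k<s. b k * w k)\<^sup>2) = (- 1) ^ s"
  proof (cases "even s")
    case True
    then have "(of_nat s :: 'a) = 0" using of_nat_eq_0 by simp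
    then show ?thesis unfolding par using True by simp
  next
    case False
    have "(of_nat s :: 'a) = 1"
      using False of_nat_eq_0[of "Suc s"] add_eq_0[of 1 "of_nat s"] by simp
    then show ?thesis unfolding par using False lam_kappa by simp
  qed
  finally show ?thesis unfolding card_vec_prefix[OF s] by (simp add: power_add)
qed

end

section \<open>Block lower triangular matrices\<close>

definition sub11 :: "nat \<Rightarrow> 'b mat \<Rightarrow> 'b mat" where
  "sub11 s A = mat s s (\<lambda>(k, j). A $$ (k, j))"

definition sub21 :: "nat \<Rightarrow> nat \<Rightarrow> 'b mat \<Rightarrow> 'b mat" where
  "sub21 s t A = mat t s (\<lambda>(k, j). A $$ (s + k, j))"

definition sub22 :: "nat \<Rightarrow> nat \<Rightarrow> 'b mat \<Rightarrow> 'b mat" where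
  "sub22 s t A = mat t t (\<lambda>(k, j). A $$ (s + k, s + j))"

definition lower_GL :: "nat \<Rightarrow> nat \<Rightarrow> 'b::field mat set" where
  "lower_GL s t = {A \<in> GL (s + t). \<forall>k<s. \<forall>j<t. A $$ (k, s + j) = 0}"

abbreviation lower_block :: "nat \<Rightarrow> nat \<Rightarrow> 'b::field mat \<Rightarrow> 'b mat \<Rightarrow> 'b mat \<Rightarrow> 'b mat" where
  "lower_block s t A1 A3 A4 \<equiv> four_block_mat A1 (0\<^sub>m s t) A3 A4"

lemma lower_block_sub:
  assumes "A \<in> carrier_mat (s + t) (s + t)" "\<And>k j. k < s \<Longrightarrow> j < t \<Longrightarrow> A $$ (k, s + j) = 0"
  shows "lower_block s t (sub11 s A) (sub21 s t A) (sub22 s t A) = A"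
proof (rule eq_matI)
  fix k l assume "k < dim_row A" "l < dim_col A"
  then have kl: "k < s + t" "l < s + t" using assms(1) by simp_all
  have "A $$ (k, l) = 0" if "k < s" "\<not> l < s" using assms(2)[OF that(1), of "l - s"] that kl by simp
  then show "lower_block s t (sub11 s A) (sub21 s t A) (sub22 s t A) $$ (k, l) = A $$ (k, l)"
    using kl by (auto simp: sub11_def sub21_def sub22_def)
qed (use assms(1) in \<open>simp_all add: sub11_def sub22_def\<close>)

lemma sub_lower_block:
  assumes "A1 \<in> carrier_mat s s" "A3 \<in> carrier_mat t s" "A4 \<in> carrier_mat t t"
  shows "sub11 s (lower_block s t A1 A3 A4) = A1" "sub21 s t (lower_block s t A1 A3 A4) = A3"
    "sub22 s t (lower_block s t A1 A3 A4) = A4"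
  using assms by (auto intro!: eq_matI simp: sub11_def sub21_def sub22_def)

lemma lower_GL_sub:
  assumes "A \<in> lower_GL s t"
  shows "sub11 s A \<in> GL s" "sub22 s t A \<in> GL t" "sub21 s t A \<in> carrier_mat t s"
    "lower_block s t (sub11 s A) (sub21 s t A) (sub22 s t A) = A"
proof -
  have c: "sub11 s A \<in> carrier_mat s s" "sub22 s t A \<in> carrier_mat t t" "sub21 s t A \<in> carrier_mat t s"
    by (simp_all add: sub11_def sub21_def sub22_def)
  show e: "lower_block s t (sub11 s A) (sub21 s t A) (sub22 s t A) = A"
    by (rule lower_block_sub) (use assms in \<open>auto simp: lower_GL_def GL_iff\<close>)
  have "det A \<noteq> 0" using assms by (auto simp: lower_GL_def GL_iff)
  then have "det (sub11 s A) * det (sub22 s t A) \<noteq> 0"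
    using det_four_block_mat_upper_right_zero[OF c(1) refl c(3,2)] e by simp
  then show "sub11 s A \<in> GL s" "sub22 s t A \<in> GL t" using c by (simp_all add: GL_iff)
  show "sub21 s t A \<in> carrier_mat t s" by (rule c)
qed

lemma lower_block_GL:
  assumes "A1 \<in> GL s" "A3 \<in> carrier_mat t s" "A4 \<in> GL t"
  shows "lower_block s t A1 A3 A4 \<in> lower_GL s t"
proof -
  have c: "A1 \<in> carrier_mat s s" "A4 \<in> carrier_mat t t" "det A1 \<noteq> 0" "det A4 \<noteq> 0" using assms by (auto simp: GL_iff)
  have "lower_block s t A1 A3 A4 \<in> GL (s + t)"
    unfolding GL_iff det_four_block_mat_upper_right_zero[OF c(1) refl assms(2) c(2)] using c by simp
  then show ?thesis using c assms(2) by (auto simp: lower_GL_def)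
qed

text \<open>X restricts the upper left block: all of \<open>GL s\<close> for the order of the block
  triangular group, the symmetric matrices for the exponential sum.\<close>

lemma bij_lower_block:
  fixes X :: "'b::field mat set"
  assumes "X \<subseteq> GL s"
  shows "bij_betw (\<lambda>(A1, A3, A4). lower_block s t A1 A3 A4) (X \<times> carrier_mat t s \<times> GL t) {A \<in> lower_GL s t. sub11 s A \<in> X}"
proof (rule bij_betw_byWitness[where f' = "\<lambda>A. (sub11 s A, sub21 s t A, sub22 s t A)"])
  have c: "A1 \<in> carrier_mat s s" if "A1 \<in> X" for A1 using that assms by (auto simp: GL_iff)
  have c4: "A4 \<in> carrier_mat t t" if "A4 \<in> GL t" for A4 :: "'b mat" using that by (auto simp: GL_iff)
  show "\<forall>p\<in>X \<times> carrier_mat t s \<times> GL t. (\<lambda>A. (sub11 s A, sub21 s t A, sub22 s t A)) ((\<lambda>(A1, A3, A4). lower_block s t A1 A3 A4) p) = p"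
    by (auto simp: sub_lower_block c c4)
  show "\<forall>A\<in>{A \<in> lower_GL s t. sub11 s A \<in> X}. (\<lambda>(A1, A3, A4). lower_block s t A1 A3 A4) (sub11 s A, sub21 s t A, sub22 s t A) = A"
    by (auto simp: lower_GL_sub)
  show "(\<lambda>(A1, A3, A4). lower_block s t A1 A3 A4) ` (X \<times> carrier_mat t s \<times> GL t) \<subseteq> {A \<in> lower_GL s t. sub11 s A \<in> X}"
  proof (rule image_subsetI)
    fix p :: "'b mat \<times> 'b mat \<times> 'b mat" assume "p \<in> X \<times> carrier_mat t s \<times> GL t"
    then obtain A1 A3 A4 where p: "p = (A1, A3, A4)" "A1 \<in> X" "A3 \<in> carrier_mat t s" "A4 \<in> GL t" by auto
    have "A1 \<in> GL s" using p(2) assms by blast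
    then show "(\<lambda>(A1, A3, A4). lower_block s t A1 A3 A4) p \<in> {A \<in> lower_GL s t. sub11 s A \<in> X}"
      using lower_block_GL[OF _ p(3,4)] sub_lower_block(1)[OF c[OF p(2)] p(3) c4[OF p(4)]] p(1,2) by simp
  qed
  show "(\<lambda>A. (sub11 s A, sub21 s t A, sub22 s t A)) ` {A \<in> lower_GL s t. sub11 s A \<in> X} \<subseteq> X \<times> carrier_mat t s \<times> GL t"
    by (auto simp: lower_GL_sub)
qed

lemma card_lower_GL:
  "card (lower_GL s t :: 'b::{field,finite} mat set) = card (GL s :: 'b mat set) * (CARD('b) ^ (t * s) * card (GL t :: 'b mat set))"
proof -
  have "{A \<in> lower_GL s t. sub11 s A \<in> GL s} = (lower_GL s t :: 'b mat set)" using lower_GL_sub(1) by blast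
  then have "card (lower_GL s t :: 'b mat set) = card (GL s \<times> carrier_mat t s \<times> GL t :: ('b mat \<times> 'b mat \<times> 'b mat) set)"
    using bij_betw_same_card[OF bij_lower_block[of "GL s :: 'b mat set" s t]] by simp
  then show ?thesis by (simp add: card_cartesian_product card_carrier_mat)
qed

context minus_form
begin

lemma dim_dmat [simp]: "dim_row (dmat h) = m" "dim_col (dmat h) = m"
  by (simp_all add: dmat_def)

lemma sym_tri_lower_GL:
  assumes "m = s + t" "A \<in> GL m" "sym_tri s A"
  shows "A \<in> lower_GL s t"
  unfolding lower_GL_def
proof (intro CollectI conjI allI impI)
  show "A \<in> GL (s + t)" using assms(1,2) by simp
  fix k j assume "k < s" "j < t"
  then have "k < s" "s \<le> s + j" "s + j < m" using assms(1) by auto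
  then show "A $$ (k, s + j) = 0" using assms(3) unfolding sym_tri_def by blast
qed

lemma lower_GL_minv:
  fixes A :: "'a mat"
  assumes A: "A \<in> lower_GL s t"
  shows "j < s \<Longrightarrow> l < t \<Longrightarrow> minv A $$ (j, s + l) = 0"
    and "k < t \<Longrightarrow> l < t \<Longrightarrow> minv A $$ (s + k, s + l) = minv (sub22 s t A) $$ (k, l)"
proof -
  have G: "A \<in> GL (s + t)" and z: "\<And>k j. k < s \<Longrightarrow> j < t \<Longrightarrow> A $$ (k, s + j) = 0"
    using A by (auto simp: lower_GL_def)
  have s1: "sub11 s A \<in> carrier_mat s s" "det (sub11 s A) \<noteq> 0" using lower_GL_sub(1)[OF A] by (auto simp: GL_iff)
  have split: "(\<Sum>j<s + b. f j) = (\<Sum>j<s. f j) + (\<Sum>j<b. f (s + j))" for f :: "nat \<Rightarrow> 'a" and b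
    by (induction b) (simp_all add: add.assoc)
  have upper: "minv A $$ (j, s + l) = 0" if jl: "j < s" "l < t" for j l
  proof (rule det_nonzero_kernel[OF s1 _ jl(1), of "\<lambda>j. minv A $$ (j, s + l)"])
    fix i assume i: "i < s"
    have "(\<Sum>j<s. sub11 s A $$ (i, j) * minv A $$ (j, s + l)) = (\<Sum>j<s + t. A $$ (i, j) * minv A $$ (j, s + l))"
      unfolding split using i z[OF i] by (simp add: sub11_def)
    also have "\<dots> = 0" using minv_index(1)[OF G, of i "s + l"] i jl by simp
    finally show "(\<Sum>j<s. sub11 s A $$ (i, j) * minv A $$ (j, s + l)) = 0" .
  qed
  then show "j < s \<Longrightarrow> l < t \<Longrightarrow> minv A $$ (j, s + l) = 0" .
  have "minv (sub22 s t A) = sub22 s t (minv A)"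
  proof (rule minv_unique[OF lower_GL_sub(2)[OF A]])
    show c: "sub22 s t (minv A) \<in> carrier_mat t t" by (simp add: sub22_def)
    have c': "sub22 s t A \<in> carrier_mat t t" by (simp add: sub22_def)
    show "sub22 s t A * sub22 s t (minv A) = 1\<^sub>m t"
    proof (rule eq_matI)
      fix k l assume "k < dim_row (1\<^sub>m t :: 'a mat)" "l < dim_col (1\<^sub>m t :: 'a mat)"
      then have kl: "k < t" "l < t" by simp_all
      have "(sub22 s t A * sub22 s t (minv A)) $$ (k, l) = (\<Sum>j<t. A $$ (s + k, s + j) * minv A $$ (s + j, s + l))"
        unfolding mult_mat_index[OF c' c kl] by (rule sum.cong) (use kl in \<open>auto simp: sub22_def\<close>)
      also have "\<dots> = (\<Sum>j<s + t. A $$ (s + k, j) * minv A $$ (j, s + l))" unfolding split using upper[OF _ kl(2)] by simp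
      also have "\<dots> = 1\<^sub>m t $$ (k, l)" using minv_index(1)[OF G, of "s + k" "s + l"] kl by simp
      finally show "(sub22 s t A * sub22 s t (minv A)) $$ (k, l) = 1\<^sub>m t $$ (k, l)" .
    qed (use c c' in auto)
  qed
  then show "k < t \<Longrightarrow> l < t \<Longrightarrow> minv A $$ (s + k, s + l) = minv (sub22 s t A) $$ (k, l)" by (simp add: sub22_def)
qed

section \<open>Parametrization of the subgroup\<close>

text \<open>In the original coordinates B is tied to h. The alternating matrix T = B + (dmat h)^T is
  independent of h, so that the parameter space \<open>Qdom\<close> becomes a plain product.\<close>

definition Qmap :: "'a mat \<times> ('a \<times> 'a) \<times> 'a mat \<times> 'a mat \<Rightarrow> 'a mat" where
  "Qmap = (\<lambda>(A, (d1, d2), h, T). Qel A (so2 d1 d2) (T + transpose_mat (dmat h)) h)"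

definition Qdom :: "('a mat \<times> ('a \<times> 'a) \<times> 'a mat \<times> 'a mat) set" where
  "Qdom = GL m \<times> SO2 \<times> carrier_mat 2 m \<times> alt_mats m 0"

lemma so2_GL: "(d1, d2) \<in> SO2 \<Longrightarrow> so2 d1 d2 \<in> GL 2"
proof -
  assume "(d1, d2) \<in> SO2"
  then have "so2 d1 d2 * so2 (d1 + d2) d2 = 1\<^sub>m 2" using SO2_inv by blast
  then have "det (so2 d1 d2) * det (so2 (d1 + d2) d2) = 1"
    using det_mult[OF so2_carrier(1) so2_carrier(1), of d1 d2 "d1 + d2" d2] by simp
  then show ?thesis by (auto simp: GL_iff)
qed

lemma alt_matsD:
  assumes "T \<in> alt_mats m s"
  shows "T \<in> carrier_mat m m" "k < m \<Longrightarrow> T $$ (k, k) = 0" "k < m \<Longrightarrow> j < m \<Longrightarrow> T $$ (k, j) = T $$ (j, k)"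
  using assms alternating_mat_iff[of T m] by (auto simp: alt_mats_def)

lemma Qpar_iff:
  assumes "A \<in> GL m" "(d1, d2) \<in> SO2" "h \<in> carrier_mat 2 m" "T \<in> carrier_mat m m"
  shows "Qpar A (so2 d1 d2) (T + transpose_mat (dmat h)) h \<longleftrightarrow> T \<in> alt_mats m 0"
proof -
  have dc: "dmat h \<in> carrier_mat m m" by simp
  have "transpose_mat (T + transpose_mat (dmat h)) + dmat h = transpose_mat T"
  proof (rule eq_matI)
    fix k l assume "k < dim_row (transpose_mat T)" "l < dim_col (transpose_mat T)"
    then have "k < m" "l < m" using assms(4) by auto
    then show "(transpose_mat (T + transpose_mat (dmat h)) + dmat h) $$ (k, l) = transpose_mat T $$ (k, l)"
      using assms(4) carrier_matD[OF dc] by (simp add: add.assoc add_self)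
  qed (use assms(4) carrier_matD[OF dc] in auto)
  moreover have "alternating_mat (transpose_mat T) \<longleftrightarrow> alternating_mat T"
    using assms(4) alternating_mat_iff[of T m] alternating_mat_iff[of "transpose_mat T" m] by auto
  moreover have "so2 d1 d2 \<in> SO_minus_2 \<kappa>" using assms(2) by (auto simp: SO_minus_2_eq)
  ultimately show ?thesis using assms by (simp add: Qpar_def alt_mats_def)
qed

lemma bij_Qmap: "bij_betw Qmap Qdom Q"
  unfolding bij_betw_def
proof
  show "inj_on Qmap Qdom"
  proof (rule inj_onI)
    fix x y assume "x \<in> Qdom" "y \<in> Qdom" and eq: "Qmap x = Qmap y"
    then obtain A d1 d2 h T A' d1' d2' h' T' where x: "x = (A, (d1, d2), h, T)" "A \<in> GL m" "(d1, d2) \<in> SO2" "h \<in> carrier_mat 2 m" "T \<in> alt_mats m 0"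
      and y: "y = (A', (d1', d2'), h', T')" "A' \<in> GL m" "(d1', d2') \<in> SO2" "h' \<in> carrier_mat 2 m" "T' \<in> alt_mats m 0"
      unfolding Qdom_def by auto
    let ?i = "so2 d1 d2" and ?i' = "so2 d1' d2'"
    let ?B = "T + transpose_mat (dmat h)" and ?B' = "T' + transpose_mat (dmat h')"
    have eq: "Qel A ?i ?B h = Qel A' ?i' ?B' h'" using eq by (simp add: x y Qmap_def)
    have Tc: "T \<in> carrier_mat m m" "T' \<in> carrier_mat m m" using x(5) y(5) alt_matsD(1) by auto
    have dc: "transpose_mat (dmat h) \<in> carrier_mat m m" by simp
    have Bc: "?B \<in> carrier_mat m m" "?B' \<in> carrier_mat m m" using Tc by auto
    have Ac: "A \<in> carrier_mat m m" "A' \<in> carrier_mat m m" using x(2) y(2) by (auto simp: GL_iff)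
    have i: "d1 = d1' \<and> d2 = d2'"
      using arg_cong[OF eq, of corner] by (simp add: corner_Qel so2_inj)
    have A: "A = A'"
    proof (rule eq_matI)
      fix k l assume "k < dim_row A'" "l < dim_col A'"
      then have kl: "k < m" "l < m" using Ac by auto
      show "A $$ (k, l) = A' $$ (k, l)"
        using arg_cong[OF eq, of "\<lambda>g. g $$ (k, l)"] Qel_index(1)[OF kl, of 0 0] by simp
    qed (use Ac in auto)
    have "A * ?B = A * ?B'"
    proof (rule eq_matI)
      fix k l assume "k < dim_row (A * ?B')" "l < dim_col (A * ?B')"
      then have kl: "k < m" "l < m" using Ac Bc by auto
      show "(A * ?B) $$ (k, l) = (A * ?B') $$ (k, l)"
        using arg_cong[OF eq, of "\<lambda>g. g $$ (k, m + l)"] Qel_index(2)[OF kl, of 0 0] A by simp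
    qed (use Ac Bc in auto)
    then have B: "?B = ?B'" by (rule GL_mult_cancel[OF x(2) Bc])
    have "?i * h = ?i * h'"
    proof (rule eq_matI)
      fix c l assume "c < dim_row (?i * h')" "l < dim_col (?i * h')"
      then have kl: "c < 2" "l < m" using y(4) by auto
      show "(?i * h) $$ (c, l) = (?i * h') $$ (c, l)"
        using arg_cong[OF eq, of "\<lambda>g. g $$ (2 * m + c, m + l)"] Qel_index(8)[OF kl(2,2,1,1)] i by simp
    qed (use x(4) y(4) in auto)
    then have h: "h = h'" by (rule GL_mult_cancel[OF so2_GL[OF x(3)] x(4) y(4)])
    have "T = T'"
    proof (rule eq_matI)
      fix k l assume "k < dim_row T'" "l < dim_col T'"
      then have kl: "k < m" "l < m" using Tc by auto
      show "T $$ (k, l) = T' $$ (k, l)"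
        using arg_cong[OF B, of "\<lambda>g. g $$ (k, l)"] kl Tc carrier_matD[OF dc] h by simp
    qed (use Tc in auto)
    then show "x = y" using x(1) y(1) A i h by simp
  qed
  show "Qmap ` Qdom = Q"
  proof
    show "Qmap ` Qdom \<subseteq> Q"
    proof (rule image_subsetI)
      fix x assume "x \<in> Qdom"
      then obtain A d1 d2 h T where x: "x = (A, (d1, d2), h, T)" "A \<in> GL m" "(d1, d2) \<in> SO2" "h \<in> carrier_mat 2 m" "T \<in> alt_mats m 0"
        unfolding Qdom_def by auto
      then have "Qpar A (so2 d1 d2) (T + transpose_mat (dmat h)) h" using Qpar_iff alt_matsD(1) by blast
      then show "Qmap x \<in> Q" using Qel_in_Q by (simp add: x(1) Qmap_def)
    qed
    show "Q \<subseteq> Qmap ` Qdom"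
    proof
      fix g assume "g \<in> Q"
      then obtain A i B h where p: "Qpar A i B h" "g = Qel A i B h" using Q_imp_Qel by metis
      then obtain d1 d2 where d: "(d1, d2) \<in> SO2" "i = so2 d1 d2" by (auto simp: Qpar_def SO_minus_2_eq)
      have c: "A \<in> GL m" "B \<in> carrier_mat m m" "h \<in> carrier_mat 2 m" using p by (auto simp: Qpar_def)
      have dc: "transpose_mat (dmat h) \<in> carrier_mat m m" by simp
      define T where "T = B + transpose_mat (dmat h)"
      have Tc: "T \<in> carrier_mat m m" using c by (simp add: T_def)
      have B: "T + transpose_mat (dmat h) = B"
        unfolding T_def by (rule eq_matI) (use c carrier_matD[OF dc] in \<open>auto simp: add.assoc add_self\<close>)
      have "T \<in> alt_mats m 0" using Qpar_iff[OF c(1) d(1) c(3) Tc] p(1) d(2) B by simp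
      then show "g \<in> Qmap ` Qdom" using c d p(2) B by (intro image_eqI[of _ _ "(A, (d1, d2), h, T)"]) (auto simp: Qmap_def Qdom_def)
    qed
  qed
qed

lemma card_SO2': "card SO2 = q + 1" using card_SO2 by simp

lemma card_Q: "card Q = card (GL m :: 'a mat set) * ((q + 1) * (q ^ (2 * m) * q ^ (\<Sum>j<m. j)))"
proof -
  have "card Q = card Qdom" using bij_betw_same_card[OF bij_Qmap] by simp
  then show ?thesis
    using card_alt_mats[of 0 m, where 'b = 'a]
    by (simp add: Qdom_def card_cartesian_product card_SO2' card_carrier_mat card_UNIV lessThan_atLeast0)
qed

section \<open>The trace and its exponential sum\<close>

text \<open>In the first s hyperbolic pairs \<sigma>_s brings the diagonal of A B and a zero block
  onto the diagonal; the other pairs keep the entries of A and of its inverse. Multiplication by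
  \<rho> adds the lower left entry d2 of the corner, which cancels the trace d2 of the corner; hence
  the torus sum becomes a mere count.\<close>

lemma trace_split:
  fixes A i h T :: "'a mat"
  assumes s: "s \<le> m" and A: "A \<in> GL m" and h: "h \<in> carrier_mat 2 m" and T: "T \<in> carrier_mat m m"
  defines "g \<equiv> Qel A i (T + transpose_mat (dmat h)) h"
  shows "mat_trace (g * \<sigma> s) = (\<Sum>k<s. \<Sum>j<m. A $$ (k, j) * T $$ (j, k)) + (\<Sum>k<s. \<Sum>j<m. A $$ (k, j) * dmat h $$ (k, j))
     + (\<Sum>k\<in>{s..<m}. A $$ (k, k) + minv A $$ (k, k)) + (i $$ (0, 0) + i $$ (Suc 0, Suc 0))" (is "_ = ?R")
    and "mat_trace (\<rho> * g * \<sigma> s) = mat_trace (g * \<sigma> s) + i $$ (Suc 0, 0)"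
proof -
  let ?B = "T + transpose_mat (dmat h)"
  have gc: "g \<in> carrier_mat N N" by (simp add: g_def)
  have Ac: "A \<in> carrier_mat m m" using A by (simp add: GL_iff)
  have dc: "dmat h \<in> carrier_mat m m" by simp
  have Bc: "?B \<in> carrier_mat m m" using T by simp
  have AB: "(A * ?B) $$ (k, k) = (\<Sum>j<m. A $$ (k, j) * T $$ (j, k)) + (\<Sum>j<m. A $$ (k, j) * dmat h $$ (k, j))" if k: "k < m" for k
    unfolding mult_mat_index[OF Ac Bc k k] sum.distrib[symmetric]
    by (rule sum.cong) (use k T carrier_matD[OF dc] in \<open>auto simp: distrib_left\<close>)
  have tr: "mat_trace (M * \<sigma> s) = (\<Sum>k<N. M $$ (k, sp s k))" if M: "M \<in> carrier_mat N N" for M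
    unfolding mat_trace_def using M mult_sigma_right[OF s M] by (intro sum.cong) auto
  have part: "(\<Sum>k<m. if k < s then f k else f' k) = (\<Sum>k<s. f k) + (\<Sum>k\<in>{s..<m}. f' k)" for f f' :: "nat \<Rightarrow> 'a"
  proof -
    have "(\<Sum>k<m. if k < s then f k else f' k) = (\<Sum>k\<in>{..<s} \<union> {s..<m}. if k < s then f k else f' k)"
      using s by (intro sum.cong) auto
    also have "\<dots> = (\<Sum>k<s. if k < s then f k else f' k) + (\<Sum>k\<in>{s..<m}. if k < s then f k else f' k)"
      by (rule sum.union_disjoint) auto
    finally show ?thesis by simp
  qed
  have "(\<Sum>k<m. g $$ (k, sp s k)) = (\<Sum>k<m. if k < s then (A * ?B) $$ (k, k) else A $$ (k, k))"
    unfolding g_def by (rule sum.cong) (auto simp: sp_eq Qel_index(1,2)[where c = 0 and d = 0])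
  moreover have "(\<Sum>k<s. (A * ?B) $$ (k, k)) = (\<Sum>k<s. \<Sum>j<m. A $$ (k, j) * T $$ (j, k)) + (\<Sum>k<s. \<Sum>j<m. A $$ (k, j) * dmat h $$ (k, j))"
    unfolding sum.distrib[symmetric] by (rule sum.cong) (use s AB in \<open>auto simp: sum.distrib\<close>)
  moreover have "(\<Sum>k<m. g $$ (m + k, sp s (m + k))) = (\<Sum>k<m. if k < s then 0 else minv A $$ (k, k))"
    unfolding g_def by (rule sum.cong) (use s in \<open>auto simp: sp_eq Qel_index(4,5)[where c = 0 and d = 0]\<close>)
  moreover have "g $$ (2 * m, sp s (2 * m)) = i $$ (0, 0)" "g $$ (Suc (2 * m), sp s (Suc (2 * m))) = i $$ (Suc 0, Suc 0)"
      "g $$ (Suc (2 * m), sp s (2 * m)) = i $$ (Suc 0, 0)"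
    using s Qel_corner[of 0 0 A i ?B h] Qel_corner[of 1 1 A i ?B h] Qel_corner[of 1 0 A i ?B h] by (auto simp: g_def sp_eq)
  ultimately have val: "(\<Sum>k<N. g $$ (k, sp s k)) = ?R" "g $$ (Suc (2 * m), sp s (2 * m)) = i $$ (Suc 0, 0)"
    unfolding sum_split3 part by (simp_all add: sum.distrib add_ac)
  show R: "mat_trace (g * \<sigma> s) = ?R" unfolding tr[OF gc] by (rule val)
  have "mat_trace (\<rho> * g * \<sigma> s) = (\<Sum>k<N. g $$ (k, sp s k) + (if k = 2 * m then g $$ (Suc (2 * m), sp s k) else 0))"
    unfolding tr[OF multN[OF rho_carrier gc]]
    by (rule sum.cong[OF refl], rule mult_rho_left[OF gc]) (use sp_less[OF s] in auto)
  also have "\<dots> = (\<Sum>k<N. g $$ (k, sp s k)) + g $$ (Suc (2 * m), sp s (2 * m))"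
    unfolding sum.distrib by (subst sum.delta) auto
  finally show "mat_trace (\<rho> * g * \<sigma> s) = mat_trace (g * \<sigma> s) + i $$ (Suc 0, 0)" unfolding val R .
qed

text \<open>These matrices are block lower triangular with invertible symmetric upper left block.
  Only the lower right block enters the exponent, and the lower left block is free.\<close>

lemma sum_sym_tri_GL:
  assumes m: "m = s + t"
  shows "(\<Sum>A\<in>{A \<in> GL m. sym_tri s A}. \<chi> (a * (\<Sum>k\<in>{s..<m}. A $$ (k, k) + minv A $$ (k, k))))
    = int (card (SymGL s :: 'a mat set)) * int q ^ (t * s) * KGL t a"
proof -
  let ?f = "\<lambda>A. \<chi> (a * (\<Sum>k\<in>{s..<m}. A $$ (k, k) + minv A $$ (k, k)))"
  have Sub: "(SymGL s :: 'a mat set) \<subseteq> GL s" by (auto simp: SymGL_def GL_iff)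
  have set: "{A \<in> GL m. sym_tri s A} = {A \<in> lower_GL s t. sub11 s A \<in> SymGL s}"
  proof (intro subset_antisym subsetI)
    fix A :: "'a mat" assume "A \<in> {A \<in> GL m. sym_tri s A}"
    then have A: "A \<in> GL m" "sym_tri s A" by auto
    have L: "A \<in> lower_GL s t" by (rule sym_tri_lower_GL[OF m A])
    have "det (sub11 s A) \<noteq> 0" using lower_GL_sub(1)[OF L] by (simp add: GL_iff)
    moreover have c: "sub11 s A \<in> carrier_mat s s" by (simp add: sub11_def)
    moreover have "transpose_mat (sub11 s A) = sub11 s A" unfolding symmetric_index[OF c] using A(2) by (auto simp: sub11_def sym_tri_def)
    ultimately show "A \<in> {A \<in> lower_GL s t. sub11 s A \<in> SymGL s}" using L by (simp add: SymGL_def)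
  next
    fix A :: "'a mat" assume "A \<in> {A \<in> lower_GL s t. sub11 s A \<in> SymGL s}"
    then have L: "A \<in> lower_GL s t" and S: "transpose_mat (sub11 s A) = sub11 s A" by (auto simp: SymGL_def)
    have c: "sub11 s A \<in> carrier_mat s s" by (simp add: sub11_def)
    have "A $$ (k, j) = A $$ (j, k)" if "k < s" "j < s" for k j
      using S[unfolded symmetric_index[OF c]] that by (auto simp: sub11_def)
    moreover have "A $$ (k, j) = 0" if "k < s" "s \<le> j" "j < m" for k j
    proof -
      have "j - s < t" "s + (j - s) = j" using that m by auto
      then show ?thesis using L that(1) unfolding lower_GL_def by (metis (mono_tags, lifting) mem_Collect_eq)
    qed
    ultimately have "sym_tri s A" unfolding sym_tri_def by blast
    moreover have "A \<in> GL m" using L m by (simp add: lower_GL_def)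
    ultimately show "A \<in> {A \<in> GL m. sym_tri s A}" by blast
  qed
  have val: "?f (lower_block s t A1 A3 A4) = \<chi> (a * (\<Sum>k<t. A4 $$ (k, k) + minv A4 $$ (k, k)))"
    if p: "A1 \<in> SymGL s" "A3 \<in> carrier_mat t s" "A4 \<in> GL t" for A1 A3 A4
  proof -
    let ?A = "lower_block s t A1 A3 A4"
    have c: "A1 \<in> GL s" "A1 \<in> carrier_mat s s" "A4 \<in> carrier_mat t t" using p Sub by (auto simp: GL_iff)
    have L: "?A \<in> lower_GL s t" by (rule lower_block_GL[OF c(1) p(2,3)])
    have "(\<Sum>k\<in>{s..<m}. ?A $$ (k, k) + minv ?A $$ (k, k)) = (\<Sum>k<t. ?A $$ (s + k, s + k) + minv ?A $$ (s + k, s + k))"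
      unfolding m by (rule sum.reindex_bij_witness[of _ "\<lambda>k. s + k" "\<lambda>k. k - s"]) auto
    also have "\<dots> = (\<Sum>k<t. A4 $$ (k, k) + minv A4 $$ (k, k))"
    proof (rule sum.cong[OF refl])
      fix k assume "k \<in> {..<t}"
      then have k: "k < t" by simp
      have "?A $$ (s + k, s + k) = A4 $$ (k, k)" using c k by simp
      then show "?A $$ (s + k, s + k) + minv ?A $$ (s + k, s + k) = A4 $$ (k, k) + minv A4 $$ (k, k)"
        unfolding lower_GL_minv(2)[OF L k k] sub_lower_block(3)[OF c(2) p(2) c(3)] by (simp only:)
    qed
    finally show ?thesis by simp
  qed
  have "(\<Sum>A\<in>{A \<in> GL m. sym_tri s A}. ?f A) = (\<Sum>x\<in>SymGL s \<times> carrier_mat t s \<times> GL t. ?f ((\<lambda>(A1, A3, A4). lower_block s t A1 A3 A4) x))"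
    unfolding set by (rule sum.reindex_bij_betw[OF bij_lower_block[OF Sub], symmetric])
  also have "\<dots> = (\<Sum>(A1, A3, A4)\<in>(SymGL s :: 'a mat set) \<times> (carrier_mat t s :: 'a mat set) \<times> GL t. \<chi> (a * (\<Sum>k<t. A4 $$ (k, k) + minv A4 $$ (k, k))))"
  proof (rule sum.cong[OF refl])
    fix x :: "'a mat \<times> 'a mat \<times> 'a mat" assume "x \<in> SymGL s \<times> carrier_mat t s \<times> GL t"
    then obtain A1 A3 A4 where "x = (A1, A3, A4)" "A1 \<in> SymGL s" "A3 \<in> carrier_mat t s" "A4 \<in> GL t" by auto
    then show "?f ((\<lambda>(A1, A3, A4). lower_block s t A1 A3 A4) x) = (case x of (A1, A3, A4) \<Rightarrow> \<chi> (a * (\<Sum>k<t. A4 $$ (k, k) + minv A4 $$ (k, k))))"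
      using val[of A1 A3 A4] by (simp only: case_prod_conv)
  qed
  also have "\<dots> = (\<Sum>A1\<in>(SymGL s :: 'a mat set). \<Sum>A3\<in>(carrier_mat t s :: 'a mat set). KGL t a)"
    unfolding KGL_def sum.cartesian_product by (simp add: case_prod_unfold)
  finally show ?thesis by (simp add: card_carrier_mat card_UNIV mult.assoc)
qed

lemma sum_Qdom:
  fixes f1 :: "'a mat \<Rightarrow> int" and f2 :: "'a \<times> 'a \<Rightarrow> int" and f3 f4 :: "'a mat \<Rightarrow> 'a mat \<Rightarrow> int"
  shows "(\<Sum>(A, d, h, T)\<in>Qdom. f1 A * f2 d * f3 A h * f4 A T)
    = (\<Sum>d\<in>SO2. f2 d) * (\<Sum>A\<in>GL m. f1 A * ((\<Sum>h\<in>carrier_mat 2 m. f3 A h) * (\<Sum>T\<in>alt_mats m 0. f4 A T)))"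
proof -
  have "(\<Sum>(A, d, h, T)\<in>Qdom. f1 A * f2 d * f3 A h * f4 A T)
     = (\<Sum>A\<in>GL m. \<Sum>d\<in>SO2. \<Sum>h\<in>carrier_mat 2 m. \<Sum>T\<in>alt_mats m 0. f1 A * f2 d * f3 A h * f4 A T)"
    unfolding Qdom_def sum.cartesian_product by (simp add: case_prod_unfold)
  also have "\<dots> = (\<Sum>A\<in>GL m. \<Sum>d\<in>SO2. f2 d * (f1 A * ((\<Sum>h\<in>carrier_mat 2 m. f3 A h) * (\<Sum>T\<in>alt_mats m 0. f4 A T))))"
    unfolding sum_product by (intro sum.cong refl) (simp add: sum_distrib_left mult_ac)
  also have "\<dots> = (\<Sum>d\<in>SO2. f2 d) * (\<Sum>A\<in>GL m. f1 A * ((\<Sum>h\<in>carrier_mat 2 m. f3 A h) * (\<Sum>T\<in>alt_mats m 0. f4 A T)))"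
    unfolding sum_product by (subst sum.swap) (rule refl)
  finally show ?thesis .
qed

text \<open>Given A, the exponent is a sum of separate terms in i, h and T, so the sum factors. The
  two claims share everything but the sum over the torus.\<close>

lemma sum_trace_Q:
  assumes m: "m = s + t" and a: "a \<noteq> 0"
  shows "(\<Sum>w\<in>Q. \<chi> (a * mat_trace (w * \<sigma> s)))
     = - K a * ((- 1) ^ s * int q ^ (m + t) * int q ^ (\<Sum>j<m. j) * (int (card (SymGL s :: 'a mat set)) * int q ^ (t * s) * KGL t a))" (is "_ = _ * ?R")
    and "(\<Sum>w\<in>Q. \<chi> (a * mat_trace (\<rho> * w * \<sigma> s)))
     = (int q + 1) * ((- 1) ^ s * int q ^ (m + t) * int q ^ (\<Sum>j<m. j) * (int (card (SymGL s :: 'a mat set)) * int q ^ (t * s) * KGL t a))"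
proof -
  have s: "s \<le> m" using m by simp
  let ?f1 = "\<lambda>A. \<chi> (a * (\<Sum>k\<in>{s..<m}. A $$ (k, k) + minv A $$ (k, k)))"
  let ?f3 = "\<lambda>A h. \<chi> (a * (\<Sum>k<s. \<Sum>j<m. A $$ (k, j) * dmat h $$ (k, j)))"
  let ?f4 = "\<lambda>A T. \<chi> (a * (\<Sum>k<s. \<Sum>j<m. A $$ (k, j) * T $$ (j, k)))"
  have R: "(\<Sum>A\<in>GL m. ?f1 A * ((\<Sum>h\<in>carrier_mat 2 m. ?f3 A h) * (\<Sum>T\<in>alt_mats m 0. ?f4 A T))) = ?R"
  proof -
    have each: "?f1 A * ((\<Sum>h\<in>carrier_mat 2 m. ?f3 A h) * (\<Sum>T\<in>alt_mats m 0. ?f4 A T))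
       = (if sym_tri s A then ?f1 A * ((- 1) ^ s * int q ^ (m + t) * int q ^ (\<Sum>j<m. j)) else 0)" if A: "A \<in> GL m" for A
    proof (cases "sym_tri s A")
      case True
      have L: "A \<in> lower_GL s t" by (rule sym_tri_lower_GL[OF m A True])
      have "mat s s (\<lambda>(k, j). A $$ (k, j)) \<in> GL s" using lower_GL_sub(1)[OF L] by (simp only: sub11_def)
      from sum_h[OF s a True this] show ?thesis unfolding sum_alt_mats[OF s a] using True m by simp
    next
      case False
      then show ?thesis unfolding sum_alt_mats[OF s a] by simp
    qed
    have "(\<Sum>A\<in>GL m. ?f1 A * ((\<Sum>h\<in>carrier_mat 2 m. ?f3 A h) * (\<Sum>T\<in>alt_mats m 0. ?f4 A T)))
      = (\<Sum>A\<in>GL m. if sym_tri s A then ?f1 A * ((- 1) ^ s * int q ^ (m + t) * int q ^ (\<Sum>j<m. j)) else 0)"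
      by (rule sum.cong[OF refl each])
    also have "\<dots> = (\<Sum>A\<in>{A \<in> GL m. sym_tri s A}. ?f1 A * ((- 1) ^ s * int q ^ (m + t) * int q ^ (\<Sum>j<m. j)))"
      by (rule sum.inter_filter[symmetric, OF finite_GL])
    also have "\<dots> = ?R"
      unfolding sum_distrib_right[symmetric] sum_sym_tri_GL[OF m] by (simp only: mult_ac)
    finally show ?thesis .
  qed
  have "(\<Sum>w\<in>Q. \<chi> (a * mat_trace (w * \<sigma> s))) = (\<Sum>x\<in>Qdom. \<chi> (a * mat_trace (Qmap x * \<sigma> s)))"
    by (rule sum.reindex_bij_betw[OF bij_Qmap, symmetric])
  also have "\<dots> = (\<Sum>(A, d, h, T)\<in>Qdom. ?f1 A * \<chi> (a * snd d) * ?f3 A h * ?f4 A T)"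
  proof (rule sum.cong[OF refl])
    fix x assume "x \<in> Qdom"
    then obtain A d1 d2 h T where x: "x = (A, (d1, d2), h, T)" "A \<in> GL m" "h \<in> carrier_mat 2 m" "T \<in> alt_mats m 0"
      unfolding Qdom_def by auto
    note Tc = alt_matsD(1)[OF x(4)]
    have "mat_trace (Qmap x * \<sigma> s) = (\<Sum>k<s. \<Sum>j<m. A $$ (k, j) * T $$ (j, k)) + (\<Sum>k<s. \<Sum>j<m. A $$ (k, j) * dmat h $$ (k, j))
     + (\<Sum>k\<in>{s..<m}. A $$ (k, k) + minv A $$ (k, k)) + d2"
      unfolding x(1) Qmap_def case_prod_conv trace_split(1)[OF s x(2,3) Tc] by (simp add: add_left_self)
    then show "\<chi> (a * mat_trace (Qmap x * \<sigma> s)) = (case x of (A, d, h, T) \<Rightarrow> ?f1 A * \<chi> (a * snd d) * ?f3 A h * ?f4 A T)"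
      unfolding x(1) case_prod_conv snd_conv by (simp only: distrib_left[of a] lam_add mult_ac)
  qed
  also have "\<dots> = (\<Sum>d\<in>SO2. \<chi> (a * snd d)) * ?R" unfolding sum_Qdom R ..
  also have "(\<Sum>d\<in>SO2. \<chi> (a * snd d)) = - K a" using sum_lam_SO2[OF a] by (simp add: case_prod_unfold)
  finally show "(\<Sum>w\<in>Q. \<chi> (a * mat_trace (w * \<sigma> s))) = - K a * ?R" .
  have "(\<Sum>w\<in>Q. \<chi> (a * mat_trace (\<rho> * w * \<sigma> s))) = (\<Sum>x\<in>Qdom. \<chi> (a * mat_trace (\<rho> * Qmap x * \<sigma> s)))"
    by (rule sum.reindex_bij_betw[OF bij_Qmap, symmetric])
  also have "\<dots> = (\<Sum>(A, d, h, T)\<in>Qdom. ?f1 A * 1 * ?f3 A h * ?f4 A T)"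
  proof (rule sum.cong[OF refl])
    fix x assume "x \<in> Qdom"
    then obtain A d1 d2 h T where x: "x = (A, (d1, d2), h, T)" "A \<in> GL m" "h \<in> carrier_mat 2 m" "T \<in> alt_mats m 0"
      unfolding Qdom_def by auto
    note Tc = alt_matsD(1)[OF x(4)]
    have "mat_trace (\<rho> * Qmap x * \<sigma> s) = (\<Sum>k<s. \<Sum>j<m. A $$ (k, j) * T $$ (j, k)) + (\<Sum>k<s. \<Sum>j<m. A $$ (k, j) * dmat h $$ (k, j))
     + (\<Sum>k\<in>{s..<m}. A $$ (k, k) + minv A $$ (k, k))"
      unfolding x(1) Qmap_def case_prod_conv trace_split(2)[OF s x(2,3) Tc] trace_split(1)[OF s x(2,3) Tc] so2_index add_left_self
      by (simp add: add.assoc add_self)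
    then show "\<chi> (a * mat_trace (\<rho> * Qmap x * \<sigma> s)) = (case x of (A, d, h, T) \<Rightarrow> ?f1 A * 1 * ?f3 A h * ?f4 A T)"
      unfolding x(1) case_prod_conv snd_conv by (simp only: distrib_left[of a] lam_add mult_ac mult_1_left)
  qed
  also have "\<dots> = (\<Sum>d\<in>SO2. 1) * ?R" unfolding sum_Qdom R ..
  also have "(\<Sum>d\<in>SO2. 1) = int q + 1" by (simp add: card_SO2')
  finally show "(\<Sum>w\<in>Q. \<chi> (a * mat_trace (\<rho> * w * \<sigma> s))) = (int q + 1) * ?R" .
qed

section \<open>The stabilizer\<close>

lemma card_h_zero_cols:
  assumes "m = s + t"
  shows "card {h \<in> carrier_mat 2 m. \<forall>c<2. \<forall>l<s. h $$ (c, l) = (0 :: 'a)} = q ^ (2 * t)"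
proof -
  have "card {h \<in> carrier_mat 2 m. \<forall>c<2. \<forall>l<s. h $$ (c, l) = (0 :: 'a)} = card (carrier_mat 2 t :: 'a mat set)"
  proof (rule bij_betw_same_card[of "\<lambda>h. mat 2 t (\<lambda>(c, l). h $$ (c, s + l))"],
      rule bij_betw_byWitness[where f' = "\<lambda>h. mat 2 m (\<lambda>(c, l). if l < s then 0 else h $$ (c, l - s))"])
  qed (use assms in \<open>auto intro!: eq_matI\<close>)
  then show ?thesis by (simp add: card_carrier_mat card_UNIV)
qed

text \<open>Conjugation by \<sigma>_s exchanges the members of the first s hyperbolic pairs, and by
  \<open>O_in_Q\<close> only the entries that land below the first m columns matter. These are the
  upper right block of A, the first s columns of i h, the upper left block of A B, and a block of
  the inverse of A that vanishes along with the first. Once those columns of h are zero,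
  \<open>dmat h\<close> vanishes in their rows and the condition on A B becomes one on T.\<close>

lemma stab_iff:
  assumes m: "m = s + t" and A: "A \<in> GL m" and d: "(d1, d2) \<in> SO2" and h: "h \<in> carrier_mat 2 m" and T: "T \<in> alt_mats m 0"
  shows "Qmap (A, (d1, d2), h, T) \<in> stab s \<longleftrightarrow>
    A \<in> lower_GL s t \<and> (\<forall>c<2. \<forall>l<s. h $$ (c, l) = 0) \<and> T \<in> alt_mats m s"
proof -
  have s: "s \<le> m" using m by simp
  let ?i = "so2 d1 d2" and ?B = "T + transpose_mat (dmat h)"
  define u where "u = Qel A ?i ?B h"
  have uQ: "u \<in> Q" using bij_Qmap A d h T unfolding bij_betw_def by (force simp: u_def Qmap_def Qdom_def)
  have uc: "u \<in> carrier_mat N N" by (simp add: u_def)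
  have Ac: "A \<in> carrier_mat m m" using A by (simp add: GL_iff)
  have Tc: "T \<in> carrier_mat m m" by (rule alt_matsD(1)[OF T])
  have dc: "dmat h \<in> carrier_mat m m" by simp
  have Bc: "?B \<in> carrier_mat m m" using Tc by simp
  let ?v = "\<sigma> s * u * \<sigma> s"
  have v: "?v $$ (k, l) = u $$ (sp s k, sp s l)" if "k < N" "l < N" for k l
    by (rule sigma_conj_index[OF s uc that])
  have vO: "?v \<in> O_minus \<kappa> (Suc m)" using O_minus_mult sigma_O[OF s] uQ Q_subset_O by blast
  have vcor: "corner ?v = corner u"
    by (rule eq_matI) (use v s in \<open>auto simp: corner_def sp_eq\<close>)
  have iG: "?i \<in> GL 2" by (rule so2_GL[OF d])
  have ix1: "u $$ (k, l) = A $$ (k, l)" if "k < m" "l < m" for k l unfolding u_def by (rule Qel_index(1)[OF that, of 0 0]) auto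
  have ix2: "u $$ (k, m + l) = (A * ?B) $$ (k, l)" if "k < m" "l < m" for k l unfolding u_def by (rule Qel_index(2)[OF that, of 0 0]) auto
  have ix4: "u $$ (m + k, l) = 0" if "k < m" "l < m" for k l unfolding u_def by (rule Qel_index(4)[OF that, of 0 0]) auto
  have ix5: "u $$ (m + k, m + l) = minv A $$ (l, k)" if "k < m" "l < m" for k l unfolding u_def by (rule Qel_index(5)[OF that, of 0 0]) auto
  have ix7: "u $$ (2 * m + c, l) = 0" if "c < 2" "l < m" for c l unfolding u_def by (rule Qel_index(7)[OF that(2,2,1,1)])
  have ix8: "u $$ (2 * m + c, m + l) = (?i * h) $$ (c, l)" if "c < 2" "l < m" for c l unfolding u_def by (rule Qel_index(8)[OF that(2,2,1,1)])
  have ih: "(?i * h) $$ (c, l) = (\<Sum>e<2. ?i $$ (c, e) * h $$ (e, l))" if "c < 2" "l < m" for c l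
    by (rule mult_mat_index[OF so2_carrier(1) h that])
  have AB: "(A * ?B) $$ (k, l) = (\<Sum>j<s. A $$ (k, j) * (T $$ (j, l) + dmat h $$ (l, j)))"
    if L: "A \<in> lower_GL s t" and kl: "k < s" "l < s" for k l
  proof -
    have km: "k < m" "l < m" using kl s by auto
    have "(A * ?B) $$ (k, l) = (\<Sum>j<m. A $$ (k, j) * (T $$ (j, l) + dmat h $$ (l, j)))"
      unfolding mult_mat_index[OF Ac Bc km] by (rule sum.cong) (use km Tc carrier_matD[OF dc] in auto)
    also have "\<dots> = (\<Sum>j<s. A $$ (k, j) * (T $$ (j, l) + dmat h $$ (l, j)))"
    proof (rule sum.mono_neutral_right)
      show "\<forall>j\<in>{..<m} - {..<s}. A $$ (k, j) * (T $$ (j, l) + dmat h $$ (l, j)) = 0"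
      proof
        fix j assume "j \<in> {..<m} - {..<s}"
        then have "j - s < t" "s + (j - s) = j" using m by auto
        then have "A $$ (k, j) = 0" using L kl(1) unfolding lower_GL_def by (metis (mono_tags, lifting) mem_Collect_eq)
        then show "A $$ (k, j) * (T $$ (j, l) + dmat h $$ (l, j)) = 0" by simp
      qed
    qed (use s in auto)
    finally show ?thesis .
  qed
  have dz: "dmat h $$ (l, j) = 0" if "\<forall>c<2. \<forall>l<s. h $$ (c, l) = 0" "l < s" "j < m" for l j
  proof -
    have "h $$ (0, l) = 0" "h $$ (Suc 0, l) = 0" using that by auto
    then show ?thesis using that s by (simp add: dmat_def)
  qed
  have stab: "u \<in> stab s \<longleftrightarrow> ?v \<in> Q" using uQ by (simp add: stab_def)
  show ?thesis
  proof
    assume "Qmap (A, (d1, d2), h, T) \<in> stab s"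
    then have vQ: "?v \<in> Q" using stab by (simp add: Qmap_def u_def)
    have z: "u $$ (sp s k, sp s l) = 0" if "m \<le> k" "k < N" "l < m" for k l
      using Q_blocks(1)[OF vQ that] v[of k l] that by simp
    have L: "A \<in> lower_GL s t"
      unfolding lower_GL_def
    proof (intro CollectI conjI allI impI)
      show "A \<in> GL (s + t)" using A m by simp
      fix k j assume kj: "k < s" "j < t"
      then have "k < m" "s + j < m" using m by auto
      then show "A $$ (k, s + j) = 0" using z[of "m + k" "s + j"] ix1[of k "s + j"] kj by (simp add: sp_eq)
    qed
    have hz: "\<forall>c<2. \<forall>l<s. h $$ (c, l) = 0"
    proof (intro allI impI)
      fix c l :: nat assume c: "c < 2" and l: "l < s"
      have lm: "l < m" using l s by simp
      show "h $$ (c, l) = 0"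
      proof (rule det_nonzero_kernel[of ?i 2 "\<lambda>e. h $$ (e, l)" c])
        show "?i \<in> carrier_mat 2 2" "det ?i \<noteq> 0" using iG by (auto simp: GL_iff)
        show "(\<Sum>j<2. ?i $$ (e, j) * h $$ (j, l)) = 0" if "e < 2" for e
          unfolding ih[OF that lm, symmetric] ix8[OF that lm, symmetric]
          using z[of "2 * m + e" l] that l lm s by (simp add: sp_eq)
      qed (rule c)
    qed
    have "T $$ (j, l) = 0" if jl: "j < s" "l < s" for j l
    proof -
      have "T $$ (j, l) + dmat h $$ (l, j) = 0"
      proof (rule det_nonzero_kernel[of "sub11 s A" s "\<lambda>j. T $$ (j, l) + dmat h $$ (l, j)" j])
        show "sub11 s A \<in> carrier_mat s s" "det (sub11 s A) \<noteq> 0" using lower_GL_sub(1)[OF L] by (auto simp: GL_iff)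
        show "(\<Sum>j<s. sub11 s A $$ (k, j) * (T $$ (j, l) + dmat h $$ (l, j))) = 0" if k: "k < s" for k
        proof -
          have "(\<Sum>j<s. sub11 s A $$ (k, j) * (T $$ (j, l) + dmat h $$ (l, j))) = (A * ?B) $$ (k, l)"
            unfolding AB[OF L k jl(2)] by (rule sum.cong) (use k in \<open>auto simp: sub11_def\<close>)
          also have "\<dots> = 0" using z[of "m + k" l] ix2[of k l] k jl s by (simp add: sp_eq)
          finally show ?thesis .
        qed
      qed (rule jl(1))
      moreover have "dmat h $$ (l, j) = 0" using dz[OF hz jl(2)] jl s by simp
      ultimately show ?thesis by simp
    qed
    then have "T \<in> alt_mats m s" using T by (simp add: alt_mats_def)
    then show "A \<in> lower_GL s t \<and> (\<forall>c<2. \<forall>l<s. h $$ (c, l) = 0) \<and> T \<in> alt_mats m s" using L hz by blast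
  next
    assume as: "A \<in> lower_GL s t \<and> (\<forall>c<2. \<forall>l<s. h $$ (c, l) = 0) \<and> T \<in> alt_mats m s"
    then have L: "A \<in> lower_GL s t" and hz: "\<forall>c<2. \<forall>l<s. h $$ (c, l) = 0" and Ts: "T \<in> alt_mats m s" by auto
    have "?v \<in> Q"
    proof (rule O_in_Q[OF vO])
      show "corner ?v \<in> SO_minus_2 \<kappa>" unfolding vcor by (rule Q_blocks(3)[OF uQ])
      fix k l assume kl: "m \<le> k" "k < N" "l < m"
      have "u $$ (sp s k, sp s l) = 0"
      proof (cases rule: index_cases[OF kl(2)])
        case 1
        then show ?thesis using kl by simp
      next
        case (2 k')
        show ?thesis
        proof (cases "k' < s"; cases "l < s")
          assume a: "k' < s" "l < s"
          have "(A * ?B) $$ (k', l) = 0"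
            unfolding AB[OF L a]
          proof (rule sum.neutral, rule)
            fix j assume "j \<in> {..<s}"
            then have "T $$ (j, l) = 0" "dmat h $$ (l, j) = 0" using Ts a(2) dz[OF hz a(2), of j] s by (auto simp: alt_mats_def)
            then show "A $$ (k', j) * (T $$ (j, l) + dmat h $$ (l, j)) = 0" by simp
          qed
          then show ?thesis using a 2 kl s ix2[of k' l] by (simp add: sp_eq)
        next
          assume a: "k' < s" "\<not> l < s"
          have "l - s < t" "s + (l - s) = l" using a kl m by auto
          then have "A $$ (k', l) = 0" using L a(1) unfolding lower_GL_def by (metis (mono_tags, lifting) mem_Collect_eq)
          then show ?thesis using a 2 kl s ix1[of k' l] by (simp add: sp_eq)
        next
          assume a: "\<not> k' < s" "l < s"
          have "minv A $$ (l, k') = 0" using lower_GL_minv(1)[OF L a(2), of "k' - s"] a 2 m by simp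
          then show ?thesis using a 2 kl s ix5[of k' l] by (simp add: sp_eq)
        next
          assume a: "\<not> k' < s" "\<not> l < s"
          then show ?thesis using 2 kl s ix4[of k' l] by (simp add: sp_eq)
        qed
      next
        case (3 c)
        show ?thesis
        proof (cases "l < s")
          case True
          have "(?i * h) $$ (c, l) = 0" unfolding ih[OF 3(2) kl(3)] using hz True by simp
          then show ?thesis using True 3 kl s ix8[of c l] by (simp add: sp_eq)
        next
          case False
          then show ?thesis using 3 kl s ix7[of c l] by (simp add: sp_eq)
        qed
      qed
      then show "?v $$ (k, l) = 0" using v[of k l] kl by simp
    qed
    then show "Qmap (A, (d1, d2), h, T) \<in> stab s" using stab by (simp add: Qmap_def u_def)
  qed
qed

lemma card_stab:
  assumes m: "m = s + t"
  shows "card (stab s) = card (GL s :: 'a mat set) * (q ^ (t * s) * card (GL t :: 'a mat set)) * ((q + 1) * (q ^ (2 * t) * q ^ (\<Sum>j\<in>{s..<m}. j)))"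
proof -
  let ?H = "{h \<in> carrier_mat 2 m. \<forall>c<2. \<forall>l<s. h $$ (c, l) = (0 :: 'a)}"
  let ?P = "(lower_GL s t :: 'a mat set) \<times> SO2 \<times> ?H \<times> (alt_mats m s :: 'a mat set)"
  have sub: "?P \<subseteq> Qdom" unfolding Qdom_def using m by (auto simp: lower_GL_def alt_mats_def)
  have "stab s = Qmap ` ?P"
  proof (intro subset_antisym subsetI)
    fix g assume g: "g \<in> stab s"
    then have "g \<in> Q" by (simp add: stab_def)
    then obtain x where x: "x \<in> Qdom" "g = Qmap x" using bij_Qmap unfolding bij_betw_def by blast
    then obtain A d1 d2 h T where y: "x = (A, (d1, d2), h, T)" "A \<in> GL m" "(d1, d2) \<in> SO2" "h \<in> carrier_mat 2 m" "T \<in> alt_mats m 0"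
      unfolding Qdom_def by auto
    have "x \<in> ?P" using stab_iff[OF m y(2-5)] g x(2) y by simp
    then show "g \<in> Qmap ` ?P" using x(2) by blast
  next
    fix g assume "g \<in> Qmap ` ?P"
    then obtain x where x: "x \<in> ?P" "g = Qmap x" by blast
    obtain A d1 d2 h T where y: "x = (A, (d1, d2), h, T)" "A \<in> GL m" "(d1, d2) \<in> SO2" "h \<in> carrier_mat 2 m" "T \<in> alt_mats m 0"
      using subsetD[OF sub x(1)] unfolding Qdom_def by auto
    show "g \<in> stab s" using stab_iff[OF m y(2-5)] x y(1) by simp
  qed
  moreover have "inj_on Qmap ?P" using bij_Qmap sub unfolding bij_betw_def by (meson inj_on_subset)
  ultimately have "card (stab s) = card ?P" by (simp add: card_image)
  also have "\<dots> = card (lower_GL s t :: 'a mat set) * (card SO2 * (card ?H * card (alt_mats m s :: 'a mat set)))"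
    by (simp only: card_cartesian_product)
  also have "card (alt_mats m s :: 'a mat set) = q ^ (\<Sum>j\<in>{s..<m}. j)" using card_alt_mats[of s m, where 'b = 'a] m card_UNIV by simp
  finally show ?thesis unfolding card_h_zero_cols[OF m] card_lower_GL card_SO2' card_UNIV by (simp only: mult.assoc)
qed

end

section \<open>Orders of linear groups and the constants\<close>

definition tri :: "nat \<Rightarrow> nat" where "tri k = (\<Sum>j<k. j)"

lemma tri_Suc: "tri (Suc k) = tri k + k" by (simp add: tri_def)

lemma tri_even: "tri (2 * k) + k = 2 * (k * k)"
  by (induction k) (simp_all add: tri_def)

lemma tri_odd: "tri (Suc (2 * k)) = 2 * (k * k) + k"
  using tri_even[of k] by (simp add: tri_Suc)

lemma odd_prod_Suc: "odd_prod q (Suc k) = odd_prod q k * (real q ^ Suc (2 * k) - 1)"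
  by (simp add: odd_prod_def)

lemma even_prod_Suc: "even_prod q (Suc k) = even_prod q k * (real q ^ Suc (Suc (2 * k)) - 1)"
  by (simp add: even_prod_def)

context char2_field
begin

abbreviation p :: real where "p \<equiv> real q"
abbreviation Gl :: "'a itself \<Rightarrow> nat \<Rightarrow> real" where "Gl T k \<equiv> real (card (GL k :: 'a mat set))"
abbreviation Sym :: "'a itself \<Rightarrow> nat \<Rightarrow> real" where "Sym T k \<equiv> real (card (SymGL k :: 'a mat set))"

lemma p_ge_2: "p \<ge> 2" using q_ge_2 by simp

lemma p_power_neq_1: "p ^ Suc k \<noteq> 1"
  using one_less_power[of p "Suc k"] p_ge_2 by simp

lemma Gl_Suc: "Gl TYPE('a) (Suc k) = (p ^ Suc k - 1) * (p ^ k * Gl TYPE('a) k)"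
proof -
  have "1 \<le> q ^ Suc k" using q_ge_2 by (intro one_le_power) simp
  then show ?thesis unfolding card_GL_Suc card_UNIV of_nat_mult by (simp only: of_nat_diff of_nat_power of_nat_1)
qed

lemma Sym_Suc: "Sym TYPE('a) (Suc k) = (p - 1) * p ^ k * Sym TYPE('a) k + (p ^ k - 1) * (p ^ k * Sym TYPE('a) (k - 1))"
proof -
  have "1 \<le> q ^ k" "1 \<le> q" using q_ge_2 by simp_all
  then show ?thesis unfolding card_SymGL_Suc card_UNIV of_nat_mult of_nat_add
    by (simp only: of_nat_diff of_nat_power of_nat_1)
qed

text \<open>The factors q^j - 1 are separated by the parity of j, since the odd ones also make up
  the number of symmetric matrices; the even ones are left over in B.\<close>

lemma Gl_closed:
  "Gl TYPE('a) (2 * k) = p ^ tri (2 * k) * (odd_prod q k * even_prod q k)"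
  "Gl TYPE('a) (Suc (2 * k)) = p ^ tri (Suc (2 * k)) * (odd_prod q (Suc k) * even_prod q k)"
proof -
  have step: "Gl TYPE('a) (2 * k) = p ^ tri (2 * k) * (odd_prod q k * even_prod q k) \<Longrightarrow>
    Gl TYPE('a) (Suc (2 * k)) = p ^ tri (Suc (2 * k)) * (odd_prod q (Suc k) * even_prod q k)" for k
    unfolding Gl_Suc odd_prod_Suc tri_Suc power_add by (simp only: mult_ac)
  have "Gl TYPE('a) (2 * k) = p ^ tri (2 * k) * (odd_prod q k * even_prod q k)"
  proof (induction k)
    case 0
    show ?case by (simp add: card_GL_0 tri_def odd_prod_def even_prod_def)
  next
    case (Suc k)
    have "Gl TYPE('a) (2 * Suc k) = (p ^ Suc (Suc (2 * k)) - 1) * (p ^ Suc (2 * k) * Gl TYPE('a) (Suc (2 * k)))"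
      unfolding Gl_Suc[symmetric] by simp
    also have "\<dots> = p ^ tri (Suc (Suc (2 * k))) * (odd_prod q (Suc k) * even_prod q (Suc k))"
      unfolding step[OF Suc] even_prod_Suc tri_Suc[of "Suc (2 * k)"] power_add by (simp only: mult_ac)
    finally show ?case by simp
  qed
  then show "Gl TYPE('a) (2 * k) = p ^ tri (2 * k) * (odd_prod q k * even_prod q k)"
    "Gl TYPE('a) (Suc (2 * k)) = p ^ tri (Suc (2 * k)) * (odd_prod q (Suc k) * even_prod q k)" using step by blast+
qed

text \<open>The recurrence reaches back two sizes, so sizes 2k and 2k + 1 go through the induction
  together. They share the power of q and differ by one factor with odd exponent.\<close>

lemma Sym_closed:
  "Sym TYPE('a) (2 * k) = p ^ (k * k + k) * odd_prod q k \<and> Sym TYPE('a) (Suc (2 * k)) = p ^ (k * k + k) * odd_prod q (Suc k)"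
proof (induction k)
  case 0
  show ?case by (simp add: card_SymGL_0 Sym_Suc odd_prod_def)
next
  case (Suc k)
  let ?y = "p ^ (k * k + k)" and ?z = "p ^ Suc (2 * k)" and ?O = "odd_prod q k"
  have O: "odd_prod q (Suc k) = ?O * (?z - 1)" by (rule odd_prod_Suc)
  have e: "p ^ (Suc k * Suc k + Suc k) = ?y * ?z * p"
  proof -
    have "Suc k * Suc k + Suc k = (k * k + k) + Suc (2 * k) + 1" by simp
    then show ?thesis by (simp only: power_add power_one_right)
  qed
  have S0: "Sym TYPE('a) (2 * k) = ?y * ?O" and S1: "Sym TYPE('a) (Suc (2 * k)) = ?y * (?O * (?z - 1))"
    using Suc O by simp_all
  have id1: "(c - 1) * z * (y * (w * (z - 1))) + (z - 1) * (z * (y * w)) = y * z * c * (w * (z - 1))" for c y z w :: real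
    by (simp add: algebra_simps)
  have even: "Sym TYPE('a) (Suc (Suc (2 * k))) = p ^ (Suc k * Suc k + Suc k) * odd_prod q (Suc k)"
    unfolding Sym_Suc[of "Suc (2 * k)", unfolded diff_Suc_1] S0 S1 e O by (rule id1)
  have z: "p ^ Suc (Suc (2 * k)) = p * ?z" "p ^ Suc (2 * Suc k) = p * (p * ?z)" by simp_all
  have id2: "(c - 1) * (c * z) * (y * z * c * (w * (z - 1))) + (c * z - 1) * (c * z * (y * (w * (z - 1))))
      = y * z * c * (w * (z - 1) * (c * (c * z) - 1))" for c y z w :: real
    by (simp add: algebra_simps)
  have "Sym TYPE('a) (Suc (Suc (Suc (2 * k)))) = p ^ (Suc k * Suc k + Suc k) * odd_prod q (Suc (Suc k))"
    unfolding Sym_Suc[of "Suc (Suc (2 * k))", unfolded diff_Suc_1] even S1 e odd_prod_Suc[of q "Suc k"] O z by (rule id2)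
  then have "Sym TYPE('a) (Suc (2 * Suc k)) = p ^ (Suc k * Suc k + Suc k) * odd_prod q (Suc (Suc k))" by simp
  then show ?case using even by simp
qed

section \<open>The constants of the statement in terms of group orders\<close>

lemma gauss_binom_values:
  "gauss_binom q k 0 = 1" "gauss_binom q k 1 = (p ^ k - 1) / (p - 1)"
  "gauss_binom q k 2 = (p ^ k - 1) / (p ^ 2 - 1) * ((p ^ (k - 1) - 1) / (p - 1))"
  by (simp_all add: gauss_binom_def numeral_2_eq_2)

text \<open>The Gaussian binomial is the index in \<open>GL (s + t)\<close> of the block triangular
  group of \<open>lower_GL\<close>. Sizes t up to 2 are checked directly from the product
  formula.\<close>

lemma Gl_ratio:
  assumes "t \<le> 2"
  shows "Gl TYPE('a) (s + t) = p ^ (t * s) * gauss_binom q (s + t) t * (Gl TYPE('a) s * Gl TYPE('a) t)"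
proof -
  have p1: "p - 1 \<noteq> 0" "p ^ 2 - 1 \<noteq> 0" using p_power_neq_1[of 0] p_power_neq_1[of 1] by (simp_all add: numeral_2_eq_2)
  have g1: "Gl TYPE('a) 1 = p - 1" using Gl_Suc[of 0] by (simp add: card_GL_0)
  have g2: "Gl TYPE('a) 2 = (p ^ 2 - 1) * (p * (p - 1))" using Gl_Suc[of 1] g1 by (simp add: numeral_2_eq_2)
  consider "t = 0" | "t = 1" | "t = 2" using assms by linarith
  then show ?thesis
  proof cases
    case 1
    then show ?thesis by (simp add: gauss_binom_values card_GL_0)
  next
    case 2
    have id: "x * (y * z) = y * (x / c) * (z * c)" if "c \<noteq> 0" for x y z c :: real using that by simp
    have "Gl TYPE('a) (s + 1) = (p ^ (s + 1) - 1) * (p ^ s * Gl TYPE('a) s)" using Gl_Suc[of s] by simp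
    also have "\<dots> = p ^ s * ((p ^ (s + 1) - 1) / (p - 1)) * (Gl TYPE('a) s * (p - 1))" by (rule id[OF p1(1)])
    finally show ?thesis unfolding 2 gauss_binom_values g1 mult_1 .
  next
    case 3
    have "Gl TYPE('a) (s + 2) = (p ^ (s + 2) - 1) * (p * p ^ s * ((p ^ Suc s - 1) * (p ^ s * Gl TYPE('a) s)))"
      using Gl_Suc[of "Suc s"] Gl_Suc[of s] by simp
    also have "\<dots> = p ^ s * p ^ s * ((p ^ (s + 2) - 1) / (p ^ 2 - 1) * ((p ^ Suc s - 1) / (p - 1))) * (Gl TYPE('a) s * ((p ^ 2 - 1) * (p * (p - 1))))"
    proof -
      have id: "(x * c) * (b * v * ((y * d) * (v * z))) = v * v * (x * y) * (z * (c * (b * d)))" for x y z c d v b :: real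
        by (simp only: mult_ac)
      have div: "x / c * c = x" if "c \<noteq> 0" for x c :: real using that by simp
      show ?thesis
        using id[of "(p ^ (s + 2) - 1) / (p ^ 2 - 1)" "p ^ 2 - 1" p "p ^ s" "(p ^ Suc s - 1) / (p - 1)" "p - 1" "Gl TYPE('a) s"]
        unfolding div[OF p1(1)] div[OF p1(2)] .
    qed
    also have "p ^ s * p ^ s = p ^ (2 * s)" by (simp add: mult_2 power_add)
    also have "Suc s = s + 2 - 1" by simp
    finally show ?thesis unfolding 3 gauss_binom_values g2 .
  qed
qed

text \<open>The absolute factor of the exponential sum over a double coset: the index of the
  stabilizer in Q times the contributions of h, of T, of the symmetric block and of the lower left
  block.\<close>

definition Afac :: "'a itself \<Rightarrow> nat \<Rightarrow> nat \<Rightarrow> real" where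
  "Afac T s t = p ^ (2 * s + tri s) * gauss_binom q (s + t) t * (p ^ (s + t + t) * p ^ tri (s + t) * (Sym TYPE('a) s * p ^ (t * s)))"

text \<open>Reduces each identity for A to a comparison E of exponents of q, once the number of
  symmetric matrices is known as a power of q times w. The next lemma does the same for B.\<close>

lemma Afac_eqI:
  assumes "Sym TYPE('a) s = p ^ e * w" "E = 2 * s + tri s + (s + t + t) + tri (s + t) + t * s + e"
  shows "p ^ E * (gauss_binom q (s + t) t * w) = Afac TYPE('a) s t"
  unfolding Afac_def assms power_add by (simp only: mult_ac)

lemma Bfac_eqI:
  assumes "Sym TYPE('a) s = p ^ e * w" "Gl TYPE('a) (s + t) = p ^ tri (s + t) * w'" "w * y = w'" "b + (t + t * s + e) = tri (s + t) + (s + t)"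
  shows "(p + 1) * (p ^ b * y) * (p ^ (t + t * s) * Sym TYPE('a) s) = (p + 1) * Gl TYPE('a) (s + t) * p ^ (s + t)"
proof -
  have "(p + 1) * (p ^ b * y) * (p ^ (t + t * s) * Sym TYPE('a) s) = (p + 1) * (p ^ (b + (t + t * s + e)) * (w * y))"
    unfolding assms(1) power_add by (simp only: mult_ac)
  also have "\<dots> = (p + 1) * Gl TYPE('a) (s + t) * p ^ (s + t)"
    unfolding assms(2,3,4) power_add by (simp only: mult_ac)
  finally show ?thesis .
qed

text \<open>What A contains beyond \<open>Afac\<close>: the factor q + 1 is the order of the torus
  in the cosets with \<rho>, and the additional q for i = 4 is the one split off from
  \<open>KGL 2\<close>.\<close>

definition cfac :: "nat \<Rightarrow> real" where
  "cfac i = (if i = 3 then p + 1 else if i = 4 then (p + 1) * p else 1)"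

text \<open>The equation N = A B after cancellation of the index of the stabilizer and of common
  powers of q.\<close>

definition Bcond :: "'a itself \<Rightarrow> nat \<Rightarrow> real \<Rightarrow> nat \<Rightarrow> nat \<Rightarrow> bool" where
  "Bcond T i B s t \<longleftrightarrow> cfac i * B * (p ^ (t + t * s) * Sym TYPE('a) s) = (p + 1) * Gl TYPE('a) (s + t) * p ^ (s + t)"

lemma consts_plus_1:
  assumes n: "n = Suc (Suc (2 * k))"
  shows "A_plus 1 n q = cfac 1 * Afac TYPE('a) (Suc (2 * k)) 0" "Bcond TYPE('a) 1 (B_plus 1 n q) (Suc (2 * k)) 0"
proof -
  have e: "(5 * n\<^sup>2 - 2 * n - 4) div 4 = 5 * (k * k) + 9 * k + 3"
  proof -
    have "5 * n\<^sup>2 = 4 * (5 * (k * k) + 9 * k + 3) + 2 * n + 4" by (simp add: n power2_eq_square)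
    then show ?thesis by simp
  qed
  have e2: "n\<^sup>2 div 4 = (k * k) + 2 * k + 1"
  proof -
    have "n\<^sup>2 = 4 * ((k * k) + 2 * k + 1)" by (simp add: n power2_eq_square)
    then show ?thesis by simp
  qed
  have n': "n - 1 = Suc (2 * k)" "(n - 2) div 2 = k" by (simp_all add: n)
  note S = Sym_closed[of k, THEN conjunct2]
  have "A_plus 1 n q = p ^ (5 * (k * k) + 9 * k + 3) * (gauss_binom q (Suc (2 * k) + 0) 0 * odd_prod q (Suc k))"
    unfolding A_plus_def e n' odd_prod_Suc gauss_binom_values by (simp add: mult_ac)
  also have "\<dots> = Afac TYPE('a) (Suc (2 * k)) 0"
    by (rule Afac_eqI[OF S]) (simp add: tri_odd)
  finally show "A_plus 1 n q = cfac 1 * Afac TYPE('a) (Suc (2 * k)) 0" by (simp add: cfac_def)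
  have "cfac 1 * B_plus 1 n q = (p + 1) * (p ^ ((k * k) + 2 * k + 1) * even_prod q k)"
    unfolding B_plus_def e2 n' by (simp add: cfac_def)
  then show "Bcond TYPE('a) 1 (B_plus 1 n q) (Suc (2 * k)) 0" unfolding Bcond_def
    using Bfac_eqI[OF S, of 0 _ "even_prod q k" "(k * k) + 2 * k + 1"] Gl_closed(2)[of k] by (simp add: tri_odd)
qed

lemma consts_plus_23:
  assumes n: "n = Suc (Suc (2 * k))" and i: "i \<in> {2, 3}"
  shows "A_plus i n q = cfac i * Afac TYPE('a) (2 * k) 1" "Bcond TYPE('a) i (B_plus i n q) (2 * k) 1"
proof -
  have e: "(5 * n\<^sup>2 - 2 * n - 8) div 4 = 5 * (k * k) + 9 * k + 2"
  proof -
    have "5 * n\<^sup>2 = 4 * (5 * (k * k) + 9 * k + 2) + 2 * n + 8" by (simp add: n power2_eq_square)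
    then show ?thesis by simp
  qed
  have e2: "(n - 2)\<^sup>2 div 4 = k * k" by (simp add: n power2_eq_square)
  have n': "n - 1 = 2 * k + 1" "(n - 2) div 2 = k" by (simp_all add: n)
  note S = Sym_closed[of k, THEN conjunct1]
  have "p ^ (5 * (k * k) + 9 * k + 2) * (gauss_binom q (2 * k + 1) 1 * odd_prod q k) = Afac TYPE('a) (2 * k) 1"
    by (rule Afac_eqI[OF S]) (use tri_even[of k] tri_odd[of k] in simp)
  then show "A_plus i n q = cfac i * Afac TYPE('a) (2 * k) 1"
    using i unfolding A_plus_def e n' by (auto simp: cfac_def mult_ac)
  have "cfac i * B_plus i n q = (p + 1) * (p ^ (k * k) * ((p ^ (2 * k + 1) - 1) * even_prod q k))"
    using i unfolding B_plus_def e2 n' by (auto simp: cfac_def)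
  then show "Bcond TYPE('a) i (B_plus i n q) (2 * k) 1" unfolding Bcond_def
    using Bfac_eqI[OF S, of 1 "odd_prod q (Suc k) * even_prod q k" "(p ^ (2 * k + 1) - 1) * even_prod q k" "k * k"] Gl_closed(2)[of k]
    by (simp add: tri_odd odd_prod_Suc)
qed

lemma consts_plus_4:
  assumes n: "n = Suc (Suc (Suc (Suc (2 * k))))"
  shows "A_plus 4 n q = cfac 4 * Afac TYPE('a) (Suc (2 * k)) 2" "Bcond TYPE('a) 4 (B_plus 4 n q) (Suc (2 * k)) 2"
proof -
  have e: "(5 * n\<^sup>2 - 6 * n - 4) div 4 = Suc (5 * (k * k) + 17 * k + 12)"
  proof -
    have "5 * n\<^sup>2 = 4 * (5 * (k * k) + 17 * k + 13) + 6 * n + 4" by (simp add: n power2_eq_square)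
    then show ?thesis by simp
  qed
  have e2: "(n - 2)\<^sup>2 div 4 = k * k + 2 * k + 1"
  proof -
    have "(n - 2)\<^sup>2 = 4 * (k * k + 2 * k + 1)" by (simp add: n power2_eq_square)
    then show ?thesis by simp
  qed
  have n': "n - 1 = Suc (2 * k) + 2" "(n - 2) div 2 = Suc k" by (simp_all add: n)
  have t: "tri (Suc (2 * k) + 2) = 2 * (k * k) + 5 * k + 3" using tri_odd[of "Suc k"] by simp
  note S = Sym_closed[of k, THEN conjunct2]
  have A: "p ^ (5 * (k * k) + 17 * k + 12) * (gauss_binom q (Suc (2 * k) + 2) 2 * odd_prod q (Suc k)) = Afac TYPE('a) (Suc (2 * k)) 2"
    by (rule Afac_eqI[OF S]) (use t tri_odd[of k] in simp)
  have "A_plus 4 n q = (p + 1) * p ^ Suc (5 * (k * k) + 17 * k + 12) * gauss_binom q (Suc (2 * k) + 2) 2 * odd_prod q (Suc k)"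
    unfolding A_plus_def e n' by simp
  also have "\<dots> = ((p + 1) * p) * (p ^ (5 * (k * k) + 17 * k + 12) * (gauss_binom q (Suc (2 * k) + 2) 2 * odd_prod q (Suc k)))"
    by (simp only: power_Suc mult_ac)
  finally show "A_plus 4 n q = cfac 4 * Afac TYPE('a) (Suc (2 * k)) 2" unfolding A by (simp add: cfac_def)
  have c: "cfac 4 * B_plus 4 n q = (p + 1) * (p ^ Suc (k * k + 2 * k + 1) * ((p ^ (Suc (2 * k) + 2) - 1) * even_prod q (Suc k)))"
    unfolding B_plus_def e2 n' by (auto simp: cfac_def mult_ac)
  have G: "Gl TYPE('a) (Suc (2 * k) + 2) = p ^ tri (Suc (2 * k) + 2) * (odd_prod q (Suc (Suc k)) * even_prod q (Suc k))"
    using Gl_closed(2)[of "Suc k"] by simp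
  show "Bcond TYPE('a) 4 (B_plus 4 n q) (Suc (2 * k)) 2" unfolding Bcond_def c
    by (rule Bfac_eqI[OF S G]) (simp add: odd_prod_Suc[of q "Suc k"], unfold t, simp)
qed

lemma consts_minus_1:
  assumes n: "n = Suc (2 * k)"
  shows "A_minus 1 n q = cfac 1 * Afac TYPE('a) (2 * k) 0" "Bcond TYPE('a) 1 (B_minus 1 n q) (2 * k) 0"
proof -
  have e: "5 * (n\<^sup>2 - 1) div 4 = 5 * (k * k) + 5 * k"
  proof -
    have "n\<^sup>2 = 4 * (k * k + k) + 1" by (simp add: n power2_eq_square)
    then show ?thesis by simp
  qed
  have e2: "(n - 1)\<^sup>2 div 4 = k * k" by (simp add: n power2_eq_square)
  have n': "(n - 1) div 2 = k" by (simp add: n)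
  note S = Sym_closed[of k, THEN conjunct1]
  have "p ^ (5 * (k * k) + 5 * k) * (gauss_binom q (2 * k + 0) 0 * odd_prod q k) = Afac TYPE('a) (2 * k) 0"
    by (rule Afac_eqI[OF S]) (use tri_even[of k] in simp)
  then show "A_minus 1 n q = cfac 1 * Afac TYPE('a) (2 * k) 0"
    unfolding A_minus_def e n' by (simp add: cfac_def gauss_binom_values)
  have "cfac 1 * B_minus 1 n q = (p + 1) * (p ^ (k * k) * even_prod q k)"
    unfolding B_minus_def e2 n' by (simp add: cfac_def)
  then show "Bcond TYPE('a) 1 (B_minus 1 n q) (2 * k) 0" unfolding Bcond_def
    using Bfac_eqI[OF S, of 0 _ "even_prod q k" "k * k"] Gl_closed(1)[of k] tri_even[of k] by simp
qed

lemma consts_minus_23: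
  assumes n: "n = Suc (Suc (Suc (2 * k)))" and i: "i \<in> {2, 3}"
  shows "A_minus i n q = cfac i * Afac TYPE('a) (Suc (2 * k)) 1" "Bcond TYPE('a) i (B_minus i n q) (Suc (2 * k)) 1"
proof -
  have e: "(5 * n\<^sup>2 - 4 * n - 5) div 4 = 5 * (k * k) + 13 * k + 7"
  proof -
    have "5 * n\<^sup>2 = 4 * (5 * (k * k) + 13 * k + 7) + 4 * n + 5" by (simp add: n power2_eq_square)
    then show ?thesis by simp
  qed
  have e2: "(n - 1)\<^sup>2 div 4 = k * k + 2 * k + 1"
  proof -
    have "(n - 1)\<^sup>2 = 4 * (k * k + 2 * k + 1)" by (simp add: n power2_eq_square)
    then show ?thesis by simp
  qed
  have n': "n - 1 = Suc (2 * k) + 1" "(Suc (2 * k) + 1) div 2 = Suc k" by (simp_all add: n)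
  have t: "tri (Suc (2 * k) + 1) = 2 * (k * k) + 3 * k + 1" using tri_odd[of k] tri_Suc[of "Suc (2 * k)"] by simp
  note S = Sym_closed[of k, THEN conjunct2]
  have "p ^ (5 * (k * k) + 13 * k + 7) * (gauss_binom q (Suc (2 * k) + 1) 1 * odd_prod q (Suc k)) = Afac TYPE('a) (Suc (2 * k)) 1"
    by (rule Afac_eqI[OF S]) (use t tri_odd[of k] in simp)
  then show "A_minus i n q = cfac i * Afac TYPE('a) (Suc (2 * k)) 1"
    using i unfolding A_minus_def e n' by (auto simp: cfac_def mult_ac)
  have c: "cfac i * B_minus i n q = (p + 1) * (p ^ (k * k + 2 * k + 1) * even_prod q (Suc k))"
    using i unfolding B_minus_def e2[unfolded n'] n' by (auto simp: cfac_def mult_ac)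
  have G: "Gl TYPE('a) (Suc (2 * k) + 1) = p ^ tri (Suc (2 * k) + 1) * (odd_prod q (Suc k) * even_prod q (Suc k))"
    using Gl_closed(1)[of "Suc k"] by simp
  show "Bcond TYPE('a) i (B_minus i n q) (Suc (2 * k)) 1" unfolding Bcond_def c
    by (rule Bfac_eqI[OF S G]) (rule refl, unfold t, simp)
qed

lemma consts_minus_4:
  assumes n: "n = Suc (Suc (Suc (2 * k)))"
  shows "A_minus 4 n q = cfac 4 * Afac TYPE('a) (2 * k) 2" "Bcond TYPE('a) 4 (B_minus 4 n q) (2 * k) 2"
proof -
  have e: "(5 * n\<^sup>2 - 4 * n - 9) div 4 = Suc (5 * (k * k) + 13 * k + 5)"
  proof -
    have "5 * n\<^sup>2 = 4 * (5 * (k * k) + 13 * k + 6) + 4 * n + 9" by (simp add: n power2_eq_square)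
    then show ?thesis by simp
  qed
  have e2: "(n - 3)\<^sup>2 div 4 = k * k" by (simp add: n power2_eq_square)
  have n': "n - 1 = 2 * k + 2" "n - 2 = Suc (2 * k)" "(n - 3) div 2 = k" by (simp_all add: n)
  have t: "tri (2 * k + 2) = 2 * (k * k) + 3 * k + 1" using tri_odd[of k] tri_Suc[of "Suc (2 * k)"] by simp
  note S = Sym_closed[of k, THEN conjunct1]
  have A: "p ^ (5 * (k * k) + 13 * k + 5) * (gauss_binom q (2 * k + 2) 2 * odd_prod q k) = Afac TYPE('a) (2 * k) 2"
    by (rule Afac_eqI[OF S]) (use t tri_even[of k] in simp)
  have "A_minus 4 n q = (p + 1) * p ^ Suc (5 * (k * k) + 13 * k + 5) * gauss_binom q (2 * k + 2) 2 * odd_prod q k"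
    unfolding A_minus_def e n' by simp
  also have "\<dots> = ((p + 1) * p) * (p ^ (5 * (k * k) + 13 * k + 5) * (gauss_binom q (2 * k + 2) 2 * odd_prod q k))"
    by (simp only: power_Suc mult_ac)
  finally show "A_minus 4 n q = cfac 4 * Afac TYPE('a) (2 * k) 2" unfolding A by (simp add: cfac_def)
  have c: "cfac 4 * B_minus 4 n q = (p + 1) * (p ^ Suc (k * k) * ((p ^ Suc (2 * k) - 1) * even_prod q (Suc k)))"
    unfolding B_minus_def e2 n' even_prod_Suc by (simp add: cfac_def mult_ac)
  have G: "Gl TYPE('a) (2 * k + 2) = p ^ tri (2 * k + 2) * (odd_prod q (Suc k) * even_prod q (Suc k))"
    using Gl_closed(1)[of "Suc k"] by simp
  show "Bcond TYPE('a) 4 (B_minus 4 n q) (2 * k) 2" unfolding Bcond_def c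
    by (rule Bfac_eqI[OF S G]) (simp only: odd_prod_Suc[of q k] mult_ac, unfold t, simp)
qed

text \<open>s is the index of \<sigma> in the double coset and t = n - 1 - s. The sign \<epsilon> is
  (-1)^n, written in the form in which (-1)^s will meet it.\<close>

lemma const_values:
  assumes ad: "admissible \<epsilon> i n"
  obtains s t where "n = Suc (s + t)" "t = (if i = 1 then 0 else if i = 4 then 2 else 1)"
    "A_const \<epsilon> i n q = cfac i * Afac TYPE('a) s t" "Bcond TYPE('a) i (B_const \<epsilon> i n q) s t" "\<epsilon> = - ((- 1) ^ (s + t))"
proof -
  from ad consider "\<epsilon> = 1" "i = 1" "even n" "n \<ge> 2" | "\<epsilon> = 1" "i \<in> {2, 3}" "even n" "n \<ge> 2" | "\<epsilon> = 1" "i = 4" "even n" "n \<ge> 4"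
    | "\<epsilon> = - 1" "i = 1" "odd n" | "\<epsilon> = - 1" "i \<in> {2, 3}" "odd n" "n \<ge> 3" | "\<epsilon> = - 1" "i = 4" "odd n" "n \<ge> 3"
    unfolding admissible_def by auto
  then show ?thesis
  proof cases
    case 1
    then have "n = 2 + (n - 2)" "even (n - 2)" by auto
    then obtain k where "n = 2 + 2 * k" by (metis evenE)
    then have n: "n = Suc (Suc (2 * k))" by simp
    show ?thesis using that[of "Suc (2 * k)" 0] consts_plus_1[OF n] 1 n by (simp add: A_const_def B_const_def)
  next
    case 2
    then have "n = 2 + (n - 2)" "even (n - 2)" by auto
    then obtain k where "n = 2 + 2 * k" by (metis evenE)
    then have n: "n = Suc (Suc (2 * k))" by simp
    show ?thesis using that[of "2 * k" 1] consts_plus_23[OF n 2(2)] 2 n by (auto simp: A_const_def B_const_def)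
  next
    case 3
    then have "n = 4 + (n - 4)" "even (n - 4)" by auto
    then obtain k where "n = 4 + 2 * k" by (metis evenE)
    then have n: "n = Suc (Suc (Suc (Suc (2 * k))))" by simp
    show ?thesis using that[of "Suc (2 * k)" 2] consts_plus_4[OF n] 3 n by (simp add: A_const_def B_const_def)
  next
    case 4
    then obtain k where n: "n = Suc (2 * k)" by (metis oddE Suc_eq_plus1)
    show ?thesis using that[of "2 * k" 0] consts_minus_1[OF n] 4 n by (simp add: A_const_def B_const_def)
  next
    case 5
    then have "n = 3 + (n - 3)" "even (n - 3)" by auto
    then obtain k where "n = 3 + 2 * k" by (metis evenE)
    then have n: "n = Suc (Suc (Suc (2 * k)))" by simp
    show ?thesis using that[of "Suc (2 * k)" 1] consts_minus_23[OF n 5(2)] 5 n by (auto simp: A_const_def B_const_def)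
  next
    case 6
    then have "n = 3 + (n - 3)" "even (n - 3)" by auto
    then obtain k where "n = 3 + 2 * k" by (metis evenE)
    then have n: "n = Suc (Suc (Suc (2 * k)))" by simp
    show ?thesis using that[of "2 * k" 2] consts_minus_4[OF n] 6 n by (simp add: A_const_def B_const_def)
  qed
qed

lemma Afac_nonzero: "t \<le> 2 \<Longrightarrow> Afac TYPE('a) s t \<noteq> 0"
proof -
  assume t: "t \<le> 2"
  have "Gl TYPE('a) k > 0" for k
    by (induction k) (use p_ge_2 one_less_power[of p "Suc _"] in \<open>auto simp: card_GL_0 Gl_Suc simp del: power_Suc\<close>)
  then have "Gl TYPE('a) (s + t) \<noteq> 0" by (simp add: less_imp_neq[symmetric])
  then have "gauss_binom q (s + t) t \<noteq> 0" unfolding Gl_ratio[OF t] by auto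
  moreover have "odd_prod q k \<noteq> 0" for k
    by (induction k) (use p_power_neq_1 in \<open>auto simp: odd_prod_Suc odd_prod_def[of _ 0] simp del: power_Suc\<close>)
  then have "Sym TYPE('a) (2 * b) \<noteq> 0 \<and> Sym TYPE('a) (Suc (2 * b)) \<noteq> 0" for b
    unfolding Sym_closed[of b, THEN conjunct1] Sym_closed[of b, THEN conjunct2] using p_ge_2 by simp
  then have "Sym TYPE('a) s \<noteq> 0" by (cases "even s") (auto elim!: evenE oddE)
  ultimately show ?thesis using p_ge_2 by (simp add: Afac_def)
qed

end

context minus_form
begin

section \<open>Sizes and trace sums of the double cosets\<close>

lemma one_mult_double_coset: "(\<lambda>g. 1\<^sub>m N * g) ` double_coset Q (\<sigma> s) Q = double_coset Q (\<sigma> s) Q"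
proof -
  have "1\<^sub>m N * g = g" if "g \<in> double_coset Q (\<sigma> s) Q" for g
  proof -
    from that obtain x y where "g = x * \<sigma> s * y" "x \<in> Q" "y \<in> Q" by (auto simp: double_coset_def)
    then have "g \<in> carrier_mat N N" using Q_carrier multN sigma_carrier by metis
    then show ?thesis by (rule left_mult_one_mat)
  qed
  then show ?thesis by simp
qed

text \<open>The index of the stabilizer in Q, for t at most 2.\<close>

definition ratio :: "nat \<Rightarrow> nat \<Rightarrow> real" where
  "ratio s t = p ^ (2 * s + tri s) * gauss_binom q (s + t) t"

lemma card_Q_ratio:
  assumes m: "m = s + t" and t: "t \<le> 2"
  shows "real (card Q) = ratio s t * real (card (stab s))"
proof -
  have tri: "tri m = tri s + (\<Sum>j\<in>{s..<m}. j)"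
    unfolding tri_def using sum.atLeastLessThan_concat[of 0 s m "\<lambda>j. j"] m by (simp add: lessThan_atLeast0)
  have G: "Gl TYPE('a) m = p ^ (t * s) * gauss_binom q m t * (Gl TYPE('a) s * Gl TYPE('a) t)" using Gl_ratio[OF t, of s] m by simp
  have e: "p ^ (2 * m) = p ^ (2 * s) * p ^ (2 * t)" by (simp add: m power_add)
  show ?thesis
    unfolding card_Q card_stab[OF m] tri_def[symmetric] tri of_nat_mult of_nat_power G e ratio_def power_add m[symmetric]
    by (simp only: mult_ac)
qed

lemma double_coset_values:
  assumes m: "m = s + t" and t: "t \<le> 2"
  defines "D \<equiv> double_coset Q (\<sigma> s) Q" and "D' \<equiv> (\<lambda>g. \<rho> * g) ` double_coset Q (\<sigma> s) Q"
  shows "real (card D) = ratio s t * real (card Q)" "real (card D') = ratio s t * real (card Q)"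
    and "a \<noteq> 0 \<Longrightarrow> real_of_int (\<Sum>g\<in>D. \<chi> (a * mat_trace g)) = (- 1) ^ Suc s * Afac TYPE('a) s t * real_of_int (K a * KGL t a)"
    and "a \<noteq> 0 \<Longrightarrow> real_of_int (\<Sum>g\<in>D'. \<chi> (a * mat_trace g)) = (- 1) ^ s * (p + 1) * Afac TYPE('a) s t * real_of_int (KGL t a)"
proof -
  have s: "s \<le> m" using m by simp
  note r = card_Q_ratio[OF m t]
  have st0: "real (card (stab s)) \<noteq> 0"
  proof
    assume "real (card (stab s)) = 0"
    then have "card Q = 0" using r by simp
    then show False using finite_Q one_Q by auto
  qed
  have one: "1\<^sub>m N * 1\<^sub>m N = (1\<^sub>m N :: 'a mat)" by simp
  have oneQ: "1\<^sub>m N * g * 1\<^sub>m N \<in> Q" if "g \<in> Q" for g using Q_carrier[OF that] that by simp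
  note d1 = double_coset_trace_sum[OF s one_carrier_mat one oneQ, unfolded one_mult_double_coset, folded D_def]
  note d2 = double_coset_trace_sum[OF s rho_carrier rho_sq rho_normalizes, folded D'_def]
  have canc: "x = ratio s t * y" if "real (card (stab s)) * x = real (card Q) * y" for x y
    using that st0 unfolding r by (simp add: mult_ac)
  show "real (card D) = ratio s t * real (card Q)"
    by (rule canc) (use d1(2) in \<open>simp only: of_nat_mult[symmetric]\<close>)
  show "real (card D') = ratio s t * real (card Q)"
    by (rule canc) (use d2(2) in \<open>simp only: of_nat_mult[symmetric]\<close>)
  let ?W = "(- 1) ^ s * int q ^ (m + t) * int q ^ (\<Sum>j<m. j) * (int (card (SymGL s :: 'a mat set)) * int q ^ (t * s) * KGL t a)"
  have W: "ratio s t * real_of_int ?W = (- 1) ^ s * Afac TYPE('a) s t * real_of_int (KGL t a)"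
    unfolding Afac_def ratio_def tri_def[symmetric] m by (simp add: mult_ac)
  show "real_of_int (\<Sum>g\<in>D. \<chi> (a * mat_trace g)) = (- 1) ^ Suc s * Afac TYPE('a) s t * real_of_int (K a * KGL t a)" if a: "a \<noteq> 0"
  proof -
    have "(\<Sum>w\<in>Q. \<chi> (a * mat_trace (1\<^sub>m N * w * \<sigma> s))) = (\<Sum>w\<in>Q. \<chi> (a * mat_trace (w * \<sigma> s)))"
    proof (rule sum.cong[OF refl])
      fix w assume w: "w \<in> Q"
      show "\<chi> (a * mat_trace (1\<^sub>m N * w * \<sigma> s)) = \<chi> (a * mat_trace (w * \<sigma> s))"
        unfolding left_mult_one_mat[OF Q_carrier[OF w]] ..
    qed
    then have "int (card (stab s)) * (\<Sum>g\<in>D. \<chi> (a * mat_trace g)) = int (card Q) * (- K a * ?W)"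
      using d1(1)[of a] sum_trace_Q(1)[OF m a] by (simp only:)
    then have "real_of_int (int (card (stab s)) * (\<Sum>g\<in>D. \<chi> (a * mat_trace g))) = real_of_int (int (card Q) * (- K a * ?W))" by (rule arg_cong)
    then have "real_of_int (\<Sum>g\<in>D. \<chi> (a * mat_trace g)) = ratio s t * real_of_int (- K a * ?W)"
      by (intro canc) (simp only: of_int_mult of_int_of_nat_eq)
    also have "\<dots> = - real_of_int (K a) * (ratio s t * real_of_int ?W)" by (simp only: of_int_mult of_int_minus mult_ac)
    also have "\<dots> = (- 1) ^ Suc s * Afac TYPE('a) s t * real_of_int (K a * KGL t a)" unfolding W by simp
    finally show ?thesis .
  qed
  show "real_of_int (\<Sum>g\<in>D'. \<chi> (a * mat_trace g)) = (- 1) ^ s * (p + 1) * Afac TYPE('a) s t * real_of_int (KGL t a)" if a: "a \<noteq> 0"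
  proof -
    have "int (card (stab s)) * (\<Sum>g\<in>D'. \<chi> (a * mat_trace g)) = int (card Q) * ((int q + 1) * ?W)"
      using d2(1)[of a] sum_trace_Q(2)[OF m a] by (simp only:)
    then have "real_of_int (int (card (stab s)) * (\<Sum>g\<in>D'. \<chi> (a * mat_trace g))) = real_of_int (int (card Q) * ((int q + 1) * ?W))" by (rule arg_cong)
    then have "real_of_int (\<Sum>g\<in>D'. \<chi> (a * mat_trace g)) = ratio s t * real_of_int ((int q + 1) * ?W)"
      by (intro canc) (simp only: of_int_mult of_int_of_nat_eq)
    also have "\<dots> = (p + 1) * (ratio s t * real_of_int ?W)" by (simp only: of_int_mult of_int_add of_int_of_nat_eq of_int_1 mult_ac)
    also have "\<dots> = (- 1) ^ s * (p + 1) * Afac TYPE('a) s t * real_of_int (KGL t a)" unfolding W by (simp only: mult_ac)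
    finally show ?thesis .
  qed
qed

lemma ratio_card_Q:
  assumes m: "m = s + t" and B: "Bcond TYPE('a) i B s t"
  shows "ratio s t * real (card Q) = cfac i * Afac TYPE('a) s t * B"
proof -
  have e: "p ^ (2 * m) = p ^ m * p ^ m" by (simp add: mult_2 power_add)
  have Q: "real (card Q) = p ^ m * p ^ tri m * ((p + 1) * Gl TYPE('a) m * p ^ m)"
    unfolding card_Q tri_def[symmetric] of_nat_mult of_nat_power e of_nat_add of_nat_1 by (simp only: mult_ac)
  have "(p + 1) * Gl TYPE('a) m * p ^ m = cfac i * B * (p ^ (t + t * s) * Sym TYPE('a) s)" using B m by (simp add: Bcond_def)
  then show ?thesis unfolding Q ratio_def Afac_def m[symmetric] power_add by (simp only: mult_ac)
qed

text \<open>The signs: without \<rho> the sum carries (-1)^(s+1), which is \<epsilon> for t = 0 and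
  -\<epsilon> for t = 1; with \<rho> it carries (-1)^s, which is \<epsilon> for t = 1 and
  -\<epsilon> for t = 2. Carlitz' identity rewrites (K a)^2 for i = 2 and the matrix Kloosterman sum
  for i = 4.\<close>

lemma DC_values:
  assumes ad: "admissible \<epsilon> i (Suc m)"
  defines "A \<equiv> A_const \<epsilon> i (Suc m) q" and "B \<equiv> B_const \<epsilon> i (Suc m) q"
  shows "A \<noteq> 0" "real (card (DC \<kappa> i (Suc m))) = A * B"
    and "a \<noteq> 0 \<Longrightarrow> real_of_int (\<Sum>g\<in>DC \<kappa> i (Suc m). \<chi> (a * mat_trace g))
      = (if i = 2 then - \<epsilon> * A * (real_of_int (K2 a) + p) else if i = 4 then - \<epsilon> * A * (real_of_int (K2 a) + p ^ 2) else \<epsilon> * A * real_of_int (K a))"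
proof -
  obtain s t where st: "Suc m = Suc (s + t)" "t = (if i = 1 then 0 else if i = 4 then 2 else 1)"
    "A = cfac i * Afac TYPE('a) s t" "Bcond TYPE('a) i B s t" "\<epsilon> = - ((- 1) ^ (s + t))"
    using const_values[OF ad] unfolding A_def B_def by blast
  have m: "m = s + t" and t: "t \<le> 2" using st by (auto split: if_splits)
  have i: "i = 1 \<or> i = 2 \<or> i = 3 \<or> i = 4" using ad by (auto simp: admissible_def)
  note v = double_coset_values[OF m t]
  have DC: "DC \<kappa> i (Suc m) = (if i = 3 \<or> i = 4 then (\<lambda>g. \<rho> * g) ` double_coset Q (\<sigma> s) Q else double_coset Q (\<sigma> s) Q)"
    using i st(2) m by (auto simp: DC_def Let_def)
  show "A \<noteq> 0" using Afac_nonzero[OF t] p_ge_2 by (auto simp: st(3) cfac_def)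
  have "real (card (DC \<kappa> i (Suc m))) = ratio s t * real (card Q)" unfolding DC using v(1,2) by simp
  then show "real (card (DC \<kappa> i (Suc m))) = A * B" unfolding ratio_card_Q[OF m st(4)] st(3) .
  assume a: "a \<noteq> 0"
  have K2: "real_of_int (K a * K a) = real_of_int (K2 a) + p" using carlitz[OF a] by (simp add: power2_eq_square)
  consider "i = 1" | "i = 2" | "i = 3" | "i = 4" using i by blast
  then show "real_of_int (\<Sum>g\<in>DC \<kappa> i (Suc m). \<chi> (a * mat_trace g))
      = (if i = 2 then - \<epsilon> * A * (real_of_int (K2 a) + p) else if i = 4 then - \<epsilon> * A * (real_of_int (K2 a) + p ^ 2) else \<epsilon> * A * real_of_int (K a))"
  proof cases
    case 1
    then have t1: "t = 0" using st(2) by simp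
    show ?thesis using v(3)[OF a] st(3,5) 1 unfolding DC t1 KGL_0 by (simp add: cfac_def)
  next
    case 2
    then have t1: "t = 1" using st(2) by simp
    show ?thesis using v(3)[OF a] st(3,5) 2 unfolding DC t1 KGL_1[OF a] K2 by (simp add: cfac_def)
  next
    case 3
    then have t1: "t = 1" using st(2) by simp
    show ?thesis using v(4)[OF a] st(3,5) 3 unfolding DC t1 KGL_1[OF a] by (simp add: cfac_def)
  next
    case 4
    then have t1: "t = 2" using st(2) by simp
    have "KGL 2 a = int q * (K2 a + int q ^ 2)"
      unfolding KGL_2[OF a] carlitz[OF a] by (simp add: algebra_simps power2_eq_square)
    then have "real_of_int (KGL 2 a) = p * (real_of_int (K2 a) + p ^ 2)" by simp
    then show ?thesis using v(4)[OF a] st(3,5) 4 unfolding DC t1 by (simp add: cfac_def)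
  qed
qed

end

section \<open>The weight distribution\<close>

context char2_field
begin

text \<open>The upper arguments, quotients by q in form, are the numbers of indices with x_k =
  \<beta>, hence natural numbers, and \<open>binom\<close> is the ordinary binomial coefficient
  there.\<close>

lemma weight_formula:
  fixes x :: "nat \<Rightarrow> 'a"
  assumes "\<And>\<beta>. p * real (card {k. k < N \<and> x k = \<beta>}) = A * (B + e * w \<beta>)"
  shows "real (card (zero_sum_sets N x j)) = (\<Sum>\<nu>\<in>weight_families j. \<Prod>\<beta>\<in>UNIV. binom (inverse p * A * (B + e * w \<beta>)) (int (\<nu> \<beta>)))"
proof -
  have "inverse p * A * (B + e * w \<beta>) = real (card {k. k < N \<and> x k = \<beta>})" for \<beta>
    using assms[of \<beta>, symmetric] p_ge_2 by (simp add: mult.assoc)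
  then show ?thesis unfolding card_zero_sum_sets by (simp add: binom_of_nat)
qed

lemma prod_tr_split:
  fixes f :: "'a \<Rightarrow> real"
  shows "(\<Prod>\<beta>\<in>UNIV. f \<beta>) = f 0 * (\<Prod>\<beta>\<in>{\<beta>. \<beta> \<noteq> 0 \<and> tr r (inverse \<beta>) = 0}. f \<beta>) * (\<Prod>\<beta>\<in>{\<beta>. \<beta> \<noteq> 0 \<and> tr r (inverse \<beta>) = 1}. f \<beta>)"
proof -
  let ?X = "{\<beta>::'a. \<beta> \<noteq> 0 \<and> tr r (inverse \<beta>) = 0}" and ?Y = "{\<beta>::'a. \<beta> \<noteq> 0 \<and> tr r (inverse \<beta>) = 1}"
  have "(\<Prod>\<beta>\<in>UNIV. f \<beta>) = f 0 * (\<Prod>\<beta>\<in>UNIV - {0}. f \<beta>)" by (rule prod.remove) auto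
  also have "UNIV - {0} = ?X \<union> ?Y" using tr_cases by auto
  also have "(\<Prod>\<beta>\<in>?X \<union> ?Y. f \<beta>) = (\<Prod>\<beta>\<in>?X. f \<beta>) * (\<Prod>\<beta>\<in>?Y. f \<beta>)" by (rule prod.union_disjoint) auto
  finally show ?thesis by (simp add: mult.assoc)
qed

lemma finite_tau_range: "finite (tau_range k)"
proof (rule finite_subset)
  show "tau_range k \<subseteq> {- \<lceil>2 * sqrt (real k)\<rceil> .. \<lceil>2 * sqrt (real k)\<rceil>}"
    unfolding tau_range_def by (auto simp: abs_le_iff ceiling_le_iff le_ceiling_iff) linarith+
qed simp

text \<open>The strict Weil bound and the congruence modulo 4 put every value of K at a nonzero
  argument into \<open>tau_range q\<close>, so grouping by \<tau> loses no factor. Values \<tau>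
  that are not attained contribute empty products.\<close>

lemma prod_kloosterman_split:
  fixes f :: "'a \<Rightarrow> real"
  assumes q4: "q \<ge> 4"
  shows "(\<Prod>\<beta>\<in>UNIV. f \<beta>) = f 0 * (\<Prod>\<tau>\<in>tau_range q. \<Prod>\<beta>\<in>{\<beta>. \<beta> \<noteq> 0 \<and> K (inverse \<beta>) = \<tau>}. f \<beta>)"
proof -
  have sub: "(\<lambda>\<beta>. K (inverse \<beta>)) ` (UNIV - {0}) \<subseteq> tau_range q"
    using weil_kloosterman kloosterman_cong q4 by (auto simp: tau_range_def)
  have "(\<Prod>\<tau>\<in>tau_range q. \<Prod>\<beta>\<in>{\<beta> \<in> UNIV - {0}. K (inverse \<beta>) = \<tau>}. f \<beta>) = (\<Prod>\<beta>\<in>UNIV - {0}. f \<beta>)"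
    by (rule prod.group[OF _ finite_tau_range sub]) simp
  moreover have "(\<Prod>\<beta>\<in>UNIV. f \<beta>) = f 0 * (\<Prod>\<beta>\<in>UNIV - {0}. f \<beta>)" by (rule prod.remove) auto
  ultimately show ?thesis by simp
qed

lemma weights_tr:
  fixes x :: "nat \<Rightarrow> 'a"
  assumes "\<And>\<beta>. p * real (card {k. k < N \<and> x k = \<beta>}) = A * (B + e * w \<beta>)" "w 0 = w0"
    and w1: "\<And>\<beta>. \<beta> \<noteq> 0 \<Longrightarrow> tr r (inverse \<beta>) = 0 \<Longrightarrow> w \<beta> = w1" and w2: "\<And>\<beta>. \<beta> \<noteq> 0 \<Longrightarrow> tr r (inverse \<beta>) = 1 \<Longrightarrow> w \<beta> = w2"
  shows "real (card (zero_sum_sets N x j)) = (\<Sum>\<nu>\<in>(weight_families j :: ('a \<Rightarrow> nat) set).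
      binom (inverse p * A * (B + e * w0)) (int (\<nu> 0))
      * (\<Prod>\<beta>\<in>{\<beta>. \<beta> \<noteq> 0 \<and> tr r (inverse \<beta>) = 0}. binom (inverse p * A * (B + e * w1)) (int (\<nu> \<beta>)))
      * (\<Prod>\<beta>\<in>{\<beta>. \<beta> \<noteq> 0 \<and> tr r (inverse \<beta>) = 1}. binom (inverse p * A * (B + e * w2)) (int (\<nu> \<beta>))))"
proof -
  have "(\<Prod>\<beta>\<in>{\<beta>. \<beta> \<noteq> 0 \<and> tr r (inverse \<beta>) = 0}. binom (inverse p * A * (B + e * w \<beta>)) (int (\<nu> \<beta>)))
      = (\<Prod>\<beta>\<in>{\<beta>. \<beta> \<noteq> 0 \<and> tr r (inverse \<beta>) = 0}. binom (inverse p * A * (B + e * w1)) (int (\<nu> \<beta>)))" for \<nu> :: "'a \<Rightarrow> nat"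
    by (rule prod.cong) (use w1 in auto)
  moreover have "(\<Prod>\<beta>\<in>{\<beta>. \<beta> \<noteq> 0 \<and> tr r (inverse \<beta>) = 1}. binom (inverse p * A * (B + e * w \<beta>)) (int (\<nu> \<beta>)))
      = (\<Prod>\<beta>\<in>{\<beta>. \<beta> \<noteq> 0 \<and> tr r (inverse \<beta>) = 1}. binom (inverse p * A * (B + e * w2)) (int (\<nu> \<beta>)))" for \<nu> :: "'a \<Rightarrow> nat"
    by (rule prod.cong) (use w2 in auto)
  ultimately show ?thesis unfolding weight_formula[of N x A B e w, OF assms(1)] prod_tr_split assms(2) by (simp only:)
qed

lemma weights_kloosterman:
  fixes x :: "nat \<Rightarrow> 'a"
  assumes "q \<ge> 4" "\<And>\<beta>. p * real (card {k. k < N \<and> x k = \<beta>}) = A * (B + e * w \<beta>)" "w 0 = w0"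
    and v: "\<And>\<beta>. \<beta> \<noteq> 0 \<Longrightarrow> w \<beta> = v (K (inverse \<beta>))"
  shows "real (card (zero_sum_sets N x j)) = (\<Sum>\<nu>\<in>weight_families j.
      binom (inverse p * A * (B + e * w0)) (int (\<nu> 0))
      * (\<Prod>\<tau>\<in>tau_range q. \<Prod>\<beta>\<in>{\<beta>. \<beta> \<noteq> 0 \<and> K (inverse \<beta>) = \<tau>}. binom (inverse p * A * (B + e * v \<tau>)) (int (\<nu> \<beta>))))"
proof -
  have "(\<Prod>\<tau>\<in>tau_range q. \<Prod>\<beta>\<in>{\<beta>. \<beta> \<noteq> 0 \<and> K (inverse \<beta>) = \<tau>}. binom (inverse p * A * (B + e * w \<beta>)) (int (\<nu> \<beta>)))
      = (\<Prod>\<tau>\<in>tau_range q. \<Prod>\<beta>\<in>{\<beta>. \<beta> \<noteq> 0 \<and> K (inverse \<beta>) = \<tau>}. binom (inverse p * A * (B + e * v \<tau>)) (int (\<nu> \<beta>)))" for \<nu> :: "'a \<Rightarrow> nat"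
    by (intro prod.cong refl) (use v in auto)
  then show ?thesis
    unfolding weight_formula[of N x A B e w, OF assms(2)] prod_kloosterman_split[OF assms(1)] assms(3) by (simp only:)
qed

lemma power_moment_sq: "power_moment (\<lambda>a. (f a)\<^sup>2) h = power_moment f (2 * h)"
  by (simp add: power_moment_def power_mult)

text \<open>A root v would give the factorization (z + v)(z + v + 1). Hence v^2 + v = \<kappa> has
  no solution, and the Artin-Schreier count is 0.\<close>

lemma lam_kappa_irreducible:
  assumes "irreducible [:\<kappa> :: 'a, 1, 1:]"
  shows "\<chi> \<kappa> = - 1"
proof -
  have "{v. v\<^sup>2 + v = \<kappa>} = {}"
  proof (rule ccontr)
    assume "{v. v\<^sup>2 + v = \<kappa>} \<noteq> {}"
    then obtain v where v: "v\<^sup>2 + v = \<kappa>" by blast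
    have "[:\<kappa>, 1, 1:] = [:v, 1:] * [:v + 1, 1:]"
      using v add_self[of v] by (simp add: power2_eq_square algebra_simps)
    then have "[:v, 1:] dvd 1 \<or> [:v + 1, 1:] dvd 1" using irreducibleD[OF assms] by blast
    then show False by (auto simp: is_unit_poly_iff)
  qed
  then show ?thesis using card_artin_schreier[of \<kappa>] by simp
qed

end

theorem theorem1:
  fixes \<kappa> :: "'a::{field,finite}"
    and r n i q N :: nat
    and \<epsilon> A B :: real
    and g :: "nat \<Rightarrow> 'a mat"
    and C :: "nat \<Rightarrow> nat"
    and MK MK2 :: "nat \<Rightarrow> real"
  assumes "r \<ge> 1" and "q = 2 ^ r" and "CARD('a) = q"
    and "irreducible [:\<kappa>, 1, 1:]"
    and "admissible \<epsilon> i n"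
    and "A = A_const \<epsilon> i n q" and "B = B_const \<epsilon> i n q"
    and "N = card (DC \<kappa> i n)"
    and "bij_betw g {..<N} (DC \<kappa> i n)"
    and "C = weight_distribution (binary_code N g)"
    and "MK = power_moment (kloosterman r :: 'a \<Rightarrow> int)"
    and "MK2 = power_moment (kloosterman2 r :: 'a \<Rightarrow> int)"
  shows "real N = A * B \<and>
    (\<comment> \<open>part (a)\<close>
     i = 1 \<and> \<epsilon> = 1 \<and> even n \<and> n \<ge> 2 \<or>
     i = 3 \<and> \<epsilon> = 1 \<and> (even n \<and> n \<ge> 4 \<or> n = 2 \<and> q \<ge> 8) \<or>
     i = 1 \<and> \<epsilon> = - 1 \<and> odd n \<and> n \<ge> 1 \<or>
     i = 3 \<and> \<epsilon> = - 1 \<and> odd n \<and> n \<ge> 3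
     \<longrightarrow>
     (\<forall>h\<ge>1. (- \<epsilon>) ^ h * MK h =
        - (\<Sum>l=0..h - 1. (- \<epsilon>) ^ l * real (h choose l) * B ^ (h - l) * MK l)
        + Sigma_term q A N C h) \<and>
     (\<forall>j\<le>N. real (C j) =
        (\<Sum>\<nu> \<in> (weight_families j :: ('a \<Rightarrow> nat) set).
           binom (inverse (real q) * A * (B + \<epsilon> * 1)) (int (\<nu> 0))
           * (\<Prod>\<beta> \<in> {\<beta>. \<beta> \<noteq> 0 \<and> tr r (inverse \<beta>) = 0}.
                binom (inverse (real q) * A * (B + \<epsilon> * (real q + 1))) (int (\<nu> \<beta>)))
           * (\<Prod>\<beta> \<in> {\<beta>. \<beta> \<noteq> 0 \<and> tr r (inverse \<beta>) = 1}.
                binom (inverse (real q) * A * (B + \<epsilon> * (- real q + 1))) (int (\<nu> \<beta>)))))) \<and>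
    (\<comment> \<open>part (b)\<close>
     i = 2 \<and> (\<epsilon> = 1 \<and> even n \<and> n \<ge> 2 \<and> q \<ge> 4 \<or> \<epsilon> = - 1 \<and> odd n \<and> n \<ge> 3 \<and> q \<ge> 4)
     \<longrightarrow>
     (\<forall>h\<ge>1.
        \<epsilon> ^ h * MK2 h =
          - (\<Sum>l=0..h - 1. \<epsilon> ^ l * real (h choose l) * (B + \<epsilon> * real q) ^ (h - l) * MK2 l)
          + Sigma_term q A N C h \<and>
        \<epsilon> ^ h * MK (2 * h) =
          - (\<Sum>l=0..h - 1. \<epsilon> ^ l * real (h choose l) * B ^ (h - l) * MK (2 * l))
          + Sigma_term q A N C h) \<and>
     (\<forall>j\<le>N. real (C j) =
        (\<Sum>\<nu> \<in> (weight_families j :: ('a \<Rightarrow> nat) set).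
           binom (inverse (real q) * A * (B + \<epsilon> * (real q + 1 - real q ^ 2))) (int (\<nu> 0))
           * (\<Prod>\<tau> \<in> tau_range q. \<Prod>\<beta> \<in> {\<beta>. \<beta> \<noteq> 0 \<and> kloosterman r (inverse \<beta>) = \<tau>}.
                binom (inverse (real q) * A * (B + \<epsilon> * (real q + 1 - real q * real_of_int \<tau>)))
                  (int (\<nu> \<beta>)))))) \<and>
    (\<comment> \<open>part (c)\<close>
     i = 4 \<and> (\<epsilon> = 1 \<and> even n \<and> n \<ge> 4 \<and> q \<ge> 4 \<or> \<epsilon> = - 1 \<and> odd n \<and> n \<ge> 3 \<and> q \<ge> 4)
     \<longrightarrow>
     (\<forall>h\<ge>1.
        \<epsilon> ^ h * MK2 h =
          - (\<Sum>l=0..h - 1. \<epsilon> ^ l * real (h choose l) * (B + \<epsilon> * real q ^ 2) ^ (h - l) * MK2 l)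
          + Sigma_term q A N C h \<and>
        \<epsilon> ^ h * MK (2 * h) =
          - (\<Sum>l=0..h - 1. \<epsilon> ^ l * real (h choose l)
               * (B + \<epsilon> * (real q ^ 2 - real q)) ^ (h - l) * MK (2 * l))
          + Sigma_term q A N C h) \<and>
     (\<forall>j\<le>N. real (C j) =
        (\<Sum>\<nu> \<in> (weight_families j :: ('a \<Rightarrow> nat) set).
           binom (inverse (real q) * A * (B + \<epsilon> * (real q ^ 2 + 1 - real q ^ 3))) (int (\<nu> 0))
           * (\<Prod>\<tau> \<in> tau_range q. \<Prod>\<beta> \<in> {\<beta>. \<beta> \<noteq> 0 \<and> kloosterman r (inverse \<beta>) = \<tau>}.
                binom (inverse (real q) * A * (B + \<epsilon> * (real q ^ 2 + 1 - real q * real_of_int \<tau>)))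
                  (int (\<nu> \<beta>))))))"
proof -
  note defs = assms(6-8,10-12)
  obtain m where n: "n = Suc m" using assms(5) by (cases n) (auto simp: admissible_def)
  interpret char2_field r q "TYPE('a)" by unfold_locales (use assms(1-3) in auto)
  interpret minus_form r q "TYPE('a)" \<kappa> m by unfold_locales (rule lam_kappa_irreducible[OF assms(4)])
  have D: "A \<noteq> 0" "real N = A * B"
      "a \<noteq> 0 \<Longrightarrow> real_of_int (\<Sum>g\<in>DC \<kappa> i n. lam r (a * mat_trace g))
      = (if i = 2 then - \<epsilon> * A * (real_of_int (kloosterman2 r a) + real q) else if i = 4 then - \<epsilon> * A * (real_of_int (kloosterman2 r a) + real q ^ 2)
         else \<epsilon> * A * real_of_int (kloosterman r a))" for a
    using DC_values[OF assms(5)[unfolded n]] unfolding defs n by blast+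
  let ?x = "\<lambda>k. mat_trace (g k)"
  have C: "C = (\<lambda>j. card (zero_sum_sets N ?x j))" unfolding assms(10) weight_distribution_eq ..
  have S: "(\<Sum>k<N. lam r (a * ?x k)) = (\<Sum>g\<in>DC \<kappa> i n. lam r (a * mat_trace g))" for a
    by (rule sum.reindex_bij_betw[OF assms(9)])
  have cnt: "real q * real (card {k. k < N \<and> ?x k = \<beta>})
     = real N + (\<Sum>a\<in>UNIV - {0}. real_of_int (lam r (a * \<beta>)) * real_of_int (\<Sum>g\<in>DC \<kappa> i n. lam r (a * mat_trace g)))" for \<beta>
    using arg_cong[OF count_by_fourier[of N ?x \<beta>], of real_of_int] unfolding S
    by (simp only: of_int_add of_int_sum of_int_mult of_int_of_nat_eq)
  have f1: "(\<Sum>a\<in>UNIV - {0}. real_of_int (lam r (a * \<beta>)) * real_of_int (kloosterman r a))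
     = (if \<beta> = 0 then 1 else real q * real_of_int (lam r (inverse \<beta>)) + 1)" for \<beta> :: 'a
    using arg_cong[OF fourier_kloosterman[of \<beta>], of real_of_int] by (simp split: if_splits)
  \<comment> \<open>The constant y stands for the q or q^2 that accompanies K2 in S(a). Its
    transform over nonzero a is y (q - 1) at \<beta> = 0 and -y elsewhere.\<close>
  have f2: "(\<Sum>a\<in>UNIV - {0}. real_of_int (lam r (a * \<beta>)) * (real_of_int (kloosterman2 r a) + y))
     = (if \<beta> = 0 then - 1 + y * (real q - 1) else real q * real_of_int (kloosterman r (inverse \<beta>)) - 1 - y)" for \<beta> :: 'a and y
  proof -
    have "(\<Sum>a\<in>UNIV - {0}. lam r (a * \<beta>)) = (if \<beta> = 0 then int q - 1 else - 1)"
      using sum_lam_nz[of \<beta>] by (simp add: mult.commute)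
    from arg_cong[OF this, of real_of_int] arg_cong[OF fourier_kloosterman2[of \<beta>], of real_of_int]
    show ?thesis by (simp add: distrib_left sum.distrib sum_distrib_right[symmetric] split: if_splits)
  qed
  \<comment> \<open>For i = 1 and i = 3 alike S(a) = \<epsilon> A K(a), so N - S(a) = A (B -
    \<epsilon> K(a)) and the moments carry (-\<epsilon>)^h, while the counts of traces carry
    \<epsilon>.\<close>
  have a: "(\<forall>h\<ge>1. (- \<epsilon>) ^ h * MK h =
        - (\<Sum>l=0..h - 1. (- \<epsilon>) ^ l * real (h choose l) * B ^ (h - l) * MK l)
        + Sigma_term q A N C h) \<and>
     (\<forall>j\<le>N. real (C j) =
        (\<Sum>\<nu> \<in> (weight_families j :: ('a \<Rightarrow> nat) set).
           binom (inverse (real q) * A * (B + \<epsilon> * 1)) (int (\<nu> 0))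
           * (\<Prod>\<beta> \<in> {\<beta>. \<beta> \<noteq> 0 \<and> tr r (inverse \<beta>) = 0}.
                binom (inverse (real q) * A * (B + \<epsilon> * (real q + 1))) (int (\<nu> \<beta>)))
           * (\<Prod>\<beta> \<in> {\<beta>. \<beta> \<noteq> 0 \<and> tr r (inverse \<beta>) = 1}.
                binom (inverse (real q) * A * (B + \<epsilon> * (- real q + 1))) (int (\<nu> \<beta>)))))" if i: "i = 1 \<or> i = 3"
  proof (intro conjI allI impI)
    have Si: "real_of_int (\<Sum>g\<in>DC \<kappa> i n. lam r (a * mat_trace g)) = \<epsilon> * A * real_of_int (kloosterman r a)" if "a \<noteq> 0" for a
      using D(3)[OF that] i by auto
    fix h :: nat assume h: "h \<ge> 1"
    show "(- \<epsilon>) ^ h * MK h = - (\<Sum>l=0..h - 1. (- \<epsilon>) ^ l * real (h choose l) * B ^ (h - l) * MK l) + Sigma_term q A N C h"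
      unfolding assms(11)
    proof (rule moment_identity[OF h C D(1)])
      fix a :: 'a assume a: "a \<noteq> 0"
      show "real N - real_of_int (\<Sum>k<N. lam r (a * ?x k)) = A * (B + - \<epsilon> * real_of_int (kloosterman r a))"
        unfolding S Si[OF a] D(2) by (simp add: algebra_simps)
    qed
  next
    have Si: "real_of_int (\<Sum>g\<in>DC \<kappa> i n. lam r (a * mat_trace g)) = \<epsilon> * A * real_of_int (kloosterman r a)" if "a \<noteq> 0" for a
      using D(3)[OF that] i by auto
    fix j assume "j \<le> N"
    let ?w = "\<lambda>\<beta>. if \<beta> = 0 then 1 else real q * real_of_int (lam r (inverse \<beta>)) + 1"
    have "real q * real (card {k. k < N \<and> ?x k = \<beta>}) = A * (B + \<epsilon> * ?w \<beta>)" for \<beta>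
    proof -
      have "(\<Sum>a\<in>UNIV - {0}. real_of_int (lam r (a * \<beta>)) * real_of_int (\<Sum>g\<in>DC \<kappa> i n. lam r (a * mat_trace g)))
        = (\<Sum>a\<in>UNIV - {0}. \<epsilon> * A * (real_of_int (lam r (a * \<beta>)) * real_of_int (kloosterman r a)))"
        by (rule sum.cong[OF refl]) (subst Si, simp, simp only: mult_ac)
      then show ?thesis unfolding cnt sum_distrib_left[symmetric] f1 D(2) by (simp only: distrib_left mult_ac)
    qed
    from weights_tr[of N ?x A B \<epsilon> ?w, OF this, of 1 "real q + 1" "- real q + 1" j]
    show "real (C j) =
        (\<Sum>\<nu> \<in> (weight_families j :: ('a \<Rightarrow> nat) set).
           binom (inverse (real q) * A * (B + \<epsilon> * 1)) (int (\<nu> 0))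
           * (\<Prod>\<beta> \<in> {\<beta>. \<beta> \<noteq> 0 \<and> tr r (inverse \<beta>) = 0}.
                binom (inverse (real q) * A * (B + \<epsilon> * (real q + 1))) (int (\<nu> \<beta>)))
           * (\<Prod>\<beta> \<in> {\<beta>. \<beta> \<noteq> 0 \<and> tr r (inverse \<beta>) = 1}.
                binom (inverse (real q) * A * (B + \<epsilon> * (- real q + 1))) (int (\<nu> \<beta>))))"
      unfolding C by (simp add: lam_def)
  qed
  \<comment> \<open>Parts (b) and (c) are the cases y = q and y = q^2 of S(a) = -\<epsilon> A (K2 a
    + y). By Carlitz' identity K2 a + y = (K a)^2 + (y - q), so the same weights yield both
    recursions; y - q is 0 in (b).\<close>
  have bc: "(\<forall>h\<ge>1.
        \<epsilon> ^ h * MK2 h =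
          - (\<Sum>l=0..h - 1. \<epsilon> ^ l * real (h choose l) * (B + \<epsilon> * y) ^ (h - l) * MK2 l)
          + Sigma_term q A N C h \<and>
        \<epsilon> ^ h * MK (2 * h) =
          - (\<Sum>l=0..h - 1. \<epsilon> ^ l * real (h choose l) * (B + \<epsilon> * (y - real q)) ^ (h - l) * MK (2 * l))
          + Sigma_term q A N C h) \<and>
     (\<forall>j. real (C j) =
        (\<Sum>\<nu> \<in> (weight_families j :: ('a \<Rightarrow> nat) set).
           binom (inverse (real q) * A * (B + \<epsilon> * (y + 1 - y * real q))) (int (\<nu> 0))
           * (\<Prod>\<tau> \<in> tau_range q. \<Prod>\<beta> \<in> {\<beta>. \<beta> \<noteq> 0 \<and> kloosterman r (inverse \<beta>) = \<tau>}.
                binom (inverse (real q) * A * (B + \<epsilon> * (y + 1 - real q * real_of_int \<tau>)))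
                  (int (\<nu> \<beta>)))))"
    if q4: "q \<ge> 4" and Si: "\<And>a. a \<noteq> 0 \<Longrightarrow> real_of_int (\<Sum>g\<in>DC \<kappa> i n. lam r (a * mat_trace g)) = - \<epsilon> * A * (real_of_int (kloosterman2 r a) + y)" for y
  proof (intro conjI allI impI)
    fix h :: nat assume h: "h \<ge> 1"
    show "\<epsilon> ^ h * MK2 h = - (\<Sum>l=0..h - 1. \<epsilon> ^ l * real (h choose l) * (B + \<epsilon> * y) ^ (h - l) * MK2 l) + Sigma_term q A N C h"
      unfolding assms(12)
    proof (rule moment_identity[OF h C D(1)])
      fix a :: 'a assume a: "a \<noteq> 0"
      show "real N - real_of_int (\<Sum>k<N. lam r (a * ?x k)) = A * (B + \<epsilon> * y + \<epsilon> * real_of_int (kloosterman2 r a))"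
        unfolding S Si[OF a] D(2) by (simp add: algebra_simps)
    qed
    have K2: "real_of_int (kloosterman2 r a) = real_of_int ((kloosterman r a)\<^sup>2) - real q" if "a \<noteq> 0" for a :: 'a
      using carlitz[OF that] by simp
    show "\<epsilon> ^ h * MK (2 * h) =
        - (\<Sum>l=0..h - 1. \<epsilon> ^ l * real (h choose l) * (B + \<epsilon> * (y - real q)) ^ (h - l) * MK (2 * l)) + Sigma_term q A N C h"
      unfolding assms(11) power_moment_sq[symmetric]
    proof (rule moment_identity[OF h C D(1)])
      fix a :: 'a assume a: "a \<noteq> 0"
      show "real N - real_of_int (\<Sum>k<N. lam r (a * ?x k)) = A * (B + \<epsilon> * (y - real q) + \<epsilon> * real_of_int ((kloosterman r a)\<^sup>2))"
        unfolding S Si[OF a] D(2) K2[OF a] by (simp add: algebra_simps)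
    qed
  next
    fix j
    \<comment> \<open>These are the values y - (transform of K2 + y) at \<beta>: N gives A B, and
      the minus sign of S(a) turns the transform into the corrections that multiply \<epsilon>, with
      1 - y (q - 1) at \<beta> = 0. The first summand y is already contained there, as y + 1 - y q =
      1 - y (q - 1).\<close>
    let ?w = "\<lambda>\<beta>. if \<beta> = 0 then y + 1 - y * real q else y + 1 - real q * real_of_int (kloosterman r (inverse \<beta>))"
    have "real q * real (card {k. k < N \<and> ?x k = \<beta>}) = A * (B + \<epsilon> * ?w \<beta>)" for \<beta>
    proof -
      have "(\<Sum>a\<in>UNIV - {0}. real_of_int (lam r (a * \<beta>)) * real_of_int (\<Sum>g\<in>DC \<kappa> i n. lam r (a * mat_trace g)))
        = (\<Sum>a\<in>UNIV - {0}. - \<epsilon> * A * (real_of_int (lam r (a * \<beta>)) * (real_of_int (kloosterman2 r a) + y)))"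
        by (rule sum.cong[OF refl]) (subst Si, simp, simp only: mult_ac)
      then show ?thesis unfolding cnt sum_distrib_left[symmetric] f2 D(2) by (simp add: algebra_simps)
    qed
    from weights_kloosterman[of N ?x A B \<epsilon> ?w, OF q4 this, of _ "\<lambda>\<tau>. y + 1 - real q * real_of_int \<tau>" j]
    show "real (C j) =
        (\<Sum>\<nu> \<in> (weight_families j :: ('a \<Rightarrow> nat) set).
           binom (inverse (real q) * A * (B + \<epsilon> * (y + 1 - y * real q))) (int (\<nu> 0))
           * (\<Prod>\<tau> \<in> tau_range q. \<Prod>\<beta> \<in> {\<beta>. \<beta> \<noteq> 0 \<and> kloosterman r (inverse \<beta>) = \<tau>}.
                binom (inverse (real q) * A * (B + \<epsilon> * (y + 1 - real q * real_of_int \<tau>)))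
                  (int (\<nu> \<beta>))))"
      unfolding C by simp
  qed
  show ?thesis
  proof (intro conjI impI, goal_cases)
    case 1
    show ?case by (rule D(2))
  next
    case 2
    then have "i = 1 \<or> i = 3" by blast
    from a[OF this] show ?case by (rule conjunct1)
  next
    case 3
    then have "i = 1 \<or> i = 3" by blast
    from a[OF this] show ?case by (rule conjunct2)
  next
    case 4
    then have q4: "q \<ge> 4" and i: "i = 2" by blast+
    from bc[OF q4, of "real q"] D(3) i show ?case by simp
  next
    case 5
    then have q4: "q \<ge> 4" and i: "i = 2" by blast+
    from bc[OF q4, of "real q"] D(3) i show ?case by (simp add: power2_eq_square)
  next
    case 6
    then have q4: "q \<ge> 4" and i: "i = 4" by blast+
    from bc[OF q4, of "real q ^ 2"] D(3) i show ?case by simp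
  next
    case 7
    then have q4: "q \<ge> 4" and i: "i = 4" by blast+
    have "real q ^ 3 = real q ^ 2 * real q" by (simp add: power3_eq_cube power2_eq_square)
    with bc[OF q4, of "real q ^ 2"] D(3) i show ?case by simp
  qed
qed

end
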